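(* Let $D^k\subset\mathbb R^d$ be a quasi-regular element with representative size $h=\operatorname{diam}(D^k)$, let $N>0$ and $m\ge1$. Let $\bm W\in\big(W^{N+1,\infty}(D^k)\big)^{m\times m}$ be a pointwise symmetric positive-definite matrix weight with $0<w_{\min}\le\|\bm W(\bm x)\|_2\le w_{\max}<\infty$ and $0<\tilde w_{\min}\le\|\bm W^{-1}(\bm x)\|_2\le\tilde w_{\max}<\infty$ for all $\bm x$, and let $\bm v\in\big(W^{N+1,2}(D^k)\big)^m$. Then $$\big\|\bm W\bm v-T^{-1}_{\bm W^{-1}}\bm v\big\|_{L^2(D^k)}\le C_{\bm W}\,h^{N+1}\,\|\bm v\|_{W^{N+1,2}(D^k)},$$ with $$C_{\bm W}=C_N\,\big\|\sqrt J\big\|_{L^\infty(D^k)}\Big\|\frac1{\sqrt J}\Big\|_{L^\infty(D^k)}\tilde w_{\max}\,w_{\max}\,\|\bm W\|_{N+1,2,\infty},$$ where $C_N$ depends on $N$ but not on $h$, $\bm W$ or $\bm v$.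
   Context: $D^k$ is the image of a reference simplex $\widehat D$ under a smooth invertible map $\bm\Phi^k$ with Jacobian determinant $J$ (positive). $P^N(D^k)$ denotes functions $u$ on $D^k$ with $u\circ\bm\Phi^k\in P^N(\widehat D)$, polynomials of total degree at most $N$. Weight-adjusted operator: for a symmetric positive-definite matrix weight $\bm A$ with $\bm A,\bm A^{-1}$ bounded, $T^{-1}_{\bm A}:(L^2(D^k))^m\to(P^N(D^k))^m$ is defined by $$\big(\bm A\,T^{-1}_{\bm A}\bm v,\bm{\delta v}\big)_{L^2(D^k)}=(\bm v,\bm{\delta v})_{L^2(D^k)}\qquad\forall\,\bm{\delta v}\in(P^N(D^k))^m.$$ The claim uses it with $\bm A=\bm W^{-1}$. Quasi-regular: the standard scaling argument applies to the map, i.e. there is a constant $C_0$, independent of $h$, such that $\|D^{\bm\alpha}\bm\Phi^k\|_{L^\infty(\widehat D)}\le C_0h^{|\bm\alpha|}$ for $1\le|\bm\alpha|\le N+1$; the constant $C_N$ may also depend on $d$, $m$ and $C_0$. (Affine elements of size $h$ satisfy this.) Norms: for vector functions, $\|\bm v\|_{W^{k,p}}^p=\sum_i\|\bm v_i\|_{W^{k,p}}^p$. For matrix weights, $\|\bm W\|_{k,p,\infty}^p=\sum_{|\bm\alpha|\le k}\sup_{\bm x}\|D^{\bm\alpha}\bm W(\bm x)\|_p^p$, where $D^{\bm\alpha}$ acts entrywise and $\|\cdot\|_p$ is the induced matrix $p$-norm; $\|\cdot\|_2$ is the spectral norm. *)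

theory Defs
  imports "HOL-Analysis.Analysis" "HOL-Probability.Essential_Supremum"
begin

text \<open>A multi-index is a function \<open>\<alpha> :: 'd \<Rightarrow> nat\<close>, where \<open>'d\<close> indexes the coordinates of
  \<open>real ^ 'd\<close>.\<close>

definition mi_order :: "('d::finite \<Rightarrow> nat) \<Rightarrow> nat" where
  "mi_order \<alpha> = (\<Sum>i\<in>UNIV. \<alpha> i)"

lemma finite_mi_order_le: "finite {\<alpha> :: 'd::finite \<Rightarrow> nat. mi_order \<alpha> \<le> k}"
proof (rule finite_subset)
  show "{\<alpha> :: 'd \<Rightarrow> nat. mi_order \<alpha> \<le> k} \<subseteq> (UNIV \<rightarrow>\<^sub>E {..k})"
  proof
    fix \<alpha> :: "'d \<Rightarrow> nat"
    assume "\<alpha> \<in> {\<alpha>. mi_order \<alpha> \<le> k}"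
    then have "\<alpha> i \<le> k" for i
      using member_le_sum[of i UNIV \<alpha>] by (simp add: mi_order_def)
    then show "\<alpha> \<in> (UNIV \<rightarrow>\<^sub>E {..k})" by (auto simp: PiE_def Pi_def)
  qed
  show "finite (UNIV \<rightarrow>\<^sub>E {..k} :: ('d \<Rightarrow> nat) set)" by (intro finite_PiE) auto
qed

definition partial_deriv ::
    "'d::finite \<Rightarrow> (real ^ 'd \<Rightarrow> 'b::real_normed_vector) \<Rightarrow> real ^ 'd \<Rightarrow> 'b" where
  "partial_deriv i f x = frechet_derivative f (at x) (axis i 1)"

text \<open>The coordinate type carries no order, so \<open>D\<^sup>\<alpha>\<close> takes the partial derivatives in some
  sequence containing each coordinate \<open>i\<close> exactly \<open>\<alpha> i\<close> times. It is only applied to smooth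
  functions, for which the choice does not matter.\<close>

definition multi_deriv ::
    "('d::finite \<Rightarrow> nat) \<Rightarrow> (real ^ 'd \<Rightarrow> 'b::real_normed_vector) \<Rightarrow> real ^ 'd \<Rightarrow> 'b" where
  "multi_deriv \<alpha> f = foldr partial_deriv (SOME xs. \<forall>i. count_list xs i = \<alpha> i) f"

lemma ex_list_of_multi_index: "\<exists>xs. \<forall>i. count_list xs i = (\<alpha> :: 'd::finite \<Rightarrow> nat) i"
proof -
  obtain xs where "mset xs = Abs_multiset \<alpha>" using ex_mset by blast
  then have "count_list xs i = \<alpha> i" for i
    by (metis (no_types, lifting) count_Abs_multiset count_mset finite)
  then show ?thesis by blast
qed

primrec Ck_on :: "nat \<Rightarrow> (real ^ 'd::finite) set \<Rightarrow> (real ^ 'd \<Rightarrow> 'b::real_normed_vector) \<Rightarrow> bool" where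
  "Ck_on 0 U f \<longleftrightarrow> continuous_on U f"
| "Ck_on (Suc k) U f \<longleftrightarrow> f differentiable_on U \<and> (\<forall>i. Ck_on k U (partial_deriv i f))"

text \<open>Used for open \<open>U\<close> only.\<close>

definition smooth_on :: "(real ^ 'd::finite) set \<Rightarrow> (real ^ 'd \<Rightarrow> 'b::real_normed_vector) \<Rightarrow> bool" where
  "smooth_on U f \<longleftrightarrow> (\<forall>k. Ck_on k U f)"

definition square_integrable :: "(real ^ 'd::finite) set \<Rightarrow> (real ^ 'd \<Rightarrow> real) \<Rightarrow> bool" where
  "square_integrable S f \<longleftrightarrow>
     f \<in> borel_measurable (lebesgue_on S) \<and> integrable (lebesgue_on S) (\<lambda>x. (f x)\<^sup>2)"

definition L2_norm :: "(real ^ 'd::finite) set \<Rightarrow> (real ^ 'd \<Rightarrow> 'b::real_normed_vector) \<Rightarrow> real" where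
  "L2_norm S f = sqrt (\<integral>x. (norm (f x))\<^sup>2 \<partial>lebesgue_on S)"

definition ess_bounded :: "(real ^ 'd::finite) set \<Rightarrow> (real ^ 'd \<Rightarrow> real) \<Rightarrow> bool" where
  "ess_bounded S f \<longleftrightarrow>
     f \<in> borel_measurable (lebesgue_on S) \<and> esssup (lebesgue_on S) (\<lambda>x. ereal \<bar>f x\<bar>) < \<infinity>"

definition Linf_norm :: "(real ^ 'd::finite) set \<Rightarrow> (real ^ 'd \<Rightarrow> 'b::real_normed_vector) \<Rightarrow> real" where
  "Linf_norm S f = real_of_ereal (esssup (lebesgue_on S) (\<lambda>x. ereal (norm (f x))))"

definition locally_integrable :: "(real ^ 'd::finite) set \<Rightarrow> (real ^ 'd \<Rightarrow> real) \<Rightarrow> bool" where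
  "locally_integrable \<Omega> f \<longleftrightarrow> (\<forall>K. compact K \<and> K \<subseteq> \<Omega> \<longrightarrow> integrable (lebesgue_on K) f)"

definition test_function :: "(real ^ 'd::finite) set \<Rightarrow> (real ^ 'd \<Rightarrow> real) \<Rightarrow> bool" where
  "test_function \<Omega> \<phi> \<longleftrightarrow>
     smooth_on UNIV \<phi> \<and> compact (closure {x. \<phi> x \<noteq> 0}) \<and> closure {x. \<phi> x \<noteq> 0} \<subseteq> \<Omega>"

definition is_weak_deriv ::
    "(real ^ 'd::finite) set \<Rightarrow> ('d \<Rightarrow> nat) \<Rightarrow> (real ^ 'd \<Rightarrow> real) \<Rightarrow> (real ^ 'd \<Rightarrow> real) \<Rightarrow> bool" where
  "is_weak_deriv \<Omega> \<alpha> f g \<longleftrightarrow>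
     locally_integrable \<Omega> f \<and> locally_integrable \<Omega> g \<and>
     (\<forall>\<phi>. test_function \<Omega> \<phi> \<longrightarrow>
        (\<integral>x. f x * multi_deriv \<alpha> \<phi> x \<partial>lebesgue_on \<Omega>)
          = (-1) ^ mi_order \<alpha> * (\<integral>x. g x * \<phi> x \<partial>lebesgue_on \<Omega>))"

text \<open>A representative of the weak derivative, which is unique almost everywhere.\<close>

definition weak_deriv ::
    "(real ^ 'd::finite) set \<Rightarrow> ('d \<Rightarrow> nat) \<Rightarrow> (real ^ 'd \<Rightarrow> real) \<Rightarrow> real ^ 'd \<Rightarrow> real" where
  "weak_deriv \<Omega> \<alpha> f = (SOME g. is_weak_deriv \<Omega> \<alpha> f g)"

text \<open>Here and below \<open>\<Omega>\<close> is meant to be open; an element enters through its interior.\<close>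

definition sobolev_2 :: "nat \<Rightarrow> (real ^ 'd::finite) set \<Rightarrow> (real ^ 'd \<Rightarrow> real) set" where
  "sobolev_2 k \<Omega> =
     {f. \<forall>\<alpha>. mi_order \<alpha> \<le> k \<longrightarrow> (\<exists>g. is_weak_deriv \<Omega> \<alpha> f g \<and> square_integrable \<Omega> g)}"

definition sobolev_inf :: "nat \<Rightarrow> (real ^ 'd::finite) set \<Rightarrow> (real ^ 'd \<Rightarrow> real) set" where
  "sobolev_inf k \<Omega> =
     {f. \<forall>\<alpha>. mi_order \<alpha> \<le> k \<longrightarrow> (\<exists>g. is_weak_deriv \<Omega> \<alpha> f g \<and> ess_bounded \<Omega> g)}"

definition sobolev_2_norm :: "nat \<Rightarrow> (real ^ 'd::finite) set \<Rightarrow> (real ^ 'd \<Rightarrow> real) \<Rightarrow> real" where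
  "sobolev_2_norm k \<Omega> f = sqrt (\<Sum>\<alpha> | mi_order \<alpha> \<le> k. (L2_norm \<Omega> (weak_deriv \<Omega> \<alpha> f))\<^sup>2)"

definition sobolev_2_norm_vec ::
    "nat \<Rightarrow> (real ^ 'd::finite) set \<Rightarrow> (real ^ 'd \<Rightarrow> real ^ 'm::finite) \<Rightarrow> real" where
  "sobolev_2_norm_vec k \<Omega> v = sqrt (\<Sum>i\<in>UNIV. (sobolev_2_norm k \<Omega> (\<lambda>x. v x $ i))\<^sup>2)"

definition spectral_norm :: "real ^ 'm::finite ^ 'm \<Rightarrow> real" where
  "spectral_norm A = onorm (\<lambda>y. A *v y)"

text \<open>The norm \<open>\<parallel>W\<parallel>\<close> with indices \<open>k, 2, \<infinity>\<close>. The derivatives are weak derivatives, defined only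
  almost everywhere, so the supremum over \<open>x\<close> is an essential supremum.\<close>

definition matrix_norm_2_inf ::
    "nat \<Rightarrow> (real ^ 'd::finite) set \<Rightarrow> (real ^ 'd \<Rightarrow> real ^ 'm::finite ^ 'm) \<Rightarrow> real" where
  "matrix_norm_2_inf k \<Omega> W = sqrt (\<Sum>\<alpha> | mi_order \<alpha> \<le> k.
     (Linf_norm \<Omega> (\<lambda>x. spectral_norm (\<chi> i j. weak_deriv \<Omega> \<alpha> (\<lambda>y. W y $ i $ j) x)))\<^sup>2)"

definition sym_pos_def :: "real ^ 'm::finite ^ 'm \<Rightarrow> bool" where
  "sym_pos_def A \<longleftrightarrow> transpose A = A \<and> (\<forall>y. y \<noteq> 0 \<longrightarrow> 0 < y \<bullet> (A *v y))"

text \<open>\<open>\<Phi>\<close> is smooth up to the boundary of the closed reference simplex. Since the Jacobian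
  determinant does not vanish there, the inverse of \<open>\<Phi>\<close> is then smooth as well.\<close>

definition element_map :: "(real ^ 'd::finite) set \<Rightarrow> (real ^ 'd \<Rightarrow> real ^ 'd) \<Rightarrow> bool" where
  "element_map Dhat \<Phi> \<longleftrightarrow>
     (\<exists>U. open U \<and> Dhat \<subseteq> U \<and> smooth_on U \<Phi>) \<and> inj_on \<Phi> Dhat \<and>
     (\<forall>x\<in>Dhat. 0 < det (matrix (frechet_derivative \<Phi> (at x))))"

text \<open>The Jacobian determinant as a function on the physical element \<open>\<Phi> ` Dhat\<close>.\<close>

definition jacobian_det ::
    "(real ^ 'd::finite) set \<Rightarrow> (real ^ 'd \<Rightarrow> real ^ 'd) \<Rightarrow> real ^ 'd \<Rightarrow> real" where
  "jacobian_det Dhat \<Phi> x = det (matrix (frechet_derivative \<Phi> (at (inv_into Dhat \<Phi> x))))"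

definition quasi_regular ::
    "nat \<Rightarrow> real \<Rightarrow> (real ^ 'd::finite) set \<Rightarrow> (real ^ 'd \<Rightarrow> real ^ 'd) \<Rightarrow> bool" where
  "quasi_regular N C0 Dhat \<Phi> \<longleftrightarrow>
     (\<forall>\<alpha>. 1 \<le> mi_order \<alpha> \<and> mi_order \<alpha> \<le> N + 1 \<longrightarrow>
        Linf_norm Dhat (multi_deriv \<alpha> \<Phi>) \<le> C0 * diameter (\<Phi> ` Dhat) ^ mi_order \<alpha>)"

definition poly_deg_le :: "nat \<Rightarrow> (real ^ 'd::finite \<Rightarrow> real) \<Rightarrow> bool" where
  "poly_deg_le N p \<longleftrightarrow>
     (\<exists>c. \<forall>x. p x = (\<Sum>\<alpha> | mi_order \<alpha> \<le> N. c \<alpha> * (\<Prod>i\<in>UNIV. (x $ i) ^ \<alpha> i)))"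

text \<open>\<open>(P\<^sup>N(D))\<^sup>m\<close> for \<open>D = \<Phi> ` Dhat\<close>. A function on \<open>D\<close> is represented by its extension by zero,
  so that distinct elements of the space differ on \<open>D\<close>.\<close>

definition PN ::
    "nat \<Rightarrow> (real ^ 'd::finite) set \<Rightarrow> (real ^ 'd \<Rightarrow> real ^ 'd) \<Rightarrow> (real ^ 'd \<Rightarrow> real ^ 'm::finite) set" where
  "PN N Dhat \<Phi> =
     {u. (\<forall>x. x \<notin> \<Phi> ` Dhat \<longrightarrow> u x = 0) \<and>
         (\<forall>i. \<exists>p. poly_deg_le N p \<and> (\<forall>x\<in>Dhat. u (\<Phi> x) $ i = p x))}"

definition L2_inner ::
    "(real ^ 'd::finite) set \<Rightarrow> (real ^ 'd \<Rightarrow> real ^ 'm::finite) \<Rightarrow> (real ^ 'd \<Rightarrow> real ^ 'm) \<Rightarrow> real" where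
  "L2_inner S u v = (\<integral>x. u x \<bullet> v x \<partial>lebesgue_on S)"

text \<open>\<open>T_inv\<close> is \<open>T\<^sup>-\<^sup>1\<close> with subscript \<open>A\<close>; like all of \<open>PN\<close>, its values vanish outside the element.\<close>

definition T_inv ::
    "nat \<Rightarrow> (real ^ 'd::finite) set \<Rightarrow> (real ^ 'd \<Rightarrow> real ^ 'd) \<Rightarrow> (real ^ 'd \<Rightarrow> real ^ 'm::finite ^ 'm)
      \<Rightarrow> (real ^ 'd \<Rightarrow> real ^ 'm) \<Rightarrow> real ^ 'd \<Rightarrow> real ^ 'm" where
  "T_inv N Dhat \<Phi> A v =
     (THE u. u \<in> PN N Dhat \<Phi> \<and>
        (\<forall>w \<in> PN N Dhat \<Phi>.
           L2_inner (\<Phi> ` Dhat) (\<lambda>x. A x *v u x) w = L2_inner (\<Phi> ` Dhat) v w))"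

end

theory Submission
  imports Defs
begin

text \<open>With \<open>A = W\<^sup>-\<^sup>1\<close> the function \<open>T\<^sup>-\<^sup>1 v\<close> is the orthogonal projection of \<open>W v\<close> onto \<open>P\<^sup>N\<close> for
  the inner product \<open>(A f, g)\<close>, because \<open>A (W v) = v\<close>; comparing this inner product with that of
  \<open>L\<^sup>2\<close> makes it quasi-optimal in \<open>L\<^sup>2\<close>, up to the factor \<open>w_max * wt_max\<close>. It remains to approximate
  the products \<open>W\<^sub>i\<^sub>j v\<^sub>j\<close>. On the reference simplex the Bramble-Hilbert argument bounds the error by
  the derivatives of order \<open>N + 1\<close> of \<open>(W\<^sub>i\<^sub>j v\<^sub>j) \<circ> \<Phi>\<close>; by the Leibniz and chain rules and the
  scaling of \<open>\<Phi>\<close> these are \<open>h\<close> to the power \<open>N + 1\<close> times derivatives of \<open>W\<^sub>i\<^sub>j\<close> and \<open>v\<^sub>j\<close>, and the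
  two changes of variables cost the suprema of \<open>J\<close> and \<open>1/J\<close>.

  The factors are only weakly differentiable, up to the boundary of the element but not beyond it.
  The estimate is therefore proved for mollified factors on shrunken copies of the simplex. A single
  polynomial serves all copies, since a polynomial is controlled on the whole simplex by its values
  on the half-size copy.\<close>

section \<open>Partial derivatives of smooth functions\<close>

text \<open>The constant has to be fixed before \<open>\<Phi>\<close>, \<open>W\<close> and
  \<open>v\<close>. This is why the chain rule bound \<open>jet_le_compose\<close> and the
  extrapolation bound \<open>poly_extrapolation_le\<close> are uniform in the map and in the set,
  and why their constants enter the locale \<open>scaled_element\<close> as parameters. Mollified
  derivatives are never shown to converge: uniform bounds in the sup norm for \<open>W\<close> and
  in L2 for \<open>V\<close> suffice, and only the product itself converges, in L2. Mollifying the
  factors separately keeps the Leibniz rule classical, with one factor bounded and one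
  square-integrable. The choice of a Taylor centre by averaging and the choice of a mollification
  radius each leave an arbitrarily small error \<open>\<eta>\<close>. It is removed only in
  \<open>error_estimate\<close>, where the other constants do not depend on it. Quasi-optimality
  concerns squared norms and would give the square root of \<open>w_max * wt_max\<close>; the stated
  first power follows because this product is at least 1.\<close>

lemma frechet_derivative_partial:
  fixes f :: "real ^ 'd::finite \<Rightarrow> 'b::real_normed_vector"
  assumes "f differentiable at x"
  shows "frechet_derivative f (at x) w = (\<Sum>i\<in>UNIV. w $ i *\<^sub>R partial_deriv i f x)"
proof -
  interpret linear "frechet_derivative f (at x)"
    by (rule linear_frechet_derivative[OF assms])
  have "frechet_derivative f (at x) w = frechet_derivative f (at x) (\<Sum>i\<in>UNIV. w $ i *\<^sub>R axis i 1)"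
    by (metis basis_expansion scalar_mult_eq_scaleR)
  then show ?thesis by (simp add: sum scale partial_deriv_def)
qed

lemma has_derivative_partial:
  fixes f :: "real ^ 'd::finite \<Rightarrow> 'b::real_normed_vector"
  assumes "f differentiable at x"
  shows "(f has_derivative (\<lambda>w. \<Sum>i\<in>UNIV. w $ i *\<^sub>R partial_deriv i f x)) (at x)"
proof -
  have "frechet_derivative f (at x) = (\<lambda>w. \<Sum>i\<in>UNIV. w $ i *\<^sub>R partial_deriv i f x)"
    using frechet_derivative_partial[OF assms] by blast
  then show ?thesis using assms frechet_derivative_works by metis
qed

lemma partial_deriv_eqI:
  "(f has_derivative f') (at x) \<Longrightarrow> partial_deriv i f x = f' (axis i 1)"
  unfolding partial_deriv_def by (metis frechet_derivative_at)

lemma differentiable_transform_open: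
  assumes "open U" "x \<in> U" "\<And>y. y \<in> U \<Longrightarrow> f y = g y" "f differentiable at x"
  shows "g differentiable at x"
  using assms has_derivative_transform_within_open[of f _ x UNIV U g]
  unfolding differentiable_def by auto

lemma partial_deriv_cong_open:
  assumes "open U" "x \<in> U" "\<And>y. y \<in> U \<Longrightarrow> f y = g y"
  shows "partial_deriv i f x = partial_deriv i g x"
proof -
  have "(f has_derivative F) (at x) \<longleftrightarrow> (g has_derivative F) (at x)" for F
    using has_derivative_transform_within_open[of f F x UNIV U g]
      has_derivative_transform_within_open[of g F x UNIV U f] assms by auto
  then show ?thesis unfolding partial_deriv_def frechet_derivative_def by simp
qed

text \<open>Openness makes differentiability and every partial derivative local to \<open>U\<close>.
  The calculus rules below give formulas for \<open>partial_deriv i f\<close> at points of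
  \<open>U\<close> only, and this lemma carries smoothness across such formulas.\<close>

lemma Ck_on_cong:
  assumes "open U" "\<And>y. y \<in> U \<Longrightarrow> f y = g y" "Ck_on k U f"
  shows "Ck_on k U g"
  using assms(2,3)
proof (induction k arbitrary: f g)
  case 0
  then show ?case by (metis Ck_on.simps(1) continuous_on_cong)
next
  case (Suc k)
  have "g differentiable_on U"
    using Suc.prems \<open>open U\<close> differentiable_transform_open[of U _ f g]
    by (auto simp: differentiable_on_eq_differentiable_at)
  moreover have "Ck_on k U (partial_deriv i g)" for i
    using Suc.IH[of "partial_deriv i f" "partial_deriv i g"] Suc.prems
      partial_deriv_cong_open[OF \<open>open U\<close>, of _ f g i] by auto
  ultimately show ?case by simp
qed

lemma Ck_on_mono_Suc: "Ck_on (Suc k) U f \<Longrightarrow> Ck_on k U f"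
proof (induction k arbitrary: f)
  case 0
  then show ?case by (simp add: differentiable_imp_continuous_on)
next
  case (Suc k)
  then show ?case by auto
qed

lemma Ck_on_continuous: "Ck_on k U f \<Longrightarrow> continuous_on U f"
  by (cases k) (auto simp: differentiable_imp_continuous_on)

lemma smooth_on_differentiable:
  "smooth_on U f \<Longrightarrow> open U \<Longrightarrow> x \<in> U \<Longrightarrow> f differentiable at x"
  unfolding smooth_on_def
  by (metis Ck_on.simps(2) differentiable_on_eq_differentiable_at)

lemma smooth_on_continuous: "smooth_on U f \<Longrightarrow> continuous_on U f"
  unfolding smooth_on_def using Ck_on_continuous by blast

lemma smooth_on_partial: "smooth_on U f \<Longrightarrow> smooth_on U (partial_deriv i f)"
  unfolding smooth_on_def by (metis Ck_on.simps(2))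

lemma smooth_onI:
  assumes "f differentiable_on U" "\<And>i. smooth_on U (partial_deriv i f)"
  shows "smooth_on U f"
  unfolding smooth_on_def
proof
  fix k show "Ck_on k U f"
    using assms by (cases k) (auto simp: smooth_on_def differentiable_imp_continuous_on)
qed

section \<open>Calculus rules for partial derivatives and smoothness\<close>

lemma partial_deriv_add:
  "f differentiable at x \<Longrightarrow> g differentiable at x \<Longrightarrow>
    partial_deriv i (\<lambda>y. f y + g y) x = partial_deriv i f x + partial_deriv i g x"
  by (rule trans[OF partial_deriv_eqI[OF has_derivative_add]])
    (auto simp: frechet_derivative_works[symmetric] partial_deriv_def)

lemma partial_deriv_mult:
  fixes f g :: "real ^ 'd::finite \<Rightarrow> real"
  assumes "f differentiable at x" "g differentiable at x"
  shows "partial_deriv i (\<lambda>y. f y * g y) x = partial_deriv i f x * g x + f x * partial_deriv i g x"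
proof -
  have "((\<lambda>y. f y * g y) has_derivative
      (\<lambda>h. f x * frechet_derivative g (at x) h + frechet_derivative f (at x) h * g x)) (at x)"
    using assms by (intro has_derivative_mult) (auto simp: frechet_derivative_works[symmetric])
  from partial_deriv_eqI[OF this] show ?thesis by (simp add: partial_deriv_def)
qed

lemma partial_deriv_const [simp]: "partial_deriv i (\<lambda>y. c) = (\<lambda>y. 0)"
  by (simp add: partial_deriv_def fun_eq_iff)

lemma smooth_on_const [simp, intro]: "smooth_on U (\<lambda>y. c)"
proof -
  have "Ck_on k U (\<lambda>y. c)" for k
    by (induction k arbitrary: c) auto
  then show ?thesis by (simp add: smooth_on_def)
qed

lemma Ck_on_add: "open U \<Longrightarrow> Ck_on k U f \<Longrightarrow> Ck_on k U g \<Longrightarrow> Ck_on k U (\<lambda>y. f y + g y)"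
proof (induction k arbitrary: f g)
  case 0
  then show ?case by (auto intro: continuous_on_add)
next
  case (Suc k)
  have "Ck_on k U (\<lambda>y. partial_deriv i f y + partial_deriv i g y)" for i
    by (rule Suc.IH) (use Suc.prems in auto)
  then have "Ck_on k U (partial_deriv i (\<lambda>y. f y + g y))" for i
    by (rule Ck_on_cong[rotated 2])
      (use Suc.prems in \<open>auto simp: partial_deriv_add differentiable_on_eq_differentiable_at\<close>)
  then show ?case using Suc.prems by (auto intro: differentiable_on_add)
qed

lemma smooth_on_add:
  "open U \<Longrightarrow> smooth_on U f \<Longrightarrow> smooth_on U g \<Longrightarrow> smooth_on U (\<lambda>y. f y + g y)"
  by (simp add: smooth_on_def Ck_on_add)

lemma smooth_on_sum:
  assumes "open U" "finite A" "\<And>a. a \<in> A \<Longrightarrow> smooth_on U (f a)"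
  shows "smooth_on U (\<lambda>y. \<Sum>a\<in>A. f a y)"
  using assms(2,3)
proof (induction A rule: finite_induct)
  case (insert a A)
  then show ?case using smooth_on_add[OF assms(1), of "f a" "\<lambda>y. \<Sum>a\<in>A. f a y"] by simp
qed simp

lemma Ck_on_mult:
  fixes f g :: "real ^ 'd::finite \<Rightarrow> real"
  shows "open U \<Longrightarrow> Ck_on k U f \<Longrightarrow> Ck_on k U g \<Longrightarrow> Ck_on k U (\<lambda>y. f y * g y)"
proof (induction k arbitrary: f g)
  case 0
  then show ?case by (auto intro: continuous_on_mult)
next
  case (Suc k)
  have "Ck_on k U (\<lambda>y. partial_deriv i f y * g y + f y * partial_deriv i g y)" for i
    using Suc.prems Ck_on_mono_Suc[OF Suc.prems(2)] Ck_on_mono_Suc[OF Suc.prems(3)]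
    by (intro Ck_on_add Suc.IH) auto
  then have "Ck_on k U (partial_deriv i (\<lambda>y. f y * g y))" for i
    by (rule Ck_on_cong[rotated 2])
      (use Suc.prems in \<open>auto simp: partial_deriv_mult differentiable_on_eq_differentiable_at\<close>)
  then show ?case using Suc.prems by (auto intro: differentiable_on_mult)
qed

lemma smooth_on_mult:
  fixes f g :: "real ^ 'd::finite \<Rightarrow> real"
  shows "open U \<Longrightarrow> smooth_on U f \<Longrightarrow> smooth_on U g \<Longrightarrow> smooth_on U (\<lambda>y. f y * g y)"
  by (simp add: smooth_on_def Ck_on_mult)

lemma smooth_on_component [simp, intro]: "smooth_on U (\<lambda>y. y $ j)"
proof (rule smooth_onI)
  show "(\<lambda>y. y $ j) differentiable_on U"
    by (simp add: bounded_linear_imp_differentiable_on bounded_linear_vec_nth)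
  have "partial_deriv i (\<lambda>y::real^'a. y $ j) = (\<lambda>y. axis i 1 $ j)" for i
    using partial_deriv_eqI[OF bounded_linear_imp_has_derivative[OF bounded_linear_vec_nth]] by blast
  then show "smooth_on U (partial_deriv i (\<lambda>y::real^'a. y $ j))" for i by simp
qed

lemma partial_deriv_nth:
  fixes f :: "real ^ 'd::finite \<Rightarrow> real ^ 'e::finite"
  assumes "f differentiable at x"
  shows "partial_deriv i (\<lambda>y. f y $ j) x = partial_deriv i f x $ j"
proof -
  have "((\<lambda>y. f y $ j) has_derivative (\<lambda>w. frechet_derivative f (at x) w $ j)) (at x)"
    by (rule bounded_linear.has_derivative[OF bounded_linear_vec_nth])
      (use assms frechet_derivative_works in blast)
  from partial_deriv_eqI[OF this] show ?thesis by (simp add: partial_deriv_def)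
qed

lemma Ck_on_nth:
  fixes f :: "real ^ 'd::finite \<Rightarrow> real ^ 'e::finite"
  shows "open U \<Longrightarrow> Ck_on k U f \<Longrightarrow> Ck_on k U (\<lambda>y. f y $ j)"
proof (induction k arbitrary: f)
  case 0
  then show ?case by (auto intro: continuous_on_component)
next
  case (Suc k)
  have "Ck_on k U (\<lambda>y. partial_deriv i f y $ j)" for i
    by (rule Suc.IH) (use Suc.prems in auto)
  then have "Ck_on k U (partial_deriv i (\<lambda>y. f y $ j))" for i
    by (rule Ck_on_cong[rotated 2])
      (use Suc.prems in \<open>auto simp: partial_deriv_nth differentiable_on_eq_differentiable_at\<close>)
  moreover have "(\<lambda>y. f y $ j) differentiable_on U"
    using Suc.prems differentiable_chain_at[of f _ "\<lambda>y. y $ j"]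
      bounded_linear_imp_differentiable[OF bounded_linear_vec_nth]
    by (auto simp: differentiable_on_eq_differentiable_at o_def)
  ultimately show ?case by simp
qed

lemma smooth_on_nth:
  fixes f :: "real ^ 'd::finite \<Rightarrow> real ^ 'e::finite"
  shows "open U \<Longrightarrow> smooth_on U f \<Longrightarrow> smooth_on U (\<lambda>y. f y $ j)"
  by (simp add: smooth_on_def Ck_on_nth)

lemma partial_deriv_compose:
  fixes f :: "real ^ 'e::finite \<Rightarrow> real" and \<Phi> :: "real ^ 'd::finite \<Rightarrow> real ^ 'e"
  assumes "\<Phi> differentiable at x" "f differentiable at (\<Phi> x)"
  shows "partial_deriv i (\<lambda>y. f (\<Phi> y)) x
    = (\<Sum>j\<in>UNIV. partial_deriv j f (\<Phi> x) * partial_deriv i (\<lambda>y. \<Phi> y $ j) x)"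
proof -
  have "((\<lambda>y. f (\<Phi> y)) has_derivative
      (\<lambda>w. frechet_derivative f (at (\<Phi> x)) (frechet_derivative \<Phi> (at x) w))) (at x)"
    using assms by (rule_tac has_derivative_compose[of \<Phi>]) (auto simp: frechet_derivative_works[symmetric])
  from partial_deriv_eqI[OF this]
  have "partial_deriv i (\<lambda>y. f (\<Phi> y)) x = frechet_derivative f (at (\<Phi> x)) (partial_deriv i \<Phi> x)"
    by (simp add: partial_deriv_def)
  also have "\<dots> = (\<Sum>j\<in>UNIV. partial_deriv i \<Phi> x $ j * partial_deriv j f (\<Phi> x))"
    using frechet_derivative_partial[OF assms(2)] by simp
  finally show ?thesis by (simp add: partial_deriv_nth[OF assms(1)] mult.commute)
qed

lemma Ck_on_sum:
  fixes f :: "'a \<Rightarrow> real ^ 'd::finite \<Rightarrow> 'b::real_normed_vector"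
  assumes "open U" "finite A" "\<And>a. a \<in> A \<Longrightarrow> Ck_on k U (f a)"
  shows "Ck_on k U (\<lambda>y. \<Sum>a\<in>A. f a y)"
  using assms(2,3)
proof (induction A rule: finite_induct)
  case empty
  show ?case using smooth_on_const[of U "0::'b"] by (simp only: smooth_on_def sum.empty)
next
  case (insert a A)
  then show ?case using Ck_on_add[OF assms(1), of k "f a" "\<lambda>y. \<Sum>a\<in>A. f a y"] by simp
qed

text \<open>The induction on the order ranges over all smooth \<open>f\<close> simultaneously, since
  the chain rule turns the composition into products that contain \<open>partial_deriv j f\<close>
  composed with \<open>\<Phi>\<close>.\<close>

lemma smooth_on_compose:
  fixes f :: "real ^ 'e::finite \<Rightarrow> real" and \<Phi> :: "real ^ 'd::finite \<Rightarrow> real ^ 'e"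
  assumes "open U" "open V" "smooth_on U \<Phi>" "\<Phi> ` U \<subseteq> V" "smooth_on V f"
  shows "smooth_on U (\<lambda>y. f (\<Phi> y))"
proof -
  have "Ck_on k U (\<lambda>y. f (\<Phi> y))" if "smooth_on V f" for k and f :: "real ^ 'e \<Rightarrow> real"
    using that
  proof (induction k arbitrary: f)
    case 0
    then show ?case
      using continuous_on_compose2[OF smooth_on_continuous[OF 0] smooth_on_continuous[OF assms(3)]] assms(4)
      by auto
  next
    case (Suc k)
    have d: "\<Phi> differentiable at x" "f differentiable at (\<Phi> x)" if "x \<in> U" for x
      using that smooth_on_differentiable assms Suc.prems by blast+
    have "Ck_on k U (\<lambda>x. \<Sum>j\<in>UNIV. partial_deriv j f (\<Phi> x) * partial_deriv i (\<lambda>y. \<Phi> y $ j) x)" for i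
      using smooth_on_partial[OF smooth_on_nth[OF assms(1,3)]] smooth_on_partial[OF Suc.prems] Suc.IH
      by (intro Ck_on_sum Ck_on_mult assms(1)) (auto simp: smooth_on_def)
    then have "Ck_on k U (partial_deriv i (\<lambda>y. f (\<Phi> y)))" for i
      by (rule Ck_on_cong[OF assms(1), rotated]) (simp add: partial_deriv_compose d)
    moreover have "(\<lambda>y. f (\<Phi> y)) differentiable_on U"
      using d differentiable_chain_at[of \<Phi> _ f] \<open>open U\<close>
      by (auto simp: differentiable_on_eq_differentiable_at o_def)
    ultimately show ?case by simp
  qed
  then show ?thesis using assms(5) by (simp add: smooth_on_def)
qed

subsection \<open>Symmetry of mixed partial derivatives\<close>

lemma partial_deriv_line:
  fixes f :: "real ^ 'd::finite \<Rightarrow> real"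
  assumes "f differentiable at (x + t *\<^sub>R axis i 1)"
  shows "((\<lambda>t. f (x + t *\<^sub>R axis i 1)) has_real_derivative partial_deriv i f (x + t *\<^sub>R axis i 1)) (at t)"
proof -
  have "((\<lambda>t. f (x + t *\<^sub>R axis i 1)) has_derivative
      (\<lambda>h. frechet_derivative f (at (x + t *\<^sub>R axis i 1)) (h *\<^sub>R axis i 1))) (at t)"
    using assms frechet_derivative_works
    by (intro has_derivative_compose[of "\<lambda>t. x + t *\<^sub>R axis i 1" "\<lambda>h. h *\<^sub>R axis i 1" _ UNIV f])
      (auto intro!: derivative_eq_intros)
  moreover have "linear (frechet_derivative f (at (x + t *\<^sub>R axis i 1)))"
    by (rule linear_frechet_derivative[OF assms])
  ultimately show ?thesis
    unfolding has_field_derivative_def partial_deriv_def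
    by (simp add: linear_scale mult.commute[of _ "frechet_derivative f _ _"])
qed

text \<open>The double difference quotient in directions \<open>i\<close> and \<open>j\<close> equals a value of the mixed
  derivative; it is symmetric in \<open>i\<close> and \<open>j\<close>.\<close>

lemma double_difference_mvt:
  fixes f :: "real ^ 'd::finite \<Rightarrow> real"
  assumes U: "ball x r \<subseteq> U" "open U" and f: "smooth_on U f" and s: "0 < s" "2 * s < r"
  obtains z where "dist x z \<le> 2 * s"
    "f (x + s *\<^sub>R axis i 1 + s *\<^sub>R axis j 1) - f (x + s *\<^sub>R axis i 1) - f (x + s *\<^sub>R axis j 1) + f x
      = s\<^sup>2 * partial_deriv j (partial_deriv i f) z"
proof -
  let ?a = "\<lambda>i. axis i (1::real) :: real^'d"
  have inU: "x + a *\<^sub>R ?a i + b *\<^sub>R ?a j \<in> U" and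
    near: "dist x (x + a *\<^sub>R ?a i + b *\<^sub>R ?a j) \<le> 2 * s" if "0 \<le> a" "a \<le> s" "0 \<le> b" "b \<le> s" for a b
  proof -
    have "norm (a *\<^sub>R ?a i + b *\<^sub>R ?a j) \<le> norm (a *\<^sub>R ?a i) + norm (b *\<^sub>R ?a j)"
      by (rule norm_triangle_ineq)
    also have "\<dots> \<le> 2 * s" using that by simp
    finally show *: "dist x (x + a *\<^sub>R ?a i + b *\<^sub>R ?a j) \<le> 2 * s"
      by (metis add.assoc dist_0_norm dist_add_cancel add.right_neutral)
    then show "x + a *\<^sub>R ?a i + b *\<^sub>R ?a j \<in> U" using U s by (auto simp: subset_iff)
  qed
  \<comment> \<open>The mean value theorem is applied in direction \<open>i\<close> to the increment
    in direction \<open>j\<close>, and then in direction \<open>j\<close> to the derivative so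
    obtained.\<close>
  let ?g = "\<lambda>t. f (x + s *\<^sub>R ?a j + t *\<^sub>R ?a i) - f (x + t *\<^sub>R ?a i)"
  have dif: "h differentiable at y" if "smooth_on U h" "y \<in> U" for h :: "real^'d \<Rightarrow> real" and y
    using smooth_on_differentiable U that by blast
  have "\<exists>\<xi>>0. \<xi> < s \<and> ?g s - ?g 0 = (s - 0) *
      (partial_deriv i f (x + s *\<^sub>R ?a j + \<xi> *\<^sub>R ?a i) - partial_deriv i f (x + \<xi> *\<^sub>R ?a i))"
  proof (rule MVT2)
    fix t assume t: "0 \<le> t" "t \<le> s"
    have "x + s *\<^sub>R ?a j + t *\<^sub>R ?a i \<in> U" "x + t *\<^sub>R ?a i \<in> U"
      using inU[of t s] inU[of t 0] t s by (auto simp: ac_simps)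
    then show "(?g has_real_derivative
        (partial_deriv i f (x + s *\<^sub>R ?a j + t *\<^sub>R ?a i) - partial_deriv i f (x + t *\<^sub>R ?a i))) (at t)"
      by (intro DERIV_diff partial_deriv_line dif[OF f])
  qed (use s in auto)
  then obtain \<xi> where \<xi>: "0 < \<xi>" "\<xi> < s" and 1: "?g s - ?g 0 = s *
      (partial_deriv i f (x + s *\<^sub>R ?a j + \<xi> *\<^sub>R ?a i) - partial_deriv i f (x + \<xi> *\<^sub>R ?a i))" by auto
  let ?k = "\<lambda>t. partial_deriv i f ((x + \<xi> *\<^sub>R ?a i) + t *\<^sub>R ?a j)"
  have "\<exists>\<zeta>>0. \<zeta> < s \<and> ?k s - ?k 0 = (s - 0) * partial_deriv j (partial_deriv i f) ((x + \<xi> *\<^sub>R ?a i) + \<zeta> *\<^sub>R ?a j)"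
    using s inU \<xi> by (intro MVT2 partial_deriv_line dif smooth_on_partial f) auto
  then obtain \<zeta> where \<zeta>: "0 < \<zeta>" "\<zeta> < s"
    and 2: "?k s - ?k 0 = s * partial_deriv j (partial_deriv i f) ((x + \<xi> *\<^sub>R ?a i) + \<zeta> *\<^sub>R ?a j)" by auto
  show ?thesis
  proof (rule that)
    show "dist x ((x + \<xi> *\<^sub>R ?a i) + \<zeta> *\<^sub>R ?a j) \<le> 2 * s" using near \<xi> \<zeta> by simp
    show "f (x + s *\<^sub>R ?a i + s *\<^sub>R ?a j) - f (x + s *\<^sub>R ?a i) - f (x + s *\<^sub>R ?a j) + f x
      = s\<^sup>2 * partial_deriv j (partial_deriv i f) ((x + \<xi> *\<^sub>R ?a i) + \<zeta> *\<^sub>R ?a j)"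
      using 1 2 by (simp add: power2_eq_square ac_simps)
  qed
qed

lemma partial_deriv_commute:
  fixes f :: "real ^ 'd::finite \<Rightarrow> real"
  assumes "open U" "smooth_on U f" "x \<in> U"
  shows "partial_deriv i (partial_deriv j f) x = partial_deriv j (partial_deriv i f) x"
proof -
  let ?p = "partial_deriv i (partial_deriv j f)" and ?q = "partial_deriv j (partial_deriv i f)"
  obtain r where r: "0 < r" "ball x r \<subseteq> U" using assms open_contains_ball by blast
  have cont: "continuous (at x) ?p" "continuous (at x) ?q"
    using smooth_on_continuous[OF smooth_on_partial[OF smooth_on_partial[OF assms(2)]]] assms
    by (auto simp: continuous_on_eq_continuous_at)
  have "\<bar>?p x - ?q x\<bar> \<le> e" if e: "e > 0" for e
  proof -
    obtain d1 where d1: "d1 > 0" "\<And>y. dist x y < d1 \<Longrightarrow> \<bar>?p y - ?p x\<bar> < e / 2"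
      using cont(1) e unfolding continuous_at_eps_delta dist_real_def
      by (metis dist_commute half_gt_zero_iff)
    obtain d2 where d2: "d2 > 0" "\<And>y. dist x y < d2 \<Longrightarrow> \<bar>?q y - ?q x\<bar> < e / 2"
      using cont(2) e unfolding continuous_at_eps_delta dist_real_def
      by (metis dist_commute half_gt_zero_iff)
    \<comment> \<open>The two intermediate points lie within \<open>2 * s\<close> of
      \<open>x\<close>; a third of the smallest radius keeps this strictly below all three
      radii.\<close>
    define s where "s = min r (min d1 d2) / 3"
    have s: "0 < s" "2 * s < r" "2 * s < d1" "2 * s < d2" using r d1 d2 by (auto simp: s_def min_def)
    obtain z1 where z1: "dist x z1 \<le> 2 * s"
      "f (x + s *\<^sub>R axis i 1 + s *\<^sub>R axis j 1) - f (x + s *\<^sub>R axis i 1) - f (x + s *\<^sub>R axis j 1) + f x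
      = s\<^sup>2 * ?q z1" using double_difference_mvt[OF r(2) assms(1,2) s(1,2)] by blast
    obtain z2 where z2: "dist x z2 \<le> 2 * s"
      "f (x + s *\<^sub>R axis j 1 + s *\<^sub>R axis i 1) - f (x + s *\<^sub>R axis j 1) - f (x + s *\<^sub>R axis i 1) + f x
      = s\<^sup>2 * ?p z2" using double_difference_mvt[OF r(2) assms(1,2) s(1,2)] by blast
    have "s\<^sup>2 * ?q z1 = s\<^sup>2 * ?p z2" using z1 z2 by (simp add: algebra_simps)
    then have "?q z1 = ?p z2" using s by simp
    moreover have "\<bar>?q z1 - ?q x\<bar> < e / 2" "\<bar>?p z2 - ?p x\<bar> < e / 2"
      using d1 d2 z1 z2 s by (meson le_less_trans)+
    ultimately show ?thesis by linarith
  qed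
  then have "\<bar>?p x - ?q x\<bar> \<le> 0" by (rule field_le_epsilon[of _ 0, simplified])
  then show ?thesis by simp
qed

subsection \<open>Iterated partial derivatives along a list of coordinates\<close>

text \<open>Lists instead of multi-indices: adding or removing one entry, at either end, is the
  induction step of the estimates. The head is the outermost derivative, the last entry the
  innermost.\<close>

abbreviation derivs ::
    "'d::finite list \<Rightarrow> (real ^ 'd \<Rightarrow> 'b::real_normed_vector) \<Rightarrow> real ^ 'd \<Rightarrow> 'b" where
  "derivs xs f \<equiv> foldr partial_deriv xs f"

lemma smooth_on_derivs: "smooth_on U f \<Longrightarrow> smooth_on U (derivs xs f)"
  by (induction xs) (auto intro: smooth_on_partial)

lemma derivs_cong_open:
  assumes "open U" "\<And>y. y \<in> U \<Longrightarrow> f y = g y" "x \<in> U"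
  shows "derivs xs f x = derivs xs g x"
  using assms(3) by (induction xs arbitrary: x) (auto intro: assms partial_deriv_cong_open)

lemma derivs_swap:
  fixes f :: "real ^ 'd::finite \<Rightarrow> real"
  assumes "open U" "smooth_on U f" "x \<in> U"
  shows "derivs (ys @ a # zs) f x = derivs (a # ys @ zs) f x"
  using assms(3)
proof (induction ys arbitrary: x)
  case (Cons b ys)
  have "derivs ((b # ys) @ a # zs) f x = partial_deriv b (partial_deriv a (derivs (ys @ zs) f)) x"
    using Cons by (auto intro!: partial_deriv_cong_open[OF assms(1)])
  also have "\<dots> = partial_deriv a (partial_deriv b (derivs (ys @ zs) f)) x"
    by (rule partial_deriv_commute[OF assms(1) smooth_on_derivs[OF assms(2)] Cons.prems])
  finally show ?case by simp
qed simp

text \<open>By symmetry only the counts matter: the head of \<open>xs\<close> occurs somewhere in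
  \<open>ys\<close>, and \<open>derivs_swap\<close> brings it to the front.\<close>

lemma derivs_perm:
  fixes f :: "real ^ 'd::finite \<Rightarrow> real"
  assumes "open U" "smooth_on U f" "x \<in> U" "mset xs = mset ys"
  shows "derivs xs f x = derivs ys f x"
  using assms(3,4)
proof (induction xs arbitrary: ys x)
  case (Cons a xs)
  then have "a \<in> set ys" by (metis list.set_intros(1) set_mset_mset)
  then obtain us vs where ys: "ys = us @ a # vs" using split_list by metis
  have "derivs xs f y = derivs (us @ vs) f y" if "y \<in> U" for y
    by (rule Cons.IH[OF that]) (use Cons.prems ys in simp)
  from partial_deriv_cong_open[OF assms(1) Cons.prems(1) this, where i = a]
  have "derivs (a # xs) f x = derivs (a # us @ vs) f x" by simp
  then show ?case using derivs_swap[OF assms(1,2) Cons.prems(1)] ys by metis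
qed simp

lemma multi_deriv_eq_derivs:
  obtains ys where "multi_deriv \<alpha> f = derivs ys f" "count_list ys = \<alpha>"
proof -
  have "\<forall>i. count_list (SOME xs. \<forall>i. count_list xs i = \<alpha> i) i = \<alpha> i"
    using ex_list_of_multi_index[of \<alpha>] by (rule someI_ex)
  then show ?thesis using that unfolding multi_deriv_def by blast
qed

lemma mset_eq_iff_count_list: "mset xs = mset ys \<longleftrightarrow> count_list xs = count_list ys"
  by (metis count_inject count_mset ext)

lemma mi_order_count_list [simp]: "mi_order (count_list xs) = length (xs :: 'd::finite list)"
  unfolding mi_order_def by (rule sum_count_set) auto

text \<open>\<open>multi_deriv\<close> uses an enumeration chosen by \<open>SOME\<close>;
  enumerations with equal counts are permutations of each other.\<close>

lemma multi_deriv_count_list: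
  fixes f :: "real ^ 'd::finite \<Rightarrow> real"
  assumes "open U" "smooth_on U f" "x \<in> U"
  shows "multi_deriv (count_list xs) f x = derivs xs f x"
proof -
  obtain ys where "multi_deriv (count_list xs) f = derivs ys f" "count_list ys = count_list xs"
    using multi_deriv_eq_derivs by metis
  then show ?thesis
    using derivs_perm[OF assms, of xs ys] mset_eq_iff_count_list by metis
qed

lemma derivs_nth:
  fixes f :: "real ^ 'd::finite \<Rightarrow> real ^ 'e::finite"
  assumes "open U" "smooth_on U f" "x \<in> U"
  shows "derivs xs (\<lambda>y. f y $ j) x = derivs xs f x $ j"
  using assms(3)
proof (induction xs arbitrary: x)
  case (Cons i xs)
  then have "derivs (i # xs) (\<lambda>y. f y $ j) x = partial_deriv i (\<lambda>y. derivs xs f y $ j) x"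
    by (auto intro!: partial_deriv_cong_open[OF assms(1)])
  then show ?case
    using smooth_on_differentiable[OF smooth_on_derivs[OF assms(2)] assms(1) Cons.prems]
    by (simp add: partial_deriv_nth)
qed simp

lemma derivs_add:
  assumes "open U" "smooth_on U f" "smooth_on U g" "x \<in> U"
  shows "derivs xs (\<lambda>y. f y + g y) x = derivs xs f x + derivs xs g x"
  using assms(4)
proof (induction xs arbitrary: x)
  case (Cons i xs)
  then have "derivs (i # xs) (\<lambda>y. f y + g y) x
      = partial_deriv i (\<lambda>y. derivs xs f y + derivs xs g y) x"
    by (auto intro!: partial_deriv_cong_open[OF assms(1)])
  also have "\<dots> = partial_deriv i (derivs xs f) x + partial_deriv i (derivs xs g) x"
    by (intro partial_deriv_add smooth_on_differentiable[OF smooth_on_derivs assms(1) Cons.prems] assms(2,3))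
  finally show ?case by simp
qed simp

lemma derivs_zero [simp]: "derivs xs (\<lambda>y. 0) = (\<lambda>y. 0)"
  by (induction xs) auto

lemma derivs_sum:
  assumes "open U" "finite A" "\<And>a. a \<in> A \<Longrightarrow> smooth_on U (f a)" "x \<in> U"
  shows "derivs xs (\<lambda>y. \<Sum>a\<in>A. f a y) x = (\<Sum>a\<in>A. derivs xs (f a) x)"
  using assms(2,3)
proof (induction A rule: finite_induct)
  case (insert a A)
  then show ?case
    using derivs_add[OF assms(1) _ smooth_on_sum[OF assms(1)] assms(4), of "f a" A f xs] by simp
qed simp

subsection \<open>Scaled bounds on jets\<close>

text \<open>Controls all derivatives up to order \<open>n\<close> at one point with length scale
  \<open>H\<close>. The power of \<open>H\<close> makes the bound multiplicative and lets one
  differentiation cost exactly one factor \<open>H\<close>.\<close>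

definition jet_le :: "nat \<Rightarrow> real \<Rightarrow> real \<Rightarrow> (real ^ 'd::finite \<Rightarrow> real) \<Rightarrow> real ^ 'd \<Rightarrow> bool" where
  "jet_le n H A f x \<longleftrightarrow> (\<forall>xs. length xs \<le> n \<longrightarrow> \<bar>derivs xs f x\<bar> \<le> A * H ^ length xs)"

lemma jet_leD: "jet_le n H A f x \<Longrightarrow> length xs \<le> n \<Longrightarrow> \<bar>derivs xs f x\<bar> \<le> A * H ^ length xs"
  by (simp add: jet_le_def)

lemma jet_le_partial: "jet_le (Suc n) H A f x \<Longrightarrow> jet_le n H (A * H) (partial_deriv i f) x"
  unfolding jet_le_def
proof (intro allI impI)
  fix xs :: "'a list"
  assume *: "\<forall>xs. length xs \<le> Suc n \<longrightarrow> \<bar>derivs xs f x\<bar> \<le> A * H ^ length xs" "length xs \<le> n"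
  then have "\<bar>derivs (xs @ [i]) f x\<bar> \<le> A * H ^ length (xs @ [i])"
    by (metis Suc_le_mono length_append_singleton)
  then show "\<bar>derivs xs (partial_deriv i f) x\<bar> \<le> A * H * H ^ length xs" by (simp add: ac_simps)
qed

lemma jet_le_mono: "jet_le (Suc n) H A f x \<Longrightarrow> jet_le n H A f x"
  by (auto simp: jet_le_def)

text \<open>Leibniz's rule without binomial coefficients: each differentiation replaces one product
  by two, which gives \<open>2 ^ n\<close>.\<close>

lemma jet_le_mult:
  assumes "open U" "smooth_on U f" "smooth_on U g" "x \<in> U" "0 \<le> H" "0 \<le> A" "0 \<le> B"
    and "jet_le n H A f x" "jet_le n H B g x"
  shows "jet_le n H (2 ^ n * A * B) (\<lambda>y. f y * g y) x"
  using assms(2-3,6-9)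
proof (induction n arbitrary: f g A B)
  case 0
  then have "\<bar>f x\<bar> \<le> A" "\<bar>g x\<bar> \<le> B" using jet_leD[of 0 H _ _ x "[]"] by fastforce+
  then show ?case by (simp add: jet_le_def abs_mult mult_mono)
next
  case (Suc n)
  show ?case unfolding jet_le_def
  proof (intro allI impI)
    fix xs :: "'a list" assume len: "length xs \<le> Suc n"
    show "\<bar>derivs xs (\<lambda>y. f y * g y) x\<bar> \<le> 2 ^ Suc n * A * B * H ^ length xs"
    proof (cases xs rule: rev_cases)
      case Nil
      have "\<bar>f x\<bar> \<le> A" "\<bar>g x\<bar> \<le> B" using Suc.prems jet_leD[of "Suc n" H _ _ x "[]"] by fastforce+
      then have "\<bar>f x * g x\<bar> \<le> 1 * (A * B)" by (simp add: abs_mult mult_mono)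
      also have "\<dots> \<le> 2 ^ Suc n * (A * B)"
        using Suc.prems by (intro mult_right_mono one_le_power) auto
      finally show ?thesis using Nil by (simp add: mult.assoc)
    next
      \<comment> \<open>The innermost derivative is taken off, so that the product rule acts on
        \<open>f\<close> and \<open>g\<close> themselves and the remaining list falls under the
        induction hypothesis.\<close>
      case (snoc ys i)
      let ?a = "\<lambda>y. partial_deriv i f y * g y" and ?b = "\<lambda>y. f y * partial_deriv i g y"
      have "jet_le n H (2 ^ n * (A * H) * B) ?a x"
        using Suc.prems assms(5)
        by (intro Suc.IH smooth_on_partial jet_le_partial jet_le_mono[of n H B]) auto
      moreover have "jet_le n H (2 ^ n * A * (B * H)) ?b x"
        using Suc.prems assms(5)
        by (intro Suc.IH smooth_on_partial jet_le_partial jet_le_mono[of n H A]) auto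
      ultimately have *: "\<bar>derivs ys ?a x\<bar> \<le> 2 ^ n * (A * H) * B * H ^ length ys"
        "\<bar>derivs ys ?b x\<bar> \<le> 2 ^ n * A * (B * H) * H ^ length ys"
        using len snoc by (auto dest: jet_leD)
      have "derivs xs (\<lambda>y. f y * g y) x = derivs ys (\<lambda>y. ?a y + ?b y) x"
        using snoc Suc.prems smooth_on_differentiable assms(1)
        by (auto intro!: derivs_cong_open[OF assms(1) _ assms(4)] partial_deriv_mult)
      also have "\<dots> = derivs ys ?a x + derivs ys ?b x"
        using Suc.prems by (intro derivs_add[OF assms(1) _ _ assms(4)] smooth_on_mult smooth_on_partial assms(1))
      finally show ?thesis using * snoc by (simp add: algebra_simps)
    qed
  qed
qed

text \<open>All derivatives of \<open>f\<close> at \<open>\<Phi> x\<close> are measured with unit length, while those of \<open>\<Phi>\<close> carry the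
  length scale \<open>H\<close>; every term of the Faa di Bruno expansion then scales like \<open>H\<close> to the order.\<close>

lemma jet_le_compose:
  assumes C: "0 \<le> C"
  shows "\<exists>K\<ge>1. \<forall>(f :: real ^ 'e::finite \<Rightarrow> real) (\<Phi> :: real ^ 'd::finite \<Rightarrow> real ^ 'e) U V x H B.
      open U \<longrightarrow> open V \<longrightarrow> smooth_on U \<Phi> \<longrightarrow> \<Phi> ` U \<subseteq> V \<longrightarrow> smooth_on V f \<longrightarrow> x \<in> U \<longrightarrow>
      0 \<le> H \<longrightarrow> 0 \<le> B \<longrightarrow>
      (\<forall>j xs. 1 \<le> length xs \<longrightarrow> length xs \<le> n \<longrightarrow>
        \<bar>derivs xs (\<lambda>y. \<Phi> y $ j) x\<bar> \<le> C * H ^ length xs) \<longrightarrow>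
      (\<forall>ys. length ys \<le> n \<longrightarrow> \<bar>derivs ys f (\<Phi> x)\<bar> \<le> B) \<longrightarrow>
      jet_le n H (K * B) (\<lambda>y. f (\<Phi> y)) x"
proof (induction n)
  case 0
  show ?case by (intro exI[of _ 1] conjI) (auto simp: jet_le_def)
next
  case (Suc n)
  obtain K where K: "1 \<le> K" and IH': "\<forall>(f :: real ^ 'e \<Rightarrow> real) (\<Phi> :: real ^ 'd \<Rightarrow> real ^ 'e) U V x H B.
      open U \<longrightarrow> open V \<longrightarrow> smooth_on U \<Phi> \<longrightarrow> \<Phi> ` U \<subseteq> V \<longrightarrow> smooth_on V f \<longrightarrow> x \<in> U \<longrightarrow>
      0 \<le> H \<longrightarrow> 0 \<le> B \<longrightarrow>
      (\<forall>j xs. 1 \<le> length xs \<longrightarrow> length xs \<le> n \<longrightarrow>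
        \<bar>derivs xs (\<lambda>y. \<Phi> y $ j) x\<bar> \<le> C * H ^ length xs) \<longrightarrow>
      (\<forall>ys. length ys \<le> n \<longrightarrow> \<bar>derivs ys f (\<Phi> x)\<bar> \<le> B) \<longrightarrow>
      jet_le n H (K * B) (\<lambda>y. f (\<Phi> y)) x"
    using Suc.IH by blast
  note IH = IH'[rule_format]
  \<comment> \<open>The chain rule gives \<open>CARD('e)\<close> products of a factor with constant
    \<open>K * B\<close>, by induction, and a factor with constant \<open>C * H\<close>;
    \<open>jet_le_mult\<close> adds \<open>2 ^ n\<close>. The summand \<open>K\<close> keeps the
    constant at least 1, as order 0 requires.\<close>
  define K' where "K' = K + real CARD('e) * (2 ^ n * K * C)"
  have "K \<le> K'" using K C by (simp add: K'_def)
  show ?case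
  proof (intro exI[of _ K'] conjI allI impI)
    show "1 \<le> K'" using K \<open>K \<le> K'\<close> by simp
    fix f :: "real ^ 'e \<Rightarrow> real" and \<Phi> :: "real ^ 'd \<Rightarrow> real ^ 'e" and U V x H B
    assume U: "open U" "open V" "smooth_on U \<Phi>" "\<Phi> ` U \<subseteq> V" "smooth_on V f" and x: "x \<in> U"
      and H: "0 \<le> H" and B: "0 \<le> B"
      and Phi': "\<forall>j xs. 1 \<le> length xs \<longrightarrow> length xs \<le> Suc n \<longrightarrow>
        \<bar>derivs xs (\<lambda>y. \<Phi> y $ j) x\<bar> \<le> C * H ^ length xs"
      and f': "\<forall>ys. length ys \<le> Suc n \<longrightarrow> \<bar>derivs ys f (\<Phi> x)\<bar> \<le> B"
    note Phi = Phi'[rule_format] and f = f'[rule_format]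
    show "jet_le (Suc n) H (K' * B) (\<lambda>y. f (\<Phi> y)) x"
      unfolding jet_le_def
    proof (intro allI impI)
      fix xs :: "'d list" assume len: "length xs \<le> Suc n"
      show "\<bar>derivs xs (\<lambda>y. f (\<Phi> y)) x\<bar> \<le> K' * B * H ^ length xs"
      proof (cases xs rule: rev_cases)
        case Nil
        have "\<bar>f (\<Phi> x)\<bar> \<le> 1 * B" using f[of "[]"] by simp
        also have "\<dots> \<le> K' * B" using K \<open>K \<le> K'\<close> B by (intro mult_right_mono) auto
        finally show ?thesis using Nil by simp
      next
        case (snoc ys i)
        let ?a = "\<lambda>j y. partial_deriv j f (\<Phi> y) * partial_deriv i (\<lambda>y. \<Phi> y $ j) y"
        have sm: "smooth_on U (\<lambda>y. partial_deriv j f (\<Phi> y))"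
          "smooth_on U (partial_deriv i (\<lambda>y. \<Phi> y $ j))" for j
          using smooth_on_compose[OF U(1-4) smooth_on_partial[OF U(5)]]
            smooth_on_partial[OF smooth_on_nth[OF U(1,3)]] by auto
        have b: "\<bar>derivs ys (?a j) x\<bar> \<le> 2 ^ n * (K * B) * (C * H) * H ^ length ys" for j
        proof (rule jet_leD)
          show "jet_le n H (2 ^ n * (K * B) * (C * H)) (?a j) x"
          proof (rule jet_le_mult[OF U(1) sm x H])
            show "jet_le n H (K * B) (\<lambda>y. partial_deriv j f (\<Phi> y)) x"
            proof (rule IH[OF U(1-4) smooth_on_partial[OF U(5)] x H B])
              show "\<bar>derivs ys (partial_deriv j f) (\<Phi> x)\<bar> \<le> B" if "length ys \<le> n" for ys
                using f[of "ys @ [j]"] that by simp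
            qed (use Phi in auto)
            show "jet_le n H (C * H) (partial_deriv i (\<lambda>y. \<Phi> y $ j)) x"
              unfolding jet_le_def
            proof (intro allI impI)
              fix zs :: "'d list" assume "length zs \<le> n"
              then show "\<bar>derivs zs (partial_deriv i (\<lambda>y. \<Phi> y $ j)) x\<bar> \<le> C * H * H ^ length zs"
                using Phi[of "zs @ [i]" j] by (simp add: ac_simps)
            qed
          qed (use K B C H in auto)
          show "length ys \<le> n" using len snoc by simp
        qed
        have "derivs xs (\<lambda>y. f (\<Phi> y)) x = derivs ys (\<lambda>y. \<Sum>j\<in>UNIV. ?a j y) x"
        proof -
          have "partial_deriv i (\<lambda>y. f (\<Phi> y)) y = (\<Sum>j\<in>UNIV. ?a j y)" if "y \<in> U" for y
          proof (rule partial_deriv_compose)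
            show "\<Phi> differentiable at y" by (rule smooth_on_differentiable[OF U(3,1) that])
            show "f differentiable at (\<Phi> y)" using smooth_on_differentiable[OF U(5,2)] U(4) that by blast
          qed
          then have "derivs ys (partial_deriv i (\<lambda>y. f (\<Phi> y))) x = derivs ys (\<lambda>y. \<Sum>j\<in>UNIV. ?a j y) x"
            by (rule derivs_cong_open[OF U(1) _ x])
          then show ?thesis using snoc by simp
        qed
        also have "\<dots> = (\<Sum>j\<in>UNIV. derivs ys (?a j) x)"
          by (rule derivs_sum[OF U(1) _ _ x]) (auto intro!: smooth_on_mult[OF U(1)] sm)
        finally have "\<bar>derivs xs (\<lambda>y. f (\<Phi> y)) x\<bar> \<le> (\<Sum>j\<in>UNIV. \<bar>derivs ys (?a j) x\<bar>)" by simp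
        also have "\<dots> \<le> real CARD('e) * (2 ^ n * (K * B) * (C * H) * H ^ length ys)"
          using sum_bounded_above[of UNIV "\<lambda>j. \<bar>derivs ys (?a j) x\<bar>", OF b] by simp
        also have "\<dots> = (real CARD('e) * (2 ^ n * K * C)) * B * H ^ length xs"
          using snoc by simp
        also have "\<dots> \<le> K' * B * H ^ length xs"
          using K B H by (intro mult_right_mono) (auto simp: K'_def)
        finally show ?thesis .
      qed
    qed
  qed
qed

section \<open>Polynomials of bounded total degree\<close>

lemma poly_deg_le_const: "poly_deg_le N (\<lambda>x :: real ^ 'd::finite. c)"
proof -
  have "c = (\<Sum>\<alpha> | mi_order \<alpha> \<le> N. (if \<alpha> = (\<lambda>_::'d. 0) then c else 0) * (\<Prod>i\<in>UNIV. (x $ i) ^ \<alpha> i))"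
    for x :: "real ^ 'd"
  proof -
    have "(\<Sum>\<alpha> | mi_order \<alpha> \<le> N. (if \<alpha> = (\<lambda>_::'d. 0) then c else 0) * (\<Prod>i\<in>UNIV. (x $ i) ^ \<alpha> i))
      = (\<Sum>\<alpha> | mi_order \<alpha> \<le> N. if \<alpha> = (\<lambda>_::'d. 0) then c else 0)"
      by (rule sum.cong) auto
    also have "\<dots> = c" by (simp add: sum.delta finite_mi_order_le) (simp add: mi_order_def)
    finally show ?thesis by simp
  qed
  then show ?thesis unfolding poly_deg_le_def by (intro exI[of _ "\<lambda>\<alpha>. if \<alpha> = (\<lambda>_::'d. 0) then c else 0"]) blast
qed

lemma poly_deg_le_add:
  assumes "poly_deg_le N p" "poly_deg_le N q"
  shows "poly_deg_le N (\<lambda>x. p x + q x)"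
proof -
  obtain c where "\<And>x. p x = (\<Sum>\<alpha> | mi_order \<alpha> \<le> N. c \<alpha> * (\<Prod>i\<in>UNIV. (x $ i) ^ \<alpha> i))"
    using assms(1) poly_deg_le_def by blast
  moreover obtain d where "\<And>x. q x = (\<Sum>\<alpha> | mi_order \<alpha> \<le> N. d \<alpha> * (\<Prod>i\<in>UNIV. (x $ i) ^ \<alpha> i))"
    using assms(2) poly_deg_le_def by blast
  ultimately show ?thesis unfolding poly_deg_le_def
    by (intro exI[of _ "\<lambda>\<alpha>. c \<alpha> + d \<alpha>"]) (simp add: distrib_right sum.distrib)
qed

lemma poly_deg_le_cmult:
  assumes "poly_deg_le N p"
  shows "poly_deg_le N (\<lambda>x. a * p x)"
proof -
  obtain c where "\<And>x. p x = (\<Sum>\<alpha> | mi_order \<alpha> \<le> N. c \<alpha> * (\<Prod>i\<in>UNIV. (x $ i) ^ \<alpha> i))"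
    using assms(1) poly_deg_le_def by blast
  then show ?thesis unfolding poly_deg_le_def
    by (intro exI[of _ "\<lambda>\<alpha>. a * c \<alpha>"]) (simp add: sum_distrib_left mult.assoc)
qed

lemma poly_deg_le_diff:
  "poly_deg_le N p \<Longrightarrow> poly_deg_le N q \<Longrightarrow> poly_deg_le N (\<lambda>x. p x - q x)"
  using poly_deg_le_add[OF _ poly_deg_le_cmult[of N q "-1"], of p] by simp

lemma poly_deg_le_sum:
  "(\<And>a. a \<in> A \<Longrightarrow> poly_deg_le N (p a)) \<Longrightarrow> poly_deg_le N (\<lambda>x. \<Sum>a\<in>A. p a x)"
proof (induction A rule: infinite_finite_induct)
  case (insert a A)
  then show ?case using poly_deg_le_add[of N "p a" "\<lambda>x. \<Sum>a\<in>A. p a x"] by simp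
qed (simp_all add: poly_deg_le_const)

lemma poly_deg_le_mono:
  assumes "poly_deg_le N p" "N \<le> M"
  shows "poly_deg_le M p"
proof -
  obtain c where c: "\<And>x. p x = (\<Sum>\<alpha> | mi_order \<alpha> \<le> N. c \<alpha> * (\<Prod>i\<in>UNIV. (x $ i) ^ \<alpha> i))"
    using assms(1) poly_deg_le_def by blast
  have "p x = (\<Sum>\<alpha> | mi_order \<alpha> \<le> M. (if mi_order \<alpha> \<le> N then c \<alpha> else 0) * (\<Prod>i\<in>UNIV. (x $ i) ^ \<alpha> i))" for x
    unfolding c using assms(2) by (intro sum.mono_neutral_cong_left finite_mi_order_le) auto
  then show ?thesis unfolding poly_deg_le_def
    by (intro exI[of _ "\<lambda>\<alpha>. if mi_order \<alpha> \<le> N then c \<alpha> else 0"]) blast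
qed

lemma poly_deg_le_coord:
  fixes p :: "real ^ 'd::finite \<Rightarrow> real"
  assumes "poly_deg_le N p"
  shows "poly_deg_le (Suc N) (\<lambda>x. x $ i * p x)"
proof -
  obtain c where c: "\<And>x. p x = (\<Sum>\<alpha> | mi_order \<alpha> \<le> N. c \<alpha> * (\<Prod>j\<in>UNIV. (x $ j) ^ \<alpha> j))"
    using assms(1) poly_deg_le_def by blast
  \<comment> \<open>\<open>?s\<close> raises the exponent of coordinate \<open>i\<close>;
    \<open>?c\<close> reads the old coefficient back and is 0 on the exponents outside the range of
    \<open>?s\<close>.\<close>
  let ?s = "\<lambda>\<alpha>::'d \<Rightarrow> nat. \<alpha>(i := Suc (\<alpha> i))" and ?c = "\<lambda>\<beta>::'d \<Rightarrow> nat. if \<beta> i > 0 then c (\<beta>(i := \<beta> i - 1)) else 0"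
  have ord: "mi_order (?s \<alpha>) = Suc (mi_order \<alpha>)" for \<alpha>
    unfolding mi_order_def by (simp add: sum.remove[of UNIV i])
  have "x $ i * p x = (\<Sum>\<beta> | mi_order \<beta> \<le> Suc N. ?c \<beta> * (\<Prod>j\<in>UNIV. (x $ j) ^ \<beta> j))" for x
  proof -
    have "x $ i * p x = (\<Sum>\<alpha> | mi_order \<alpha> \<le> N. c \<alpha> * (x $ i * (\<Prod>j\<in>UNIV. (x $ j) ^ \<alpha> j)))"
      unfolding c by (simp add: sum_distrib_left algebra_simps)
    also have "\<dots> = (\<Sum>\<alpha> | mi_order \<alpha> \<le> N. ?c (?s \<alpha>) * (\<Prod>j\<in>UNIV. (x $ j) ^ (?s \<alpha>) j))"
      by (rule sum.cong) (simp_all add: prod.remove[of UNIV i])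
    also have "\<dots> = (\<Sum>\<beta> \<in> ?s ` {\<alpha>. mi_order \<alpha> \<le> N}. ?c \<beta> * (\<Prod>j\<in>UNIV. (x $ j) ^ \<beta> j))"
    proof (rule sum.reindex_cong[symmetric, where l = ?s])
      show "inj_on ?s {\<alpha>. mi_order \<alpha> \<le> N}"
      proof (rule inj_onI)
        fix a b assume "?s a = ?s b"
        then have "(?s a)(i := a i) = (?s b)(i := b i)" by (metis fun_upd_same nat.inject)
        then show "a = b" by simp
      qed
    qed simp_all
    also have "\<dots> = (\<Sum>\<beta> | mi_order \<beta> \<le> Suc N. ?c \<beta> * (\<Prod>j\<in>UNIV. (x $ j) ^ \<beta> j))"
    proof (rule sum.mono_neutral_left[OF finite_mi_order_le])
      show "\<forall>\<beta>\<in>{\<beta>. mi_order \<beta> \<le> Suc N} - ?s ` {\<alpha>. mi_order \<alpha> \<le> N}.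
        ?c \<beta> * (\<Prod>j\<in>UNIV. (x $ j) ^ \<beta> j) = 0"
      proof
        fix \<beta> assume \<beta>: "\<beta> \<in> {\<beta>. mi_order \<beta> \<le> Suc N} - ?s ` {\<alpha>. mi_order \<alpha> \<le> N}"
        have "\<beta> i = 0"
        proof (rule ccontr)
          assume "\<beta> i \<noteq> 0"
          then have *: "?s (\<beta>(i := \<beta> i - 1)) = \<beta>" by auto
          then have "mi_order (\<beta>(i := \<beta> i - 1)) \<le> N" using \<beta> ord[of "\<beta>(i := \<beta> i - 1)"] by simp
          then show False using * \<beta> by (metis (mono_tags) DiffD2 image_eqI mem_Collect_eq)
        qed
        then show "?c \<beta> * (\<Prod>j\<in>UNIV. (x $ j) ^ \<beta> j) = 0" by simp
      qed
    qed (use ord in auto)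
    finally show ?thesis .
  qed
  then show ?thesis unfolding poly_deg_le_def by (intro exI[of _ ?c]) blast
qed

lemma poly_deg_le_coord_diff:
  "poly_deg_le N p \<Longrightarrow> poly_deg_le (Suc N) (\<lambda>x. (x $ i - a) * p x)"
  using poly_deg_le_diff[OF poly_deg_le_coord[of N p i] poly_deg_le_mono[OF poly_deg_le_cmult[of N p a], of "Suc N"]]
  by (simp add: left_diff_distrib)

lemma poly_deg_le_prod_list:
  fixes y :: "real ^ 'd::finite"
  shows "poly_deg_le (length xs) (\<lambda>x. prod_list (map (($) (x - y)) xs))"
proof (induction xs)
  case (Cons i xs)
  from poly_deg_le_coord_diff[OF Cons, of i "y $ i"] show ?case by simp
qed (simp add: poly_deg_le_const)

lemma continuous_on_poly_deg_le: "poly_deg_le N p \<Longrightarrow> continuous_on S p"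
proof -
  assume "poly_deg_le N p"
  then obtain c where "p = (\<lambda>x. \<Sum>\<alpha> | mi_order \<alpha> \<le> N. c \<alpha> * (\<Prod>i\<in>UNIV. (x $ i) ^ \<alpha> i))"
    unfolding poly_deg_le_def by blast
  then show ?thesis by (auto intro!: continuous_intros)
qed

section \<open>The Taylor remainder along segments\<close>

text \<open>\<open>\<phi> k\<close> stands for the \<open>k\<close>-th derivative. The kernel of the
  exact remainder is replaced by the bound 1: the induction applies the estimate to the shifted
  family and integrates it by the mean value inequality, so that only the L1 norm of the last
  derivative survives.\<close>

lemma taylor_remainder_le:
  fixes \<phi> :: "nat \<Rightarrow> real \<Rightarrow> real"
  assumes "\<And>k s. k \<le> n \<Longrightarrow> s \<in> {0..1} \<Longrightarrow> (\<phi> k has_real_derivative \<phi> (Suc k) s) (at s within {0..1})"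
    and "continuous_on {0..1} (\<phi> (Suc n))" and "s \<in> {0..1}"
  shows "\<bar>\<phi> 0 s - (\<Sum>k\<le>n. \<phi> k 0 * s ^ k / fact k)\<bar> \<le> integral {0..1} (\<lambda>t. \<bar>\<phi> (Suc n) t\<bar>)"
  using assms
proof (induction n arbitrary: \<phi> s)
  case 0
  have "(\<phi> 1 has_integral \<phi> 0 s - \<phi> 0 0) {0..s}"
  proof (rule fundamental_theorem_of_calculus)
    fix x assume "x \<in> {0..s}"
    then have "(\<phi> 0 has_real_derivative \<phi> 1 x) (at x within {0..1})" using 0 by auto
    then show "(\<phi> 0 has_vector_derivative \<phi> 1 x) (at x within {0..s})"
      unfolding has_real_derivative_iff_has_vector_derivative
      by (rule has_vector_derivative_within_subset) (use 0 in auto)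
  qed (use 0 in auto)
  then have i: "integral {0..s} (\<phi> 1) = \<phi> 0 s - \<phi> 0 0" by (rule integral_unique)
  have c: "continuous_on {0..1} (\<lambda>t. \<bar>\<phi> 1 t\<bar>)" "continuous_on {0..1} (\<phi> 1)"
    using 0 by (auto intro!: continuous_intros)
  have int: "(\<lambda>t. \<bar>\<phi> 1 t\<bar>) integrable_on {0..s}" "\<phi> 1 integrable_on {0..s}" "(\<lambda>t. \<bar>\<phi> 1 t\<bar>) integrable_on {0..1}"
    using 0 c by (auto intro!: integrable_continuous_interval elim!: continuous_on_subset)
  have "\<bar>\<phi> 0 s - \<phi> 0 0\<bar> \<le> integral {0..s} (\<lambda>t. \<bar>\<phi> 1 t\<bar>)"
    unfolding i[symmetric] using integral_norm_bound_integral[OF int(2,1)] by simp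
  also have "\<dots> \<le> integral {0..1} (\<lambda>t. \<bar>\<phi> 1 t\<bar>)"
    using 0 int by (intro integral_subset_le) auto
  finally show ?case by simp
next
  case (Suc n)
  let ?M = "integral {0..1} (\<lambda>t. \<bar>\<phi> (Suc (Suc n)) t\<bar>)"
  let ?E = "\<lambda>s. \<phi> 0 s - (\<Sum>k\<le>Suc n. \<phi> k 0 * s ^ k / fact k)"
  have IH: "\<bar>\<phi> 1 t - (\<Sum>k\<le>n. \<phi> (Suc k) 0 * t ^ k / fact k)\<bar> \<le> ?M" if "t \<in> {0..1}" for t
    using Suc.IH[of "\<lambda>k. \<phi> (Suc k)" t] Suc.prems that by simp
  have d: "(?E has_real_derivative \<phi> 1 t - (\<Sum>k\<le>n. \<phi> (Suc k) 0 * t ^ k / fact k)) (at t within {0..1})"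
    if "t \<in> {0..1}" for t
  proof -
    have "((\<lambda>s. \<Sum>k\<le>Suc n. \<phi> k 0 * s ^ k / fact k) has_real_derivative
        (\<Sum>k\<le>Suc n. \<phi> k 0 * (real k * t ^ (k - 1)) / fact k)) (at t within {0..1})"
      by (rule DERIV_sum) (auto intro!: derivative_eq_intros)
    also have "(\<Sum>k\<le>Suc n. \<phi> k 0 * (real k * t ^ (k - 1)) / fact k) = (\<Sum>k\<le>n. \<phi> (Suc k) 0 * t ^ k / fact k)"
      by (subst sum.atMost_Suc_shift) (auto intro!: sum.cong simp: divide_simps)
    finally show ?thesis using Suc.prems(1)[of 0 t] that by (intro DERIV_diff) auto
  qed
  have M: "0 \<le> ?M"
    using IH[of 0] by fastforce
  have "norm (?E s - ?E 0) \<le> ?M * norm (s - 0)"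
    using IH d Suc.prems(3) by (intro field_differentiable_bound[of "{0..1}" ?E]) auto
  also have "\<dots> \<le> ?M * 1" using M Suc.prems(3) by (intro mult_left_mono) auto
  finally show ?case by simp
qed

text \<open>Jensen on the unit interval: the variance of \<open>\<bar>f\<bar>\<close> about its mean
  \<open>?c\<close> is nonnegative.\<close>

lemma square_integral_le:
  fixes f :: "real \<Rightarrow> real"
  assumes "continuous_on {0..1} f"
  shows "(integral {0..1} (\<lambda>t. \<bar>f t\<bar>))\<^sup>2 \<le> integral {0..1} (\<lambda>t. (f t)\<^sup>2)"
proof -
  let ?c = "integral {0..1} (\<lambda>t. \<bar>f t\<bar>)"
  have "0 \<le> integral {0..1} (\<lambda>t. (\<bar>f t\<bar> - ?c)\<^sup>2)"
    by (intro integral_nonneg integrable_continuous_interval continuous_intros assms) auto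
  also have "(\<lambda>t. (\<bar>f t\<bar> - ?c)\<^sup>2) = (\<lambda>t. ((f t)\<^sup>2 - 2 * ?c * \<bar>f t\<bar>) + ?c\<^sup>2)"
    by (auto simp: power2_eq_square algebra_simps)
  also have "integral {0..1} \<dots> = (integral {0..1} (\<lambda>t. (f t)\<^sup>2) - integral {0..1} (\<lambda>t. 2 * ?c * \<bar>f t\<bar>)) + ?c\<^sup>2"
    by (subst integral_add integral_diff;
        (intro integrable_continuous_interval continuous_intros assms)?)+ auto
  also have "integral {0..1} (\<lambda>t. 2 * ?c * \<bar>f t\<bar>) = 2 * ?c * ?c" by simp
  finally show ?thesis by (simp add: power2_eq_square)
qed

text \<open>The \<open>k\<close>-th derivative of \<open>g\<close> at \<open>z\<close> in direction
  \<open>w\<close>. Each mixed derivative is counted once per ordering of its coordinates, which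
  replaces the multinomial coefficients.\<close>

definition nth_directional :: "(real ^ 'd::finite \<Rightarrow> real) \<Rightarrow> nat \<Rightarrow> real ^ 'd \<Rightarrow> real ^ 'd \<Rightarrow> real" where
  "nth_directional g k w z = (\<Sum>xs | length xs = k. derivs xs g z * prod_list (map (($) w) xs))"

lemma card_lists_length: "card {xs :: 'd::finite list. length xs = k} = CARD('d) ^ k"
  using card_lists_length_eq[of "UNIV :: 'd set" k] by simp

lemma sum_lists_Suc:
  fixes F :: "'d::finite list \<Rightarrow> 'b::comm_monoid_add"
  shows "(\<Sum>xs | length xs = Suc k. F xs) = (\<Sum>xs | length xs = k. \<Sum>i\<in>UNIV. F (i # xs))"
proof -
  have "(\<Sum>xs | length xs = Suc k. F xs) = (\<Sum>(xs, i) \<in> {xs. length xs = k} \<times> UNIV. F (i # xs))"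
    by (rule sum.reindex_bij_witness[of _ "\<lambda>(xs, i). i # xs" "\<lambda>xs. (tl xs, hd xs)"])
      (auto simp: length_Suc_conv)
  then show ?thesis by (simp add: sum.cartesian_product)
qed

lemma has_real_derivative_segment:
  fixes f :: "real ^ 'd::finite \<Rightarrow> real"
  assumes "f differentiable at (y + s *\<^sub>R w)"
  shows "((\<lambda>s. f (y + s *\<^sub>R w)) has_real_derivative (\<Sum>i\<in>UNIV. w $ i * partial_deriv i f (y + s *\<^sub>R w))) (at s)"
proof -
  have "((\<lambda>s. f (y + s *\<^sub>R w)) has_derivative
      (\<lambda>h. \<Sum>i\<in>UNIV. (h *\<^sub>R w) $ i *\<^sub>R partial_deriv i f (y + s *\<^sub>R w))) (at s)"
    by (rule has_derivative_compose[of "\<lambda>s. y + s *\<^sub>R w" "\<lambda>h. h *\<^sub>R w" s UNIV f, OF _ has_derivative_partial[OF assms]])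
      (auto intro!: derivative_eq_intros)
  then show ?thesis
    unfolding has_field_derivative_def
    by (rule back_subst[of "\<lambda>F. (_ has_derivative F) _"])
      (auto simp: fun_eq_iff sum_distrib_left sum_distrib_right mult_ac)
qed

lemma nth_directional_derivative:
  fixes g :: "real ^ 'd::finite \<Rightarrow> real"
  assumes "open U" "smooth_on U g" "y + s *\<^sub>R w \<in> U"
  shows "((\<lambda>s. nth_directional g k w (y + s *\<^sub>R w)) has_real_derivative
    nth_directional g (Suc k) w (y + s *\<^sub>R w)) (at s)"
proof -
  have "((\<lambda>s. nth_directional g k w (y + s *\<^sub>R w)) has_real_derivative
     (\<Sum>xs | length xs = k. (\<Sum>i\<in>UNIV. w $ i * partial_deriv i (derivs xs g) (y + s *\<^sub>R w)) *
        prod_list (map (($) w) xs))) (at s)"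
    unfolding nth_directional_def
    by (intro DERIV_sum DERIV_cmult_right has_real_derivative_segment
        smooth_on_differentiable[OF smooth_on_derivs assms(1)] assms)
  also have "(\<Sum>xs | length xs = k. (\<Sum>i\<in>UNIV. w $ i * partial_deriv i (derivs xs g) (y + s *\<^sub>R w)) *
        prod_list (map (($) w) xs)) = nth_directional g (Suc k) w (y + s *\<^sub>R w)"
    unfolding nth_directional_def sum_lists_Suc
    by (rule sum.cong[OF refl], subst sum_distrib_right) (auto simp: mult_ac)
  finally show ?thesis .
qed

text \<open>Cauchy-Schwarz over the \<open>CARD('d) ^ k\<close> lists; each product of components of
  \<open>w\<close> has modulus at most \<open>\<delta> ^ k\<close>.\<close>

lemma nth_directional_sq_le:
  fixes g :: "real ^ 'd::finite \<Rightarrow> real"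
  assumes "norm w \<le> \<delta>"
  shows "(nth_directional g k w z)\<^sup>2 \<le> real CARD('d) ^ k * \<delta> ^ (2 * k) * (\<Sum>xs | length xs = k. (derivs xs g z)\<^sup>2)"
proof -
  have \<delta>: "\<bar>w $ i\<bar> \<le> \<delta>" for i using component_le_norm_cart[of w i] assms by simp
  then have \<delta>0: "0 \<le> \<delta>" using abs_ge_zero order_trans by blast
  have p: "(prod_list (map (($) w) xs))\<^sup>2 \<le> \<delta> ^ (2 * length xs)" for xs
  proof (induction xs)
    case (Cons i xs)
    have "(w $ i)\<^sup>2 * (prod_list (map (($) w) xs))\<^sup>2 \<le> \<delta>\<^sup>2 * \<delta> ^ (2 * length xs)"
      using \<delta>[of i] \<delta>0 Cons by (intro mult_mono) (auto simp: abs_le_square_iff[symmetric])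
    then show ?case by (simp add: power_mult_distrib power_add[symmetric])
  qed simp
  have "(nth_directional g k w z)\<^sup>2 \<le> (\<Sum>xs | length xs = k. (derivs xs g z)\<^sup>2) *
      (\<Sum>xs :: 'd list | length xs = k. (prod_list (map (($) w) xs))\<^sup>2)"
    unfolding nth_directional_def by (rule Cauchy_Schwarz_ineq_sum)
  also have "\<dots> \<le> (\<Sum>xs | length xs = k. (derivs xs g z)\<^sup>2) * (\<Sum>xs :: 'd list | length xs = k. \<delta> ^ (2 * k))"
    using p by (intro mult_left_mono sum_mono sum_nonneg) (auto simp: sum_nonneg)
  finally show ?thesis by (simp add: card_lists_length mult_ac)
qed

definition taylor_poly :: "nat \<Rightarrow> (real ^ 'd::finite \<Rightarrow> real) \<Rightarrow> real ^ 'd \<Rightarrow> real ^ 'd \<Rightarrow> real" where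
  "taylor_poly n g y x = (\<Sum>k\<le>n. nth_directional g k (x - y) y / fact k)"

lemma poly_deg_le_taylor_poly:
  fixes g :: "real ^ 'd::finite \<Rightarrow> real"
  shows "poly_deg_le n (taylor_poly n g y)"
proof -
  have "poly_deg_le n (\<lambda>x. \<Sum>k\<le>n. 1 / fact k * (\<Sum>xs | length xs = k. derivs xs g y * prod_list (map (($) (x - y)) xs)))"
    using poly_deg_le_mono[OF poly_deg_le_prod_list]
    by (intro poly_deg_le_sum poly_deg_le_cmult) auto
  moreover have "(\<lambda>x. \<Sum>k\<le>n. 1 / fact k * (\<Sum>xs | length xs = k. derivs xs g y * prod_list (map (($) (x - y)) xs)))
      = taylor_poly n g y"
    by (auto simp: taylor_poly_def nth_directional_def fun_eq_iff)
  ultimately show ?thesis by simp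
qed

text \<open>Passes from the gauge integral of the Taylor remainder to a nonnegative Lebesgue
  integral, to which Tonelli's theorem applies.\<close>

lemma nn_integral_unit_interval:
  fixes f :: "real \<Rightarrow> real"
  assumes "continuous_on {0..1} f" "\<And>s. s \<in> {0..1} \<Longrightarrow> 0 \<le> f s"
  shows "(\<integral>\<^sup>+s\<in>{0..1}. ennreal (f s) \<partial>lborel) = ennreal (integral {0..1} f)"
proof -
  let ?f = "\<lambda>s. indicator {0..1} s * f s"
  have "integral\<^sup>N lborel (\<lambda>s. ennreal (?f s)) = ennreal (integral {0..1} f)"
  proof (rule nn_integral_has_integral_lborel)
    show "?f \<in> borel_measurable borel"
      using borel_measurable_continuous_on_indicator[of "{0..1}" f] assms by simp
    have "(f has_integral integral {0..1} f) {0..1}"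
      using integrable_continuous_interval[OF assms(1)] by blast
    then have "((\<lambda>s. if s \<in> {0..1} then f s else 0) has_integral integral {0..1} f) UNIV"
      by (simp only: has_integral_restrict_UNIV)
    then show "(?f has_integral integral {0..1} f) UNIV"
      by (rule has_integral_eq[rotated]) (auto simp: indicator_def)
  qed (use assms in \<open>auto simp: indicator_def\<close>)
  moreover have "(\<integral>\<^sup>+s\<in>{0..1}. ennreal (f s) \<partial>lborel) = integral\<^sup>N lborel (\<lambda>s. ennreal (?f s))"
    by (rule nn_integral_cong) (auto simp: indicator_def)
  ultimately show ?thesis by simp
qed

lemma taylor_segment_le:
  fixes g :: "real ^ 'd::finite \<Rightarrow> real"
  assumes U: "open U" "smooth_on U g" and K: "convex K" "K \<subseteq> U" "x \<in> K" "y \<in> K" and \<delta>: "norm (x - y) \<le> \<delta>"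
  shows "ennreal ((g x - taylor_poly n g y x)\<^sup>2) \<le> ennreal (real CARD('d) ^ Suc n * \<delta> ^ (2 * Suc n)) *
    (\<integral>\<^sup>+s\<in>{0..1}. ennreal (\<Sum>xs | length xs = Suc n. (derivs xs g (y + s *\<^sub>R (x - y)))\<^sup>2) \<partial>lborel)"
proof -
  let ?w = "x - y" and ?G = "\<lambda>z. \<Sum>xs | length xs = Suc n. (derivs xs g z)\<^sup>2"
  let ?A = "real CARD('d) ^ Suc n * \<delta> ^ (2 * Suc n)"
  have seg: "y + s *\<^sub>R ?w \<in> K" if "s \<in> {0..1}" for s
    using convexD_alt[OF K(1,4,3), of s] that by (simp add: algebra_simps)
  define \<phi> where "\<phi> k s = nth_directional g k ?w (y + s *\<^sub>R ?w)" for k s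
  have d: "(\<phi> k has_real_derivative \<phi> (Suc k) s) (at s)" if "s \<in> {0..1}" for k s
    using nth_directional_derivative[OF U, of y s ?w k] seg[OF that] K unfolding \<phi>_def by auto
  have c: "continuous_on {0..1} (\<phi> k)" for k
    using d[THEN DERIV_continuous] continuous_at_imp_continuous_on by blast
  have cG: "continuous_on {0..1} (\<lambda>s. ?G (y + s *\<^sub>R ?w))"
  proof (intro continuous_intros continuous_on_compose2[OF smooth_on_continuous[OF smooth_on_derivs[OF U(2)]]])
    show "(\<lambda>s. y + s *\<^sub>R ?w) ` {0..1} \<subseteq> U" using seg K by auto
  qed
  have "\<phi> 0 0 = g y" "\<phi> 0 1 = g x" by (simp_all add: \<phi>_def nth_directional_def)
  then have "\<bar>g x - taylor_poly n g y x\<bar> \<le> integral {0..1} (\<lambda>t. \<bar>\<phi> (Suc n) t\<bar>)"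
    using taylor_remainder_le[of n \<phi> 1] d c
    by (force simp: taylor_poly_def \<phi>_def dest: has_field_derivative_at_within)
  then have "(g x - taylor_poly n g y x)\<^sup>2 \<le> (integral {0..1} (\<lambda>t. \<bar>\<phi> (Suc n) t\<bar>))\<^sup>2"
    by (metis abs_ge_zero power2_abs power_mono)
  also have "\<dots> \<le> integral {0..1} (\<lambda>t. (\<phi> (Suc n) t)\<^sup>2)" by (rule square_integral_le[OF c])
  also have "\<dots> \<le> integral {0..1} (\<lambda>t. ?A * ?G (y + t *\<^sub>R ?w))"
    using c[of "Suc n"] nth_directional_sq_le[OF \<delta>, of g "Suc n" "y + _ *\<^sub>R ?w", folded \<phi>_def]
    by (intro integral_le integrable_continuous_interval continuous_on_power
        continuous_on_mult[OF continuous_on_const cG]) auto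
  also have "\<dots> = ?A * integral {0..1} (\<lambda>t. ?G (y + t *\<^sub>R ?w))" by (rule integral_mult_right)
  finally have "ennreal ((g x - taylor_poly n g y x)\<^sup>2) \<le> ennreal ?A * ennreal (integral {0..1} (\<lambda>t. ?G (y + t *\<^sub>R ?w)))"
    using order_trans[OF norm_ge_zero \<delta>]
    by (subst ennreal_mult[symmetric]) (auto intro!: ennreal_leI integral_nonneg integrable_continuous_interval cG sum_nonneg)
  also have "ennreal (integral {0..1} (\<lambda>t. ?G (y + t *\<^sub>R ?w))) = (\<integral>\<^sup>+s\<in>{0..1}. ennreal (?G (y + s *\<^sub>R ?w)) \<partial>lborel)"
    by (rule nn_integral_unit_interval[symmetric]) (auto intro: cG sum_nonneg)
  finally show ?thesis .
qed

section \<open>A Bramble-Hilbert estimate on convex sets\<close>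

lemma nn_integral_lborel_affine:
  fixes f :: "'a::euclidean_space \<Rightarrow> ennreal"
  assumes [measurable]: "f \<in> borel_measurable borel" and "c \<noteq> 0"
  shows "(\<integral>\<^sup>+x. f x \<partial>lborel) = ennreal (\<bar>c\<bar> ^ DIM('a)) * (\<integral>\<^sup>+x. f (t + c *\<^sub>R x) \<partial>lborel)"
  by (subst lborel_affine[OF assms(2), of t]) (simp add: nn_integral_density nn_integral_distr nn_integral_cmult)

lemma nn_integral_scaled_le:
  fixes f :: "real ^ 'd::finite \<Rightarrow> ennreal"
  assumes f: "f \<in> borel_measurable borel" and "1 / 2 \<le> c"
  shows "(\<integral>\<^sup>+x. f (t + c *\<^sub>R x) \<partial>lborel) \<le> 2 ^ CARD('d) * (\<integral>\<^sup>+x. f x \<partial>lborel)"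
proof -
  have "(1::real) \<le> 2 ^ CARD('d) * c ^ CARD('d)"
    using power_mono[of 1 "2 * c" "CARD('d)"] assms(2) by (simp add: power_mult_distrib)
  then have "(1::ennreal) \<le> ennreal (2 ^ CARD('d) * c ^ CARD('d))"
    using ennreal_leI[of 1] by fastforce
  also have "\<dots> = 2 ^ CARD('d) * ennreal (\<bar>c\<bar> ^ CARD('d))"
    using assms(2) by (simp add: ennreal_mult ennreal_power[symmetric])
  finally have "1 * (\<integral>\<^sup>+x. f (t + c *\<^sub>R x) \<partial>lborel)
      \<le> 2 ^ CARD('d) * ennreal (\<bar>c\<bar> ^ CARD('d)) * (\<integral>\<^sup>+x. f (t + c *\<^sub>R x) \<partial>lborel)"
    by (rule mult_right_mono) simp
  also have "\<dots> = 2 ^ CARD('d) * (\<integral>\<^sup>+x. f x \<partial>lborel)"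
    using nn_integral_lborel_affine[OF f, of c t] assms(2) by (simp add: mult.assoc)
  finally show ?thesis by simp
qed

text \<open>For \<open>s \<le> 1/2\<close> the point \<open>y + s (x - y)\<close> is integrated in \<open>y\<close>, otherwise in \<open>x\<close>; the Jacobian
  of the substitution is then bounded below.\<close>

lemma nn_integral_segments_le:
  fixes G :: "real ^ 'd::finite \<Rightarrow> ennreal" and K :: "(real ^ 'd) set"
  assumes [measurable]: "G \<in> borel_measurable borel" "K \<in> sets borel"
  shows "(\<integral>\<^sup>+y\<in>K. (\<integral>\<^sup>+x\<in>K. (\<integral>\<^sup>+s\<in>{0..1::real}. G (y + s *\<^sub>R (x - y)) \<partial>lborel) \<partial>lborel) \<partial>lborel)
    \<le> emeasure lborel K * (2 ^ CARD('d) * (\<integral>\<^sup>+z. G z \<partial>lborel))"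
proof -
  let ?H = "\<lambda>y x s. indicator K y * (indicator K x * (indicator {0..1::real} s * G (y + s *\<^sub>R (x - y))))"
  let ?I = "2 ^ CARD('d) * (\<integral>\<^sup>+z. G z \<partial>lborel)"
  have "(\<integral>\<^sup>+y\<in>K. (\<integral>\<^sup>+x\<in>K. (\<integral>\<^sup>+s\<in>{0..1::real}. G (y + s *\<^sub>R (x - y)) \<partial>lborel) \<partial>lborel) \<partial>lborel)
      = (\<integral>\<^sup>+y. \<integral>\<^sup>+x. \<integral>\<^sup>+s. ?H y x s \<partial>lborel \<partial>lborel \<partial>lborel)"
    by (simp add: nn_integral_cmult[symmetric] mult_ac)
  \<comment> \<open>With \<open>s\<close> outermost, the better of the two substitutions can be
    chosen for each \<open>s\<close> separately.\<close>
  also have "\<dots> = (\<integral>\<^sup>+y. \<integral>\<^sup>+s. \<integral>\<^sup>+x. ?H y x s \<partial>lborel \<partial>lborel \<partial>lborel)"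
    by (intro nn_integral_cong lborel_pair.Fubini') measurable
  also have "\<dots> = (\<integral>\<^sup>+s. \<integral>\<^sup>+y. \<integral>\<^sup>+x. ?H y x s \<partial>lborel \<partial>lborel \<partial>lborel)"
    by (intro lborel_pair.Fubini') measurable
  also have "\<dots> \<le> (\<integral>\<^sup>+s. indicator {0..1::real} s * (emeasure lborel K * ?I) \<partial>lborel)"
  proof (rule nn_integral_mono)
    fix s :: real
    show "(\<integral>\<^sup>+y. \<integral>\<^sup>+x. ?H y x s \<partial>lborel \<partial>lborel) \<le> indicator {0..1} s * (emeasure lborel K * ?I)"
    proof (cases "s \<in> {0..1}")
      case s: True
      show ?thesis
      proof (cases "s \<le> 1 / 2")
        case True
        have "(\<integral>\<^sup>+y. \<integral>\<^sup>+x. ?H y x s \<partial>lborel \<partial>lborel) = (\<integral>\<^sup>+x. \<integral>\<^sup>+y. ?H y x s \<partial>lborel \<partial>lborel)"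
          by (intro lborel_pair.Fubini') measurable
        also have "\<dots> \<le> (\<integral>\<^sup>+x. indicator K x * ?I \<partial>lborel)"
        proof (rule nn_integral_mono)
          \<comment> \<open>For fixed \<open>x\<close> the indicator of \<open>K\<close> in
            \<open>y\<close> is dropped, so that the substitution runs over the whole space.\<close>
          fix x :: "real ^ 'd"
          have "(\<integral>\<^sup>+y. ?H y x s \<partial>lborel) \<le> (\<integral>\<^sup>+y. indicator K x * G (s *\<^sub>R x + (1 - s) *\<^sub>R y) \<partial>lborel)"
            using s by (intro nn_integral_mono) (auto simp: indicator_def algebra_simps)
          also have "\<dots> = indicator K x * (\<integral>\<^sup>+y. G (s *\<^sub>R x + (1 - s) *\<^sub>R y) \<partial>lborel)"
            by (rule nn_integral_cmult) measurable
          also have "\<dots> \<le> indicator K x * ?I"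
            using True by (intro mult_left_mono nn_integral_scaled_le) auto
          finally show "(\<integral>\<^sup>+y. ?H y x s \<partial>lborel) \<le> indicator K x * ?I" .
        qed
        also have "\<dots> = emeasure lborel K * ?I" by (simp add: nn_integral_multc)
        finally show ?thesis using s by simp
      next
        case False
        have "(\<integral>\<^sup>+y. \<integral>\<^sup>+x. ?H y x s \<partial>lborel \<partial>lborel) \<le> (\<integral>\<^sup>+y. indicator K y * ?I \<partial>lborel)"
        proof (rule nn_integral_mono)
          fix y :: "real ^ 'd"
          have "(\<integral>\<^sup>+x. ?H y x s \<partial>lborel) \<le> (\<integral>\<^sup>+x. indicator K y * G ((1 - s) *\<^sub>R y + s *\<^sub>R x) \<partial>lborel)"
            using s by (intro nn_integral_mono) (auto simp: indicator_def algebra_simps)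
          also have "\<dots> = indicator K y * (\<integral>\<^sup>+x. G ((1 - s) *\<^sub>R y + s *\<^sub>R x) \<partial>lborel)"
            by (rule nn_integral_cmult) measurable
          also have "\<dots> \<le> indicator K y * ?I"
            using False by (intro mult_left_mono nn_integral_scaled_le) auto
          finally show "(\<integral>\<^sup>+x. ?H y x s \<partial>lborel) \<le> indicator K y * ?I" .
        qed
        also have "\<dots> = emeasure lborel K * ?I" by (simp add: nn_integral_multc)
        finally show ?thesis using s by simp
      qed
    qed simp
  qed
  also have "\<dots> = emeasure lborel K * ?I" by (simp add: nn_integral_multc)
  finally show ?thesis .
qed

text \<open>The centre of the Taylor polynomial is found by averaging: over \<open>y\<close> in
  \<open>K\<close> the remainder functional \<open>?\<Psi>\<close> has mean at most
  \<open>?I\<close>, so some \<open>y\<close> exceeds this by at most \<open>\<eta>\<close>. The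
  slack turns the comparison of means into a strict one.\<close>

lemma bramble_hilbert:
  fixes g :: "real ^ 'd::finite \<Rightarrow> real"
  assumes U: "open U" "smooth_on U g" and K: "compact K" "convex K" "K \<subseteq> U" "0 < emeasure lborel K"
    and \<delta>: "\<And>x y. x \<in> K \<Longrightarrow> y \<in> K \<Longrightarrow> norm (x - y) \<le> \<delta>" and \<eta>: "0 < \<eta>"
  obtains p where "poly_deg_le n p"
    "(\<integral>\<^sup>+x\<in>K. ennreal ((g x - p x)\<^sup>2) \<partial>lborel) \<le> ennreal (real CARD('d) ^ Suc n * \<delta> ^ (2 * Suc n)) *
      (2 ^ CARD('d) * (\<integral>\<^sup>+x\<in>K. ennreal (\<Sum>xs | length xs = Suc n. (derivs xs g x)\<^sup>2) \<partial>lborel) + ennreal \<eta>)"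
proof -
  let ?A = "ennreal (real CARD('d) ^ Suc n * \<delta> ^ (2 * Suc n))"
  let ?G = "\<lambda>x. \<Sum>xs | length xs = Suc n. (derivs xs g x)\<^sup>2"
  \<comment> \<open>The cut-off gives a Borel function on the whole space; by convexity no segment
    between points of \<open>K\<close> notices it.\<close>
  define H where "H z = ennreal (indicator K z * ?G z)" for z
  have [measurable]: "K \<in> sets borel" using K borel_compact by blast
  have cG: "continuous_on K ?G"
    using smooth_on_continuous[OF smooth_on_derivs[OF U(2)]] K(3)
    by (intro continuous_intros) (auto intro: continuous_on_subset)
  have [measurable]: "H \<in> borel_measurable borel"
    using borel_measurable_continuous_on_indicator[OF _ cG] unfolding H_def by simp
  have HI: "(\<integral>\<^sup>+z. H z \<partial>lborel) = (\<integral>\<^sup>+x\<in>K. ennreal (?G x) \<partial>lborel)"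
    unfolding H_def by (rule nn_integral_cong) (auto simp: indicator_def)
  let ?I = "2 ^ CARD('d) * (\<integral>\<^sup>+z. H z \<partial>lborel)"
  let ?\<Psi> = "\<lambda>y. \<integral>\<^sup>+x\<in>K. (\<integral>\<^sup>+s\<in>{0..1}. H (y + s *\<^sub>R (x - y)) \<partial>lborel) \<partial>lborel"
  have fin: "emeasure lborel K < \<infinity>" using K(1) emeasure_bounded_finite compact_imp_bounded by blast
  \<comment> \<open>Finiteness permits the cancellation of \<open>emeasure lborel K * ?I\<close> in
    the argument by contradiction below.\<close>
  have "?I < \<infinity>"
  proof -
    obtain M where "\<forall>v\<in>?G ` K. norm v \<le> M"
      using compact_imp_bounded[OF compact_continuous_image[OF cG K(1)]] unfolding bounded_iff by blast
    then have M: "?G x \<le> M" if "x \<in> K" for x using that by (auto dest!: bspec)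
    have "(\<integral>\<^sup>+z. H z \<partial>lborel) \<le> (\<integral>\<^sup>+z. ennreal M * indicator K z \<partial>lborel)"
      unfolding H_def by (intro nn_integral_mono) (auto simp: indicator_def intro!: ennreal_leI M)
    also have "\<dots> < \<infinity>" using fin by (simp add: nn_integral_cmult ennreal_mult_less_top)
    finally show ?thesis by (simp add: ennreal_mult_less_top power_less_top_ennreal)
  qed
  have "\<exists>y\<in>K. ?\<Psi> y \<le> ?I + ennreal \<eta>"
  proof (rule ccontr)
    assume "\<not> ?thesis"
    then have "(\<integral>\<^sup>+y\<in>K. (?I + ennreal \<eta>) \<partial>lborel) \<le> (\<integral>\<^sup>+y\<in>K. ?\<Psi> y \<partial>lborel)"
      by (intro nn_integral_mono) (auto simp: indicator_def not_le less_imp_le)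
    also have "\<dots> \<le> emeasure lborel K * ?I" by (rule nn_integral_segments_le) measurable
    also have "(\<integral>\<^sup>+y\<in>K. (?I + ennreal \<eta>) \<partial>lborel) = (?I + ennreal \<eta>) * emeasure lborel K"
      by (rule nn_integral_cmult_indicator) measurable
    finally have "emeasure lborel K * ?I + emeasure lborel K * ennreal \<eta> \<le> emeasure lborel K * ?I + 0"
      by (simp only: distrib_left mult.commute[of _ "emeasure lborel K"] add_0_right)
    then have "emeasure lborel K * ennreal \<eta> \<le> 0"
      using fin \<open>?I < \<infinity>\<close> ennreal_add_left_cancel_le[of "emeasure lborel K * ?I"]
      by (metis ennreal_mult_less_top infinity_ennreal_def less_top)
    then show False using K(4) \<eta> by simp
  qed
  then obtain y where y: "y \<in> K" "?\<Psi> y \<le> ?I + ennreal \<eta>" by blast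
  show ?thesis
  proof
    show "poly_deg_le n (taylor_poly n g y)" by (rule poly_deg_le_taylor_poly)
    have "(\<integral>\<^sup>+x\<in>K. ennreal ((g x - taylor_poly n g y x)\<^sup>2) \<partial>lborel) \<le>
        (\<integral>\<^sup>+x. ?A * ((\<integral>\<^sup>+s\<in>{0..1}. H (y + s *\<^sub>R (x - y)) \<partial>lborel) * indicator K x) \<partial>lborel)"
    proof (rule nn_integral_mono)
      fix x :: "real ^ 'd"
      show "ennreal ((g x - taylor_poly n g y x)\<^sup>2) * indicator K x \<le>
        ?A * ((\<integral>\<^sup>+s\<in>{0..1}. H (y + s *\<^sub>R (x - y)) \<partial>lborel) * indicator K x)"
      proof (cases "x \<in> K")
        case True
        have seg: "y + s *\<^sub>R (x - y) \<in> K" if "s \<in> {0..1}" for s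
          using convexD_alt[OF K(2) y(1) True, of s] that by (simp add: algebra_simps)
        have "(\<integral>\<^sup>+s\<in>{0..1}. H (y + s *\<^sub>R (x - y)) \<partial>lborel) = (\<integral>\<^sup>+s\<in>{0..1}. ennreal (?G (y + s *\<^sub>R (x - y))) \<partial>lborel)"
          unfolding H_def using seg by (intro nn_integral_cong) (auto simp: indicator_def)
        then show ?thesis
          using taylor_segment_le[OF U K(2,3) True y(1) \<delta>[OF True y(1)], of n] True by simp
      qed simp
    qed
    also have "\<dots> = ?A * ?\<Psi> y" by (rule nn_integral_cmult) measurable
    also have "\<dots> \<le> ?A * (?I + ennreal \<eta>)" using y by (intro mult_left_mono) auto
    finally show "(\<integral>\<^sup>+x\<in>K. ennreal ((g x - taylor_poly n g y x)\<^sup>2) \<partial>lborel) \<le>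
        ?A * (2 ^ CARD('d) * (\<integral>\<^sup>+x\<in>K. ennreal (?G x) \<partial>lborel) + ennreal \<eta>)" unfolding HI .
  qed
qed

section \<open>Extrapolation of polynomials from a smaller concentric set\<close>

lemma poly_deg_le_ray:
  fixes p :: "real ^ 'd::finite \<Rightarrow> real"
  assumes "poly_deg_le N p"
  obtains q :: "real poly" where "degree q \<le> N" "\<And>s. p (x + s *\<^sub>R w) = poly q s"
proof -
  obtain c where c: "\<And>x. p x = (\<Sum>\<alpha> | mi_order \<alpha> \<le> N. c \<alpha> * (\<Prod>i\<in>UNIV. (x $ i) ^ \<alpha> i))"
    using assms poly_deg_le_def by blast
  let ?m = "\<lambda>\<alpha>::'d \<Rightarrow> nat. \<Prod>i\<in>UNIV. [:x $ i, w $ i:] ^ \<alpha> i"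
  show ?thesis
  proof
    show "degree (\<Sum>\<alpha> | mi_order \<alpha> \<le> N. smult (c \<alpha>) (?m \<alpha>)) \<le> N"
    proof (rule degree_sum_le[OF finite_mi_order_le])
      fix \<alpha> :: "'d \<Rightarrow> nat" assume "\<alpha> \<in> {\<alpha>. mi_order \<alpha> \<le> N}"
      have "degree (?m \<alpha>) \<le> (\<Sum>i\<in>UNIV. degree ([:x $ i, w $ i:] ^ \<alpha> i))"
        using degree_prod_sum_le[of UNIV "\<lambda>i. [:x $ i, w $ i:] ^ \<alpha> i"] by simp
      also have "\<dots> \<le> (\<Sum>i\<in>UNIV. \<alpha> i)"
      proof (rule sum_mono)
        fix i
        have "degree ([:x $ i, w $ i:] ^ \<alpha> i) \<le> degree [:x $ i, w $ i:] * \<alpha> i" by (rule degree_power_le)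
        also have "\<dots> \<le> 1 * \<alpha> i" by (intro mult_right_mono) auto
        finally show "degree ([:x $ i, w $ i:] ^ \<alpha> i) \<le> \<alpha> i" by simp
      qed
      finally show "degree (smult (c \<alpha>) (?m \<alpha>)) \<le> N"
        using \<open>\<alpha> \<in> _\<close> degree_smult_le[of "c \<alpha>" "?m \<alpha>"] by (simp add: mi_order_def)
    qed
    show "p (x + s *\<^sub>R w) = poly (\<Sum>\<alpha> | mi_order \<alpha> \<le> N. smult (c \<alpha>) (?m \<alpha>)) s" for s
      unfolding c by (simp add: poly_sum poly_prod)
  qed
qed

text \<open>\<open>\<mu> j\<close> is the value at 1 of the Lagrange basis polynomial of the node
  \<open>s j\<close>, hence independent of \<open>q\<close>.\<close>

lemma lagrange_extrapolation:
  fixes s :: "nat \<Rightarrow> real"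
  assumes "inj_on s {..N}"
  obtains \<mu> where "\<And>q. degree q \<le> N \<Longrightarrow> poly q 1 = (\<Sum>j\<le>N. \<mu> j * poly q (s j))"
proof -
  define L where "L j = (\<Prod>k\<in>{..N}-{j}. smult (1 / (s j - s k)) [:- s k, 1:])" for j
  have L: "poly (L j) (s i) = (if i = j then 1 else 0)" if "i \<le> N" "j \<le> N" for i j
  proof (cases "i = j")
    case True
    have "poly (L i) (s i) = (\<Prod>k\<in>{..N}-{i}. 1)"
      unfolding L_def poly_prod
    proof (rule prod.cong)
      fix k assume "k \<in> {..N} - {i}"
      then have "s i \<noteq> s k" using assms that by (auto dest: inj_onD)
      then show "poly (smult (1 / (s i - s k)) [:- s k, 1:]) (s i) = 1"
        by (simp add: diff_divide_distrib[symmetric])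
    qed simp
    then show ?thesis using True by simp
  next
    case False
    have "poly (L j) (s i) = 0"
      unfolding L_def poly_prod
    proof (rule prod_zero)
      show "\<exists>k\<in>{..N} - {j}. poly (smult (1 / (s j - s k)) [:- s k, 1:]) (s i) = 0"
        by (rule bexI[of _ i]) (use that False in auto)
    qed simp
    then show ?thesis using False by simp
  qed
  have dL: "degree (L j) \<le> N" if "j \<le> N" for j
  proof -
    have "degree (L j) \<le> (\<Sum>k\<in>{..N}-{j}. degree (smult (1 / (s j - s k)) [:- s k, 1:]))"
      unfolding L_def using degree_prod_sum_le[of "{..N}-{j}" "\<lambda>k. smult (1 / (s j - s k)) [:- s k, 1:]"] by simp
    also have "\<dots> \<le> (\<Sum>k\<in>{..N}-{j}. 1)" by (intro sum_mono) (simp add: degree_smult_eq)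
    also have "\<dots> = N" using that by simp
    finally show ?thesis .
  qed
  have "q = (\<Sum>j\<le>N. smult (poly q (s j)) (L j))" if q: "degree q \<le> N" for q
  proof (rule poly_eqI_degree[of "s ` {..N}"])
    show "poly q x = poly (\<Sum>j\<le>N. smult (poly q (s j)) (L j)) x" if x: "x \<in> s ` {..N}" for x
    proof -
      obtain i where i: "i \<le> N" "x = s i" using x by auto
      have "poly (\<Sum>j\<le>N. smult (poly q (s j)) (L j)) x = (\<Sum>j\<le>N. poly q (s j) * (if i = j then 1 else 0))"
        unfolding poly_sum using L[OF i(1)] i by (intro sum.cong) auto
      also have "\<dots> = poly q x" using i by (simp add: if_distrib[of "(*) _"] cong: if_cong)
      finally show ?thesis by simp
    qed
    show "degree q < card (s ` {..N})" using q assms by (simp add: card_image)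
    have "degree (\<Sum>j\<le>N. smult (poly q (s j)) (L j)) \<le> N"
      by (intro degree_sum_le) (auto intro: dL)
    then show "degree (\<Sum>j\<le>N. smult (poly q (s j)) (L j)) < card (s ` {..N})"
      using assms by (simp add: card_image)
  qed
  from arg_cong[OF this, of _ "\<lambda>q. poly q 1"]
  have "poly q 1 = (\<Sum>j\<le>N. poly (L j) 1 * poly q (s j))" if "degree q \<le> N" for q
    using that by (simp add: poly_sum mult.commute)
  then show ?thesis by (rule that)
qed

definition dilate :: "'a::real_vector \<Rightarrow> real \<Rightarrow> 'a \<Rightarrow> 'a" where
  "dilate x0 t x = x0 + t *\<^sub>R (x - x0)"

lemma compact_dilate: "compact K \<Longrightarrow> compact (dilate (x0::'a::real_normed_vector) t ` K)"
  unfolding dilate_def by (intro compact_continuous_image continuous_intros)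

lemma convex_dilate: "convex K \<Longrightarrow> convex (dilate x0 t ` K)"
proof -
  assume "convex K"
  moreover have "dilate x0 t ` K = (+) (x0 - t *\<^sub>R x0) ` (*\<^sub>R) t ` K"
    by (auto simp: dilate_def image_image algebra_simps)
  ultimately show ?thesis by (simp add: convex_translation convex_scaling)
qed

lemma dilate_mem:
  assumes "convex K" "x0 \<in> K" "x \<in> K" "0 \<le> s" "s \<le> t" "0 < t"
  shows "dilate x0 s x \<in> dilate x0 t ` K"
proof -
  have "dilate x0 s x = dilate x0 t (dilate x0 (s / t) x)" using assms by (simp add: dilate_def)
  moreover have "dilate x0 (s / t) x \<in> K"
    using convexD_alt[OF assms(1-3), of "s / t"] assms by (simp add: dilate_def algebra_simps)
  ultimately show ?thesis by blast
qed

text \<open>On each ray from \<open>x0\<close> the value at parameter 1 is a fixed combination of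
  the values at \<open>N + 1\<close> parameters in the interval from 0 to \<open>1/2\<close>, and
  these belong to the half-size copy. The constant depends on \<open>N\<close> and the dimension
  only, so one constant serves all \<open>K\<close> and \<open>x0\<close>.\<close>

lemma poly_extrapolation_le:
  obtains C :: real where "0 \<le> C"
    "\<And>(p :: real ^ 'd::finite \<Rightarrow> real) K x0. compact K \<Longrightarrow> convex K \<Longrightarrow> x0 \<in> K \<Longrightarrow> poly_deg_le N p \<Longrightarrow>
      (\<integral>\<^sup>+x\<in>K. ennreal ((p x)\<^sup>2) \<partial>lborel) \<le>
      ennreal C * (\<integral>\<^sup>+x\<in>dilate x0 (1/2) ` K. ennreal ((p x)\<^sup>2) \<partial>lborel)"
proof -
  \<comment> \<open>\<open>N + 1\<close> distinct nodes: at most \<open>1/2\<close>, to stay in the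
    half-size copy, and positive, to allow the substitution.\<close>
  define s where "s j = (real j + 1) / (2 * (real N + 1))" for j
  have s: "0 < s j" "s j \<le> 1 / 2" if "j \<le> N" for j
    using that by (simp_all add: s_def field_simps)
  have "inj_on s {..N}" by (auto simp: s_def inj_on_def field_simps)
  then obtain \<mu> where \<mu>: "\<And>q. degree q \<le> N \<Longrightarrow> poly q 1 = (\<Sum>j\<le>N. \<mu> j * poly q (s j))"
    using lagrange_extrapolation by blast
  \<comment> \<open>\<open>N + 1\<close> comes from Cauchy-Schwarz over the nodes, the power of
    \<open>s j\<close> from the Jacobian of the dilation.\<close>
  let ?c = "\<lambda>j. (real N + 1) * (\<mu> j)\<^sup>2 / s j ^ CARD('d)"
  have c0: "0 \<le> ?c j" if "j \<le> N" for j using s[OF that] by simp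
  show ?thesis
  proof (rule that[of "\<Sum>j\<le>N. ?c j"])
    show "0 \<le> (\<Sum>j\<le>N. ?c j)" using c0 by (intro sum_nonneg) auto
    fix p :: "real ^ 'd \<Rightarrow> real" and K :: "(real ^ 'd) set" and x0
    assume K: "compact K" "convex K" "x0 \<in> K" and p: "poly_deg_le N p"
    have [measurable]: "K \<in> sets borel" by (rule borel_compact[OF K(1)])
    have [measurable]: "dilate x0 (1/2) ` K \<in> sets borel"
      by (rule borel_compact[OF compact_dilate[OF K(1)]])
    have [measurable]: "p \<in> borel_measurable borel"
      by (rule borel_measurable_continuous_onI[OF continuous_on_poly_deg_le[OF p]])
    let ?F = "\<lambda>x. ennreal ((p x)\<^sup>2) * indicator (dilate x0 (1/2) ` K) x"
    have pw: "(p x)\<^sup>2 \<le> (\<Sum>j\<le>N. (real N + 1) * (\<mu> j)\<^sup>2 * (p (dilate x0 (s j) x))\<^sup>2)" for x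
    proof -
      obtain q where q: "degree q \<le> N" "\<And>s. p (x0 + s *\<^sub>R (x - x0)) = poly q s"
        using poly_deg_le_ray[OF p] by blast
      have "p x = (\<Sum>j\<le>N. 1 * (\<mu> j * p (dilate x0 (s j) x)))"
        using \<mu>[OF q(1)] q(2)[of 1] q(2) by (simp add: dilate_def)
      then have "(p x)\<^sup>2 \<le> (\<Sum>j\<le>N. 1\<^sup>2) * (\<Sum>j\<le>N. (\<mu> j * p (dilate x0 (s j) x))\<^sup>2)"
        using Cauchy_Schwarz_ineq_sum[of "\<lambda>j. 1" "\<lambda>j. \<mu> j * p (dilate x0 (s j) x)" "{..N}"] by simp
      then show ?thesis by (simp add: sum_distrib_left power_mult_distrib mult_ac add.commute)
    qed
    have "(\<integral>\<^sup>+x\<in>K. ennreal ((p x)\<^sup>2) \<partial>lborel)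
      \<le> (\<integral>\<^sup>+x. (\<Sum>j\<le>N. ennreal ((real N + 1) * (\<mu> j)\<^sup>2) * ?F ((1 - s j) *\<^sub>R x0 + s j *\<^sub>R x)) \<partial>lborel)"
    proof (rule nn_integral_mono)
      fix x
      show "ennreal ((p x)\<^sup>2) * indicator K x
        \<le> (\<Sum>j\<le>N. ennreal ((real N + 1) * (\<mu> j)\<^sup>2) * ?F ((1 - s j) *\<^sub>R x0 + s j *\<^sub>R x))"
      proof (cases "x \<in> K")
        case True
        have d: "(1 - s j) *\<^sub>R x0 + s j *\<^sub>R x = dilate x0 (s j) x" for j
          by (simp add: dilate_def algebra_simps)
        have "dilate x0 (s j) x \<in> dilate x0 (1/2) ` K" if "j \<le> N" for j
          using s[OF that] by (intro dilate_mem K True) auto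
        then have "(\<Sum>j\<le>N. ennreal ((real N + 1) * (\<mu> j)\<^sup>2) * ?F ((1 - s j) *\<^sub>R x0 + s j *\<^sub>R x))
          = (\<Sum>j\<le>N. ennreal ((real N + 1) * (\<mu> j)\<^sup>2 * (p (dilate x0 (s j) x))\<^sup>2))"
          unfolding d by (intro sum.cong) (auto simp: ennreal_mult)
        also have "\<dots> = ennreal (\<Sum>j\<le>N. (real N + 1) * (\<mu> j)\<^sup>2 * (p (dilate x0 (s j) x))\<^sup>2)"
          by (rule sum_ennreal) auto
        finally show ?thesis using True pw[of x] by (simp add: ennreal_leI)
      qed simp
    qed
    also have "\<dots> = (\<Sum>j\<le>N. ennreal ((real N + 1) * (\<mu> j)\<^sup>2) * (\<integral>\<^sup>+x. ?F ((1 - s j) *\<^sub>R x0 + s j *\<^sub>R x) \<partial>lborel))"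
      by (subst nn_integral_sum) (auto intro!: sum.cong nn_integral_cmult)
    also have "\<dots> = (\<Sum>j\<le>N. ennreal (?c j) * (\<integral>\<^sup>+x. ?F x \<partial>lborel))"
    proof (rule sum.cong[OF refl])
      fix j assume "j \<in> {..N}"
      then have sj: "0 < s j" using s by auto
      have "(\<integral>\<^sup>+x. ?F x \<partial>lborel) = ennreal (s j ^ CARD('d)) * (\<integral>\<^sup>+x. ?F ((1 - s j) *\<^sub>R x0 + s j *\<^sub>R x) \<partial>lborel)"
        using nn_integral_lborel_affine[of ?F "s j" "(1 - s j) *\<^sub>R x0"] sj by simp
      moreover have "ennreal ((real N + 1) * (\<mu> j)\<^sup>2) = ennreal (?c j) * ennreal (s j ^ CARD('d))"
        by (subst ennreal_mult[symmetric]) (use sj in auto)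
      ultimately show "ennreal ((real N + 1) * (\<mu> j)\<^sup>2) * (\<integral>\<^sup>+x. ?F ((1 - s j) *\<^sub>R x0 + s j *\<^sub>R x) \<partial>lborel)
        = ennreal (?c j) * (\<integral>\<^sup>+x. ?F x \<partial>lborel)" by (simp only: mult.assoc)
    qed
    also have "\<dots> = ennreal (\<Sum>j\<le>N. ?c j) * (\<integral>\<^sup>+x. ?F x \<partial>lborel)"
      using sum_ennreal[of "{..N}" ?c] c0 by (simp only: sum_distrib_right[symmetric] atMost_iff)
    finally show "(\<integral>\<^sup>+x\<in>K. ennreal ((p x)\<^sup>2) \<partial>lborel) \<le> ennreal (\<Sum>j\<le>N. ?c j) * (\<integral>\<^sup>+x. ?F x \<partial>lborel)" .
  qed
qed

section \<open>A smooth bump function\<close>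

text \<open>The classical flat function is \<open>flat 1\<close>. The polynomial in
  \<open>1 / x\<close> makes the family closed under differentiation, so that smoothness becomes an
  induction over the order with \<open>q\<close> arbitrary.\<close>

definition flat :: "real poly \<Rightarrow> real \<Rightarrow> real" where
  "flat q x = (if x > 0 then poly q (1 / x) * exp (- 1 / x) else 0)"

lemma tendsto_poly_div_exp: "((\<lambda>x. poly q x / exp x) \<longlongrightarrow> (0::real)) at_top"
proof -
  have "((\<lambda>x. \<Sum>i\<le>degree q. coeff q i * (x ^ i / exp x)) \<longlongrightarrow> (\<Sum>i\<le>degree q. coeff q i * 0)) at_top"
    by (intro tendsto_intros tendsto_power_div_exp_0)
  then show ?thesis by (simp add: poly_altdef sum_divide_distrib)
qed

lemma flat_has_derivative:
  "(flat q has_real_derivative flat ([:0, 0, 1:] * (q - pderiv q)) x) (at x)"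
proof -
  consider "x > 0" | "x < 0" | "x = 0" by linarith
  then show ?thesis
  proof cases
    case 1
    have "((\<lambda>x. poly q (1 / x) * exp (- 1 / x)) has_real_derivative flat ([:0, 0, 1:] * (q - pderiv q)) x) (at x)"
      using 1 by (auto intro!: derivative_eq_intros poly_DERIV[THEN DERIV_chain2]
          simp: flat_def power2_eq_square field_simps)
    then show ?thesis
      by (rule has_field_derivative_transform_within_open[of _ _ _ "{0<..}"]) (use 1 in \<open>auto simp: flat_def\<close>)
  next
    case 2
    have "((\<lambda>x. 0) has_real_derivative 0) (at x)" by simp
    then have "(flat q has_real_derivative 0) (at x)"
      by (rule has_field_derivative_transform_within_open[of _ _ _ "{..<0}"]) (use 2 in \<open>auto simp: flat_def\<close>)
    then show ?thesis using 2 by (simp add: flat_def)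
  next
    case 3
    \<comment> \<open>\<open>pCons 0 q\<close> absorbs the division by \<open>x\<close> in the
      difference quotient at 0.\<close>
    have "((\<lambda>x. poly (pCons 0 q) (inverse x) / exp (inverse x)) \<longlongrightarrow> 0) (at_right (0::real))"
      by (rule filterlim_compose[OF tendsto_poly_div_exp filterlim_inverse_at_top_right])
    then have r: "((\<lambda>x. flat q x / x) \<longlongrightarrow> 0) (at_right 0)"
      by (rule Lim_transform_eventually)
        (auto simp: eventually_at_right_field flat_def exp_minus field_simps intro!: exI[of _ 1])
    have "((\<lambda>x. 0) \<longlongrightarrow> (0::real)) (at_left (0::real))" by simp
    then have l: "((\<lambda>x. flat q x / x) \<longlongrightarrow> 0) (at_left 0)"
      by (rule Lim_transform_eventually)
        (auto simp: eventually_at_left_field flat_def intro!: exI[of _ "-1"])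
    have "((\<lambda>x. flat q x / x) \<longlongrightarrow> 0) (at 0)" by (rule filterlim_split_at[OF l r])
    then show ?thesis using 3 by (simp add: has_field_derivative_iff flat_def)
  qed
qed

lemma smooth_on_flat:
  fixes g :: "real ^ 'd::finite \<Rightarrow> real"
  assumes "open U" "smooth_on U g"
  shows "smooth_on U (\<lambda>x. flat q (g x))"
proof -
  have d: "((\<lambda>x. flat q (g x)) has_derivative
      (\<lambda>w. frechet_derivative g (at x) w * flat ([:0, 0, 1:] * (q - pderiv q)) (g x))) (at x)"
    if "x \<in> U" for x q
    using has_derivative_compose[OF frechet_derivative_works[THEN iffD1, OF smooth_on_differentiable[OF assms(2,1) that]]
        flat_has_derivative[of q "g x", unfolded has_field_derivative_def]]
    by (simp add: mult.commute)
  have "Ck_on k U (\<lambda>x. flat q (g x))" for k q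
  proof (induction k arbitrary: q)
    case 0
    then show ?case
      using continuous_on_compose2[OF _ smooth_on_continuous[OF assms(2)], of UNIV "flat q"]
        flat_has_derivative[THEN DERIV_isCont] by (auto simp: continuous_at_imp_continuous_on)
  next
    case (Suc k)
    have "Ck_on k U (partial_deriv i (\<lambda>x. flat q (g x)))" for i
    proof (rule Ck_on_cong[OF assms(1)])
      show "Ck_on k U (\<lambda>x. partial_deriv i g x * flat ([:0, 0, 1:] * (q - pderiv q)) (g x))"
        using smooth_on_partial[OF assms(2)] Suc.IH
        by (intro Ck_on_mult assms(1)) (auto simp: smooth_on_def)
      show "partial_deriv i g x * flat ([:0, 0, 1:] * (q - pderiv q)) (g x) = partial_deriv i (\<lambda>x. flat q (g x)) x"
        if "x \<in> U" for x
        using partial_deriv_eqI[OF d[OF that, of q], of i] by (simp only: partial_deriv_def)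
    qed
    then show ?case
      using d assms(1) by (auto simp: differentiable_on_eq_differentiable_at differentiable_def)
  qed
  then show ?thesis by (simp add: smooth_on_def)
qed

text \<open>Squaring the norm keeps the argument of \<open>flat\<close> smooth at the
  origin.\<close>

definition bump :: "real \<Rightarrow> real ^ 'd::finite \<Rightarrow> real" where
  "bump e x = flat 1 (e\<^sup>2 - (norm x)\<^sup>2)"

lemma smooth_on_bump: "smooth_on UNIV (bump e :: real ^ 'd::finite \<Rightarrow> real)"
proof -
  have "smooth_on UNIV (\<lambda>x :: real ^ 'd. e\<^sup>2 + (- 1) * (\<Sum>i\<in>UNIV. x $ i * x $ i))"
    by (intro smooth_on_add smooth_on_mult smooth_on_sum smooth_on_const smooth_on_component open_UNIV) auto
  then have "smooth_on UNIV (\<lambda>x :: real ^ 'd. flat 1 (e\<^sup>2 + (- 1) * (\<Sum>i\<in>UNIV. x $ i * x $ i)))"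
    by (intro smooth_on_flat open_UNIV)
  moreover have "(\<lambda>x :: real ^ 'd. flat 1 (e\<^sup>2 + (- 1) * (\<Sum>i\<in>UNIV. x $ i * x $ i))) = bump e"
    by (simp add: bump_def fun_eq_iff power2_norm_eq_inner inner_vec_def)
  ultimately show ?thesis by simp
qed

lemma bump_nonneg: "0 \<le> bump e x"
  by (simp add: bump_def flat_def)

lemma bump_pos_iff: "0 < e \<Longrightarrow> 0 < bump e x \<longleftrightarrow> norm x < e"
  by (auto simp: bump_def flat_def power_strict_mono dest: power2_less_imp_less)

lemma bump_eq_0: "0 < e \<Longrightarrow> e \<le> norm x \<Longrightarrow> bump e x = 0"
  using bump_pos_iff[of e x] bump_nonneg[of e x] by linarith

lemma continuous_smooth_UNIV: "smooth_on UNIV k \<Longrightarrow> continuous_on S k"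
  using smooth_on_continuous continuous_on_subset by blast

lemma smooth_UNIV_borel_measurable:
  fixes k :: "real ^ 'd::finite \<Rightarrow> real"
  shows "smooth_on UNIV k \<Longrightarrow> k \<in> borel_measurable borel"
  by (rule borel_measurable_continuous_onI[OF continuous_smooth_UNIV])

lemma smooth_UNIV_bounded:
  fixes k :: "real ^ 'd::finite \<Rightarrow> real"
  assumes "smooth_on UNIV k" "\<And>z. r < norm z \<Longrightarrow> k z = 0"
  obtains M where "0 \<le> M" "\<And>z. \<bar>k z\<bar> \<le> M"
proof -
  have "bounded (k ` cball 0 r)"
    by (intro compact_imp_bounded compact_continuous_image continuous_smooth_UNIV assms) auto
  then obtain M where "\<forall>v\<in>k ` cball 0 r. norm v \<le> M" unfolding bounded_iff by blast
  then have "\<bar>k z\<bar> \<le> max M 0" for z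
    using assms(2)[of z] by (cases "norm z \<le> r") force+
  then show ?thesis by (intro that[of "max M 0"]) auto
qed

lemma smooth_UNIV_integrable:
  fixes k :: "real ^ 'd::finite \<Rightarrow> real"
  assumes "smooth_on UNIV k" "\<And>z. r < norm z \<Longrightarrow> k z = 0"
  shows "integrable lborel k"
proof -
  have "integrable lborel (\<lambda>x. indicator (cball 0 r) x *\<^sub>R k x)"
    by (rule borel_integrable_compact) (auto intro: continuous_smooth_UNIV assms)
  moreover have "(\<lambda>x. indicator (cball 0 r) x *\<^sub>R k x) = k"
    using assms(2) by (auto simp: fun_eq_iff indicator_def)
  ultimately show ?thesis by simp
qed

definition mollifier :: "real \<Rightarrow> real ^ 'd::finite \<Rightarrow> real" where
  "mollifier e x = inverse (\<integral>z. bump e z \<partial>(lborel :: (real ^ 'd) measure)) * bump e x"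

lemma smooth_on_mollifier: "smooth_on UNIV (mollifier e)"
  unfolding mollifier_def by (intro smooth_on_mult smooth_on_const smooth_on_bump open_UNIV)

lemma mollifier_eq_0: "0 < e \<Longrightarrow> e \<le> norm x \<Longrightarrow> mollifier e x = 0"
  by (simp add: mollifier_def bump_eq_0)

lemma mollifier_nonneg: "0 \<le> mollifier e x"
  by (simp add: mollifier_def bump_nonneg)

lemma integral_mollifier:
  assumes "0 < e"
  shows "(\<integral>z. mollifier e z \<partial>(lborel :: (real ^ 'd::finite) measure)) = 1"
proof -
  let ?I = "\<integral>z. bump e z \<partial>(lborel :: (real ^ 'd) measure)"
  have int: "integrable lborel (bump e :: real ^ 'd \<Rightarrow> real)"
    by (rule smooth_UNIV_integrable[OF smooth_on_bump, of e]) (use assms in \<open>auto intro: bump_eq_0\<close>)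
  have "?I \<noteq> 0"
  proof
    assume "?I = 0"
    then have "AE x in (lborel :: (real ^ 'd) measure). bump e x = 0"
      using integral_nonneg_eq_0_iff_AE[OF int] bump_nonneg by auto
    then have "AE x in (lborel :: (real ^ 'd) measure). x \<notin> ball 0 e"
      by (rule AE_mp) (auto intro!: AE_I2 dest: bump_pos_iff[OF assms, THEN iffD2])
    then have "emeasure lborel (ball (0 :: real ^ 'd) e) = 0"
      using ball_def[of "0 :: real ^ 'd" e] by (subst (asm) AE_iff_measurable[OF _ refl]) (auto simp: dist_norm)
    then show False
      using content_ball_pos[OF assms, of "0 :: real ^ 'd"] by (simp add: measure_def)
  qed
  then show ?thesis by (simp add: mollifier_def)
qed

text \<open>A nonintegrable function has Bochner integral 0 by convention, so the value 1 settles
  integrability.\<close>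

lemma integrable_mollifier: "0 < e \<Longrightarrow> integrable lborel (mollifier e)"
  using not_integrable_integral_eq integral_mollifier by (metis zero_neq_one)

section \<open>Convolution with a smooth kernel\<close>

definition conv :: "(real ^ 'd::finite \<Rightarrow> real) \<Rightarrow> (real ^ 'd \<Rightarrow> real) \<Rightarrow> real ^ 'd \<Rightarrow> real" where
  "conv k f x = (\<integral>y. k (x - y) * f y \<partial>lborel)"

lemma integrable_conv:
  fixes k :: "real ^ 'd::finite \<Rightarrow> real"
  assumes k: "smooth_on UNIV k" "\<And>z. r < norm z \<Longrightarrow> k z = 0" and f: "integrable lborel f"
  shows "integrable lborel (\<lambda>y. k (x - y) * f y)"
proof -
  obtain M where M: "0 \<le> M" "\<And>z. \<bar>k z\<bar> \<le> M" using smooth_UNIV_bounded[OF k] by blast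
  have [measurable]: "k \<in> borel_measurable borel" "f \<in> borel_measurable lborel"
    using smooth_UNIV_borel_measurable[OF k(1)] f by auto
  show ?thesis
  proof (rule Bochner_Integration.integrable_bound[of _ "\<lambda>y. M * f y"])
    show "AE y in lborel. norm (k (x - y) * f y) \<le> norm (M * f y)"
      using M by (auto simp: abs_mult intro!: mult_right_mono)
  qed (use f in auto)
qed

lemma kernel_partial_eq_0:
  fixes k :: "real ^ 'd::finite \<Rightarrow> real"
  assumes "\<And>z. r < norm z \<Longrightarrow> k z = 0" "r < norm z"
  shows "partial_deriv i k z = 0"
proof -
  have "partial_deriv i k z = partial_deriv i (\<lambda>_. 0) z"
  proof (rule partial_deriv_cong_open[of "- cball 0 r"])
    show "open (- cball (0 :: real ^ 'd) r)" by (simp add: open_Compl)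
  qed (use assms in auto)
  then show ?thesis by simp
qed

lemma kernel_derivs_eq_0:
  fixes k :: "real ^ 'd::finite \<Rightarrow> real"
  assumes "\<And>z. r < norm z \<Longrightarrow> k z = 0" "r < norm z"
  shows "derivs xs k z = 0"
  using assms(2)
proof (induction xs arbitrary: z)
  case (Cons i xs)
  show ?case using kernel_partial_eq_0[of r "derivs xs k" z i] Cons by simp
qed (use assms in auto)

lemma kernel_uniformly_continuous:
  fixes k :: "real ^ 'd::finite \<Rightarrow> real"
  assumes "smooth_on UNIV k" "\<And>z. r < norm z \<Longrightarrow> k z = 0" "0 < e"
  obtains \<delta> where "0 < \<delta>" "\<And>x z. norm (x - z) < \<delta> \<Longrightarrow> \<bar>k x - k z\<bar> < e"
proof -
  have "uniformly_continuous_on (cball 0 (r + 1)) k"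
    by (intro compact_uniformly_continuous continuous_smooth_UNIV assms) auto
  then obtain d where d: "0 < d" "\<And>x z. x \<in> cball 0 (r + 1) \<Longrightarrow> z \<in> cball 0 (r + 1) \<Longrightarrow> dist z x < d \<Longrightarrow> dist (k z) (k x) < e"
    unfolding uniformly_continuous_on_def using assms(3) by metis
  show ?thesis
  \<comment> \<open>With distance below 1, either both points lie in the enlarged ball or both lie
    outside the ball of radius \<open>r\<close>, where \<open>k\<close> is 0.\<close>
  proof (rule that[of "min d 1"])
    fix x z :: "real ^ 'd" assume xz: "norm (x - z) < min d 1"
    show "\<bar>k x - k z\<bar> < e"
    proof (cases "norm x \<le> r \<or> norm z \<le> r")
      case True
      have "norm x \<le> norm (x - z) + norm z" "norm z \<le> norm (x - z) + norm x"
        using norm_triangle_sub[of x z] norm_triangle_sub[of z x] by (auto simp: norm_minus_commute)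
      then have "norm x \<le> r + 1" "norm z \<le> r + 1" using True xz by auto
      then show ?thesis using d(2)[of z x] xz by (simp add: dist_norm)
    next
      case False
      then show ?thesis using assms by simp
    qed
  qed (use d in auto)
qed

text \<open>Uniform continuity of the partial derivatives makes the first-order expansion uniform in
  \<open>z\<close>; this is what allows it to be integrated against \<open>f\<close> in
  \<open>conv_has_derivative\<close>.\<close>

lemma kernel_linearization:
  fixes k :: "real ^ 'd::finite \<Rightarrow> real"
  assumes k: "smooth_on UNIV k" "\<And>z. r < norm z \<Longrightarrow> k z = 0" and e: "0 < e"
  obtains \<delta> where "0 < \<delta>" "\<And>z h. norm h < \<delta> \<Longrightarrow>
    \<bar>k (z + h) - k z - (\<Sum>i\<in>UNIV. h $ i * partial_deriv i k z)\<bar> \<le> e * norm h"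
proof -
  let ?e = "e / CARD('d)"
  have z: "partial_deriv i k z = 0" if "r < norm z" for i z
    using kernel_partial_eq_0[of r k] k(2) that by blast
  have "\<exists>\<delta>>0. \<forall>x z. norm (x - z) < \<delta> \<longrightarrow> \<bar>partial_deriv i k x - partial_deriv i k z\<bar> < ?e" for i
  proof -
    have "0 < ?e" using e by simp
    from kernel_uniformly_continuous[OF smooth_on_partial[OF k(1)] z this]
    show ?thesis by metis
  qed
  then obtain \<delta>' where \<delta>': "\<And>i. 0 < \<delta>' i"
    "\<And>i x z. norm (x - z) < \<delta>' i \<Longrightarrow> \<bar>partial_deriv i k x - partial_deriv i k z\<bar> < ?e"
    by metis
  define \<delta> where "\<delta> = Min (range \<delta>')"
  have \<delta>: "0 < \<delta>" "\<And>i. \<delta> \<le> \<delta>' i" using \<delta>'(1) by (auto simp: \<delta>_def)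
  show ?thesis
  proof (rule that[OF \<delta>(1)])
    fix z h :: "real ^ 'd" assume h: "norm h < \<delta>"
    let ?f' = "\<lambda>x w. \<Sum>i\<in>UNIV. w $ i *\<^sub>R partial_deriv i k x"
    have "norm (k (z + h) - k z - ?f' z (z + h - z)) \<le> norm (z + h - z) * e"
    proof (rule differentiable_bound_linearization[where S = "ball z \<delta>"])
      show "z + t *\<^sub>R (z + h - z) \<in> ball z \<delta>" if "t \<in> {0..1}" for t
      proof -
        have "\<bar>t\<bar> * norm h \<le> 1 * norm h" using that by (intro mult_right_mono) auto
        then show ?thesis using h by (simp add: dist_norm)
      qed
      show "(k has_derivative ?f' x) (at x within ball z \<delta>)" for x
        by (rule has_derivative_at_withinI[OF has_derivative_partial])
          (rule smooth_on_differentiable[OF k(1)], auto)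
      show "onorm (?f' x - ?f' z) \<le> e" if "x \<in> ball z \<delta>" for x
      proof (rule onorm_bound)
        fix w :: "real ^ 'd"
        have "norm ((?f' x - ?f' z) w) = \<bar>\<Sum>i\<in>UNIV. w $ i * (partial_deriv i k x - partial_deriv i k z)\<bar>"
          by (simp add: sum_subtractf[symmetric] algebra_simps)
        also have "\<dots> \<le> (\<Sum>i\<in>UNIV. \<bar>w $ i * (partial_deriv i k x - partial_deriv i k z)\<bar>)"
          by (rule sum_abs)
        also have "\<dots> \<le> (\<Sum>i\<in>(UNIV :: 'd set). norm w * ?e)"
        proof (rule sum_mono)
          fix i
          have "norm (x - z) < \<delta>' i" using that \<delta>(2)[of i] by (simp add: dist_norm norm_minus_commute)
          then show "\<bar>w $ i * (partial_deriv i k x - partial_deriv i k z)\<bar> \<le> norm w * ?e"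
            unfolding abs_mult using \<delta>'(2)[of x z i] component_le_norm_cart[of w i] e
            by (intro mult_mono) auto
        qed
        finally show "norm ((?f' x - ?f' z) w) \<le> e * norm w" by (simp add: mult.commute)
      qed (use e in simp)
    qed (use \<delta> in simp)
    then show "\<bar>k (z + h) - k z - (\<Sum>i\<in>UNIV. h $ i * partial_deriv i k z)\<bar> \<le> e * norm h"
      by (simp add: mult.commute)
  qed
qed

lemma conv_has_derivative:
  fixes k f :: "real ^ 'd::finite \<Rightarrow> real"
  assumes k: "smooth_on UNIV k" "\<And>z. r < norm z \<Longrightarrow> k z = 0" and f: "integrable lborel f"
  shows "(conv k f has_derivative (\<lambda>h. \<Sum>i\<in>UNIV. h $ i * conv (partial_deriv i k) f x)) (at x)"
  unfolding has_derivative_at_alt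
proof (intro conjI allI impI)
  show "bounded_linear (\<lambda>h. \<Sum>i\<in>UNIV. h $ i * conv (partial_deriv i k) f x)"
    by (intro bounded_linear_sum bounded_linear_mult_const bounded_linear_vec_nth)
  fix e :: real assume "0 < e"
  have z: "partial_deriv i k z = 0" if "r < norm z" for i z
    using kernel_partial_eq_0[of r k] k(2) that by blast
  let ?F = "\<integral>y. \<bar>f y\<bar> \<partial>lborel"
  have F: "0 \<le> ?F" by simp
  then have F1: "0 < 1 + ?F" by linarith
  \<comment> \<open>The summand 1 keeps the tolerance meaningful when the L1 norm \<open>?F\<close>
    is 0.\<close>
  have pos: "0 < e / (1 + ?F)" using \<open>0 < e\<close> F1 by (rule divide_pos_pos)
  obtain \<delta> where \<delta>: "0 < \<delta>" "\<And>z h. norm h < \<delta> \<Longrightarrow>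
    \<bar>k (z + h) - k z - (\<Sum>i\<in>UNIV. h $ i * partial_deriv i k z)\<bar> \<le> e / (1 + ?F) * norm h"
    by (rule kernel_linearization[of k r, OF k(1) _ pos]) (erule k(2), rule that, assumption, blast)
  show "\<exists>\<delta>>0. \<forall>y. norm (y - x) < \<delta> \<longrightarrow>
    norm (conv k f y - conv k f x - (\<Sum>i\<in>UNIV. (y - x) $ i * conv (partial_deriv i k) f x)) \<le> e * norm (y - x)"
  proof (intro exI[of _ \<delta>] conjI allI impI \<delta>(1))
    fix y assume y: "norm (y - x) < \<delta>"
    have int1: "integrable lborel (\<lambda>w. k (u - w) * f w)" for u
      by (rule integrable_conv[of k r, OF k(1) _ f]) (erule k(2))
    have int2: "integrable lborel (\<lambda>w. partial_deriv i k (u - w) * f w)" for i u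
      by (rule integrable_conv[of "partial_deriv i k" r, OF smooth_on_partial[OF k(1)] _ f]) (erule z)
    note int = int1 int2
    let ?R = "\<lambda>w. (k (y - w) * f w - k (x - w) * f w) - (\<Sum>i\<in>UNIV. (y - x) $ i * (partial_deriv i k (x - w) * f w))"
    have iR: "integrable lborel ?R"
      by (intro Bochner_Integration.integrable_diff Bochner_Integration.integrable_sum integrable_mult_right int)
    have "conv k f y - conv k f x - (\<Sum>i\<in>UNIV. (y - x) $ i * conv (partial_deriv i k) f x) = (\<integral>w. ?R w \<partial>lborel)"
    proof -
      have "(\<integral>w. ?R w \<partial>lborel) = (\<integral>w. k (y - w) * f w - k (x - w) * f w \<partial>lborel)
          - (\<integral>w. (\<Sum>i\<in>UNIV. (y - x) $ i * (partial_deriv i k (x - w) * f w)) \<partial>lborel)"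
        by (intro Bochner_Integration.integral_diff Bochner_Integration.integrable_diff
            Bochner_Integration.integrable_sum integrable_mult_right int)
      also have "(\<integral>w. (\<Sum>i\<in>UNIV. (y - x) $ i * (partial_deriv i k (x - w) * f w)) \<partial>lborel)
          = (\<Sum>i\<in>UNIV. (y - x) $ i * conv (partial_deriv i k) f x)"
        unfolding conv_def
        by (subst Bochner_Integration.integral_sum) (intro integrable_mult_right int, simp)
      finally show ?thesis using int1 by (simp add: conv_def)
    qed
    also have "norm \<dots> \<le> (\<integral>w. e / (1 + ?F) * norm (y - x) * \<bar>f w\<bar> \<partial>lborel)"
    proof (rule Bochner_Integration.integral_norm_bound_integral[OF iR])
      show "integrable lborel (\<lambda>w. e / (1 + ?F) * norm (y - x) * \<bar>f w\<bar>)" using f by simp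
      fix w
      have "?R w = (k ((x - w) + (y - x)) - k (x - w) - (\<Sum>i\<in>UNIV. (y - x) $ i * partial_deriv i k (x - w))) * f w"
        by (simp add: left_diff_distrib sum_distrib_right mult.assoc)
      then show "norm (?R w) \<le> e / (1 + ?F) * norm (y - x) * \<bar>f w\<bar>"
        using \<delta>(2)[OF y, of "x - w"] by (simp only: real_norm_def abs_mult mult_right_mono[OF _ abs_ge_zero])
    qed
    also have "\<dots> = (e * norm (y - x)) * (?F / (1 + ?F))" by simp
    also have "\<dots> \<le> (e * norm (y - x)) * 1"
      using F F1 \<open>0 < e\<close> by (intro mult_left_mono) (auto simp: divide_simps)
    finally show "norm (conv k f y - conv k f x - (\<Sum>i\<in>UNIV. (y - x) $ i * conv (partial_deriv i k) f x)) \<le> e * norm (y - x)"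
      by simp
  qed
qed

lemma partial_deriv_conv:
  fixes k f :: "real ^ 'd::finite \<Rightarrow> real"
  assumes "smooth_on UNIV k" "\<And>z. r < norm z \<Longrightarrow> k z = 0" "integrable lborel f"
  shows "partial_deriv i (conv k f) = conv (partial_deriv i k) f"
proof
  fix x
  have "partial_deriv i (conv k f) x = (\<Sum>j\<in>UNIV. axis i 1 $ j * conv (partial_deriv j k) f x)"
    using partial_deriv_eqI[OF conv_has_derivative[OF assms]] .
  also have "\<dots> = (\<Sum>j\<in>UNIV. if j = i then conv (partial_deriv j k) f x else 0)"
    by (rule sum.cong) (auto simp: axis_def)
  finally show "partial_deriv i (conv k f) x = conv (partial_deriv i k) f x" by simp
qed

lemma smooth_on_conv:
  fixes k f :: "real ^ 'd::finite \<Rightarrow> real"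
  assumes "smooth_on UNIV k" "\<And>z. r < norm z \<Longrightarrow> k z = 0" "integrable lborel f"
  shows "smooth_on UNIV (conv k f)"
proof -
  have d: "conv k f differentiable_on UNIV"
    if "smooth_on UNIV k" "\<And>z. r < norm z \<Longrightarrow> k z = 0" for k :: "real ^ 'd \<Rightarrow> real"
    unfolding differentiable_on_def differentiable_def
    using conv_has_derivative[OF that assms(3)] by (auto intro: has_derivative_at_withinI)
  have "Ck_on n UNIV (conv k f)" for n
    using assms(1,2)
  proof (induction n arbitrary: k)
    case 0
    then show ?case using d differentiable_imp_continuous_on by auto
  next
    case (Suc n)
    have "Ck_on n UNIV (conv (partial_deriv i k) f)" for i
      using Suc.prems kernel_partial_eq_0[of r k] by (intro Suc.IH smooth_on_partial) auto
    then show ?case using Suc.prems d by (simp add: partial_deriv_conv[OF Suc.prems assms(3)])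
  qed
  then show ?thesis by (simp add: smooth_on_def)
qed

lemma derivs_conv:
  fixes k f :: "real ^ 'd::finite \<Rightarrow> real"
  assumes "smooth_on UNIV k" "\<And>z. r < norm z \<Longrightarrow> k z = 0" "integrable lborel f"
  shows "derivs xs (conv k f) = conv (derivs xs k) f"
proof (induction xs)
  case (Cons i xs)
  have "derivs xs k z = 0" if "r < norm z" for z
    using kernel_derivs_eq_0[of r k] assms(2) that by blast
  then show ?case
    using partial_deriv_conv[of "derivs xs k" r f i] smooth_on_derivs[OF assms(1)] assms(3) Cons by simp
qed simp

text \<open>The test function that yields the value of a mollification at \<open>x\<close> is the
  reflected kernel in the variable \<open>y\<close>; the sign found here cancels against the sign in
  \<open>is_weak_deriv\<close>.\<close>

lemma derivs_reflect:
  fixes k :: "real ^ 'd::finite \<Rightarrow> real"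
  assumes "smooth_on UNIV k"
  shows "smooth_on UNIV (\<lambda>y. k (x - y))"
    and "derivs xs (\<lambda>y. k (x - y)) y = (- 1) ^ length xs * derivs xs k (x - y)"
proof -
  let ?R = "\<lambda>y :: real ^ 'd. x - y"
  have d: "partial_deriv i (\<lambda>y. c * h (x - y)) y = - c * partial_deriv i h (x - y)"
    if "smooth_on UNIV h" for h :: "real ^ 'd \<Rightarrow> real" and c i y
  proof -
    have "(h has_derivative frechet_derivative h (at (x - y))) (at (x - y))"
      using smooth_on_differentiable[OF that] frechet_derivative_works by blast
    then have "((\<lambda>y. c * h (x - y)) has_derivative (\<lambda>w. c * frechet_derivative h (at (x - y)) (- w))) (at y)"
      by (intro has_derivative_mult_right has_derivative_compose[of ?R "\<lambda>w. - w" y UNIV h])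
        (auto intro!: derivative_eq_intros)
    from partial_deriv_eqI[OF this, of i] show ?thesis
      using linear_frechet_derivative[OF smooth_on_differentiable[OF that]]
      by (simp add: partial_deriv_def linear_neg)
  qed
  have sm: "smooth_on UNIV (\<lambda>y. x $ i + (-1) * (y :: real ^ 'd) $ i)" for i
    by (intro smooth_on_add smooth_on_mult smooth_on_const smooth_on_component open_UNIV)
  have R: "smooth_on UNIV ?R"
  proof (rule smooth_onI)
    show "?R differentiable_on UNIV" by (auto intro!: derivative_intros simp: differentiable_on_def)
    have "partial_deriv i ?R = (\<lambda>y. - axis i 1)" for i
      by (rule ext, rule partial_deriv_eqI) (auto intro!: derivative_eq_intros)
    then show "smooth_on UNIV (partial_deriv i ?R)" for i by simp
  qed
  show "smooth_on UNIV (\<lambda>y. k (x - y))"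
    by (rule smooth_on_compose[OF open_UNIV open_UNIV R _ assms]) simp
  show "derivs xs (\<lambda>y. k (x - y)) y = (- 1) ^ length xs * derivs xs k (x - y)"
  proof (induction xs arbitrary: y)
    case (Cons i xs)
    then have "derivs xs (\<lambda>y. k (x - y)) = (\<lambda>y. (- 1) ^ length xs * derivs xs k (x - y))" by blast
    then show ?case using d[OF smooth_on_derivs[OF assms]] by simp
  qed simp
qed

section \<open>Convergence of mollifications\<close>

lemma nn_integral_lborel_shift:
  fixes f :: "real ^ 'd::finite \<Rightarrow> ennreal"
  assumes [measurable]: "f \<in> borel_measurable borel"
  shows "(\<integral>\<^sup>+x. f (x - z) \<partial>lborel) = (\<integral>\<^sup>+x. f x \<partial>lborel)"
  using nn_integral_lborel_affine[OF assms, of 1 "- z"] by simp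

lemma nn_integral_lborel_reflect:
  fixes f :: "real ^ 'd::finite \<Rightarrow> ennreal"
  assumes [measurable]: "f \<in> borel_measurable borel"
  shows "(\<integral>\<^sup>+y. f (x - y) \<partial>lborel) = (\<integral>\<^sup>+y. f y \<partial>lborel)"
  using nn_integral_lborel_affine[OF assms, of "-1" x] by simp

definition shift_modulus :: "(real ^ 'd::finite \<Rightarrow> real) \<Rightarrow> real ^ 'd \<Rightarrow> ennreal" where
  "shift_modulus f z = (\<integral>\<^sup>+x. ennreal \<bar>f (x - z) - f x\<bar> \<partial>lborel)"

lemma shift_modulus_le:
  assumes [measurable]: "f \<in> borel_measurable borel" "g \<in> borel_measurable borel"
  shows "shift_modulus f z \<le> shift_modulus g z + 2 * (\<integral>\<^sup>+x. ennreal \<bar>f x - g x\<bar> \<partial>lborel)"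
proof -
  have "shift_modulus f z \<le> (\<integral>\<^sup>+x. ennreal \<bar>g (x - z) - g x\<bar> +
      (ennreal \<bar>f (x - z) - g (x - z)\<bar> + ennreal \<bar>f x - g x\<bar>) \<partial>lborel)"
    unfolding shift_modulus_def
    by (intro nn_integral_mono) (auto simp flip: ennreal_plus intro!: ennreal_leI)
  also have "\<dots> = shift_modulus g z + ((\<integral>\<^sup>+x. ennreal \<bar>f (x - z) - g (x - z)\<bar> \<partial>lborel)
      + (\<integral>\<^sup>+x. ennreal \<bar>f x - g x\<bar> \<partial>lborel))"
    unfolding shift_modulus_def by (simp add: nn_integral_add)
  also have "(\<integral>\<^sup>+x. ennreal \<bar>f (x - z) - g (x - z)\<bar> \<partial>lborel) = (\<integral>\<^sup>+x. ennreal \<bar>f x - g x\<bar> \<partial>lborel)"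
    by (rule nn_integral_lborel_shift) measurable
  finally show ?thesis by (simp add: mult_2)
qed

text \<open>The modulus of the difference of two indicators is their sum minus twice their product,
  and translation changes only the integral of the product. The product converges pointwise: for
  \<open>x\<close> in \<open>T\<close> by openness, and outside \<open>T\<close> it is 0
  throughout.\<close>

lemma shift_modulus_tendsto_indicator_open:
  fixes T :: "(real ^ 'd::finite) set"
  assumes T: "open T" "emeasure lborel T < \<infinity>" and Z: "Z \<longlonglongrightarrow> 0"
  shows "(\<lambda>n. shift_modulus (indicator T) (Z n)) \<longlonglongrightarrow> 0"
proof -
  have [measurable]: "T \<in> sets borel" using T by auto
  let ?m = "\<lambda>n x. indicator T (x - Z n) * indicator T x :: real"
  have iT: "integrable lborel (indicator T :: _ \<Rightarrow> real)"
    using T by (intro integrable_real_indicator) auto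
  have iTz: "integrable lborel (\<lambda>x. indicator T (x - z) :: real)"
    and mTz: "(\<integral>x. indicator T (x - z) \<partial>lborel) = measure lborel T" for z
  proof -
    have e: "(\<integral>\<^sup>+x. ennreal (indicator T (x - z)) \<partial>lborel) = emeasure lborel T"
      using nn_integral_lborel_shift[of "\<lambda>x. ennreal (indicator T x)" z] by (simp add: ennreal_indicator)
    show "integrable lborel (\<lambda>x. indicator T (x - z) :: real)"
      using e T(2) by (intro integrableI_nonneg) auto
    show "(\<integral>x. indicator T (x - z) \<partial>lborel) = measure lborel T"
      using e by (subst integral_eq_nn_integral) (auto simp: measure_def)
  qed
  have im: "integrable lborel (?m n)" for n
    by (rule Bochner_Integration.integrable_bound[OF iT]) (auto simp: indicator_def)
  have "(\<lambda>n. \<integral>x. ?m n x \<partial>lborel) \<longlonglongrightarrow> (\<integral>x. indicator T x \<partial>lborel)"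
  proof (rule integral_dominated_convergence[OF _ _ iT])
    show "AE x in lborel. (\<lambda>n. ?m n x) \<longlonglongrightarrow> indicator T x"
    proof (rule AE_I2)
      fix x
      show "(\<lambda>n. ?m n x) \<longlonglongrightarrow> indicator T x"
      proof (cases "x \<in> T")
        case True
        have "(\<lambda>n. x - Z n) \<longlonglongrightarrow> x - 0" by (intro tendsto_intros Z)
        then have "\<forall>\<^sub>F n in sequentially. x - Z n \<in> T"
          using topological_tendstoD[OF _ T(1)] True by fastforce
        then have "\<forall>\<^sub>F n in sequentially. ?m n x = 1" by eventually_elim (use True in simp)
        then show ?thesis using True by (simp add: tendsto_eventually)
      qed simp
    qed
  qed (auto simp: indicator_def)
  then have "(\<lambda>n. 2 * measure lborel T - 2 * (\<integral>x. ?m n x \<partial>lborel)) \<longlonglongrightarrow> 2 * measure lborel T - 2 * measure lborel T"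
    by (intro tendsto_intros) simp
  moreover have "shift_modulus (indicator T) (Z n) = ennreal (2 * measure lborel T - 2 * (\<integral>x. ?m n x \<partial>lborel))" for n
  proof -
    have "shift_modulus (indicator T) (Z n)
      = (\<integral>\<^sup>+x. ennreal ((indicator T (x - Z n) + indicator T x) - 2 * ?m n x) \<partial>lborel)"
      unfolding shift_modulus_def by (intro nn_integral_cong) (auto simp: indicator_def)
    also have "\<dots> = ennreal (\<integral>x. (indicator T (x - Z n) + indicator T x) - 2 * ?m n x \<partial>lborel)"
      by (intro nn_integral_eq_integral Bochner_Integration.integrable_diff Bochner_Integration.integrable_add
          integrable_mult_right iTz iT im) (auto simp: indicator_def)
    also have "(\<integral>x. (indicator T (x - Z n) + indicator T x) - 2 * ?m n x \<partial>lborel)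
      = measure lborel T + measure lborel T - 2 * (\<integral>x. ?m n x \<partial>lborel)"
      by (subst Bochner_Integration.integral_diff Bochner_Integration.integral_add;
          (intro Bochner_Integration.integrable_add integrable_mult_right iTz iT im)?)+ (simp add: mTz)
    finally show ?thesis by simp
  qed
  ultimately show ?thesis using tendsto_ennrealI by fastforce
qed

text \<open>Continuity of translations in L1. \<open>approx\<close> closes the property under L1
  limits; this reduces Borel sets to open ones by outer regularity and also settles the limit case
  of \<open>integrable_induct\<close>.\<close>

lemma shift_modulus_tendsto:
  fixes f :: "real ^ 'd::finite \<Rightarrow> real"
  assumes "integrable lborel f" "Z \<longlonglongrightarrow> 0"
  shows "(\<lambda>n. shift_modulus f (Z n)) \<longlonglongrightarrow> 0"
proof -
  have approx: "(\<lambda>n. shift_modulus f (Z n)) \<longlonglongrightarrow> 0"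
    if [measurable]: "f \<in> borel_measurable borel" and
      g: "\<And>e. 0 < e \<Longrightarrow> \<exists>g. g \<in> borel_measurable borel \<and> (\<integral>\<^sup>+x. ennreal \<bar>f x - g x\<bar> \<partial>lborel) < ennreal e \<and>
        (\<lambda>n. shift_modulus g (Z n)) \<longlonglongrightarrow> 0" for f :: "real ^ 'd \<Rightarrow> real"
  proof (rule tendsto_zero_ennreal)
    fix e :: real assume e: "0 < e"
    then have "0 < e / 4" by simp
    from g[OF this] obtain g where [measurable]: "g \<in> borel_measurable borel"
      and d: "(\<integral>\<^sup>+x. ennreal \<bar>f x - g x\<bar> \<partial>lborel) < ennreal (e / 4)"
      and gZ: "(\<lambda>n. shift_modulus g (Z n)) \<longlonglongrightarrow> 0" by blast
    have "\<forall>\<^sub>F n in sequentially. shift_modulus g (Z n) < ennreal (e / 4)"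
      using order_tendstoD(2)[OF gZ, of "ennreal (e / 4)"] e by simp
    then show "\<forall>\<^sub>F n in sequentially. shift_modulus f (Z n) < ennreal e"
    proof eventually_elim
      case (elim n)
      have "shift_modulus f (Z n) \<le> shift_modulus g (Z n) + 2 * (\<integral>\<^sup>+x. ennreal \<bar>f x - g x\<bar> \<partial>lborel)"
        by (rule shift_modulus_le) measurable
      also have "\<dots> \<le> ennreal (e / 4) + 2 * ennreal (e / 4)"
        using elim d by (intro add_mono mult_left_mono) auto
      also have "\<dots> = ennreal (3 * e / 4)"
        using e by (simp add: mult_2 flip: ennreal_plus)
      also have "\<dots> < ennreal e" using e by (intro ennreal_lessI) auto
      finally show ?case .
    qed
  qed
  show ?thesis using assms(1)
  proof (induction rule: integrable_induct)
    case (base A c)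
    show ?case
    proof (rule approx)
      have [measurable]: "A \<in> sets borel" using base by simp
      show "(\<lambda>x. indicator A x *\<^sub>R c) \<in> borel_measurable borel" by measurable
      fix e :: real assume e: "0 < e"
      \<comment> \<open>Dividing by \<open>1 + \<bar>c\<bar>\<close> leaves a strict inequality
        after multiplication by \<open>\<bar>c\<bar>\<close>, also for \<open>c = 0\<close>.\<close>
      obtain T where T: "open T" "A \<subseteq> T" "T - A \<in> lmeasurable" "emeasure lebesgue (T - A) < ennreal (e / (1 + \<bar>c\<bar>))"
        using sets_lebesgue_outer_open[of A "e / (1 + \<bar>c\<bar>)"] base e by (auto simp: sets_completionI_sets)
      have [measurable]: "T \<in> sets borel" using T(1) by simp
      have TA: "emeasure lborel (T - A) < ennreal (e / (1 + \<bar>c\<bar>))" using T(4) by simp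
      have "emeasure lborel T \<le> emeasure lborel A + emeasure lborel (T - A)"
        using emeasure_subadditive[of A lborel "T - A"] T(2) by (simp add: Un_absorb1)
      also have "\<dots> < \<infinity>" using base TA by (auto simp: less_top[symmetric] intro: ennreal_add_less_top)
      finally have fin: "emeasure lborel T < \<infinity>" .
      show "\<exists>g. g \<in> borel_measurable borel \<and> (\<integral>\<^sup>+x. ennreal \<bar>indicator A x *\<^sub>R c - g x\<bar> \<partial>lborel) < ennreal e \<and>
        (\<lambda>n. shift_modulus g (Z n)) \<longlonglongrightarrow> 0"
      proof (intro exI[of _ "\<lambda>x. c * indicator T x"] conjI)
        have "(\<integral>\<^sup>+x. ennreal \<bar>indicator A x *\<^sub>R c - c * indicator T x\<bar> \<partial>lborel)
          = (\<integral>\<^sup>+x. ennreal \<bar>c\<bar> * indicator (T - A) x \<partial>lborel)"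
          using T(2) by (intro nn_integral_cong) (auto simp: indicator_def)
        also have "\<dots> = ennreal \<bar>c\<bar> * emeasure lborel (T - A)" by (rule nn_integral_cmult_indicator) measurable
        also have "\<dots> \<le> ennreal \<bar>c\<bar> * ennreal (e / (1 + \<bar>c\<bar>))" using TA by (intro mult_left_mono) auto
        also have "\<dots> = ennreal (\<bar>c\<bar> * (e / (1 + \<bar>c\<bar>)))" using e by (simp add: ennreal_mult[symmetric])
        also have "\<dots> < ennreal e" using e by (intro ennreal_lessI) (auto simp: field_simps)
        finally show "(\<integral>\<^sup>+x. ennreal \<bar>indicator A x *\<^sub>R c - c * indicator T x\<bar> \<partial>lborel) < ennreal e" .
        have "shift_modulus (\<lambda>x. c * indicator T x) z = ennreal \<bar>c\<bar> * shift_modulus (indicator T) z" for z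
          unfolding shift_modulus_def
          by (subst nn_integral_cmult[symmetric]) (auto simp: abs_mult ennreal_mult simp flip: right_diff_distrib)
        then show "(\<lambda>n. shift_modulus (\<lambda>x. c * indicator T x) (Z n)) \<longlonglongrightarrow> 0"
          using ennreal_tendsto_cmult[OF _ shift_modulus_tendsto_indicator_open[OF T(1) fin assms(2)], of "ennreal \<bar>c\<bar>"]
          by simp
      qed measurable
    qed
  next
    case (add f g)
    have [measurable]: "f \<in> borel_measurable borel" "g \<in> borel_measurable borel" using add by auto
    have lim: "(\<lambda>n. shift_modulus f (Z n) + shift_modulus g (Z n)) \<longlonglongrightarrow> 0"
      using tendsto_add[OF add(3) add(4)] by simp
    show ?case
    proof (rule tendsto_sandwich[OF _ _ tendsto_const lim])
      show "\<forall>\<^sub>F n in sequentially. shift_modulus (\<lambda>x. f x + g x) (Z n) \<le> shift_modulus f (Z n) + shift_modulus g (Z n)"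
      proof (rule always_eventually, rule allI)
        fix n
        have "shift_modulus (\<lambda>x. f x + g x) (Z n)
          \<le> (\<integral>\<^sup>+x. ennreal \<bar>f (x - Z n) - f x\<bar> + ennreal \<bar>g (x - Z n) - g x\<bar> \<partial>lborel)"
          unfolding shift_modulus_def
          by (intro nn_integral_mono) (auto simp flip: ennreal_plus intro!: ennreal_leI)
        then show "shift_modulus (\<lambda>x. f x + g x) (Z n) \<le> shift_modulus f (Z n) + shift_modulus g (Z n)"
          unfolding shift_modulus_def by (subst (asm) nn_integral_add) auto
      qed
    qed auto
  next
    case (lim f s)
    have [measurable]: "f \<in> borel_measurable borel" "\<And>i. s i \<in> borel_measurable borel" using lim by auto
    show ?case
    proof (rule approx)
      fix e :: real assume e: "0 < e"
      have "(\<lambda>i. \<integral>\<^sup>+x. ennreal (norm (f x - s i x)) \<partial>lborel) \<longlonglongrightarrow> 0"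
      proof (rule nn_integral_dominated_convergence_norm[where w = "\<lambda>x. 2 * norm (f x)"])
        show "(\<integral>\<^sup>+x. ennreal (2 * norm (f x)) \<partial>lborel) < \<infinity>"
          using lim by (auto simp: integrable_iff_bounded ennreal_mult nn_integral_cmult ennreal_mult_less_top)
      qed (use lim in auto)
      then have "\<forall>\<^sub>F i in sequentially. (\<integral>\<^sup>+x. ennreal (norm (f x - s i x)) \<partial>lborel) < ennreal e"
        using order_tendstoD(2)[of _ 0 sequentially "ennreal e"] e by simp
      then obtain i where "(\<integral>\<^sup>+x. ennreal (norm (f x - s i x)) \<partial>lborel) < ennreal e"
        using eventually_happens by fastforce
      then show "\<exists>g. g \<in> borel_measurable borel \<and> (\<integral>\<^sup>+x. ennreal \<bar>f x - g x\<bar> \<partial>lborel) < ennreal e \<and>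
        (\<lambda>n. shift_modulus g (Z n)) \<longlonglongrightarrow> 0"
        using lim by (intro exI[of _ "s i"]) auto
    qed simp
  qed
qed

lemma shift_modulus_small:
  fixes f :: "real ^ 'd::finite \<Rightarrow> real"
  assumes "integrable lborel f" "0 < e"
  obtains \<delta> where "0 < \<delta>" "\<And>z. norm z < \<delta> \<Longrightarrow> shift_modulus f z < ennreal e"
proof -
  have 0: "shift_modulus f 0 = 0" by (simp add: shift_modulus_def)
  have "\<exists>\<delta>>0. \<forall>z. norm z < \<delta> \<longrightarrow> shift_modulus f z < ennreal e"
  proof (rule ccontr)
    assume n: "\<not> ?thesis"
    have "\<exists>z. norm z < inverse (real (Suc n)) \<and> \<not> shift_modulus f z < ennreal e" for n
      using n by (metis inverse_positive_iff_positive of_nat_0_less_iff zero_less_Suc)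
    then obtain Z where Z: "\<And>n. norm (Z n) < inverse (real (Suc n))" "\<And>n. \<not> shift_modulus f (Z n) < ennreal e"
      by metis
    have "Z \<longlonglongrightarrow> 0"
      by (rule Lim_null_comparison[OF _ LIMSEQ_inverse_real_of_nat]) (use Z(1) in \<open>auto intro: always_eventually less_imp_le\<close>)
    from order_tendstoD(2)[OF shift_modulus_tendsto[OF assms(1) this], of "ennreal e"]
    show False using Z(2) assms(2) eventually_happens by fastforce
  qed
  then show ?thesis using that by blast
qed

section \<open>Averages against the mollifier in L1 and L2\<close>

lemma nn_integral_mollifier:
  "0 < e \<Longrightarrow> (\<integral>\<^sup>+z. ennreal (mollifier e z) \<partial>(lborel :: (real ^ 'd::finite) measure)) = 1"
  using nn_integral_eq_integral[OF integrable_mollifier[where 'a = 'd, of e]] mollifier_nonneg[where 'a='d] integral_mollifier[where 'd='d, of e]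
  by simp

lemma mollifier_measurable [measurable]: "mollifier e \<in> borel_measurable borel"
  by (rule smooth_UNIV_borel_measurable[OF smooth_on_mollifier])

lemma nn_integral_mollifier_shift:
  "0 < e \<Longrightarrow> (\<integral>\<^sup>+y. ennreal (mollifier e (x - y)) \<partial>(lborel :: (real ^ 'd::finite) measure)) = 1"
  using nn_integral_lborel_reflect[of "\<lambda>z. ennreal (mollifier e z)" x] nn_integral_mollifier[where 'd='d, of e] by simp

lemma integral_mollifier_shift:
  assumes "0 < e"
  shows "integrable lborel (\<lambda>y :: real ^ 'd::finite. mollifier e (x - y))"
    and "(\<integral>y. mollifier e (x - y) \<partial>(lborel :: (real ^ 'd::finite) measure)) = 1"
proof -
  show "integrable lborel (\<lambda>y :: real ^ 'd. mollifier e (x - y))"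
    using nn_integral_mollifier_shift[where 'd='d, OF assms, of x] mollifier_nonneg
    by (intro integrableI_nonneg) auto
  show "(\<integral>y. mollifier e (x - y) \<partial>(lborel :: (real ^ 'd) measure)) = 1"
    using nn_integral_mollifier_shift[where 'd='d, OF assms, of x] mollifier_nonneg
    by (subst integral_eq_nn_integral) auto
qed

lemma integrable_mollify:
  "0 < e \<Longrightarrow> integrable lborel f \<Longrightarrow> integrable lborel (\<lambda>y. mollifier e (x - y) * f y)"
  by (rule integrable_conv[OF smooth_on_mollifier, of e]) (auto intro: mollifier_eq_0)

lemma smooth_on_mollify:
  "0 < e \<Longrightarrow> integrable lborel f \<Longrightarrow> smooth_on UNIV (conv (mollifier e) f)"
  by (rule smooth_on_conv[OF smooth_on_mollifier, of e]) (auto intro: mollifier_eq_0)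

lemma conv_measurable [measurable]:
  fixes f :: "real ^ 'd::finite \<Rightarrow> real"
  shows "0 < e \<Longrightarrow> integrable lborel f \<Longrightarrow> conv (mollifier e) f \<in> borel_measurable borel"
  by (rule smooth_UNIV_borel_measurable[OF smooth_on_mollify])

text \<open>A mollification is an average of translates, so by Tonelli its L1 error is at most the
  average of \<open>shift_modulus f\<close> over shifts shorter than \<open>e\<close>.\<close>

lemma mollify_L1_le:
  fixes f :: "real ^ 'd::finite \<Rightarrow> real"
  assumes e: "0 < e" and f: "integrable lborel f" and z: "\<And>z. norm z < e \<Longrightarrow> shift_modulus f z \<le> \<eta>"
  shows "(\<integral>\<^sup>+x. ennreal \<bar>conv (mollifier e) f x - f x\<bar> \<partial>lborel) \<le> \<eta>"
proof -
  have [measurable]: "f \<in> borel_measurable borel" using f by auto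
  have "ennreal \<bar>conv (mollifier e) f x - f x\<bar> \<le> (\<integral>\<^sup>+y. ennreal (mollifier e (x - y) * \<bar>f y - f x\<bar>) \<partial>lborel)" for x
  proof -
    have i: "integrable lborel (\<lambda>y. mollifier e (x - y) * (f y - f x))"
      unfolding right_diff_distrib
      by (intro Bochner_Integration.integrable_diff integrable_mollify e f integrable_mult_left integral_mollifier_shift)
    have "conv (mollifier e) f x - f x = (\<integral>y. mollifier e (x - y) * f y - mollifier e (x - y) * f x \<partial>lborel)"
      using integrable_mollify[OF e f, of x] integral_mollifier_shift[OF e, of x]
      by (simp add: conv_def)
    then have "\<bar>conv (mollifier e) f x - f x\<bar> \<le> (\<integral>y. \<bar>mollifier e (x - y) * (f y - f x)\<bar> \<partial>lborel)"
      using integral_abs_bound[of lborel "\<lambda>y. mollifier e (x - y) * (f y - f x)"] by (simp add: right_diff_distrib)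
    then have "ennreal \<bar>conv (mollifier e) f x - f x\<bar> \<le> ennreal (\<integral>y. \<bar>mollifier e (x - y) * (f y - f x)\<bar> \<partial>lborel)"
      by (rule ennreal_leI)
    also have "\<dots> = (\<integral>\<^sup>+y. ennreal \<bar>mollifier e (x - y) * (f y - f x)\<bar> \<partial>lborel)"
      using i by (subst nn_integral_eq_integral) auto
    finally show ?thesis by (simp add: abs_mult mollifier_nonneg)
  qed
  then have "(\<integral>\<^sup>+x. ennreal \<bar>conv (mollifier e) f x - f x\<bar> \<partial>lborel)
    \<le> (\<integral>\<^sup>+x. \<integral>\<^sup>+y. ennreal (mollifier e (x - y) * \<bar>f y - f x\<bar>) \<partial>lborel \<partial>lborel)"
    by (rule nn_integral_mono)
  also have "\<dots> = (\<integral>\<^sup>+x. \<integral>\<^sup>+z. ennreal (mollifier e z * \<bar>f (x - z) - f x\<bar>) \<partial>lborel \<partial>lborel)"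
    using nn_integral_lborel_reflect[of "\<lambda>z. ennreal (mollifier e z * \<bar>f (x - z) - f x\<bar>)" x for x] by simp
  also have "\<dots> = (\<integral>\<^sup>+z. \<integral>\<^sup>+x. ennreal (mollifier e z * \<bar>f (x - z) - f x\<bar>) \<partial>lborel \<partial>lborel)"
    by (rule lborel_pair.Fubini') measurable
  also have "\<dots> = (\<integral>\<^sup>+z. ennreal (mollifier e z) * shift_modulus f z \<partial>lborel)"
    unfolding shift_modulus_def
    by (subst nn_integral_cmult[symmetric]) (auto simp: ennreal_mult mollifier_nonneg)
  also have "\<dots> \<le> (\<integral>\<^sup>+z. ennreal (mollifier e z) * \<eta> \<partial>(lborel :: (real ^ 'd) measure))"
  proof (rule nn_integral_mono)
    fix x :: "real ^ 'd"
    show "ennreal (mollifier e x) * shift_modulus f x \<le> ennreal (mollifier e x) * \<eta>"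
      using z[of x] mollifier_eq_0[OF e, of x] by (cases "norm x < e") (auto intro: mult_left_mono)
  qed
  also have "\<dots> = \<eta>" using nn_integral_mollifier[where 'd='d, OF e] by (simp add: nn_integral_multc)
  finally show ?thesis .
qed

lemma mollify_L1_small:
  fixes f :: "real ^ 'd::finite \<Rightarrow> real"
  assumes f: "integrable lborel f" and "0 < \<eta>"
  obtains \<delta> where "0 < \<delta>" "\<And>e. 0 < e \<Longrightarrow> e \<le> \<delta> \<Longrightarrow>
    (\<integral>\<^sup>+x. ennreal \<bar>conv (mollifier e) f x - f x\<bar> \<partial>lborel) \<le> ennreal \<eta>"
proof -
  obtain \<delta> where "0 < \<delta>" and \<delta>: "\<And>z. norm z < \<delta> \<Longrightarrow> shift_modulus f z < ennreal \<eta>"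
    using shift_modulus_small[OF assms] by blast
  show ?thesis
  proof (rule that[OF \<open>0 < \<delta>\<close>])
    fix e :: real assume "0 < e" "e \<le> \<delta>"
    then show "(\<integral>\<^sup>+x. ennreal \<bar>conv (mollifier e) f x - f x\<bar> \<partial>lborel) \<le> ennreal \<eta>"
      using \<delta> by (intro mollify_L1_le f) (auto intro: less_imp_le)
  qed
qed

lemma mollify_bounded:
  fixes f :: "real ^ 'd::finite \<Rightarrow> real"
  assumes e: "0 < e" and f: "integrable lborel f" and B: "AE x in lborel. \<bar>f x\<bar> \<le> B"
  shows "\<bar>conv (mollifier e) f x\<bar> \<le> B"
proof -
  have "\<bar>conv (mollifier e) f x\<bar> \<le> (\<integral>y. \<bar>mollifier e (x - y) * f y\<bar> \<partial>lborel)"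
    unfolding conv_def by (rule integral_abs_bound)
  also have "\<dots> \<le> (\<integral>y. mollifier e (x - y) * B \<partial>lborel)"
  proof (rule integral_mono_AE)
    show "AE y in lborel. \<bar>mollifier e (x - y) * f y\<bar> \<le> mollifier e (x - y) * B"
      using B by eventually_elim (simp add: abs_mult mollifier_nonneg mult_left_mono)
  qed (use integrable_mollify[OF e f] integral_mollifier_shift[OF e] in auto)
  also have "\<dots> = B" using integral_mollifier_shift[OF e, of x] by simp
  finally show ?thesis .
qed

text \<open>Jensen for the probability density \<open>?\<rho>\<close>, again from a nonnegative
  variance; an infinite right-hand side leaves nothing to prove.\<close>

lemma mollify_sq_le:
  fixes f :: "real ^ 'd::finite \<Rightarrow> real"
  assumes e: "0 < e" and f: "integrable lborel f"
  shows "ennreal ((conv (mollifier e) f x)\<^sup>2) \<le> (\<integral>\<^sup>+y. ennreal (mollifier e (x - y) * (f y)\<^sup>2) \<partial>lborel)"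
    (is "_ \<le> ?R")
proof (cases "?R < \<infinity>")
  case True
  have [measurable]: "f \<in> borel_measurable borel" using f by auto
  let ?\<rho> = "\<lambda>y. mollifier e (x - y)" and ?c = "conv (mollifier e) f x"
  note \<rho> = integral_mollifier_shift[where 'd='d, OF e, of x]
  have i2: "integrable lborel (\<lambda>y. ?\<rho> y * (f y)\<^sup>2)"
    using True by (intro integrableI_nonneg) (auto simp: mollifier_nonneg)
  have i1: "integrable lborel (\<lambda>y. ?\<rho> y * f y)" by (rule integrable_mollify[OF e f])
  have "0 \<le> (\<integral>y. ?\<rho> y * (f y - ?c)\<^sup>2 \<partial>lborel)" by (rule Bochner_Integration.integral_nonneg) (simp add: mollifier_nonneg)
  also have "(\<lambda>y. ?\<rho> y * (f y - ?c)\<^sup>2) = (\<lambda>y. ?\<rho> y * (f y)\<^sup>2 - 2 * ?c * (?\<rho> y * f y) + ?c\<^sup>2 * ?\<rho> y)"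
    by (auto simp: power2_eq_square algebra_simps)
  also have "(\<integral>y. \<dots> y \<partial>lborel) = (\<integral>y. ?\<rho> y * (f y)\<^sup>2 \<partial>lborel) - 2 * ?c * ?c + ?c\<^sup>2"
    using i1 i2 \<rho> by (simp add: conv_def)
  finally have "?c\<^sup>2 \<le> (\<integral>y. ?\<rho> y * (f y)\<^sup>2 \<partial>lborel)" by (simp add: power2_eq_square)
  then have "ennreal (?c\<^sup>2) \<le> ennreal (\<integral>y. ?\<rho> y * (f y)\<^sup>2 \<partial>lborel)" by (rule ennreal_leI)
  also have "\<dots> = ?R" using i2 by (subst nn_integral_eq_integral) (auto simp: mollifier_nonneg)
  finally show ?thesis .
next
  case False
  then show ?thesis by (simp add: not_less_iff_gr_or_eq top.extremum_unique less_top)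
qed

lemma mollify_L2_le:
  fixes f :: "real ^ 'd::finite \<Rightarrow> real"
  assumes e: "0 < e" and f: "integrable lborel f"
  shows "(\<integral>\<^sup>+x. ennreal ((conv (mollifier e) f x)\<^sup>2) \<partial>lborel) \<le> (\<integral>\<^sup>+x. ennreal ((f x)\<^sup>2) \<partial>lborel)"
proof -
  have [measurable]: "f \<in> borel_measurable borel" using f by auto
  have "(\<integral>\<^sup>+x. ennreal ((conv (mollifier e) f x)\<^sup>2) \<partial>lborel)
    \<le> (\<integral>\<^sup>+x. \<integral>\<^sup>+y. ennreal (mollifier e (x - y) * (f y)\<^sup>2) \<partial>lborel \<partial>lborel)"
    by (rule nn_integral_mono[OF mollify_sq_le[OF assms]])
  also have "\<dots> = (\<integral>\<^sup>+y. \<integral>\<^sup>+x. ennreal (mollifier e (x - y) * (f y)\<^sup>2) \<partial>lborel \<partial>lborel)"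
    by (rule lborel_pair.Fubini') measurable
  also have "\<dots> = (\<integral>\<^sup>+y. (\<integral>\<^sup>+x. ennreal (mollifier e (x - y)) \<partial>lborel) * ennreal ((f y)\<^sup>2) \<partial>lborel)"
    by (subst nn_integral_multc[symmetric]) (auto simp: ennreal_mult mollifier_nonneg)
  also have "\<dots> = (\<integral>\<^sup>+x. ennreal ((f x)\<^sup>2) \<partial>lborel)"
    using nn_integral_lborel_shift[of "\<lambda>x :: real ^ 'd. ennreal (mollifier e x)"] nn_integral_mollifier[where 'd='d, OF e] by simp
  finally show ?thesis .
qed

lemma sum3_sq_le: "((a::real) + b + c)\<^sup>2 \<le> 3 * a\<^sup>2 + 3 * b\<^sup>2 + 3 * c\<^sup>2"
  using sum_squares_ge_zero[of "a - b" "b - c"] zero_le_power2[of "a - c"]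
  by (auto simp: power2_eq_square algebra_simps)

lemma conv_diff:
  fixes f g :: "real ^ 'd::finite \<Rightarrow> real"
  assumes "0 < e" "integrable lborel f" "integrable lborel g"
  shows "conv (mollifier e) (\<lambda>x. f x - g x) x = conv (mollifier e) f x - conv (mollifier e) g x"
  unfolding conv_def right_diff_distrib using assms
  by (intro Bochner_Integration.integral_diff integrable_mollify)

text \<open>Truncation reduces L2 to L1: for the bounded part the square of the error is at most
  \<open>2 * (M + 1)\<close> times its modulus, while the tail is small in L2 before mollification
  and, by \<open>mollify_L2_le\<close>, also after it.\<close>

lemma mollify_L2_small:
  fixes f :: "real ^ 'd::finite \<Rightarrow> real"
  assumes f: "integrable lborel f" and f2: "(\<integral>\<^sup>+x. ennreal ((f x)\<^sup>2) \<partial>lborel) < \<infinity>" and \<eta>: "0 < \<eta>"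
  obtains \<delta> where "0 < \<delta>" "\<And>e. 0 < e \<Longrightarrow> e \<le> \<delta> \<Longrightarrow>
    (\<integral>\<^sup>+x. ennreal ((conv (mollifier e) f x - f x)\<^sup>2) \<partial>lborel) \<le> ennreal \<eta>"
proof -
  have [measurable]: "f \<in> borel_measurable borel" using f by auto
  define F where "F M x = (if \<bar>f x\<bar> \<le> real M then f x else 0)" for M x
  have [measurable]: "F M \<in> borel_measurable borel" for M unfolding F_def by measurable
  have "(\<lambda>M. \<integral>\<^sup>+x. ennreal ((f x - F M x)\<^sup>2) \<partial>lborel) \<longlonglongrightarrow> (\<integral>\<^sup>+x. 0 \<partial>(lborel :: (real ^ 'd) measure))"
  proof (rule nn_integral_dominated_convergence[where w = "\<lambda>x. ennreal ((f x)\<^sup>2)"])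
    show "AE x in lborel. (\<lambda>M. ennreal ((f x - F M x)\<^sup>2)) \<longlonglongrightarrow> 0"
    proof (rule AE_I2)
      fix x
      obtain M0 where "\<bar>f x\<bar> \<le> real M0" using real_arch_simple by blast
      then have "\<forall>\<^sub>F M in sequentially. ennreal ((f x - F M x)\<^sup>2) = 0"
        by (intro eventually_sequentiallyI[of M0]) (auto simp: F_def)
      then show "(\<lambda>M. ennreal ((f x - F M x)\<^sup>2)) \<longlonglongrightarrow> 0" by (rule tendsto_eventually)
    qed
  qed (use f2 in \<open>auto simp: F_def intro!: AE_I2 ennreal_leI\<close>)
  then have "\<forall>\<^sub>F M in sequentially. (\<integral>\<^sup>+x. ennreal ((f x - F M x)\<^sup>2) \<partial>lborel) < ennreal (\<eta> / 12)"
    using order_tendstoD(2)[of _ 0 sequentially "ennreal (\<eta> / 12)"] \<eta> by simp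
  then obtain M where M: "(\<integral>\<^sup>+x. ennreal ((f x - F M x)\<^sup>2) \<partial>lborel) < ennreal (\<eta> / 12)"
    using eventually_happens by fastforce
  let ?g = "F M"
  have g: "integrable lborel ?g"
    by (rule Bochner_Integration.integrable_bound[OF f]) (auto simp: F_def)
  have gM: "\<bar>?g x\<bar> \<le> real M" for x by (simp add: F_def)
  have r: "integrable lborel (\<lambda>x. f x - ?g x)" using f g by simp
  \<comment> \<open>Makes \<open>6 * (M + 1) * \<kappa>\<close> equal to \<open>\<eta> / 2\<close>;
    the two tail terms take \<open>\<eta> / 4\<close> each.\<close>
  define \<kappa> where "\<kappa> = \<eta> / (12 * (real M + 1))"
  have \<kappa>: "0 < \<kappa>" using \<eta> by (simp add: \<kappa>_def)
  obtain \<delta> where \<delta>: "0 < \<delta>" "\<And>e. 0 < e \<Longrightarrow> e \<le> \<delta> \<Longrightarrow>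
    (\<integral>\<^sup>+x. ennreal \<bar>conv (mollifier e) ?g x - ?g x\<bar> \<partial>lborel) \<le> ennreal \<kappa>"
    using mollify_L1_small[OF g \<kappa>] by blast
  show ?thesis
  proof (rule that[OF \<delta>(1)])
    fix e :: real assume e: "0 < e" "e \<le> \<delta>"
    note [measurable] = conv_measurable[OF e(1) g] conv_measurable[OF e(1) r] conv_measurable[OF e(1) f]
    let ?a = "\<lambda>x. conv (mollifier e) (\<lambda>x. f x - ?g x) x" and ?b = "\<lambda>x. f x - ?g x"
      and ?d = "\<lambda>x. conv (mollifier e) ?g x - ?g x"
    have d: "(?d x)\<^sup>2 \<le> 2 * (real M + 1) * \<bar>?d x\<bar>" for x
    proof -
      have "\<bar>conv (mollifier e) ?g x\<bar> \<le> real M" by (rule mollify_bounded[OF e(1) g]) (simp add: gM)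
      then have "\<bar>conv (mollifier e) ?g x\<bar> + \<bar>?g x\<bar> \<le> real M + real M"
        using gM by (rule add_mono)
      with abs_triangle_ineq4[of "conv (mollifier e) ?g x" "?g x"]
      have "\<bar>?d x\<bar> \<le> real M + real M" by (rule order_trans)
      also have "\<dots> \<le> 2 * (real M + 1)" by simp
      finally have "\<bar>?d x\<bar> \<le> 2 * (real M + 1)" .
      then have "\<bar>?d x\<bar> * \<bar>?d x\<bar> \<le> 2 * (real M + 1) * \<bar>?d x\<bar>" by (rule mult_right_mono) simp
      then show ?thesis by (simp add: power2_eq_square flip: abs_mult)
    qed
    have "(\<integral>\<^sup>+x. ennreal ((conv (mollifier e) f x - f x)\<^sup>2) \<partial>lborel)
      \<le> (\<integral>\<^sup>+x. 3 * ennreal ((?a x)\<^sup>2) + 3 * ennreal ((?b x)\<^sup>2) + ennreal (6 * (real M + 1)) * ennreal \<bar>?d x\<bar> \<partial>lborel)"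
    proof (rule nn_integral_mono)
      fix x
      have "(conv (mollifier e) f x - f x)\<^sup>2 = (?a x + (- ?b x) + ?d x)\<^sup>2"
        by (simp add: conv_diff[OF e(1) f g])
      also have "\<dots> \<le> 3 * (?a x)\<^sup>2 + 3 * (- ?b x)\<^sup>2 + 3 * (?d x)\<^sup>2" by (rule sum3_sq_le)
      also have "\<dots> \<le> 3 * (?a x)\<^sup>2 + 3 * (?b x)\<^sup>2 + 6 * (real M + 1) * \<bar>?d x\<bar>"
        using mult_left_mono[OF d[of x], of 3] by (simp add: power2_commute[of "f x"] algebra_simps)
      finally have "ennreal ((conv (mollifier e) f x - f x)\<^sup>2)
        \<le> ennreal (3 * (?a x)\<^sup>2 + 3 * (?b x)\<^sup>2 + 6 * (real M + 1) * \<bar>?d x\<bar>)" by (rule ennreal_leI)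
      then show "ennreal ((conv (mollifier e) f x - f x)\<^sup>2)
        \<le> 3 * ennreal ((?a x)\<^sup>2) + 3 * ennreal ((?b x)\<^sup>2) + ennreal (6 * (real M + 1)) * ennreal \<bar>?d x\<bar>"
        by (simp add: ennreal_mult ennreal_plus)
    qed
    also have "\<dots> = 3 * (\<integral>\<^sup>+x. ennreal ((?a x)\<^sup>2) \<partial>lborel) + 3 * (\<integral>\<^sup>+x. ennreal ((?b x)\<^sup>2) \<partial>lborel)
        + ennreal (6 * (real M + 1)) * (\<integral>\<^sup>+x. ennreal \<bar>?d x\<bar> \<partial>lborel)"
      by (simp add: nn_integral_add nn_integral_cmult)
    also have "\<dots> \<le> 3 * ennreal (\<eta> / 12) + 3 * ennreal (\<eta> / 12) + ennreal (6 * (real M + 1)) * ennreal \<kappa>"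
      using M mollify_L2_le[OF e(1) r] \<delta>(2)[OF e]
      by (intro add_mono mult_left_mono) (auto intro: order_trans less_imp_le)
    also have "\<dots> = ennreal (3 * (\<eta> / 12) + 3 * (\<eta> / 12) + 6 * (real M + 1) * \<kappa>)"
    proof -
      have "3 * ennreal (\<eta> / 12) = ennreal (3 * (\<eta> / 12))"
        using ennreal_mult[of 3 "\<eta> / 12"] \<eta> by simp
      moreover have "ennreal (6 * (real M + 1)) * ennreal \<kappa> = ennreal (6 * (real M + 1) * \<kappa>)"
        using \<kappa> by (intro ennreal_mult[symmetric]) auto
      ultimately show ?thesis using \<eta> \<kappa> by (simp only:) (simp flip: ennreal_plus)
    qed
    also have "3 * (\<eta> / 12) + 3 * (\<eta> / 12) + 6 * (real M + 1) * \<kappa> = \<eta>"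
      by (simp add: \<kappa>_def field_simps)
    finally show "(\<integral>\<^sup>+x. ennreal ((conv (mollifier e) f x - f x)\<^sup>2) \<partial>lborel) \<le> ennreal \<eta>" .
  qed
qed

section \<open>Mollification of weakly differentiable functions\<close>

text \<open>Tonelli's theorem and translations are available for \<open>lborel\<close>; measurable functions for
  \<open>lebesgue_on \<Omega>\<close> are replaced by Borel representatives vanishing outside \<open>\<Omega>\<close>.\<close>

definition borel_rep ::
    "(real ^ 'd::finite) set \<Rightarrow> (real ^ 'd \<Rightarrow> real) \<Rightarrow> (real ^ 'd \<Rightarrow> real) \<Rightarrow> bool" where
  "borel_rep \<Omega> f F \<longleftrightarrow> F \<in> borel_measurable borel \<and> (\<forall>x. x \<notin> \<Omega> \<longrightarrow> F x = 0) \<and>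
     (AE x in lborel. x \<in> \<Omega> \<longrightarrow> F x = f x)"

lemma borel_rep_measurable: "borel_rep \<Omega> f F \<Longrightarrow> F \<in> borel_measurable borel"
  by (simp add: borel_rep_def)

lemma borel_rep_AE: "borel_rep \<Omega> f F \<Longrightarrow> AE x in lborel. F x = indicator \<Omega> x * f x"
  unfolding borel_rep_def by (auto simp: indicator_def elim!: eventually_mono)

lemma lebesgue_on_measurable_iff:
  fixes f :: "real ^ 'd::finite \<Rightarrow> real"
  assumes "\<Omega> \<in> sets borel"
  shows "f \<in> borel_measurable (lebesgue_on \<Omega>) \<longleftrightarrow> (\<lambda>x. indicator \<Omega> x * f x) \<in> borel_measurable lebesgue"
proof -
  have "\<Omega> \<inter> space lebesgue \<in> sets lebesgue" using assms by (simp add: sets_completionI_sets)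
  from borel_measurable_restrict_space_iff[OF this, of f] show ?thesis by simp
qed

lemma borel_rep_exists:
  fixes f :: "real ^ 'd::finite \<Rightarrow> real"
  assumes \<Omega>: "\<Omega> \<in> sets borel" and f: "f \<in> borel_measurable (lebesgue_on \<Omega>)"
  obtains F where "borel_rep \<Omega> f F"
proof -
  obtain G where [measurable]: "G \<in> borel_measurable lborel" and G: "AE x in lborel. indicator \<Omega> x * f x = G x"
    using completion_ex_borel_measurable_real[OF f[unfolded lebesgue_on_measurable_iff[OF \<Omega>]]] by blast
  note \<Omega>[measurable]
  have "borel_rep \<Omega> f (\<lambda>x. indicator \<Omega> x * G x)"
    unfolding borel_rep_def
  proof (intro conjI)
    show "AE x in lborel. x \<in> \<Omega> \<longrightarrow> indicator \<Omega> x * G x = f x"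
      using G by eventually_elim auto
  qed auto
  then show ?thesis by (rule that)
qed

lemma borel_rep_integral:
  fixes f :: "real ^ 'd::finite \<Rightarrow> real"
  assumes \<Omega>: "\<Omega> \<in> sets borel" and f: "f \<in> borel_measurable (lebesgue_on \<Omega>)" and F: "borel_rep \<Omega> f F"
    and \<phi>: "\<phi> \<in> borel_measurable borel"
  shows "(\<integral>x. f x * \<phi> x \<partial>lebesgue_on \<Omega>) = (\<integral>x. F x * \<phi> x \<partial>lborel)"
proof -
  note [measurable] = borel_rep_measurable[OF F] \<phi>
  have m: "\<Omega> \<inter> space lebesgue \<in> sets lebesgue" using \<Omega> by (simp add: sets_completionI_sets)
  have [measurable]: "\<phi> \<in> borel_measurable lebesgue" using measurable_completion[of \<phi> lborel borel] \<phi> by simp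
  note [measurable] = f[unfolded lebesgue_on_measurable_iff[OF \<Omega>]]
  have mF: "(\<lambda>x. F x * \<phi> x) \<in> borel_measurable lborel" by measurable
  have "(\<integral>x. f x * \<phi> x \<partial>lebesgue_on \<Omega>) = (\<integral>x. (indicator \<Omega> x * f x) * \<phi> x \<partial>lebesgue)"
    by (subst integral_restrict_space[OF m]) (simp add: mult.assoc)
  also have "\<dots> = (\<integral>x. F x * \<phi> x \<partial>lebesgue)"
  proof (rule integral_cong_AE)
    show "AE x in lebesgue. (indicator \<Omega> x * f x) * \<phi> x = F x * \<phi> x"
      using AE_completion[OF borel_rep_AE[OF F]] by eventually_elim simp
    show "(\<lambda>x. F x * \<phi> x) \<in> borel_measurable lebesgue" using measurable_completion[OF mF] .
  qed measurable
  also have "\<dots> = (\<integral>x. F x * \<phi> x \<partial>lborel)" by (rule integral_completion[OF mF])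
  finally show ?thesis .
qed

lemma borel_rep_integrable:
  fixes f :: "real ^ 'd::finite \<Rightarrow> real"
  assumes \<Omega>: "\<Omega> \<in> sets borel" and F: "borel_rep \<Omega> f F" and K: "K \<in> sets borel" "K \<subseteq> \<Omega>"
    and f: "integrable (lebesgue_on K) f"
  shows "integrable lborel (\<lambda>x. indicator K x * F x)"
proof -
  note [measurable] = borel_rep_measurable[OF F] K(1)
  have m: "K \<inter> space lebesgue \<in> sets lebesgue" using K by (simp add: sets_completionI_sets)
  have mF: "(\<lambda>x. indicator K x * F x) \<in> borel_measurable lborel" by measurable
  have "integrable lebesgue (\<lambda>x. indicator K x * f x)" using f by (subst (asm) integrable_restrict_space[OF m]) simp
  then have "integrable lebesgue (\<lambda>x. indicator K x * F x)"
  proof (rule integrable_cong_AE_imp)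
    show "AE x in lebesgue. indicator K x * f x = indicator K x * F x"
      using AE_completion[OF borel_rep_AE[OF F]] by eventually_elim (use K(2) in \<open>auto simp: indicator_def\<close>)
    show "(\<lambda>x. indicator K x * F x) \<in> borel_measurable lebesgue" using measurable_completion[OF mF] .
  qed
  then show ?thesis using integrable_completion[OF mF] by simp
qed

text \<open>Local integrability speaks about compact subsets only; measurability on
  \<open>\<Omega>\<close> follows as a pointwise limit along a compact exhaustion.\<close>

lemma locally_integrable_measurable:
  fixes f :: "real ^ 'd::finite \<Rightarrow> real"
  assumes "open \<Omega>" "locally_integrable \<Omega> f"
  shows "f \<in> borel_measurable (lebesgue_on \<Omega>)"
proof -
  obtain C where C: "\<And>n. compact (C n)" "\<And>n. C n \<subseteq> \<Omega>" "\<And>n. C n \<subseteq> interior (C (Suc n))"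
    "\<Union>(range C) = \<Omega>"
    using open_Union_compact_subsets[OF assms(1)] by metis
  have "f \<in> borel_measurable (lebesgue_on (C n))" for n
    using assms(2) C(1,2) unfolding locally_integrable_def by blast
  then have m: "(\<lambda>x. indicator (C n) x * f x) \<in> borel_measurable lebesgue" for n
    using lebesgue_on_measurable_iff[of "C n" f] borel_compact[OF C(1)] by blast
  have "(\<lambda>x. indicator \<Omega> x * f x) \<in> borel_measurable lebesgue"
  proof (rule borel_measurable_LIMSEQ_real[OF _ m])
    fix x
    show "(\<lambda>n. indicator (C n) x * f x) \<longlonglongrightarrow> indicator \<Omega> x * f x"
    proof (cases "x \<in> \<Omega>")
      case True
      then obtain N where N: "x \<in> C N" using C(4) by blast
      have "C n \<subseteq> C (Suc n)" for n using C(3) interior_subset by blast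
      then have "x \<in> C n" if "N \<le> n" for n using lift_Suc_mono_le[of C N n] N that by blast
      then have "\<forall>\<^sub>F n in sequentially. indicator (C n) x * f x = indicator \<Omega> x * f x"
        using True by (intro eventually_sequentiallyI[of N]) auto
      then show ?thesis by (rule tendsto_eventually)
    next
      case False
      then have "indicator (C n) x = (0::real)" for n using C(2) by (auto simp: indicator_def)
      then show ?thesis using False by simp
    qed
  qed
  then show ?thesis using lebesgue_on_measurable_iff[of \<Omega> f] assms(1) by simp
qed

lemma test_function_mollifier:
  fixes x :: "real ^ 'd::finite"
  assumes "0 < e" "cball x e \<subseteq> \<Omega>"
  shows "test_function \<Omega> (\<lambda>y. mollifier e (x - y))"
proof -
  let ?S = "closure {y. mollifier e (x - y) \<noteq> 0}"
  have "{y. mollifier e (x - y) \<noteq> 0} \<subseteq> cball x e"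
    using mollifier_eq_0[OF assms(1)] by (force simp: dist_norm)
  then have S: "?S \<subseteq> cball x e" by (rule closure_minimal) simp
  moreover have "compact ?S"
    using bounded_subset[OF bounded_cball S] compact_eq_bounded_closed by blast
  ultimately show ?thesis
    using derivs_reflect(1)[OF smooth_on_mollifier] assms(2) by (auto simp: test_function_def)
qed

lemma weak_deriv_locally_integrable:
  "is_weak_deriv \<Omega> \<alpha> f g \<Longrightarrow> locally_integrable \<Omega> f" "is_weak_deriv \<Omega> \<alpha> f g \<Longrightarrow> locally_integrable \<Omega> g"
  by (auto simp: is_weak_deriv_def)

text \<open>Order 0 enters the Sobolev norms through \<open>weak_deriv\<close>, so bounds on it must
  be transferred to the function itself. The zero multi-index is enumerated by the empty list
  only.\<close>

lemma is_weak_deriv_0: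
  assumes "locally_integrable \<Omega> f"
  shows "is_weak_deriv \<Omega> (\<lambda>_. 0) f f"
proof -
  have "multi_deriv (\<lambda>_. 0) \<phi> = \<phi>" for \<phi> :: "real ^ 'a \<Rightarrow> real"
  proof -
    obtain ys where ys: "multi_deriv (\<lambda>_. 0) \<phi> = derivs ys \<phi>" "count_list ys = (\<lambda>_. 0)"
      using multi_deriv_eq_derivs by blast
    have "ys = []"
    proof (cases ys)
      case (Cons a zs)
      then have "count_list ys a \<noteq> 0" by simp
      then show ?thesis using ys(2) by simp
    qed
    then show ?thesis using ys by simp
  qed
  moreover have "mi_order (\<lambda>_::'a. 0) = 0" by (simp add: mi_order_def)
  ultimately show ?thesis using assms by (simp add: is_weak_deriv_def)
qed

text \<open>The right-hand side does not mention \<open>g\<close>, which gives uniqueness of weak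
  derivatives; rewritten with derivatives of the kernel, it is also the derivative of the mollified
  \<open>f\<close>.\<close>

lemma integral_mollifier_weak_deriv:
  fixes f g :: "real ^ 'd::finite \<Rightarrow> real"
  assumes \<Omega>: "open \<Omega>" and w: "is_weak_deriv \<Omega> \<alpha> f g" and G: "borel_rep \<Omega> g G"
    and e: "0 < e" "cball x e \<subseteq> \<Omega>"
  shows "conv (mollifier e) G x =
    (-1) ^ mi_order \<alpha> * (\<integral>y. f y * multi_deriv \<alpha> (\<lambda>y. mollifier e (x - y)) y \<partial>lebesgue_on \<Omega>)"
proof -
  let ?\<phi> = "\<lambda>y. mollifier e (x - y)"
  have "(\<integral>y. f y * multi_deriv \<alpha> ?\<phi> y \<partial>lebesgue_on \<Omega>) = (-1) ^ mi_order \<alpha> * (\<integral>y. g y * ?\<phi> y \<partial>lebesgue_on \<Omega>)"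
    using w test_function_mollifier[OF e] by (simp add: is_weak_deriv_def)
  also have "(\<integral>y. g y * ?\<phi> y \<partial>lebesgue_on \<Omega>) = (\<integral>y. G y * ?\<phi> y \<partial>lborel)"
    using \<Omega> locally_integrable_measurable[OF \<Omega> weak_deriv_locally_integrable(2)[OF w]]
    by (intro borel_rep_integral[OF _ _ G]) auto
  also have "\<dots> = conv (mollifier e) G x" by (simp add: conv_def mult.commute)
  finally show ?thesis by (simp add: power_mult_distrib[symmetric] mult.assoc[symmetric])
qed

text \<open>The fundamental lemma of the calculus of variations in L1 form: \<open>u\<close> is the
  L1 limit of its mollifications, and for small radii these vanish on \<open>K\<close>.\<close>

lemma AE_zero_if_local_mollifications_zero:
  fixes u :: "real ^ 'd::finite \<Rightarrow> real"
  assumes u: "integrable lborel u" and K: "K \<in> sets borel" and r: "0 < r"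
    and z: "\<And>x e. x \<in> K \<Longrightarrow> 0 < e \<Longrightarrow> e < r \<Longrightarrow> conv (mollifier e) u x = 0"
  shows "AE x in lborel. x \<in> K \<longrightarrow> u x = 0"
proof -
  note [measurable] = K
  have [measurable]: "u \<in> borel_measurable borel" using u by auto
  have small: "(\<integral>\<^sup>+x. ennreal \<bar>u x\<bar> * indicator K x \<partial>lborel) \<le> 0 + ennreal \<eta>" if "0 < \<eta>" for \<eta>
  proof -
    obtain \<delta> where \<delta>: "0 < \<delta>" "\<And>e. 0 < e \<Longrightarrow> e \<le> \<delta> \<Longrightarrow>
      (\<integral>\<^sup>+x. ennreal \<bar>conv (mollifier e) u x - u x\<bar> \<partial>lborel) \<le> ennreal \<eta>"
      using mollify_L1_small[OF u \<open>0 < \<eta>\<close>] by blast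
    define e where "e = min \<delta> (r / 2)"
    have e: "0 < e" "e \<le> \<delta>" "e < r" using \<delta> r by (auto simp: e_def)
    have "(\<integral>\<^sup>+x. ennreal \<bar>u x\<bar> * indicator K x \<partial>lborel)
      \<le> (\<integral>\<^sup>+x. ennreal \<bar>conv (mollifier e) u x - u x\<bar> \<partial>lborel)"
      by (intro nn_integral_mono) (auto simp: indicator_def z e)
    then show ?thesis using \<delta>(2)[OF e(1,2)] by simp
  qed
  have "(\<integral>\<^sup>+x. ennreal \<bar>u x\<bar> * indicator K x \<partial>lborel) \<le> 0"
    by (rule ennreal_le_epsilon) (rule small)
  then have "AE x in lborel. ennreal \<bar>u x\<bar> * indicator K x = 0"
    by (subst (asm) le_zero_eq, subst (asm) nn_integral_0_iff_AE) auto
  then show ?thesis by eventually_elim (auto simp: indicator_def)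
qed

lemma weak_deriv_unique:
  fixes f g1 g2 :: "real ^ 'd::finite \<Rightarrow> real"
  assumes \<Omega>: "open \<Omega>" and w: "is_weak_deriv \<Omega> \<alpha> f g1" "is_weak_deriv \<Omega> \<alpha> f g2"
  shows "AE x in lborel. x \<in> \<Omega> \<longrightarrow> g1 x = g2 x"
proof -
  have \<Omega>b: "\<Omega> \<in> sets borel" using \<Omega> by simp
  note li = weak_deriv_locally_integrable(2)[OF w(1)] weak_deriv_locally_integrable(2)[OF w(2)]
  obtain G1 where G1: "borel_rep \<Omega> g1 G1"
    using borel_rep_exists[OF \<Omega>b locally_integrable_measurable[OF \<Omega> li(1)]] by blast
  obtain G2 where G2: "borel_rep \<Omega> g2 G2"
    using borel_rep_exists[OF \<Omega>b locally_integrable_measurable[OF \<Omega> li(2)]] by blast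
  obtain C where C: "\<And>n. compact (C n)" "\<And>n. C n \<subseteq> \<Omega>" "\<And>n. C n \<subseteq> interior (C (Suc n))"
    "\<Union>(range C) = \<Omega>"
    using open_Union_compact_subsets[OF \<Omega>] by metis
  have "AE x in lborel. x \<in> C n \<longrightarrow> G1 x = G2 x" for n
  proof -
    \<comment> \<open>The next set of the exhaustion: cutting off there makes the representatives
      integrable, while mollifications of small radius at points of \<open>C n\<close> do not notice
      the cut.\<close>
    let ?K = "C (Suc n)"
    have lK: "integrable (lebesgue_on ?K) g1" "integrable (lebesgue_on ?K) g2"
      using li C(1,2) unfolding locally_integrable_def by auto
    note i = borel_rep_integrable[OF \<Omega>b G1 borel_compact[OF C(1)] C(2) lK(1)]
      borel_rep_integrable[OF \<Omega>b G2 borel_compact[OF C(1)] C(2) lK(2)]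
    obtain r where r: "0 < r" "(\<Union>x\<in>C n. ball x r) \<subseteq> interior ?K"
      using compact_subset_open_imp_ball_epsilon_subset[OF C(1) open_interior C(3)] by blast
    let ?u = "\<lambda>x. indicator ?K x * G1 x - indicator ?K x * G2 x"
    have "AE x in lborel. x \<in> C n \<longrightarrow> ?u x = 0"
    proof (rule AE_zero_if_local_mollifications_zero[OF _ borel_compact[OF C(1)] r(1)])
      show "integrable lborel ?u" using i by simp
      fix x e assume x: "x \<in> C n" and e: "0 < e" "e < r"
      have "cball x e \<subseteq> ball x r" using e by auto
      then have sub: "cball x e \<subseteq> ?K" using r(2) x interior_subset by fastforce
      have cut: "conv (mollifier e) (\<lambda>x. indicator ?K x * G x) x = conv (mollifier e) G x" for G
        unfolding conv_def
      proof (rule Bochner_Integration.integral_cong[OF refl])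
        fix y
        show "mollifier e (x - y) * (indicator ?K y * G y) = mollifier e (x - y) * G y"
        proof (cases "norm (x - y) < e")
          case True
          then have "y \<in> ?K" using sub by (auto simp: dist_norm)
          then show ?thesis by simp
        qed (simp add: mollifier_eq_0[OF e(1)])
      qed
      have "conv (mollifier e) G1 x = conv (mollifier e) G2 x"
        using integral_mollifier_weak_deriv[OF \<Omega> w(1) G1 e(1)] integral_mollifier_weak_deriv[OF \<Omega> w(2) G2 e(1)]
          sub C(2)[of "Suc n"] by (metis subset_trans)
      then show "conv (mollifier e) ?u x = 0" using conv_diff[OF e(1) i] cut by simp
    qed
    moreover have sub: "C n \<subseteq> ?K" using C(3) interior_subset by blast
    ultimately show ?thesis by (elim eventually_mono) (use sub in \<open>auto simp: indicator_def split: if_splits\<close>)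
  qed
  then have "AE x in lborel. \<forall>n. x \<in> C n \<longrightarrow> G1 x = G2 x"
    by (simp only: AE_all_countable simp_thms)
  moreover have "AE x in lborel. x \<in> \<Omega> \<longrightarrow> G1 x = g1 x" "AE x in lborel. x \<in> \<Omega> \<longrightarrow> G2 x = g2 x"
    using G1 G2 by (auto simp: borel_rep_def)
  ultimately show ?thesis
  proof eventually_elim
    case (elim x)
    show ?case
    proof
      assume "x \<in> \<Omega>"
      then obtain n where "x \<in> C n" using C(4) by blast
      then show "g1 x = g2 x" using elim \<open>x \<in> \<Omega>\<close> by metis
    qed
  qed
qed

lemma weak_deriv_AE_eq:
  assumes "open \<Omega>" "is_weak_deriv \<Omega> \<alpha> f g"
  shows "is_weak_deriv \<Omega> \<alpha> f (weak_deriv \<Omega> \<alpha> f)" "AE x in lborel. x \<in> \<Omega> \<longrightarrow> weak_deriv \<Omega> \<alpha> f x = g x"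
proof -
  show "is_weak_deriv \<Omega> \<alpha> f (weak_deriv \<Omega> \<alpha> f)" unfolding weak_deriv_def by (rule someI[where P = "is_weak_deriv \<Omega> \<alpha> f", OF assms(2)])
  then show "AE x in lborel. x \<in> \<Omega> \<longrightarrow> weak_deriv \<Omega> \<alpha> f x = g x"
    using weak_deriv_unique[OF assms(1)] assms(2) by blast
qed

text \<open>Where the \<open>e\<close>-ball stays in \<open>\<Omega>\<close>, the shifted kernel is
  a test function, and the sign of the integration by parts cancels that of the reflection.\<close>

lemma derivs_mollify:
  fixes f g :: "real ^ 'd::finite \<Rightarrow> real"
  assumes \<Omega>: "open \<Omega>" and w: "is_weak_deriv \<Omega> (count_list xs) f g"
    and F: "borel_rep \<Omega> f F" "integrable lborel F" and G: "borel_rep \<Omega> g G"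
    and e: "0 < e" "cball x e \<subseteq> \<Omega>"
  shows "derivs xs (conv (mollifier e) F) x = conv (mollifier e) G x"
proof -
  let ?\<phi> = "\<lambda>y. mollifier e (x - y)"
  have \<phi>: "multi_deriv (count_list xs) ?\<phi> y = (-1) ^ length xs * derivs xs (mollifier e) (x - y)" for y
    by (subst multi_deriv_count_list[OF open_UNIV derivs_reflect(1)[OF smooth_on_mollifier]])
      (simp_all add: derivs_reflect(2)[OF smooth_on_mollifier])
  have m: "(\<lambda>y. (-1) ^ length xs * derivs xs (mollifier e) (x - y)) \<in> borel_measurable borel"
    using smooth_UNIV_borel_measurable[OF smooth_on_derivs[OF smooth_on_mollifier], of xs e] by measurable
  have "conv (mollifier e) G x = (-1) ^ length xs *
    (\<integral>y. f y * ((-1) ^ length xs * derivs xs (mollifier e) (x - y)) \<partial>lebesgue_on \<Omega>)"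
    using integral_mollifier_weak_deriv[OF \<Omega> w G e] by (simp add: \<phi>)
  also have "\<dots> = (-1) ^ length xs * (\<integral>y. F y * ((-1) ^ length xs * derivs xs (mollifier e) (x - y)) \<partial>lborel)"
    using \<Omega> locally_integrable_measurable[OF \<Omega> weak_deriv_locally_integrable(1)[OF w]]
    by (subst borel_rep_integral[OF _ _ F(1) m]) auto
  also have "(\<integral>y. F y * ((-1) ^ length xs * derivs xs (mollifier e) (x - y)) \<partial>lborel)
      = (-1) ^ length xs * conv (derivs xs (mollifier e)) F x"
    unfolding conv_def by (subst integral_mult_right_zero[symmetric]) (simp add: mult_ac)
  also have "conv (derivs xs (mollifier e)) F = derivs xs (conv (mollifier e) F)"
    by (rule derivs_conv[OF smooth_on_mollifier _ F(2), of e, symmetric]) (use e in \<open>auto intro: mollifier_eq_0\<close>)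
  finally show ?thesis by (simp add: power_mult_distrib[symmetric] mult.assoc[symmetric])
qed

section \<open>Change of variables for an arbitrary finite index type\<close>

text \<open>The change of variables theorem of the library requires the coordinates to be well-ordered;
  it is transported along a well-ordered copy of the index type.\<close>

typedef 'a wo_copy = "UNIV :: 'a set" morphisms of_wo to_wo ..

lemma of_wo_to_wo [simp]: "of_wo (to_wo x) = x" "to_wo (of_wo y) = y"
  by (simp_all add: to_wo_inverse of_wo_inverse)

lemma bij_of_wo: "bij of_wo" and bij_to_wo: "bij to_wo"
  by (rule o_bij[of to_wo] o_bij[of of_wo]; simp add: fun_eq_iff)+

instance wo_copy :: (finite) finite
proof
  have "(UNIV :: 'a wo_copy set) = range to_wo" by (rule bij_is_surj[OF bij_to_wo, symmetric])
  then show "finite (UNIV :: 'a wo_copy set)" by (metis finite finite_imageI)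
qed

instantiation wo_copy :: (finite) wellorder
begin

definition wo_rank :: "'a wo_copy \<Rightarrow> nat" where "wo_rank = (SOME f. inj f)"

definition less_eq_wo_copy :: "'a wo_copy \<Rightarrow> 'a wo_copy \<Rightarrow> bool" where
  "less_eq_wo_copy x y \<longleftrightarrow> wo_rank x \<le> wo_rank y"

definition less_wo_copy :: "'a wo_copy \<Rightarrow> 'a wo_copy \<Rightarrow> bool" where
  "less_wo_copy x y \<longleftrightarrow> wo_rank x < wo_rank y"

instance
proof
  have "\<exists>f :: 'a wo_copy \<Rightarrow> nat. inj f"
    using finite_imp_inj_to_nat_seg[of "UNIV :: 'a wo_copy set"] by auto
  then have inj: "inj (wo_rank :: 'a wo_copy \<Rightarrow> nat)" unfolding wo_rank_def by (rule someI_ex)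
  fix x y z :: "'a wo_copy" and P :: "'a wo_copy \<Rightarrow> bool"
  show "x \<le> y \<Longrightarrow> y \<le> x \<Longrightarrow> x = y"
    using inj by (auto simp: less_eq_wo_copy_def dest: injD)
  assume *: "\<And>x. (\<And>y. y < x \<Longrightarrow> P y) \<Longrightarrow> P x"
  show "P z"
  proof (induction "wo_rank z" arbitrary: z rule: less_induct)
    case less
    show ?case by (rule *) (rule less, simp add: less_wo_copy_def)
  qed
qed (auto simp: less_eq_wo_copy_def less_wo_copy_def)

end

section \<open>Relabelling of coordinates: invariance of measure, integrals and determinants\<close>

definition vec_wo :: "real ^ 'd::finite \<Rightarrow> real ^ 'd wo_copy" where
  "vec_wo x = (\<chi> k. x $ of_wo k)"

definition vec_unwo :: "real ^ 'd wo_copy \<Rightarrow> real ^ 'd::finite" where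
  "vec_unwo y = (\<chi> i. y $ to_wo i)"

lemma vec_wo_unwo [simp]: "vec_unwo (vec_wo x) = x" "vec_wo (vec_unwo y) = y"
  by (simp_all add: vec_wo_def vec_unwo_def vec_eq_iff)

lemma bounded_linear_vec_wo: "bounded_linear vec_wo" and bounded_linear_vec_unwo: "bounded_linear vec_unwo"
  by (rule linear_conv_bounded_linear[THEN iffD1], rule linearI, simp_all add: vec_wo_def vec_unwo_def vec_eq_iff)+

lemma vec_wo_measurable [measurable]: "vec_wo \<in> borel_measurable borel"
  and vec_unwo_measurable [measurable]: "vec_unwo \<in> borel_measurable borel"
  by (simp_all add: borel_measurable_continuous_onI bounded_linear_vec_wo bounded_linear_vec_unwo linear_continuous_on)

lemma prod_Basis_cart:
  "(\<Prod>b\<in>(Basis :: (real ^ 'n::finite) set). g b) = (\<Prod>i\<in>UNIV. g (axis i 1))"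
proof -
  have B: "(Basis :: (real ^ 'n) set) = range (\<lambda>i. axis i 1)" by (auto simp: Basis_vec_def)
  have inj: "inj (\<lambda>i :: 'n. axis i (1::real))" by (auto simp: inj_def axis_eq_axis)
  show ?thesis unfolding B prod.reindex[OF inj] by simp
qed

lemma lborel_vec_wo: "distr lborel borel (vec_wo :: real ^ 'd::finite \<Rightarrow> _) = lborel"
proof (rule sym, rule lborel_eqI)
  fix l u :: "real ^ 'd wo_copy"
  assume le: "\<And>b. b \<in> Basis \<Longrightarrow> l \<bullet> b \<le> u \<bullet> b"
  have lu: "l $ k \<le> u $ k" for k
  proof -
    have "axis k (1::real) \<in> Basis" by (auto simp: Basis_vec_def)
    from le[OF this] show ?thesis by (simp add: inner_axis)
  qed
  have "vec_wo -` box l u = box (vec_unwo l) (vec_unwo u :: real ^ 'd)"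
    by (auto simp: mem_box_cart vec_wo_def vec_unwo_def) (metis of_wo_to_wo)+
  then have "emeasure (distr lborel borel vec_wo) (box l u) = emeasure lborel (box (vec_unwo l) (vec_unwo u :: real ^ 'd))"
    by (subst emeasure_distr) auto
  also have "\<dots> = ennreal (\<Prod>b\<in>Basis. (vec_unwo u - vec_unwo l :: real ^ 'd) \<bullet> b)"
    using lu by (intro emeasure_lborel_box) (auto simp: Basis_vec_def inner_axis vec_unwo_def)
  also have "(\<Prod>b\<in>Basis. (vec_unwo u - vec_unwo l :: real ^ 'd) \<bullet> b) = (\<Prod>i\<in>UNIV. u $ to_wo i - l $ to_wo i)"
    by (simp add: prod_Basis_cart inner_axis vec_unwo_def)
  also have "\<dots> = (\<Prod>k\<in>UNIV. u $ k - l $ k)"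
    by (rule prod.reindex_bij_betw[OF bij_to_wo])
  also have "\<dots> = (\<Prod>b\<in>Basis. (u - l) \<bullet> b)"
    by (simp add: prod_Basis_cart inner_axis)
  finally show "emeasure (distr lborel borel vec_wo) (box l u) = (\<Prod>b\<in>Basis. (u - l) \<bullet> b)" .
qed simp

lemma lebesgue_vec_wo:
  "(vec_wo :: real ^ 'd::finite \<Rightarrow> _) \<in> lebesgue \<rightarrow>\<^sub>M lebesgue"
  "distr lebesgue lebesgue (vec_wo :: real ^ 'd \<Rightarrow> _) = lebesgue"
proof -
  let ?T = "vec_wo :: real ^ 'd \<Rightarrow> _"
  have eq: "distr lebesgue lborel ?T = lborel"
    using lborel_vec_wo[where 'd = 'd] by (simp add: distr_completion cong: distr_cong)
  show "?T \<in> lebesgue \<rightarrow>\<^sub>M lebesgue"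
    by (simp add: completion.measurable_completion2 eq measurable_completion)
  have "lebesgue = completion (distr lebesgue lborel ?T)" by (simp add: eq)
  also have "\<dots> = distr lebesgue lebesgue ?T"
    by (subst completion.completion_distr_eq) (auto simp: eq measurable_completion)
  finally show "distr lebesgue lebesgue ?T = lebesgue" by simp
qed

text \<open>Measurability of \<open>h\<close> passes through the relabelling in both directions, so
  the equivalence holds for arbitrary \<open>h\<close>; without integrability both integrals are 0
  by convention.\<close>

lemma vec_wo_integral:
  fixes h :: "real ^ 'd::finite \<Rightarrow> real"
  shows "integrable lebesgue (\<lambda>y. h (vec_unwo y)) \<longleftrightarrow> integrable lebesgue h"
    and "integral\<^sup>L lebesgue (\<lambda>y. h (vec_unwo y)) = integral\<^sup>L lebesgue h"
proof -
  let ?T = "vec_wo :: real ^ 'd \<Rightarrow> _" and ?T' = "vec_unwo :: _ \<Rightarrow> real ^ 'd"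
  have mT': "?T' \<in> lebesgue \<rightarrow>\<^sub>M lebesgue"
  proof -
    have "distr lborel borel ?T' = distr (distr lborel borel ?T) borel ?T'" by (simp add: lborel_vec_wo)
    also have "\<dots> = distr lborel borel (\<lambda>x. x)"
      by (subst distr_distr) (auto simp: o_def)
    also have "\<dots> = lborel" using distr_id2[of borel lborel] by simp
    finally have "distr lebesgue lborel ?T' = lborel" by (simp add: distr_completion cong: distr_cong)
    then show ?thesis by (simp add: completion.measurable_completion2 measurable_completion)
  qed
  have m: "(\<lambda>y. h (?T' y)) \<in> borel_measurable lebesgue" if "h \<in> borel_measurable lebesgue"
    using measurable_compose[OF mT' that] .
  have m': "h \<in> borel_measurable lebesgue" if "(\<lambda>y. h (?T' y)) \<in> borel_measurable lebesgue"
    using measurable_compose[OF lebesgue_vec_wo(1) that] by simp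
  have "integrable lebesgue (\<lambda>y. h (?T' y)) \<longleftrightarrow> integrable (distr lebesgue lebesgue ?T) (\<lambda>y. h (?T' y))"
    by (simp add: lebesgue_vec_wo)
  also have "\<dots> \<longleftrightarrow> integrable lebesgue h"
  proof (cases "h \<in> borel_measurable lebesgue")
    case True
    then show ?thesis by (subst integrable_distr_eq[OF lebesgue_vec_wo(1) m]) auto
  next
    case False
    then have "(\<lambda>y. h (?T' y)) \<notin> borel_measurable lebesgue" using m' by blast
    then show ?thesis
      using False by (metis borel_measurable_integrable lebesgue_vec_wo(2))
  qed
  finally show "integrable lebesgue (\<lambda>y. h (?T' y)) \<longleftrightarrow> integrable lebesgue h" .
  then show "integral\<^sup>L lebesgue (\<lambda>y. h (?T' y)) = integral\<^sup>L lebesgue h"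
  proof (cases "integrable lebesgue h")
    case True
    then have "(\<lambda>y. h (?T' y)) \<in> borel_measurable lebesgue" using m by auto
    from integral_distr[OF lebesgue_vec_wo(1) this] show ?thesis by (simp add: lebesgue_vec_wo)
  qed (simp add: not_integrable_integral_eq)
qed

text \<open>Conjugation with the relabelling is a sign-preserving bijection of permutations, so the
  two Leibniz sums agree term by term.\<close>

lemma det_vec_wo:
  fixes A :: "real ^ 'd::finite ^ 'd"
  shows "det (\<chi> k l. A $ of_wo k $ of_wo l) = det A"
proof -
  let ?c = "\<lambda>p i. of_wo (p (to_wo i))" and ?c' = "\<lambda>q k. to_wo (q (of_wo k))"
  have perm: "?c p permutes UNIV" "sign (?c p) = sign p" if "p permutes UNIV" for p :: "'d wo_copy \<Rightarrow> _"
  proof -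
    have inv: "inv of_wo = to_wo" by (rule inv_equality) auto
    have "range (of_wo :: 'd wo_copy \<Rightarrow> 'd) = UNIV" by (rule bij_is_surj[OF bij_of_wo])
    then have e: "map_permutation UNIV of_wo p = ?c p"
      by (simp add: map_permutation_def restrict_id_def inv fun_eq_iff)
    show "?c p permutes UNIV" using map_permutation_permutes[OF bij_of_wo that] e by simp
    show "sign (?c p) = sign p"
      using sign_map_permutation[of of_wo UNIV p] bij_is_inj[OF bij_of_wo] that e by simp
  qed
  have perm': "?c' q permutes UNIV" if "q permutes UNIV" for q :: "'d \<Rightarrow> _"
  proof (rule bij_imp_permutes)
    show "bij_betw (?c' q) UNIV UNIV"
      using bij_comp[OF bij_comp[OF bij_of_wo permutes_bij[OF that]] bij_to_wo] by (simp add: o_def)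
  qed simp
  have "det (\<chi> k l. A $ of_wo k $ of_wo l) = (\<Sum>p | p permutes UNIV. of_int (sign p) * (\<Prod>k\<in>UNIV. A $ of_wo k $ of_wo (p k)))"
    by (simp add: det_def)
  also have "\<dots> = (\<Sum>q | q permutes UNIV. of_int (sign q) * (\<Prod>i\<in>UNIV. A $ i $ q i))"
  proof (rule sum.reindex_bij_witness[of _ ?c' ?c])
    fix p :: "'d wo_copy \<Rightarrow> 'd wo_copy" assume p: "p \<in> {p. p permutes UNIV}"
    show "?c p \<in> {q. q permutes UNIV}" using perm(1) p by blast
    have "(\<Prod>k\<in>UNIV. A $ of_wo k $ of_wo (p k)) = (\<Prod>k\<in>UNIV. (\<lambda>i. A $ i $ ?c p i) (of_wo k))" by simp
    also have "\<dots> = (\<Prod>i\<in>UNIV. A $ i $ ?c p i)" by (rule prod.reindex_bij_betw[OF bij_of_wo])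
    finally show "of_int (sign (?c p)) * (\<Prod>i\<in>UNIV. A $ i $ ?c p i) = of_int (sign p) * (\<Prod>k\<in>UNIV. A $ of_wo k $ of_wo (p k))"
      using perm(2) p by simp
  qed (use perm' in auto)
  finally show ?thesis by (simp add: det_def)
qed

lemma change_of_variables_cart:
  fixes f :: "real ^ 'd::finite \<Rightarrow> real" and \<Phi> :: "real ^ 'd \<Rightarrow> real ^ 'd"
  assumes S: "S \<in> sets lebesgue"
    and d: "\<And>x. x \<in> S \<Longrightarrow> (\<Phi> has_derivative \<Phi>' x) (at x within S)"
    and inj: "inj_on \<Phi> S"
  shows "integrable lebesgue (\<lambda>x. indicator (\<Phi> ` S) x * f x) \<longleftrightarrow>
      integrable lebesgue (\<lambda>x. indicator S x * (\<bar>det (matrix (\<Phi>' x))\<bar> * f (\<Phi> x)))"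
    and "integral\<^sup>L lebesgue (\<lambda>x. indicator (\<Phi> ` S) x * f x) =
      integral\<^sup>L lebesgue (\<lambda>x. indicator S x * (\<bar>det (matrix (\<Phi>' x))\<bar> * f (\<Phi> x)))"
proof -
  let ?T = "vec_wo :: real ^ 'd \<Rightarrow> _" and ?T' = "vec_unwo :: _ \<Rightarrow> real ^ 'd"
  let ?S = "?T ` S" and ?g = "\<lambda>y. ?T (\<Phi> (?T' y))" and ?g' = "\<lambda>y w. ?T (\<Phi>' (?T' y) (?T' w))"
  \<comment> \<open>The vector-valued theorem is applied with values in \<open>real ^ 1\<close> and
    translated back below.\<close>
  let ?f = "\<lambda>y. vec (f (?T' y)) :: real ^ 1"
  have memT: "y \<in> ?T ` A \<longleftrightarrow> ?T' y \<in> A" for y A by (metis image_eqI image_iff vec_wo_unwo)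
  have gS: "?g ` ?S = ?T ` \<Phi> ` S" by (auto simp: image_image)
  have card: "CARD('d wo_copy) = CARD('d)" by (rule bij_betw_same_card[OF bij_of_wo])
  have S': "?S \<in> sets lebesgue"
    by (rule differentiable_image_in_sets_lebesgue[OF S _ bounded_linear_imp_differentiable_on[OF bounded_linear_vec_wo]])
      (simp add: card)
  have d': "(?g has_derivative ?g' y) (at y within ?S)" if "y \<in> ?S" for y
  proof -
    have "(\<Phi> has_derivative \<Phi>' (?T' y)) (at (?T' y) within ?T' ` ?S)"
      using d[of "?T' y"] that by (auto simp: memT image_image)
    from has_derivative_in_compose[OF bounded_linear_imp_has_derivative[OF bounded_linear_vec_unwo] this]
    have "((\<lambda>y. \<Phi> (?T' y)) has_derivative (\<lambda>w. \<Phi>' (?T' y) (?T' w))) (at y within ?S)" .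
    from bounded_linear.has_derivative[OF bounded_linear_vec_wo this] show ?thesis .
  qed
  have inj': "inj_on ?g ?S"
  proof (rule inj_onI)
    fix y z assume "y \<in> ?S" "z \<in> ?S" "?g y = ?g z"
    then show "y = z" using inj by (metis inj_onD memT vec_wo_unwo)
  qed
  have det: "det (matrix (?g' y)) = det (matrix (\<Phi>' (?T' y)))" for y
  proof -
    have e: "?T' (axis l 1) = axis (of_wo l) 1" for l
      by (auto simp: vec_unwo_def vec_eq_iff axis_def)
    then have "matrix (?g' y) = (\<chi> k l. matrix (\<Phi>' (?T' y)) $ of_wo k $ of_wo l)"
      unfolding matrix_def e by (simp add: vec_eq_iff vec_wo_def)
    then show ?thesis by (simp add: det_vec_wo)
  qed
  have ai: "k absolutely_integrable_on A \<longleftrightarrow> integrable lebesgue (\<lambda>x. indicator A x * k x)" for k :: "'b::euclidean_space \<Rightarrow> real" and A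
    by (simp add: set_integrable_def)
  let ?L = "\<lambda>x. indicator S x * (\<bar>det (matrix (\<Phi>' x))\<bar> * f (\<Phi> x))" and ?R = "\<lambda>x. indicator (\<Phi> ` S) x * f x"
  have L: "(\<lambda>y. indicator ?S y * (\<bar>det (matrix (?g' y))\<bar> * f (?T' (?g y)))) = (\<lambda>y. ?L (?T' y))"
    by (auto simp: fun_eq_iff indicator_def memT det)
  have R: "(\<lambda>y. indicator (?g ` ?S) y * f (?T' y)) = (\<lambda>y. ?R (?T' y))"
    unfolding gS by (auto simp: fun_eq_iff indicator_def memT)
  have main: "(\<lambda>y. \<bar>det (matrix (?g' y))\<bar> *\<^sub>R ?f (?g y)) absolutely_integrable_on ?S \<and>
      integral ?S (\<lambda>y. \<bar>det (matrix (?g' y))\<bar> *\<^sub>R ?f (?g y)) = b \<longleftrightarrow>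
      ?f absolutely_integrable_on (?g ` ?S) \<and> integral (?g ` ?S) ?f = b" for b
    by (rule has_absolute_integral_change_of_variables[OF S' d' inj'])
  have 1: "(\<lambda>y. \<bar>det (matrix (?g' y))\<bar> *\<^sub>R ?f (?g y)) absolutely_integrable_on ?S \<longleftrightarrow> integrable lebesgue ?L"
    by (subst absolutely_integrable_on_1_iff) (simp add: ai L[simplified] vec_wo_integral(1)[of ?L, simplified])
  have 2: "?f absolutely_integrable_on (?g ` ?S) \<longleftrightarrow> integrable lebesgue ?R"
    by (subst absolutely_integrable_on_1_iff) (simp add: ai R vec_wo_integral(1)[of ?R])
  show iff: "integrable lebesgue ?R \<longleftrightarrow> integrable lebesgue ?L"
    using main 1 2 by blast
  show "integral\<^sup>L lebesgue ?R = integral\<^sup>L lebesgue ?L"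
  proof (cases "integrable lebesgue ?R")
    case True
    have il: "integral A k = integral\<^sup>L lebesgue (\<lambda>x. indicator A x * k x)"
      if "integrable lebesgue (\<lambda>x. indicator A x * k x)" for k :: "real ^ 'd wo_copy \<Rightarrow> real" and A
      using set_lebesgue_integral_eq_integral(2)[of A k] that
      by (simp add: set_integrable_def set_lebesgue_integral_def)
    have "integral ?S (\<lambda>y. \<bar>det (matrix (?g' y))\<bar> *\<^sub>R ?f (?g y)) = integral (?g ` ?S) ?f"
      using main True 1 2 iff by blast
    then have "integral ?S (\<lambda>y. \<bar>det (matrix (?g' y))\<bar> * f (?T' (?g y))) = integral (?g ` ?S) (\<lambda>y. f (?T' y))"
      unfolding integral_on_1_eq by (simp add: vec_eq_iff)
    moreover have "integral ?S (\<lambda>y. \<bar>det (matrix (?g' y))\<bar> * f (?T' (?g y))) = integral\<^sup>L lebesgue (\<lambda>y. ?L (?T' y))"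
      using il[of ?S "\<lambda>y. \<bar>det (matrix (?g' y))\<bar> * f (?T' (?g y))", unfolded L] True iff vec_wo_integral(1)[of ?L] by blast
    moreover have "integral (?g ` ?S) (\<lambda>y. f (?T' y)) = integral\<^sup>L lebesgue (\<lambda>y. ?R (?T' y))"
      using il[of "?g ` ?S" "\<lambda>y. f (?T' y)", unfolded R] True vec_wo_integral(1)[of ?R] by blast
    ultimately show ?thesis using vec_wo_integral(2)[of ?L] vec_wo_integral(2)[of ?R] by simp
  next
    case False
    then show ?thesis using iff by (simp add: not_integrable_integral_eq)
  qed
qed

section \<open>The local approximation estimate\<close>

abbreviation lborel_on :: "(real ^ 'd::finite) set \<Rightarrow> (real ^ 'd) measure" where
  "lborel_on S \<equiv> restrict_space lborel S"

lemma nn_integral_lborel_on: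
  "S \<in> sets borel \<Longrightarrow> (\<integral>\<^sup>+x. f x \<partial>lborel_on S) = (\<integral>\<^sup>+x\<in>S. f x \<partial>lborel)"
  by (simp add: nn_integral_restrict_space)

lemma borel_measurable_lborel_on: "f \<in> borel_measurable borel \<Longrightarrow> f \<in> borel_measurable (lborel_on S)"
  by (rule measurable_restrict_space1) simp

lemma continuous_lborel_on:
  fixes f :: "real ^ 'd::finite \<Rightarrow> 'b::topological_space"
  assumes "continuous_on S f"
  shows "f \<in> borel_measurable (lborel_on S)"
proof -
  have "measurable (lborel_on S) borel = measurable (restrict_space borel S) (borel :: 'b measure)"
    by (intro measurable_cong_sets sets_restrict_space_cong) auto
  then show ?thesis using borel_measurable_continuous_on_restrict[OF assms] by simp
qed

lemma AE_lborel_on: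
  "S \<in> sets borel \<Longrightarrow> AE x in lborel. x \<in> S \<longrightarrow> P x \<Longrightarrow> AE x in lborel_on S. P x"
  by (subst AE_restrict_space_iff) auto

lemma nn_integral_lborel_on_mono_set:
  "S \<subseteq> T \<Longrightarrow> S \<in> sets borel \<Longrightarrow> T \<in> sets borel \<Longrightarrow>
    (\<integral>\<^sup>+x. f x \<partial>lborel_on S) \<le> (\<integral>\<^sup>+x. f x \<partial>lborel_on T)"
  by (auto simp: nn_integral_lborel_on indicator_def intro!: nn_integral_mono)

lemma nn_integral_lborel_on_le_UNIV:
  "S \<in> sets borel \<Longrightarrow> (\<integral>\<^sup>+x. f x \<partial>lborel_on S) \<le> (\<integral>\<^sup>+x. f x \<partial>lborel)"
  by (auto simp: nn_integral_lborel_on indicator_def intro!: nn_integral_mono)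

lemma nn_integral_lin2_le:
  assumes "a \<in> borel_measurable M" "b \<in> borel_measurable M"
    and "\<And>x. 0 \<le> a x" "\<And>x. 0 \<le> b x" "0 \<le> c" "0 \<le> d" "0 \<le> A" "0 \<le> B"
    and "(\<integral>\<^sup>+x. ennreal (a x) \<partial>M) \<le> ennreal A" "(\<integral>\<^sup>+x. ennreal (b x) \<partial>M) \<le> ennreal B"
  shows "(\<integral>\<^sup>+x. ennreal (c * a x + d * b x) \<partial>M) \<le> ennreal (c * A + d * B)"
proof -
  have "(\<integral>\<^sup>+x. ennreal (c * a x + d * b x) \<partial>M) = (\<integral>\<^sup>+x. ennreal c * ennreal (a x) + ennreal d * ennreal (b x) \<partial>M)"
    using assms by (simp add: ennreal_mult)
  also have "\<dots> = ennreal c * (\<integral>\<^sup>+x. ennreal (a x) \<partial>M) + ennreal d * (\<integral>\<^sup>+x. ennreal (b x) \<partial>M)"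
    using assms(1,2) by (simp add: nn_integral_add nn_integral_cmult)
  also have "\<dots> \<le> ennreal c * ennreal A + ennreal d * ennreal B"
    using assms by (intro add_mono mult_left_mono) auto
  also have "\<dots> = ennreal (c * A + d * B)" using assms by (simp add: ennreal_mult)
  finally show ?thesis .
qed

lemma sum2_sq_le: "((a::real) + b)\<^sup>2 \<le> 2 * a\<^sup>2 + 2 * b\<^sup>2"
  using zero_le_power2[of "a - b"] by (simp add: power2_eq_square algebra_simps)

lemma nn_integral_sq_diff_le:
  assumes "a \<in> borel_measurable M" "b \<in> borel_measurable M" "c \<in> borel_measurable M" "0 \<le> A" "0 \<le> B"
    and "(\<integral>\<^sup>+x. ennreal ((a x - b x)\<^sup>2) \<partial>M) \<le> ennreal A" "(\<integral>\<^sup>+x. ennreal ((b x - c x)\<^sup>2) \<partial>M) \<le> ennreal B"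
  shows "(\<integral>\<^sup>+x. ennreal ((a x - c x)\<^sup>2) \<partial>M) \<le> ennreal (2 * A + 2 * B)"
proof -
  have "(\<integral>\<^sup>+x. ennreal ((a x - c x)\<^sup>2) \<partial>M) \<le> (\<integral>\<^sup>+x. ennreal (2 * (a x - b x)\<^sup>2 + 2 * (b x - c x)\<^sup>2) \<partial>M)"
    using sum2_sq_le[of "a x - b x" "b x - c x" for x] by (intro nn_integral_mono ennreal_leI) simp
  also have "\<dots> \<le> ennreal (2 * A + 2 * B)"
    using assms by (intro nn_integral_lin2_le) auto
  finally show ?thesis .
qed

text \<open>With \<open>We\<close>, \<open>Ve\<close> for the mollifications, the error is
  \<open>(W - We) V + We (V - Ve)\<close>. In the first term \<open>V\<close> may be unbounded:
  where \<open>\<bar>V\<bar> \<le> M\<close> the L2 smallness of \<open>W - We\<close> suffices, and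
  elsewhere \<open>\<bar>W - We\<bar> \<le> 2 B\<close> meets the small tail \<open>T M\<close> of
  the square of \<open>V\<close>.\<close>

lemma mollify_product_L2_small:
  fixes W V :: "real ^ 'd::finite \<Rightarrow> real"
  assumes W: "integrable lborel W" "(\<integral>\<^sup>+x. ennreal ((W x)\<^sup>2) \<partial>lborel) < \<infinity>" "AE x in lborel. \<bar>W x\<bar> \<le> B"
    and V: "integrable lborel V" "(\<integral>\<^sup>+x. ennreal ((V x)\<^sup>2) \<partial>lborel) < \<infinity>" and \<eta>: "0 < \<eta>"
  obtains \<delta> where "0 < \<delta>" "\<And>e. 0 < e \<Longrightarrow> e \<le> \<delta> \<Longrightarrow>
    (\<integral>\<^sup>+x. ennreal ((W x * V x - conv (mollifier e) W x * conv (mollifier e) V x)\<^sup>2) \<partial>lborel) \<le> ennreal \<eta>"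
proof -
  have [measurable]: "W \<in> borel_measurable borel" "V \<in> borel_measurable borel" using W V by auto
  define T where "T M x = (if \<bar>V x\<bar> \<le> real M then 0 else (V x)\<^sup>2)" for M x
  have [measurable]: "T M \<in> borel_measurable borel" for M unfolding T_def by measurable
  have T0: "0 \<le> T M x" for M x by (simp add: T_def)
  have "(\<lambda>M. \<integral>\<^sup>+x. ennreal (T M x) \<partial>lborel) \<longlonglongrightarrow> (\<integral>\<^sup>+x. 0 \<partial>(lborel :: (real ^ 'd) measure))"
  proof (rule nn_integral_dominated_convergence[where w = "\<lambda>x. ennreal ((V x)\<^sup>2)"])
    show "AE x in lborel. (\<lambda>M. ennreal (T M x)) \<longlonglongrightarrow> 0"
    proof (rule AE_I2)
      fix x
      obtain M0 where "\<bar>V x\<bar> \<le> real M0" using real_arch_simple by blast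
      then have "\<forall>\<^sub>F M in sequentially. ennreal (T M x) = 0"
        by (intro eventually_sequentiallyI[of M0]) (auto simp: T_def)
      then show "(\<lambda>M. ennreal (T M x)) \<longlonglongrightarrow> 0" by (rule tendsto_eventually)
    qed
  qed (use V in \<open>auto simp: T_def intro!: AE_I2 ennreal_leI\<close>)
  then have "\<forall>\<^sub>F M in sequentially. (\<integral>\<^sup>+x. ennreal (T M x) \<partial>lborel) < ennreal (\<eta> / (16 * (B\<^sup>2 + 1)))"
    using order_tendstoD(2)[of _ 0 sequentially "ennreal (\<eta> / (16 * (B\<^sup>2 + 1)))"] \<eta> by (simp add: add_nonneg_pos)
  then obtain M where M: "(\<integral>\<^sup>+x. ennreal (T M x) \<partial>lborel) < ennreal (\<eta> / (16 * (B\<^sup>2 + 1)))"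
    using eventually_happens by fastforce
  let ?M = "(real M)\<^sup>2"
  \<comment> \<open>With these shares the final sum is at most
    \<open>\<eta> / 4 + \<eta> / 2 + \<eta> / 4\<close>, the tail taking the half; the summands 1
    avoid zero denominators.\<close>
  have p: "0 < \<eta> / (8 * (B\<^sup>2 + 1))" "0 < \<eta> / (8 * (?M + 1))" "0 < \<eta> / (16 * (B\<^sup>2 + 1))"
    using \<eta> by (simp_all add: add_nonneg_pos)
  obtain \<delta>1 where \<delta>1: "0 < \<delta>1" "\<And>e. 0 < e \<Longrightarrow> e \<le> \<delta>1 \<Longrightarrow>
    (\<integral>\<^sup>+x. ennreal ((conv (mollifier e) V x - V x)\<^sup>2) \<partial>lborel) \<le> ennreal (\<eta> / (8 * (B\<^sup>2 + 1)))"
    using mollify_L2_small[OF V p(1)] by blast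
  obtain \<delta>2 where \<delta>2: "0 < \<delta>2" "\<And>e. 0 < e \<Longrightarrow> e \<le> \<delta>2 \<Longrightarrow>
    (\<integral>\<^sup>+x. ennreal ((conv (mollifier e) W x - W x)\<^sup>2) \<partial>lborel) \<le> ennreal (\<eta> / (8 * (?M + 1)))"
    using mollify_L2_small[OF W(1,2) p(2)] by blast
  show ?thesis
  proof (rule that[of "min \<delta>1 \<delta>2"])
    show "0 < min \<delta>1 \<delta>2" using \<delta>1 \<delta>2 by simp
    fix e assume e: "0 < e" "e \<le> min \<delta>1 \<delta>2"
    let ?W = "conv (mollifier e) W" and ?V = "conv (mollifier e) V"
    note [measurable] = conv_measurable[OF e(1) W(1)] conv_measurable[OF e(1) V(1)]
    have "(\<integral>\<^sup>+x. ennreal ((W x * V x - ?W x * ?V x)\<^sup>2) \<partial>lborel)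
      \<le> (\<integral>\<^sup>+x. ennreal (1 * (2 * ?M * (?W x - W x)\<^sup>2 + 8 * B\<^sup>2 * T M x) + 2 * B\<^sup>2 * (?V x - V x)\<^sup>2) \<partial>lborel)"
    proof (rule nn_integral_mono_AE, use W(3) in eventually_elim)
      fix x assume WB: "\<bar>W x\<bar> \<le> B"
      have WeB: "\<bar>?W x\<bar> \<le> B" by (rule mollify_bounded[OF e(1) W(1,3)])
      have "(W x * V x - ?W x * ?V x)\<^sup>2 = ((W x - ?W x) * V x + ?W x * (V x - ?V x))\<^sup>2"
        by (simp add: algebra_simps)
      also have "\<dots> \<le> 2 * ((W x - ?W x) * V x)\<^sup>2 + 2 * (?W x * (V x - ?V x))\<^sup>2" by (rule sum2_sq_le)
      also have "(?W x * (V x - ?V x))\<^sup>2 \<le> B\<^sup>2 * (?V x - V x)\<^sup>2"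
        unfolding power_mult_distrib power2_commute[of "V x"]
        using WeB by (intro mult_right_mono) (auto simp: abs_le_square_iff[symmetric])
      also have "((W x - ?W x) * V x)\<^sup>2 \<le> ?M * (?W x - W x)\<^sup>2 + 4 * B\<^sup>2 * T M x"
      proof (cases "\<bar>V x\<bar> \<le> real M")
        case True
        have "(W x - ?W x)\<^sup>2 * (V x)\<^sup>2 \<le> (W x - ?W x)\<^sup>2 * ?M"
          using True by (intro mult_left_mono) (auto simp: abs_le_square_iff[symmetric])
        then show ?thesis using T0[of M x]
          by (simp add: power_mult_distrib power2_commute[of "W x"] mult.commute add_increasing2)
      next
        case False
        have "\<bar>W x - ?W x\<bar> \<le> \<bar>2 * B\<bar>" using WB WeB by linarith
        then have "(W x - ?W x)\<^sup>2 \<le> (2 * B)\<^sup>2" by (simp add: abs_le_square_iff)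
        then have "(W x - ?W x)\<^sup>2 * (V x)\<^sup>2 \<le> (2 * B)\<^sup>2 * (V x)\<^sup>2" by (rule mult_right_mono) simp
        then show ?thesis using False by (simp add: T_def power_mult_distrib add_increasing)
      qed
      finally have "(W x * V x - ?W x * ?V x)\<^sup>2 \<le>
        2 * (?M * (?W x - W x)\<^sup>2 + 4 * B\<^sup>2 * T M x) + 2 * (B\<^sup>2 * (?V x - V x)\<^sup>2)" by simp
      then show "ennreal ((W x * V x - ?W x * ?V x)\<^sup>2)
        \<le> ennreal (1 * (2 * ?M * (?W x - W x)\<^sup>2 + 8 * B\<^sup>2 * T M x) + 2 * B\<^sup>2 * (?V x - V x)\<^sup>2)"
        by (intro ennreal_leI) (simp add: algebra_simps)
    qed
    also have "\<dots> \<le> ennreal (1 * (2 * ?M * (\<eta> / (8 * (?M + 1))) + 8 * B\<^sup>2 * (\<eta> / (16 * (B\<^sup>2 + 1))))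
        + 2 * B\<^sup>2 * (\<eta> / (8 * (B\<^sup>2 + 1))))"
      using \<delta>1(2)[OF e(1)] \<delta>2(2)[OF e(1)] e(2) M p T0 \<eta>
      by (intro nn_integral_lin2_le)
        (auto intro: less_imp_le intro!: add_nonneg_nonneg mult_nonneg_nonneg divide_nonneg_nonneg)
    also have "\<dots> \<le> ennreal \<eta>"
    proof (rule ennreal_leI)
      have a: "c / (c + 1) \<le> 1" if "0 \<le> c" for c :: real using that by (simp add: divide_simps)
      have id: "k * c * (\<eta> / (l * (c + 1))) = k * \<eta> / l * (c / (c + 1))" for k l c :: real by simp
      have "1 * (2 * ?M * (\<eta> / (8 * (?M + 1))) + 8 * B\<^sup>2 * (\<eta> / (16 * (B\<^sup>2 + 1)))) + 2 * B\<^sup>2 * (\<eta> / (8 * (B\<^sup>2 + 1)))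
        = 2 * \<eta> / 8 * (?M / (?M + 1)) + 8 * \<eta> / 16 * (B\<^sup>2 / (B\<^sup>2 + 1)) + 2 * \<eta> / 8 * (B\<^sup>2 / (B\<^sup>2 + 1))"
        unfolding id mult_1 by (rule refl)
      also have "\<dots> \<le> 2 * \<eta> / 8 * 1 + 8 * \<eta> / 16 * 1 + 2 * \<eta> / 8 * 1"
        using \<eta> by (intro add_mono mult_left_mono a) auto
      finally show "1 * (2 * ?M * (\<eta> / (8 * (?M + 1))) + 8 * B\<^sup>2 * (\<eta> / (16 * (B\<^sup>2 + 1)))) + 2 * B\<^sup>2 * (\<eta> / (8 * (B\<^sup>2 + 1))) \<le> \<eta>"
        by simp
    qed
    finally show "(\<integral>\<^sup>+x. ennreal ((W x * V x - ?W x * ?V x)\<^sup>2) \<partial>lborel) \<le> ennreal \<eta>" .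
  qed
qed

text \<open>The simplex is treated as a compact convex body; the interior point \<open>x0\<close> is
  the centre of all dilations, and \<open>U\<close> is a neighbourhood on which
  \<open>\<Phi>\<close> can be differentiated up to the boundary of \<open>Dhat\<close>.\<close>

locale element =
  fixes Dhat U :: "(real ^ 'd::finite) set" and \<Phi> :: "real ^ 'd \<Rightarrow> real ^ 'd" and x0 :: "real ^ 'd"
  assumes compact_Dhat: "compact Dhat" and convex_Dhat: "convex Dhat" and x0: "x0 \<in> interior Dhat"
    and U: "open U" "Dhat \<subseteq> U" "smooth_on U \<Phi>" and inj: "inj_on \<Phi> Dhat"
    and jac_pos: "\<And>x. x \<in> Dhat \<Longrightarrow> 0 < det (matrix (frechet_derivative \<Phi> (at x)))"
begin

definition jac :: "real ^ 'd \<Rightarrow> real" where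
  "jac x = det (matrix (frechet_derivative \<Phi> (at x)))"

abbreviation "D \<equiv> \<Phi> ` Dhat"
abbreviation "J \<equiv> jacobian_det Dhat \<Phi>"

lemma J_image: "x \<in> Dhat \<Longrightarrow> J (\<Phi> x) = jac x"
  by (simp add: jacobian_det_def jac_def inv_into_f_f[OF inj])

lemma continuous_Phi: "S \<subseteq> Dhat \<Longrightarrow> continuous_on S \<Phi>"
  using smooth_on_continuous[OF U(3)] U(2) continuous_on_subset by blast

lemma compact_D: "compact D"
  by (rule compact_continuous_image[OF continuous_Phi compact_Dhat]) simp

lemma D_borel [measurable]: "D \<in> sets borel"
  by (rule borel_compact[OF compact_D])

lemma Dhat_borel [measurable]: "Dhat \<in> sets borel"
  by (rule borel_compact[OF compact_Dhat])

lemma continuous_jac: "continuous_on Dhat jac"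
proof -
  have "jac x = det (\<chi> i j. partial_deriv j \<Phi> x $ i)" for x
    by (simp add: jac_def matrix_def partial_deriv_def)
  moreover have "continuous_on Dhat (\<lambda>x. partial_deriv j \<Phi> x $ i)" for i j
    using smooth_on_continuous[OF smooth_on_partial[OF U(3)]] U(2)
    by (intro continuous_on_component) (auto intro: continuous_on_subset)
  ultimately show ?thesis
    by (auto simp: det_def intro!: continuous_on_sum continuous_on_mult continuous_on_prod continuous_on_const)
qed

lemma continuous_J: "continuous_on D J"
proof -
  have "continuous_on D (inv_into Dhat \<Phi>)"
    by (rule continuous_on_inv[OF continuous_Phi compact_Dhat]) (auto simp: inv_into_f_f[OF inj])
  moreover have "inv_into Dhat \<Phi> ` D \<subseteq> Dhat" by (auto simp: inv_into_f_f[OF inj])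
  ultimately have "continuous_on D (\<lambda>y. jac (inv_into Dhat \<Phi> y))"
    by (rule continuous_on_compose2[OF continuous_jac])
  then show ?thesis by (simp add: jacobian_det_def jac_def)
qed

lemma J_pos: "y \<in> D \<Longrightarrow> 0 < J y"
  using J_image jac_pos by (auto simp: jac_def)

lemma interior_image: "\<Phi> ` interior Dhat \<subseteq> interior D"
proof (rule interior_maximal)
  show "open (\<Phi> ` interior Dhat)"
    using interior_subset[of Dhat] inj_on_subset[OF inj]
    by (intro invariance_of_domain_gen continuous_Phi) auto
qed (use interior_subset in blast)

lemma Phi_derivative: "x \<in> Dhat \<Longrightarrow> (\<Phi> has_derivative frechet_derivative \<Phi> (at x)) (at x within S)"
  using smooth_on_differentiable[OF U(3,1)] U(2) frechet_derivative_works has_derivative_at_withinI by blast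

text \<open>The Sobolev spaces refer to the interior of \<open>D\<close>, the L2 norms and inner
  products to \<open>D\<close> itself. The difference lies in the image of the frontier of a convex
  set under a differentiable map.\<close>

lemma negligible_boundary: "negligible (D - interior D)"
proof -
  have "D - interior D \<subseteq> \<Phi> ` (Dhat \<inter> frontier Dhat)"
  proof
    fix y assume "y \<in> D - interior D"
    then obtain x where "x \<in> Dhat" "y = \<Phi> x" "x \<notin> interior Dhat" using interior_image by blast
    then show "y \<in> \<Phi> ` (Dhat \<inter> frontier Dhat)"
      using closure_subset[of Dhat] by (auto simp: frontier_def)
  qed
  moreover have "negligible (\<Phi> ` (Dhat \<inter> frontier Dhat))"
  proof (rule negligible_differentiable_image_negligible)
    show "negligible (Dhat \<inter> frontier Dhat)"
      by (rule negligible_subset[OF negligible_convex_frontier[OF convex_Dhat]]) simp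
    show "\<Phi> differentiable_on Dhat \<inter> frontier Dhat"
      unfolding differentiable_on_def differentiable_def using Phi_derivative by blast
  qed simp
  ultimately show ?thesis by (rule negligible_subset[rotated])
qed

lemma nn_change_of_variables:
  assumes S: "compact S" "S \<subseteq> Dhat" and G: "G \<in> borel_measurable borel" "\<And>y. 0 \<le> G y"
  shows "(\<integral>\<^sup>+y. ennreal (G y) \<partial>lborel_on (\<Phi> ` S)) = (\<integral>\<^sup>+x. ennreal (jac x * G (\<Phi> x)) \<partial>lborel_on S)"
proof -
  have [measurable]: "S \<in> sets borel" by (rule borel_compact[OF S(1)])
  have "compact (\<Phi> ` S)" by (rule compact_continuous_image[OF continuous_Phi[OF S(2)] S(1)])
  then have [measurable]: "\<Phi> ` S \<in> sets borel" by (rule borel_compact)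
  note [measurable] = G(1)
  let ?L = "\<lambda>x. indicator S x * (\<bar>jac x\<bar> * G (\<Phi> x))" and ?R = "\<lambda>y. indicator (\<Phi> ` S) y * G y"
  have "(\<lambda>x. jac x * G (\<Phi> x)) \<in> borel_measurable (lborel_on S)"
    using continuous_lborel_on[OF continuous_on_subset[OF continuous_jac S(2)]]
      measurable_compose[OF continuous_lborel_on[OF continuous_Phi[OF S(2)]] G(1)] by measurable
  then have "(\<lambda>x. indicator S x * (jac x * G (\<Phi> x))) \<in> borel_measurable borel"
    by (subst (asm) borel_measurable_restrict_space_iff) auto
  moreover have abs_jac: "\<bar>jac x\<bar> = jac x" if "x \<in> S" for x
    using jac_pos[of x] S(2) that by (auto simp: jac_def)
  then have "(\<lambda>x. indicator S x * (jac x * G (\<Phi> x))) = ?L"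
    by (auto simp: fun_eq_iff indicator_def)
  ultimately have [measurable]: "?L \<in> borel_measurable borel" by simp
  have [measurable]: "?R \<in> borel_measurable borel" by measurable
  have Leb: "S \<in> sets lebesgue" by (simp add: sets_completionI_sets)
  note cov = change_of_variables_cart[OF Leb _ inj_on_subset[OF inj S(2)], of "\<lambda>x. frechet_derivative \<Phi> (at x)" G,
      folded jac_def]
  have iff: "integrable lebesgue ?R \<longleftrightarrow> integrable lebesgue ?L" and eq: "integral\<^sup>L lebesgue ?R = integral\<^sup>L lebesgue ?L"
    using cov Phi_derivative S(2) by blast+
  have "(\<integral>\<^sup>+y. ennreal (?R y) \<partial>lborel) = (\<integral>\<^sup>+x. ennreal (?L x) \<partial>lborel)"
  proof (cases "integrable lebesgue ?R")
    case True
    then have "integrable lborel ?R" "integrable lborel ?L" using iff by (simp_all add: integrable_completion)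
    then show ?thesis using eq G(2)
      by (subst (1 2) nn_integral_eq_integral) (auto simp: integral_completion)
  next
    \<comment> \<open>Without integrability both sides are infinite, since both integrands are
      nonnegative and Borel.\<close>
    case False
    have "(\<integral>\<^sup>+x. ennreal (h x) \<partial>lborel) = \<infinity>"
      if "\<not> integrable lebesgue h" "h \<in> borel_measurable borel" "\<And>x. 0 \<le> h x" for h :: "real ^ 'd \<Rightarrow> real"
    proof (rule ccontr)
      assume "(\<integral>\<^sup>+x. ennreal (h x) \<partial>lborel) \<noteq> \<infinity>"
      then have "integrable lborel h" using that(2,3) by (intro integrableI_nonneg) (auto simp: less_top)
      then show False using that(1,2) by (simp add: integrable_completion)
    qed
    then show ?thesis using False iff G(2) by simp
  qed
  moreover have "(\<integral>\<^sup>+y. ennreal (G y) \<partial>lborel_on (\<Phi> ` S)) = (\<integral>\<^sup>+y. ennreal (?R y) \<partial>lborel)"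
    by (subst nn_integral_lborel_on) (auto simp: indicator_def intro!: nn_integral_cong)
  moreover have "(\<integral>\<^sup>+x. ennreal (jac x * G (\<Phi> x)) \<partial>lborel_on S) = (\<integral>\<^sup>+x. ennreal (?L x) \<partial>lborel)"
    by (subst nn_integral_lborel_on) (auto simp: indicator_def abs_jac intro!: nn_integral_cong)
  ultimately show ?thesis by simp
qed

lemma nn_integral_pullback:
  assumes S: "compact S" "S \<subseteq> Dhat" and G: "G \<in> borel_measurable borel" "\<And>y. 0 \<le> G y"
  shows "(\<integral>\<^sup>+x. ennreal (G (\<Phi> x)) \<partial>lborel_on S) = (\<integral>\<^sup>+y. ennreal (G y / J y) \<partial>lborel_on (\<Phi> ` S))"
proof -
  have sub: "\<Phi> ` S \<subseteq> D" using S by blast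
  \<comment> \<open>Outside \<open>D\<close> the function \<open>J\<close> depends on arbitrary
    values of \<open>inv_into\<close>; the cut-off makes \<open>1 / J\<close> Borel on the whole
    space.\<close>
  let ?G = "\<lambda>y. G y * (indicator D y * (1 / J y))"
  have "continuous_on D (\<lambda>y. 1 / J y)"
    using J_pos by (intro continuous_intros continuous_J) force
  from borel_measurable_continuous_on_indicator[OF D_borel this]
  have [measurable]: "(\<lambda>y. indicator D y * (1 / J y)) \<in> borel_measurable borel"
    by (simp only: real_scaleR_def)
  note [measurable] = G(1)
  have "(\<integral>\<^sup>+y. ennreal (?G y) \<partial>lborel_on (\<Phi> ` S)) = (\<integral>\<^sup>+x. ennreal (jac x * ?G (\<Phi> x)) \<partial>lborel_on S)"
  proof (rule nn_change_of_variables[OF S])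
    show "?G \<in> borel_measurable borel" by measurable
    show "0 \<le> ?G y" for y using G(2)[of y] J_pos[of y] by (auto simp: indicator_def less_imp_le)
  qed
  moreover have "(\<integral>\<^sup>+y. ennreal (?G y) \<partial>lborel_on (\<Phi> ` S)) = (\<integral>\<^sup>+y. ennreal (G y / J y) \<partial>lborel_on (\<Phi> ` S))"
    using sub by (intro nn_integral_cong) (auto simp: space_restrict_space)
  moreover have "(\<integral>\<^sup>+x. ennreal (jac x * ?G (\<Phi> x)) \<partial>lborel_on S) = (\<integral>\<^sup>+x. ennreal (G (\<Phi> x)) \<partial>lborel_on S)"
    using S(2) jac_pos by (intro nn_integral_cong) (force simp: space_restrict_space J_image jac_def)
  ultimately show ?thesis by simp
qed

lemma nn_integral_pullback_le:
  assumes S: "compact S" "S \<subseteq> Dhat" and G: "G \<in> borel_measurable borel" "\<And>y. 0 \<le> G y"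
    and R: "0 \<le> R" "AE y in lborel. y \<in> D \<longrightarrow> 1 / J y \<le> R"
  shows "(\<integral>\<^sup>+x. ennreal (G (\<Phi> x)) \<partial>lborel_on S) \<le> ennreal R * (\<integral>\<^sup>+y. ennreal (G y) \<partial>lborel_on (\<Phi> ` S))"
proof -
  have "compact (\<Phi> ` S)" by (rule compact_continuous_image[OF continuous_Phi[OF S(2)] S(1)])
  then have b: "\<Phi> ` S \<in> sets borel" by (rule borel_compact)
  have ae: "AE y in lborel. y \<in> \<Phi> ` S \<longrightarrow> 1 / J y \<le> R" using R(2) by eventually_elim (use S(2) in auto)
  have "(\<integral>\<^sup>+x. ennreal (G (\<Phi> x)) \<partial>lborel_on S) = (\<integral>\<^sup>+y. ennreal (G y / J y) \<partial>lborel_on (\<Phi> ` S))"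
    by (rule nn_integral_pullback[OF S G])
  also have "\<dots> \<le> (\<integral>\<^sup>+y. ennreal R * ennreal (G y) \<partial>lborel_on (\<Phi> ` S))"
  proof (rule nn_integral_mono_AE, use AE_lborel_on[OF b ae] in eventually_elim)
    fix y assume "1 / J y \<le> R"
    then have "(1 / J y) * G y \<le> R * G y" using G(2) by (rule mult_right_mono)
    then show "ennreal (G y / J y) \<le> ennreal R * ennreal (G y)"
      using R(1) G(2) by (simp add: ennreal_mult[symmetric] ennreal_leI)
  qed
  also have "\<dots> = ennreal R * (\<integral>\<^sup>+y. ennreal (G y) \<partial>lborel_on (\<Phi> ` S))"
    using borel_measurable_lborel_on[OF G(1)] by (intro nn_integral_cmult) simp
  finally show ?thesis .
qed

lemma nn_integral_pushforward_le:
  assumes G: "G \<in> borel_measurable borel" "\<And>y. 0 \<le> G y"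
    and Q: "0 \<le> Q" "AE y in lborel. y \<in> D \<longrightarrow> J y \<le> Q"
  shows "(\<integral>\<^sup>+y. ennreal (G y) \<partial>lborel_on D) \<le> ennreal Q * (\<integral>\<^sup>+x. ennreal (G (\<Phi> x)) \<partial>lborel_on Dhat)"
proof -
  have ae: "AE y in lborel_on D. J y \<le> Q \<and> y \<in> D"
    using Q(2) by (intro AE_lborel_on) auto
  have m: "(\<lambda>y. G y / J y) \<in> borel_measurable (lborel_on D)"
    using borel_measurable_lborel_on[OF G(1)] continuous_lborel_on[OF continuous_J] by measurable
  have "(\<integral>\<^sup>+y. ennreal (G y) \<partial>lborel_on D) \<le> (\<integral>\<^sup>+y. ennreal Q * ennreal (G y / J y) \<partial>lborel_on D)"
  proof (rule nn_integral_mono_AE, use ae in eventually_elim)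
    fix y assume y: "J y \<le> Q \<and> y \<in> D"
    then have "J y * (G y / J y) \<le> Q * (G y / J y)" using G(2)[of y] J_pos[of y] by (intro mult_right_mono) auto
    then show "ennreal (G y) \<le> ennreal Q * ennreal (G y / J y)"
      using Q(1) G(2)[of y] J_pos[of y] y by (simp add: ennreal_mult[symmetric] ennreal_leI)
  qed
  also have "\<dots> = ennreal Q * (\<integral>\<^sup>+y. ennreal (G y / J y) \<partial>lborel_on D)"
    using m by (intro nn_integral_cmult) simp
  also have "(\<integral>\<^sup>+y. ennreal (G y / J y) \<partial>lborel_on D) = (\<integral>\<^sup>+x. ennreal (G (\<Phi> x)) \<partial>lborel_on Dhat)"
    by (rule nn_integral_pullback[OF compact_Dhat _ G, symmetric]) simp
  finally show ?thesis .
qed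

end

lemma finite_bounded_lists [simp]: "finite {xs :: 'd::finite list. length xs \<le> k}"
  using finite_lists_length_le[of "UNIV :: 'd set" k] by simp

text \<open>\<open>jet\<close> and \<open>extrapolation\<close> are assumptions with the constants
  as parameters, so that \<open>Kc\<close> and \<open>Ce\<close> can be fixed once and then used for
  every map. \<open>H\<close> is the element size.\<close>

locale scaled_element = element Dhat U \<Phi> x0
  for Dhat U :: "(real ^ 'd::finite) set" and \<Phi> x0 +
  fixes N :: nat and H Kc Ce :: real
  assumes H: "0 \<le> H" and Kc: "0 \<le> Kc" and Ce: "0 \<le> Ce"
    and jet: "\<And>f B x. smooth_on UNIV f \<Longrightarrow> x \<in> interior Dhat \<Longrightarrow> 0 \<le> B \<Longrightarrow>
      (\<And>ys. length ys \<le> Suc N \<Longrightarrow> \<bar>derivs ys f (\<Phi> x)\<bar> \<le> B) \<Longrightarrow>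
      jet_le (Suc N) H (Kc * B) (\<lambda>y. f (\<Phi> y)) x"
    and extrapolation: "\<And>p. poly_deg_le N p \<Longrightarrow>
      (\<integral>\<^sup>+x. ennreal ((p x)\<^sup>2) \<partial>lborel_on Dhat) \<le>
      ennreal Ce * (\<integral>\<^sup>+x. ennreal ((p x)\<^sup>2) \<partial>lborel_on (dilate x0 (1/2) ` Dhat))"
begin

definition bh_const :: real where
  "bh_const = real CARD('d) ^ Suc N * diameter Dhat ^ (2 * Suc N)"

definition n_lists :: real where
  "n_lists = real (card {xs :: 'd list. length xs \<le> Suc N})"

text \<open>From the outside inwards: 2 for the comparison of the product with its mollified
  version, \<open>bh_const\<close> for the Taylor remainder, \<open>2 ^ CARD('d)\<close> for the
  averaging over segments, the number of lists of length \<open>N + 1\<close>, the squares of the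
  chain rule and Leibniz constants, and \<open>n_lists\<close> once for Cauchy-Schwarz and once for
  the sum over all derivatives of \<open>V\<close>.\<close>

definition local_const :: real where
  "local_const = 2 * (bh_const * (2 ^ CARD('d) *
     (real CARD('d) ^ Suc N * (Kc\<^sup>2 * (2 ^ Suc N)\<^sup>2) * n_lists\<^sup>2)))"

lemma bh_const_nonneg: "0 \<le> bh_const"
  using diameter_ge_0[OF compact_imp_bounded[OF compact_Dhat]] by (simp add: bh_const_def)

lemma local_const_nonneg: "0 \<le> local_const"
  using bh_const_nonneg by (simp add: local_const_def)

lemma dilate_subset_interior:
  assumes "0 < t" "t < 1"
  shows "dilate x0 t ` Dhat \<subseteq> interior Dhat"
proof
  fix y assume "y \<in> dilate x0 t ` Dhat"
  then obtain x where x: "x \<in> Dhat" "y = dilate x0 t x" by blast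
  have "x - (1 - t) *\<^sub>R (x - x0) \<in> interior Dhat"
    using assms by (intro mem_interior_convex_shrink convex_Dhat x0 x) auto
  moreover have "dilate x0 t x = x - (1 - t) *\<^sub>R (x - x0)" by (simp add: dilate_def algebra_simps)
  ultimately show "y \<in> interior Dhat" using x by simp
qed

lemma emeasure_dilate_pos:
  assumes "0 < t"
  shows "0 < emeasure lborel (dilate x0 t ` Dhat)"
proof -
  obtain r where r: "0 < r" "ball x0 r \<subseteq> Dhat" using x0 mem_interior by blast
  have "ball x0 (t * r) \<subseteq> dilate x0 t ` Dhat"
  proof
    fix y assume y: "y \<in> ball x0 (t * r)"
    have "y = dilate x0 t (dilate x0 (1 / t) y)" using assms by (simp add: dilate_def)
    moreover have "dist x0 (dilate x0 (1 / t) y) = dist x0 y / t"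
      using assms by (simp add: dilate_def dist_norm norm_minus_commute)
    then have "dilate x0 (1 / t) y \<in> ball x0 r" using y assms by (simp add: pos_divide_less_eq mult.commute)
    ultimately show "y \<in> dilate x0 t ` Dhat" using r(2) by blast
  qed
  moreover have "dilate x0 t ` Dhat \<in> sets borel" by (rule borel_compact[OF compact_dilate[OF compact_Dhat]])
  ultimately have "emeasure lborel (ball x0 (t * r)) \<le> emeasure lborel (dilate x0 t ` Dhat)"
    by (intro emeasure_mono) auto
  moreover have "0 < measure lborel (ball x0 (t * r))" using assms r content_ball_pos by simp
  then have "emeasure lborel (ball x0 (t * r)) \<noteq> 0" by (auto simp: measure_def)
  ultimately show ?thesis using less_le_trans zero_less_iff_neq_zero by blast
qed

end

text \<open>The data of the estimate: Borel functions \<open>W\<close> and \<open>V\<close> with families of derivatives along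
  coordinate lists, known only through the mollifications.\<close>

locale weight_times_function = scaled_element Dhat U \<Phi> x0 N H Kc Ce
  for Dhat U :: "(real ^ 'd::finite) set" and \<Phi> x0 N H Kc Ce +
  fixes W V :: "real ^ 'd \<Rightarrow> real" and Wd Vd :: "'d list \<Rightarrow> real ^ 'd \<Rightarrow> real" and B V2 R :: real
  assumes W: "integrable lborel W" "(\<integral>\<^sup>+x. ennreal ((W x)\<^sup>2) \<partial>lborel) < \<infinity>" "AE x in lborel. \<bar>W x\<bar> \<le> B"
    and V: "integrable lborel V" "(\<integral>\<^sup>+x. ennreal ((V x)\<^sup>2) \<partial>lborel) < \<infinity>"
    and Wd: "\<And>ys. length ys \<le> Suc N \<Longrightarrow> integrable lborel (Wd ys)"
      "\<And>ys. length ys \<le> Suc N \<Longrightarrow> AE x in lborel. \<bar>Wd ys x\<bar> \<le> B"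
      "\<And>ys e z. length ys \<le> Suc N \<Longrightarrow> 0 < e \<Longrightarrow> cball z e \<subseteq> interior D \<Longrightarrow>
        derivs ys (conv (mollifier e) W) z = conv (mollifier e) (Wd ys) z"
    and Vd: "\<And>ys. length ys \<le> Suc N \<Longrightarrow> integrable lborel (Vd ys)"
      "\<And>ys. length ys \<le> Suc N \<Longrightarrow> (\<integral>\<^sup>+x. ennreal ((Vd ys x)\<^sup>2) \<partial>lborel) \<le> ennreal V2"
      "\<And>ys e z. length ys \<le> Suc N \<Longrightarrow> 0 < e \<Longrightarrow> cball z e \<subseteq> interior D \<Longrightarrow>
        derivs ys (conv (mollifier e) V) z = conv (mollifier e) (Vd ys) z"
    and B: "0 \<le> B" and V2: "0 \<le> V2" and R: "0 \<le> R" "AE y in lborel. y \<in> D \<longrightarrow> 1 / J y \<le> R"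
begin

definition scale :: real where
  "scale = B\<^sup>2 * R * V2 * (H ^ Suc N)\<^sup>2"

lemma scale_nonneg: "0 \<le> scale"
  using R V2 by (simp add: scale_def)

text \<open>The derivatives of the mollified \<open>W\<close> are bounded by \<open>B\<close>, those
  of the mollified \<open>V\<close> are controlled only in the mean. Hence the pointwise sum
  \<open>?S\<close> serves as jet constant of \<open>V\<close>, and Cauchy-Schwarz turns it into a
  sum of squares fit for integration. At \<open>\<Phi> x\<close> the length scale is 1;
  \<open>H\<close> enters through \<open>jet\<close> alone.\<close>

lemma derivs_mollified_product_le:
  assumes x: "x \<in> interior Dhat" and e: "0 < e" "cball (\<Phi> x) e \<subseteq> interior D" and xs: "length xs = Suc N"
  shows "(derivs xs (\<lambda>y. conv (mollifier e) W (\<Phi> y) * conv (mollifier e) V (\<Phi> y)) x)\<^sup>2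
    \<le> Kc\<^sup>2 * (2 ^ Suc N)\<^sup>2 * B\<^sup>2 * (H ^ Suc N)\<^sup>2 * n_lists *
      (\<Sum>ys | length ys \<le> Suc N. (conv (mollifier e) (Vd ys) (\<Phi> x))\<^sup>2)"
proof -
  let ?W = "conv (mollifier e) W" and ?V = "conv (mollifier e) V" and ?z = "\<Phi> x"
  let ?S = "\<Sum>ys | length ys \<le> Suc N. \<bar>conv (mollifier e) (Vd ys) ?z\<bar>"
  have sm: "smooth_on UNIV ?W" "smooth_on UNIV ?V" by (intro smooth_on_mollify e W V)+
  have jW: "jet_le (Suc N) 1 B ?W ?z"
    unfolding jet_le_def using Wd e by (auto intro!: mollify_bounded[OF e(1)])
  have jV: "jet_le (Suc N) 1 ?S ?V ?z"
    unfolding jet_le_def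
  proof (intro allI impI)
    fix ys :: "'d list" assume ys: "length ys \<le> Suc N"
    then have "\<bar>conv (mollifier e) (Vd ys) ?z\<bar> \<le> ?S" by (intro member_le_sum) auto
    then show "\<bar>derivs ys ?V ?z\<bar> \<le> ?S * 1 ^ length ys" using Vd(3)[OF ys e] by simp
  qed
  have S0: "0 \<le> ?S" by (intro sum_nonneg) auto
  have jWV: "jet_le (Suc N) 1 (2 ^ Suc N * B * ?S) (\<lambda>y. ?W y * ?V y) ?z"
    by (rule jet_le_mult[OF open_UNIV sm _ _ B S0 jW jV]) auto
  have "jet_le (Suc N) H (Kc * (2 ^ Suc N * B * ?S)) (\<lambda>y. ?W (\<Phi> y) * ?V (\<Phi> y)) x"
  proof (rule jet[OF smooth_on_mult[OF open_UNIV sm] x])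
    show "0 \<le> 2 ^ Suc N * B * ?S" using B S0 by simp
    show "\<bar>derivs ys (\<lambda>y. ?W y * ?V y) ?z\<bar> \<le> 2 ^ Suc N * B * ?S" if "length ys \<le> Suc N" for ys
      using jet_leD[OF jWV that] by simp
  qed
  from jet_leD[OF this, of xs]
  have "\<bar>derivs xs (\<lambda>y. ?W (\<Phi> y) * ?V (\<Phi> y)) x\<bar> \<le> \<bar>Kc * (2 ^ Suc N * B * ?S) * H ^ Suc N\<bar>" using xs by simp
  then have "(derivs xs (\<lambda>y. ?W (\<Phi> y) * ?V (\<Phi> y)) x)\<^sup>2 \<le> (Kc * (2 ^ Suc N * B * ?S) * H ^ Suc N)\<^sup>2"
    by (simp only: abs_le_square_iff)
  also have "\<dots> = Kc\<^sup>2 * (2 ^ Suc N)\<^sup>2 * B\<^sup>2 * (H ^ Suc N)\<^sup>2 * ?S\<^sup>2"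
    by (simp only: power_mult_distrib mult_ac)
  also have "?S\<^sup>2 \<le> (\<Sum>ys :: 'd list | length ys \<le> Suc N. 1\<^sup>2) * (\<Sum>ys | length ys \<le> Suc N. \<bar>conv (mollifier e) (Vd ys) ?z\<bar>\<^sup>2)"
    using Cauchy_Schwarz_ineq_sum[of "\<lambda>_. 1" "\<lambda>ys. \<bar>conv (mollifier e) (Vd ys) ?z\<bar>" "{ys. length ys \<le> Suc N}"] by simp
  also have "\<dots> = n_lists * (\<Sum>ys | length ys \<le> Suc N. (conv (mollifier e) (Vd ys) ?z)\<^sup>2)"
    by (simp add: n_lists_def)
  finally show ?thesis by (simp add: mult_left_mono mult.assoc)
qed

lemma F_measurable: "(\<lambda>x. W (\<Phi> x) * V (\<Phi> x)) \<in> borel_measurable (lborel_on Dhat)"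
proof -
  have "W \<in> borel_measurable borel" "V \<in> borel_measurable borel" using W V by auto
  then show ?thesis
    using measurable_compose[OF continuous_lborel_on[OF continuous_Phi[OF order_refl]]] by (intro borel_measurable_times) auto
qed

lemma F_measurable_subset:
  assumes "S \<subseteq> Dhat"
  shows "(\<lambda>x. W (\<Phi> x) * V (\<Phi> x)) \<in> borel_measurable (lborel_on S)"
proof -
  have "W \<in> borel_measurable borel" "V \<in> borel_measurable borel" using W V by auto
  then show ?thesis
    using measurable_compose[OF continuous_lborel_on[OF continuous_Phi[OF assms]]] by (intro borel_measurable_times) auto
qed

text \<open>The shrunken copy is mapped to a compact subset of the open element, so one radius
  \<open>e\<close> suits all its points. Bramble-Hilbert applies to the pulled-back mollified
  product, with derivative bounds that do not depend on \<open>e\<close>; the return to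
  \<open>W\<close> and \<open>V\<close> uses L2 convergence of the product alone.\<close>

lemma poly_approx_dilate:
  assumes t: "0 < t" "t < 1" and \<eta>: "0 < \<eta>"
  obtains p where "poly_deg_le N p"
    "(\<integral>\<^sup>+x. ennreal ((W (\<Phi> x) * V (\<Phi> x) - p x)\<^sup>2) \<partial>lborel_on (dilate x0 t ` Dhat)) \<le> ennreal (local_const * scale + \<eta>)"
proof -
  let ?K = "dilate x0 t ` Dhat"
  have K: "compact ?K" "convex ?K" by (rule compact_dilate[OF compact_Dhat] convex_dilate[OF convex_Dhat])+
  have Kint: "?K \<subseteq> interior Dhat" by (rule dilate_subset_interior[OF t])
  then have KD: "?K \<subseteq> Dhat" using interior_subset by blast
  have KU: "?K \<subseteq> U" using KD U(2) by blast
  have Kb [measurable]: "?K \<in> sets borel" by (rule borel_compact[OF K(1)])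
  have PK: "compact (\<Phi> ` ?K)" by (rule compact_continuous_image[OF continuous_Phi[OF KD] K(1)])
  have PKb: "\<Phi> ` ?K \<in> sets borel" by (rule borel_compact[OF PK])
  have "\<Phi> ` ?K \<subseteq> interior D" using Kint interior_image by blast
  then obtain r where r: "0 < r" "(\<Union>z\<in>\<Phi> ` ?K. ball z r) \<subseteq> interior D"
    using compact_subset_open_imp_ball_epsilon_subset[OF PK open_interior] by blast
  \<comment> \<open>After the factors \<open>2 * R\<close> and \<open>2 * bh_const\<close> of the
    final sum, each of the two errors contributes at most \<open>\<eta> / 2\<close>.\<close>
  have \<eta>1: "0 < \<eta> / (4 * (R + 1))" and \<eta>2: "0 < \<eta> / (4 * (bh_const + 1))"
    using \<eta> R(1) bh_const_nonneg by (simp_all add: add_nonneg_pos)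
  obtain \<delta> where \<delta>: "0 < \<delta>" "\<And>e. 0 < e \<Longrightarrow> e \<le> \<delta> \<Longrightarrow>
    (\<integral>\<^sup>+x. ennreal ((W x * V x - conv (mollifier e) W x * conv (mollifier e) V x)\<^sup>2) \<partial>lborel) \<le> ennreal (\<eta> / (4 * (R + 1)))"
    using mollify_product_L2_small[OF W V \<eta>1] by blast
  define e where "e = min \<delta> (r / 2)"
  have e: "0 < e" "e \<le> \<delta>" "e < r" using \<delta> r by (auto simp: e_def)
  have ball: "cball (\<Phi> x) e \<subseteq> interior D" if "x \<in> ?K" for x
  proof -
    have "cball (\<Phi> x) e \<subseteq> ball (\<Phi> x) r" using e(3) by auto
    also have "\<dots> \<subseteq> interior D" using r(2) that by blast
    finally show ?thesis .
  qed
  let ?We = "conv (mollifier e) W" and ?Ve = "conv (mollifier e) V"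
  note [measurable] = conv_measurable[OF e(1) W(1)] conv_measurable[OF e(1) V(1)]
  have [measurable]: "W \<in> borel_measurable borel" "V \<in> borel_measurable borel" using W V by auto
  let ?F = "\<lambda>x. W (\<Phi> x) * V (\<Phi> x)" and ?Fe = "\<lambda>x. ?We (\<Phi> x) * ?Ve (\<Phi> x)"
  have "smooth_on UNIV (\<lambda>z. ?We z * ?Ve z)"
    by (intro smooth_on_mult open_UNIV smooth_on_mollify e W V)
  then have sm: "smooth_on U ?Fe" by (rule smooth_on_compose[OF U(1) open_UNIV U(3) subset_UNIV])
  have 1: "(\<integral>\<^sup>+x. ennreal ((?F x - ?Fe x)\<^sup>2) \<partial>lborel_on ?K) \<le> ennreal (R * (\<eta> / (4 * (R + 1))))"
  proof -
    have "(\<integral>\<^sup>+x. ennreal ((?F x - ?Fe x)\<^sup>2) \<partial>lborel_on ?K)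
      \<le> ennreal R * (\<integral>\<^sup>+y. ennreal ((W y * V y - ?We y * ?Ve y)\<^sup>2) \<partial>lborel_on (\<Phi> ` ?K))"
      by (rule nn_integral_pullback_le[OF K(1) KD _ _ R]) auto
    also have "\<dots> \<le> ennreal R * ennreal (\<eta> / (4 * (R + 1)))"
      by (intro mult_left_mono order_trans[OF nn_integral_lborel_on_le_UNIV[OF PKb] \<delta>(2)[OF e(1,2)]]) simp
    also have "\<dots> = ennreal (R * (\<eta> / (4 * (R + 1))))" using R(1) \<eta>1 by (intro ennreal_mult[symmetric]) auto
    finally show ?thesis .
  qed
  let ?c = "Kc\<^sup>2 * (2 ^ Suc N)\<^sup>2 * B\<^sup>2 * (H ^ Suc N)\<^sup>2 * n_lists"
  let ?cc = "real CARD('d) ^ Suc N * ?c"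
  have c0: "0 \<le> ?cc" by (simp add: n_lists_def)
  have 2: "(\<integral>\<^sup>+x\<in>?K. ennreal (\<Sum>xs | length xs = Suc N. (derivs xs ?Fe x)\<^sup>2) \<partial>lborel)
    \<le> ennreal (?cc * (n_lists * (R * V2)))"
  proof -
    have "(\<integral>\<^sup>+x\<in>?K. ennreal (\<Sum>xs | length xs = Suc N. (derivs xs ?Fe x)\<^sup>2) \<partial>lborel)
      = (\<integral>\<^sup>+x. ennreal (\<Sum>xs | length xs = Suc N. (derivs xs ?Fe x)\<^sup>2) \<partial>lborel_on ?K)"
      by (rule nn_integral_lborel_on[OF Kb, symmetric])
    also have "\<dots> \<le> (\<integral>\<^sup>+x. (\<Sum>ys | length ys \<le> Suc N. ennreal ?cc * ennreal ((conv (mollifier e) (Vd ys) (\<Phi> x))\<^sup>2)) \<partial>lborel_on ?K)"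
    proof (rule nn_integral_mono)
      fix x assume "x \<in> space (lborel_on ?K)"
      then have x: "x \<in> ?K" by (simp add: space_restrict_space)
      let ?s = "\<Sum>ys | length ys \<le> Suc N. (conv (mollifier e) (Vd ys) (\<Phi> x))\<^sup>2"
      have "(\<Sum>xs :: 'd list | length xs = Suc N. (derivs xs ?Fe x)\<^sup>2) \<le> (\<Sum>xs :: 'd list | length xs = Suc N. ?c * ?s)"
        using derivs_mollified_product_le[OF _ e(1) ball[OF x]] Kint x by (intro sum_mono) auto
      also have "\<dots> = ?cc * ?s" by (simp only: sum_constant card_lists_length of_nat_power mult.assoc)
      also have "\<dots> = (\<Sum>ys | length ys \<le> Suc N. ?cc * (conv (mollifier e) (Vd ys) (\<Phi> x))\<^sup>2)"
        by (rule sum_distrib_left)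
      finally have "ennreal (\<Sum>xs :: 'd list | length xs = Suc N. (derivs xs ?Fe x)\<^sup>2)
        \<le> ennreal (\<Sum>ys | length ys \<le> Suc N. ?cc * (conv (mollifier e) (Vd ys) (\<Phi> x))\<^sup>2)" by (rule ennreal_leI)
      also have "\<dots> = (\<Sum>ys | length ys \<le> Suc N. ennreal ?cc * ennreal ((conv (mollifier e) (Vd ys) (\<Phi> x))\<^sup>2))"
        using c0 by (subst sum_ennreal[symmetric]) (auto simp only: ennreal_mult zero_le_power2 mult_nonneg_nonneg)
      finally show "ennreal (\<Sum>xs | length xs = Suc N. (derivs xs ?Fe x)\<^sup>2)
        \<le> (\<Sum>ys | length ys \<le> Suc N. ennreal ?cc * ennreal ((conv (mollifier e) (Vd ys) (\<Phi> x))\<^sup>2))" .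
    qed
    also have "\<dots> = (\<Sum>ys | length ys \<le> Suc N. ennreal ?cc * (\<integral>\<^sup>+x. ennreal ((conv (mollifier e) (Vd ys) (\<Phi> x))\<^sup>2) \<partial>lborel_on ?K))"
    proof -
      have m: "(\<lambda>x. ennreal ((conv (mollifier e) (Vd ys) (\<Phi> x))\<^sup>2)) \<in> borel_measurable (lborel_on ?K)"
        if "ys \<in> {ys. length ys \<le> Suc N}" for ys
      proof -
        have "conv (mollifier e) (Vd ys) \<in> borel_measurable borel" using Vd(1) that by (intro conv_measurable e) auto
        from measurable_compose[OF continuous_lborel_on[OF continuous_Phi[OF KD]] this]
        have "(\<lambda>x. conv (mollifier e) (Vd ys) (\<Phi> x)) \<in> borel_measurable (lborel_on ?K)" .
        from measurable_compose[OF borel_measurable_power[OF this] measurable_ennreal] show ?thesis .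
      qed
      have "(\<integral>\<^sup>+x. (\<Sum>ys | length ys \<le> Suc N. ennreal ?cc * ennreal ((conv (mollifier e) (Vd ys) (\<Phi> x))\<^sup>2)) \<partial>lborel_on ?K)
        = (\<Sum>ys | length ys \<le> Suc N. (\<integral>\<^sup>+x. ennreal ?cc * ennreal ((conv (mollifier e) (Vd ys) (\<Phi> x))\<^sup>2) \<partial>lborel_on ?K))"
        by (rule nn_integral_sum) (rule borel_measurable_times_ennreal[OF borel_measurable_const m])
      also have "\<dots> = (\<Sum>ys | length ys \<le> Suc N. ennreal ?cc * (\<integral>\<^sup>+x. ennreal ((conv (mollifier e) (Vd ys) (\<Phi> x))\<^sup>2) \<partial>lborel_on ?K))"
        by (rule sum.cong[OF refl]) (rule nn_integral_cmult[OF m])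
      finally show ?thesis .
    qed
    also have "\<dots> \<le> (\<Sum>ys :: 'd list | length ys \<le> Suc N. ennreal ?cc * (ennreal R * ennreal V2))"
    proof (intro sum_mono mult_left_mono)
      fix ys :: "'d list" assume "ys \<in> {ys. length ys \<le> Suc N}"
      then have ys: "length ys \<le> Suc N" by simp
      note [measurable] = conv_measurable[OF e(1) Vd(1)[OF ys]]
      have "(\<integral>\<^sup>+x. ennreal ((conv (mollifier e) (Vd ys) (\<Phi> x))\<^sup>2) \<partial>lborel_on ?K)
        \<le> ennreal R * (\<integral>\<^sup>+y. ennreal ((conv (mollifier e) (Vd ys) y)\<^sup>2) \<partial>lborel_on (\<Phi> ` ?K))"
        by (rule nn_integral_pullback_le[OF K(1) KD _ _ R]) auto
      also have "\<dots> \<le> ennreal R * ennreal V2"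
        by (intro mult_left_mono order_trans[OF nn_integral_lborel_on_le_UNIV[OF PKb]
              order_trans[OF mollify_L2_le[OF e(1) Vd(1)[OF ys]] Vd(2)[OF ys]]]) simp
      finally show "(\<integral>\<^sup>+x. ennreal ((conv (mollifier e) (Vd ys) (\<Phi> x))\<^sup>2) \<partial>lborel_on ?K) \<le> ennreal R * ennreal V2" .
    qed auto
    also have "\<dots> = ennreal n_lists * (ennreal ?cc * (ennreal R * ennreal V2))"
      by (simp add: n_lists_def ennreal_of_nat_eq_real_of_nat)
    also have "\<dots> = ennreal (n_lists * (?cc * (R * V2)))"
      using c0 R V2 by (simp only: ennreal_mult[symmetric] mult_nonneg_nonneg n_lists_def of_nat_0_le_iff)
    finally show ?thesis by (simp only: mult_ac)
  qed
  have \<delta>D: "norm (x - y) \<le> diameter Dhat" if "x \<in> ?K" "y \<in> ?K" for x y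
    using diameter_bounded_bound[OF compact_imp_bounded[OF compact_Dhat], of x y] that KD by (auto simp: dist_norm)
  obtain p where p: "poly_deg_le N p"
    "(\<integral>\<^sup>+x\<in>?K. ennreal ((?Fe x - p x)\<^sup>2) \<partial>lborel) \<le> ennreal bh_const *
      (2 ^ CARD('d) * (\<integral>\<^sup>+x\<in>?K. ennreal (\<Sum>xs | length xs = Suc N. (derivs xs ?Fe x)\<^sup>2) \<partial>lborel) + ennreal (\<eta> / (4 * (bh_const + 1))))"
    using bramble_hilbert[OF U(1) sm K KU emeasure_dilate_pos[OF t(1)] \<delta>D \<eta>2, of N] unfolding bh_const_def by blast
  let ?Y = "?cc * (n_lists * (R * V2))"
  have Y0: "0 \<le> ?Y" using c0 R V2 by (intro mult_nonneg_nonneg) (auto simp: n_lists_def)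
  have 3: "(\<integral>\<^sup>+x. ennreal ((?Fe x - p x)\<^sup>2) \<partial>lborel_on ?K) \<le> ennreal (bh_const * (2 ^ CARD('d) * ?Y + \<eta> / (4 * (bh_const + 1))))"
  proof -
    have "(\<integral>\<^sup>+x. ennreal ((?Fe x - p x)\<^sup>2) \<partial>lborel_on ?K) \<le> ennreal bh_const *
      (2 ^ CARD('d) * ennreal ?Y + ennreal (\<eta> / (4 * (bh_const + 1))))"
      unfolding nn_integral_lborel_on[OF Kb]
      by (rule order_trans[OF p(2)]) (intro mult_left_mono add_mono 2 order_refl, auto)
    also have "2 ^ CARD('d) * ennreal ?Y = ennreal (2 ^ CARD('d) * ?Y)"
      using ennreal_mult[of "2 ^ CARD('d)" ?Y] Y0 by (simp add: ennreal_power[symmetric])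
    also have "ennreal (2 ^ CARD('d) * ?Y) + ennreal (\<eta> / (4 * (bh_const + 1))) = ennreal (2 ^ CARD('d) * ?Y + \<eta> / (4 * (bh_const + 1)))"
      by (rule ennreal_plus[symmetric, OF mult_nonneg_nonneg[OF _ Y0] less_imp_le[OF \<eta>2]]) simp
    also have "ennreal bh_const * \<dots> = ennreal (bh_const * (2 ^ CARD('d) * ?Y + \<eta> / (4 * (bh_const + 1))))"
      by (rule ennreal_mult[symmetric, OF bh_const_nonneg])
        (rule add_nonneg_nonneg[OF mult_nonneg_nonneg[OF _ Y0] less_imp_le[OF \<eta>2]], simp)
    finally show ?thesis .
  qed
  show ?thesis
  proof (rule that[OF p(1)])
    have "(\<integral>\<^sup>+x. ennreal ((?F x - p x)\<^sup>2) \<partial>lborel_on ?K)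
      \<le> ennreal (2 * (R * (\<eta> / (4 * (R + 1)))) + 2 * (bh_const * (2 ^ CARD('d) * ?Y + \<eta> / (4 * (bh_const + 1)))))"
    proof (rule nn_integral_sq_diff_le[OF _ _ _ _ _ 1 3])
      show "?F \<in> borel_measurable (lborel_on ?K)" by (rule F_measurable_subset[OF KD])
      show "?Fe \<in> borel_measurable (lborel_on ?K)"
        using smooth_on_continuous[OF sm] KU by (intro continuous_lborel_on) (auto intro: continuous_on_subset)
      show "p \<in> borel_measurable (lborel_on ?K)" by (intro continuous_lborel_on continuous_on_poly_deg_le[OF p(1)])
      show "0 \<le> R * (\<eta> / (4 * (R + 1)))" using R(1) \<eta>1 by (intro mult_nonneg_nonneg) auto
      show "0 \<le> bh_const * (2 ^ CARD('d) * ?Y + \<eta> / (4 * (bh_const + 1)))"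
        by (rule mult_nonneg_nonneg[OF bh_const_nonneg
              add_nonneg_nonneg[OF mult_nonneg_nonneg[OF _ Y0] less_imp_le[OF \<eta>2]]]) simp
    qed
    also have "\<dots> \<le> ennreal (local_const * scale + \<eta>)"
    proof (rule ennreal_leI)
      have a: "c * (\<eta> / (4 * (c + 1))) \<le> \<eta> / 4" if "0 \<le> c" for c :: real
        using that \<eta> by (simp add: field_simps)
      have "2 * (bh_const * (2 ^ CARD('d) * ?Y)) = local_const * scale"
        unfolding local_const_def scale_def by (simp add: power2_eq_square)
      then show "2 * (R * (\<eta> / (4 * (R + 1)))) + 2 * (bh_const * (2 ^ CARD('d) * ?Y + \<eta> / (4 * (bh_const + 1)))) \<le> local_const * scale + \<eta>"
        using a[OF R(1)] a[OF bh_const_nonneg] by (simp only: distrib_left)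
    qed
    finally show "(\<integral>\<^sup>+x. ennreal ((?F x - p x)\<^sup>2) \<partial>lborel_on ?K) \<le> ennreal (local_const * scale + \<eta>)" .
  qed
qed

text \<open>The polynomial for \<open>t = 1/2\<close> serves all \<open>t < 1\<close>, since polynomials on \<open>Dhat\<close> are controlled
  by their values on the half-size simplex.\<close>

lemma poly_approx:
  assumes \<eta>: "0 < \<eta>"
  obtains p where "poly_deg_le N p"
    "(\<integral>\<^sup>+x. ennreal ((W (\<Phi> x) * V (\<Phi> x) - p x)\<^sup>2) \<partial>lborel_on Dhat)
      \<le> ennreal ((2 + 8 * Ce) * (local_const * scale + \<eta>))"
proof -
  let ?F = "\<lambda>x. W (\<Phi> x) * V (\<Phi> x)" and ?K = "\<lambda>t. dilate x0 t ` Dhat" and ?E = "local_const * scale + \<eta>"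
  have E0: "0 \<le> ?E" using local_const_nonneg scale_nonneg \<eta> by simp
  have x0D: "x0 \<in> Dhat" using x0 interior_subset by blast
  have Kb: "?K t \<in> sets borel" for t by (rule borel_compact[OF compact_dilate[OF compact_Dhat]])
  have KD: "?K t \<subseteq> Dhat" if "0 < t" "t < 1" for t using dilate_subset_interior[OF that] interior_subset by blast
  obtain p where p: "poly_deg_le N p" "(\<integral>\<^sup>+x. ennreal ((?F x - p x)\<^sup>2) \<partial>lborel_on (?K (1/2))) \<le> ennreal ?E"
    using poly_approx_dilate[of "1/2" \<eta>] \<eta> by auto
  have bound: "(\<integral>\<^sup>+x. ennreal ((?F x - p x)\<^sup>2) \<partial>lborel_on (?K t)) \<le> ennreal ((2 + 8 * Ce) * ?E)"
    if t: "1/2 \<le> t" "t < 1" for t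
  proof -
    have t0: "0 < t" using t by simp
    obtain q where q: "poly_deg_le N q" "(\<integral>\<^sup>+x. ennreal ((?F x - q x)\<^sup>2) \<partial>lborel_on (?K t)) \<le> ennreal ?E"
      using poly_approx_dilate[OF t0 t(2) \<eta>] by blast
    \<comment> \<open>Both \<open>p\<close> and \<open>q\<close> approximate on the half-size copy,
      so \<open>q - p\<close> is small there, and by extrapolation on all of
      \<open>Dhat\<close>.\<close>
    have half: "?K (1/2) \<subseteq> ?K t"
      using dilate_mem[OF convex_Dhat x0D, of _ "1/2" t] t by auto
    have m: "?F \<in> borel_measurable (lborel_on (?K s))" if "0 < s" "s < 1" for s
      by (rule F_measurable_subset[OF KD[OF that]])
    have mp: "p \<in> borel_measurable (lborel_on S)" "q \<in> borel_measurable (lborel_on S)" for S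
      by (intro continuous_lborel_on continuous_on_poly_deg_le[OF p(1)] continuous_on_poly_deg_le[OF q(1)])+
    have "(\<integral>\<^sup>+x. ennreal ((?F x - q x)\<^sup>2) \<partial>lborel_on (?K (1/2))) \<le> ennreal ?E"
      by (rule order_trans[OF nn_integral_lborel_on_mono_set[OF half Kb Kb] q(2)])
    then have "(\<integral>\<^sup>+x. ennreal ((q x - ?F x)\<^sup>2) \<partial>lborel_on (?K (1/2))) \<le> ennreal ?E"
      by (simp add: power2_commute)
    from nn_integral_sq_diff_le[OF mp(2) m mp(1) E0 E0 this p(2)]
    have 1: "(\<integral>\<^sup>+x. ennreal ((q x - p x)\<^sup>2) \<partial>lborel_on (?K (1/2))) \<le> ennreal (2 * ?E + 2 * ?E)" by simp
    have "(\<integral>\<^sup>+x. ennreal ((q x - p x)\<^sup>2) \<partial>lborel_on (?K t)) \<le> (\<integral>\<^sup>+x. ennreal ((q x - p x)\<^sup>2) \<partial>lborel_on Dhat)"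
      by (rule nn_integral_lborel_on_mono_set[OF KD[OF t0 t(2)] Kb Dhat_borel])
    also have "\<dots> \<le> ennreal Ce * (\<integral>\<^sup>+x. ennreal ((q x - p x)\<^sup>2) \<partial>lborel_on (?K (1/2)))"
      by (rule extrapolation[OF poly_deg_le_diff[OF q(1) p(1)]])
    also have "\<dots> \<le> ennreal Ce * ennreal (2 * ?E + 2 * ?E)" using 1 by (rule mult_left_mono) simp
    also have "\<dots> = ennreal (Ce * (4 * ?E))" using Ce E0 by (simp add: ennreal_mult)
    finally have 2: "(\<integral>\<^sup>+x. ennreal ((q x - p x)\<^sup>2) \<partial>lborel_on (?K t)) \<le> ennreal (Ce * (4 * ?E))" .
    have "0 \<le> Ce * (4 * ?E)" using Ce E0 by simp
    from nn_integral_sq_diff_le[OF m[OF t0 t(2)] mp(2) mp(1) E0 this q(2) 2]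
    have "(\<integral>\<^sup>+x. ennreal ((?F x - p x)\<^sup>2) \<partial>lborel_on (?K t)) \<le> ennreal (2 * ?E + 2 * (Ce * (4 * ?E)))" .
    also have "2 * ?E + 2 * (Ce * (4 * ?E)) = (2 + 8 * Ce) * ?E" by (simp add: distrib_right)
    finally show ?thesis .
  qed
  \<comment> \<open>Increasing to 1 and starting at \<open>1/2\<close>, where \<open>bound\<close>
    begins to apply; hence the two successors.\<close>
  define T where "T n = 1 - inverse (real (Suc (Suc n)))" for n
  have T: "1/2 \<le> T n" "T n < 1" "0 < T n" for n
    by (auto simp: T_def field_simps)
  have inc: "?K (T m) \<subseteq> ?K (T n)" if "m \<le> n" for m n
  proof -
    have "T m \<le> T n" using that by (auto simp: T_def field_simps)
    then show ?thesis using dilate_mem[OF convex_Dhat x0D, of _ "T m" "T n"] T(3)[of m] T(3)[of n] by auto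
  qed
  have cover: "\<exists>n. x \<in> ?K (T n)" if x: "x \<in> interior Dhat" for x
  proof -
    have "(\<lambda>n. dilate x0 (1 / T n) x) \<longlonglongrightarrow> dilate x0 (1 / (1 - 0)) x"
      unfolding dilate_def T_def by (intro tendsto_intros LIMSEQ_Suc[OF LIMSEQ_inverse_real_of_nat]) simp
    then have "\<forall>\<^sub>F n in sequentially. dilate x0 (1 / T n) x \<in> interior Dhat"
      using topological_tendstoD[OF _ open_interior, of "\<lambda>n. dilate x0 (1 / T n) x" x sequentially Dhat] x
      by (simp add: dilate_def)
    then obtain n where "dilate x0 (1 / T n) x \<in> interior Dhat" using eventually_happens by fastforce
    moreover have "x = dilate x0 (T n) (dilate x0 (1 / T n) x)" using T(3)[of n] by (simp add: dilate_def)
    ultimately show ?thesis using interior_subset by blast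
  qed
  have mF: "(\<lambda>x. ennreal ((?F x - p x)\<^sup>2)) \<in> borel_measurable (lborel_on Dhat)"
    using F_measurable continuous_lborel_on[OF continuous_on_poly_deg_le[OF p(1)], of Dhat] by measurable
  then have mF': "(\<lambda>x. ennreal ((?F x - p x)\<^sup>2) * indicator Dhat x) \<in> borel_measurable lborel"
    by (subst (asm) borel_measurable_restrict_space_iff_ennreal) auto
  have eqK: "(\<lambda>x. ennreal ((?F x - p x)\<^sup>2) * indicator (?K (T n)) x)
      = (\<lambda>x. ennreal ((?F x - p x)\<^sup>2) * indicator Dhat x * indicator (?K (T n)) x)" for n
    using KD[OF T(3,2)] by (auto simp: fun_eq_iff indicator_def)
  show ?thesis
  proof (rule that[OF p(1)])
    \<comment> \<open>The copies exhaust only the interior of \<open>Dhat\<close>; the frontier of a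
      convex set is negligible.\<close>
    have "AE x in lborel. x \<notin> frontier Dhat"
      using negligible_convex_frontier[OF convex_Dhat] frontier_closed[of Dhat]
      by (intro AE_not_in) (auto simp: negligible_iff_null_sets null_sets_completion_iff)
    then have "AE x in lborel. ennreal ((?F x - p x)\<^sup>2) * indicator Dhat x
      \<le> (SUP n. ennreal ((?F x - p x)\<^sup>2) * indicator (?K (T n)) x)"
    proof eventually_elim
      fix x assume "x \<notin> frontier Dhat"
      show "ennreal ((?F x - p x)\<^sup>2) * indicator Dhat x \<le> (SUP n. ennreal ((?F x - p x)\<^sup>2) * indicator (?K (T n)) x)"
      proof (cases "x \<in> Dhat")
        case True
        then have "x \<in> interior Dhat" using \<open>x \<notin> frontier Dhat\<close> closure_subset by (auto simp: frontier_def)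
        then obtain n where "x \<in> ?K (T n)" using cover by blast
        then show ?thesis by (intro SUP_upper2[of n]) (simp_all add: True)
      qed simp
    qed
    then have "(\<integral>\<^sup>+x. ennreal ((?F x - p x)\<^sup>2) \<partial>lborel_on Dhat)
      \<le> (\<integral>\<^sup>+x. (SUP n. ennreal ((?F x - p x)\<^sup>2) * indicator (?K (T n)) x) \<partial>lborel)"
      unfolding nn_integral_lborel_on[OF Dhat_borel] by (rule nn_integral_mono_AE)
    also have "\<dots> = (SUP n. (\<integral>\<^sup>+x. ennreal ((?F x - p x)\<^sup>2) * indicator (?K (T n)) x \<partial>lborel))"
    proof (rule nn_integral_monotone_convergence_SUP)
      show "incseq (\<lambda>n x. ennreal ((?F x - p x)\<^sup>2) * indicator (?K (T n)) x)"
        using inc by (auto simp: incseq_def le_fun_def indicator_def)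
      show "(\<lambda>x. ennreal ((?F x - p x)\<^sup>2) * indicator (?K (T n)) x) \<in> borel_measurable lborel" for n
        unfolding eqK using mF' Kb by measurable
    qed
    also have "\<dots> \<le> ennreal ((2 + 8 * Ce) * ?E)"
      using bound[OF T(1,2)] unfolding nn_integral_lborel_on[OF Kb] by (intro SUP_least) auto
    finally show "(\<integral>\<^sup>+x. ennreal ((?F x - p x)\<^sup>2) \<partial>lborel_on Dhat) \<le> ennreal ((2 + 8 * Ce) * ?E)" .
  qed
qed

end

section \<open>The estimate for weakly differentiable factors\<close>

lemma nn_integral_lebesgue_on:
  fixes f :: "real ^ 'd::finite \<Rightarrow> ennreal"
  assumes "S \<in> sets borel"
  shows "(\<integral>\<^sup>+x. f x \<partial>lebesgue_on S) = (\<integral>\<^sup>+x. f x \<partial>lborel_on S)"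
  using assms
  by (simp add: nn_integral_restrict_space sets_completionI_sets nn_integral_completion)

lemma AE_lebesgue_on_iff:
  fixes P :: "real ^ 'd::finite \<Rightarrow> bool"
  assumes "S \<in> sets borel"
  shows "(AE x in lebesgue_on S. P x) \<longleftrightarrow> (AE x in lborel. x \<in> S \<longrightarrow> P x)"
proof -
  have "(AE x in lebesgue_on S. P x) \<longleftrightarrow> (AE x in lebesgue. x \<in> S \<longrightarrow> P x)"
    using assms by (intro AE_restrict_space_iff) (simp add: sets_completionI_sets)
  then show ?thesis by (simp add: AE_completion_iff)
qed

lemma borel_rep_nn_integral:
  fixes f :: "real ^ 'd::finite \<Rightarrow> real"
  assumes "\<Omega> \<in> sets borel" "borel_rep \<Omega> f F"
  shows "(\<integral>\<^sup>+x. ennreal ((F x)\<^sup>2) \<partial>lborel) = (\<integral>\<^sup>+x. ennreal ((f x)\<^sup>2) \<partial>lebesgue_on \<Omega>)"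
proof -
  have "(\<integral>\<^sup>+x. ennreal ((F x)\<^sup>2) \<partial>lborel) = (\<integral>\<^sup>+x. ennreal ((f x)\<^sup>2) * indicator \<Omega> x \<partial>lborel)"
    using borel_rep_AE[OF assms(2)]
    by (intro nn_integral_cong_AE) (auto elim!: eventually_mono simp: indicator_def)
  then show ?thesis using assms(1) by (simp add: nn_integral_lebesgue_on nn_integral_lborel_on)
qed

text \<open>The mollification lemmas ask for integrability, which on a bounded set follows from
  square integrability.\<close>

lemma integrable_if_square_finite:
  fixes F :: "real ^ 'd::finite \<Rightarrow> real"
  assumes [measurable]: "F \<in> borel_measurable borel" "S \<in> sets borel" and S: "bounded S" "\<And>x. x \<notin> S \<Longrightarrow> F x = 0"
    and F: "(\<integral>\<^sup>+x. ennreal ((F x)\<^sup>2) \<partial>lborel) < \<infinity>"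
  shows "integrable lborel F"
proof -
  have "integrable lborel (\<lambda>x. (F x)\<^sup>2)" using F by (intro integrableI_nonneg) auto
  moreover have "integrable lborel (indicator S :: _ \<Rightarrow> real)"
    using emeasure_bounded_finite[OF S(1)] by (intro integrable_real_indicator) auto
  ultimately have "integrable lborel (\<lambda>x. indicator S x + (F x)\<^sup>2)" by (intro Bochner_Integration.integrable_add)
  then show ?thesis
  proof (rule Bochner_Integration.integrable_bound)
    have "\<bar>F x\<bar> \<le> indicator S x + (F x)\<^sup>2" for x
    proof (cases "x \<in> S")
      case True
      have "2 * \<bar>F x\<bar> \<le> 1 + (F x)\<^sup>2" using zero_le_power2[of "\<bar>F x\<bar> - 1"] by (simp add: power2_diff)
      then have "\<bar>F x\<bar> \<le> 1 + (F x)\<^sup>2" using zero_le_power2[of "F x"] by linarith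
      then show ?thesis using True by simp
    qed (simp add: S)
    then show "AE x in lborel. norm (F x) \<le> norm (indicator S x + (F x)\<^sup>2)" by (auto intro!: AE_I2 simp: add_nonneg_nonneg)
  qed simp
qed

lemma square_finite_if_bounded:
  fixes F :: "real ^ 'd::finite \<Rightarrow> real"
  assumes "S \<in> sets borel" "bounded S" "\<And>x. x \<notin> S \<Longrightarrow> F x = 0" "AE x in lborel. \<bar>F x\<bar> \<le> B"
  shows "(\<integral>\<^sup>+x. ennreal ((F x)\<^sup>2) \<partial>lborel) < \<infinity>"
proof -
  have "(\<integral>\<^sup>+x. ennreal ((F x)\<^sup>2) \<partial>lborel) \<le> (\<integral>\<^sup>+x. ennreal (B\<^sup>2) * indicator S x \<partial>lborel)"
  proof (rule nn_integral_mono_AE, use assms(4) in eventually_elim)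
    fix x assume "\<bar>F x\<bar> \<le> B"
    then have "(F x)\<^sup>2 \<le> B\<^sup>2" by (simp add: abs_le_square_iff[symmetric])
    then show "ennreal ((F x)\<^sup>2) \<le> ennreal (B\<^sup>2) * indicator S x"
      using assms(3)[of x] by (auto simp: indicator_def ennreal_leI)
  qed
  also have "\<dots> = ennreal (B\<^sup>2) * emeasure lborel S" by (rule nn_integral_cmult_indicator) (use assms in simp)
  also have "\<dots> < \<infinity>" using emeasure_bounded_finite[OF assms(2)] by (simp add: ennreal_mult_less_top)
  finally show ?thesis .
qed

lemma borel_rep_bounded:
  assumes "\<Omega> \<in> sets borel" "borel_rep \<Omega> f F" "AE x in lborel. x \<in> \<Omega> \<longrightarrow> \<bar>f x\<bar> \<le> B" "0 \<le> B"
  shows "AE x in lborel. \<bar>F x\<bar> \<le> B"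
  using borel_rep_AE[OF assms(2)] assms(3) by eventually_elim (use assms(4) in \<open>auto simp: indicator_def\<close>)

context scaled_element
begin

text \<open>Borel representatives that vanish outside the open element may lose differentiability
  across its boundary. But derivatives of mollifications are evaluated only where the
  \<open>e\<close>-ball stays inside, and the L2 estimates tolerate the jump.\<close>

lemma poly_approx_weak:
  assumes w: "w \<in> sobolev_inf (Suc N) (interior D)" and v: "v \<in> sobolev_2 (Suc N) (interior D)"
    and B: "0 \<le> B" "\<And>\<alpha>. mi_order \<alpha> \<le> Suc N \<Longrightarrow>
      AE x in lborel. x \<in> interior D \<longrightarrow> \<bar>weak_deriv (interior D) \<alpha> w x\<bar> \<le> B"
    and V2: "0 \<le> V2" "\<And>\<alpha>. mi_order \<alpha> \<le> Suc N \<Longrightarrow> (L2_norm (interior D) (weak_deriv (interior D) \<alpha> v))\<^sup>2 \<le> V2"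
    and R: "0 \<le> R" "AE y in lborel. y \<in> D \<longrightarrow> 1 / J y \<le> R" and \<eta>: "0 < \<eta>"
  obtains W V p where "W \<in> borel_measurable borel" "V \<in> borel_measurable borel"
    "AE x in lborel. x \<in> interior D \<longrightarrow> W x = w x" "AE x in lborel. x \<in> interior D \<longrightarrow> V x = v x"
    "AE x in lborel. \<bar>W x\<bar> \<le> B" "(\<integral>\<^sup>+x. ennreal ((V x)\<^sup>2) \<partial>lborel) \<le> ennreal V2" "poly_deg_le N p"
    "(\<integral>\<^sup>+x. ennreal ((W (\<Phi> x) * V (\<Phi> x) - p x)\<^sup>2) \<partial>lborel_on Dhat)
      \<le> ennreal ((2 + 8 * Ce) * (local_const * (B\<^sup>2 * R * V2 * (H ^ Suc N)\<^sup>2) + \<eta>))"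
proof -
  let ?\<Omega> = "interior D"
  have \<Omega>: "open ?\<Omega>" "?\<Omega> \<in> sets borel" "bounded ?\<Omega>"
    using bounded_subset[OF compact_imp_bounded[OF compact_D] interior_subset] by auto
  have wd: "is_weak_deriv ?\<Omega> \<alpha> w (weak_deriv ?\<Omega> \<alpha> w)" if "mi_order \<alpha> \<le> Suc N" for \<alpha>
    using w that weak_deriv_AE_eq(1)[OF \<Omega>(1)] unfolding sobolev_inf_def by blast
  have vd: "is_weak_deriv ?\<Omega> \<alpha> v (weak_deriv ?\<Omega> \<alpha> v)"
    and vL2: "(\<integral>\<^sup>+x. ennreal ((weak_deriv ?\<Omega> \<alpha> v x)\<^sup>2) \<partial>lebesgue_on ?\<Omega>) \<le> ennreal V2" if \<alpha>: "mi_order \<alpha> \<le> Suc N" for \<alpha>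
  proof -
    obtain g where g: "is_weak_deriv ?\<Omega> \<alpha> v g" "square_integrable ?\<Omega> g" using v \<alpha> unfolding sobolev_2_def by blast
    show vd: "is_weak_deriv ?\<Omega> \<alpha> v (weak_deriv ?\<Omega> \<alpha> v)" by (rule weak_deriv_AE_eq(1)[OF \<Omega>(1) g(1)])
    let ?v = "weak_deriv ?\<Omega> \<alpha> v"
    have m: "?v \<in> borel_measurable (lebesgue_on ?\<Omega>)"
      by (rule locally_integrable_measurable[OF \<Omega>(1) weak_deriv_locally_integrable(2)[OF vd]])
    have ae: "AE x in lebesgue_on ?\<Omega>. (g x)\<^sup>2 = (?v x)\<^sup>2"
      unfolding AE_lebesgue_on_iff[OF \<Omega>(2)] using weak_deriv_AE_eq(2)[OF \<Omega>(1) g(1)] by eventually_elim simp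
    have "integrable (lebesgue_on ?\<Omega>) (\<lambda>x. (?v x)\<^sup>2)"
      by (rule integrable_cong_AE_imp[OF _ _ ae]) (use g(2) m in \<open>auto simp: square_integrable_def\<close>)
    then have "(\<integral>\<^sup>+x. ennreal ((?v x)\<^sup>2) \<partial>lebesgue_on ?\<Omega>) = ennreal (\<integral>x. (?v x)\<^sup>2 \<partial>lebesgue_on ?\<Omega>)"
      by (intro nn_integral_eq_integral) auto
    also have "(\<integral>x. (?v x)\<^sup>2 \<partial>lebesgue_on ?\<Omega>) = (L2_norm ?\<Omega> ?v)\<^sup>2" by (simp add: L2_norm_def)
    finally show "(\<integral>\<^sup>+x. ennreal ((?v x)\<^sup>2) \<partial>lebesgue_on ?\<Omega>) \<le> ennreal V2"
      using V2(2)[OF \<alpha>] by (simp add: ennreal_leI)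
  qed
  have zero: "mi_order (\<lambda>_ :: 'd. 0) \<le> Suc N" by (simp add: mi_order_def)
  note li = weak_deriv_locally_integrable(1)[OF wd[OF zero]] weak_deriv_locally_integrable(1)[OF vd[OF zero]]
  have w0: "AE x in lborel. x \<in> ?\<Omega> \<longrightarrow> weak_deriv ?\<Omega> (\<lambda>_. 0) w x = w x"
    by (rule weak_deriv_AE_eq(2)[OF \<Omega>(1) is_weak_deriv_0[OF li(1)]])
  have v0: "AE x in lborel. x \<in> ?\<Omega> \<longrightarrow> weak_deriv ?\<Omega> (\<lambda>_. 0) v x = v x"
    by (rule weak_deriv_AE_eq(2)[OF \<Omega>(1) is_weak_deriv_0[OF li(2)]])
  obtain W where W: "borel_rep ?\<Omega> w W" and repW: "borel_rep ?\<Omega> w W"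
    using borel_rep_exists[OF \<Omega>(2) locally_integrable_measurable[OF \<Omega>(1) li(1)]] by blast
  obtain V where V: "borel_rep ?\<Omega> v V" and repV: "borel_rep ?\<Omega> v V"
    using borel_rep_exists[OF \<Omega>(2) locally_integrable_measurable[OF \<Omega>(1) li(2)]] by blast
  have "\<exists>F. borel_rep ?\<Omega> (weak_deriv ?\<Omega> (count_list ys) w) F" if "length ys \<le> Suc N" for ys
    using borel_rep_exists[OF \<Omega>(2) locally_integrable_measurable[OF \<Omega>(1) weak_deriv_locally_integrable(2)[OF wd]]] that
    by (metis mi_order_count_list)
  then obtain Wd where Wd: "\<And>ys. length ys \<le> Suc N \<Longrightarrow> borel_rep ?\<Omega> (weak_deriv ?\<Omega> (count_list ys) w) (Wd ys)" by metis
  have "\<exists>F. borel_rep ?\<Omega> (weak_deriv ?\<Omega> (count_list ys) v) F" if "length ys \<le> Suc N" for ys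
    using borel_rep_exists[OF \<Omega>(2) locally_integrable_measurable[OF \<Omega>(1) weak_deriv_locally_integrable(2)[OF vd]]] that
    by (metis mi_order_count_list)
  then obtain Vd where Vd: "\<And>ys. length ys \<le> Suc N \<Longrightarrow> borel_rep ?\<Omega> (weak_deriv ?\<Omega> (count_list ys) v) (Vd ys)" by metis
  have rep0: "F x = 0" if "borel_rep ?\<Omega> f F" "x \<notin> ?\<Omega>" for f F x using that by (simp add: borel_rep_def)
  have WB: "AE x in lborel. \<bar>W x\<bar> \<le> B"
  proof (rule borel_rep_bounded[OF \<Omega>(2) W _ B(1)])
    show "AE x in lborel. x \<in> ?\<Omega> \<longrightarrow> \<bar>w x\<bar> \<le> B" using w0 B(2)[OF zero] by eventually_elim auto
  qed
  have WdB: "AE x in lborel. \<bar>Wd ys x\<bar> \<le> B" if "length ys \<le> Suc N" for ys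
    using borel_rep_bounded[OF \<Omega>(2) Wd[OF that] B(2) B(1)] that by simp
  have int: "integrable lborel F" if "borel_rep ?\<Omega> f F" "(\<integral>\<^sup>+x. ennreal ((F x)\<^sup>2) \<partial>lborel) < \<infinity>" for f F
    using integrable_if_square_finite[OF borel_rep_measurable[OF that(1)] \<Omega>(2,3) rep0[OF that(1)] that(2)] .
  have fin: "(\<integral>\<^sup>+x. ennreal ((F x)\<^sup>2) \<partial>lborel) < \<infinity>" if "borel_rep ?\<Omega> f F" "AE x in lborel. \<bar>F x\<bar> \<le> B" for f F
    using square_finite_if_bounded[OF \<Omega>(2,3) rep0[OF that(1)] that(2)] .
  have VdL2: "(\<integral>\<^sup>+x. ennreal ((Vd ys x)\<^sup>2) \<partial>lborel) \<le> ennreal V2" if "length ys \<le> Suc N" for ys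
    using borel_rep_nn_integral[OF \<Omega>(2) Vd[OF that]] vL2[of "count_list ys"] that by simp
  have VL2: "(\<integral>\<^sup>+x. ennreal ((V x)\<^sup>2) \<partial>lborel) \<le> ennreal V2"
  proof -
    have "(\<integral>\<^sup>+x. ennreal ((V x)\<^sup>2) \<partial>lborel) = (\<integral>\<^sup>+x. ennreal ((v x)\<^sup>2) \<partial>lebesgue_on ?\<Omega>)"
      by (rule borel_rep_nn_integral[OF \<Omega>(2) V])
    also have "\<dots> = (\<integral>\<^sup>+x. ennreal ((weak_deriv ?\<Omega> (\<lambda>_. 0) v x)\<^sup>2) \<partial>lebesgue_on ?\<Omega>)"
    proof (rule nn_integral_cong_AE)
      show "AE x in lebesgue_on ?\<Omega>. ennreal ((v x)\<^sup>2) = ennreal ((weak_deriv ?\<Omega> (\<lambda>_. 0) v x)\<^sup>2)"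
        unfolding AE_lebesgue_on_iff[OF \<Omega>(2)] using v0 by eventually_elim simp
    qed
    also have "\<dots> \<le> ennreal V2" by (rule vL2[OF zero])
    finally show ?thesis .
  qed
  have lt: "x < \<infinity>" if "x \<le> ennreal V2" for x using that by (metis ennreal_less_top infinity_ennreal_def le_less_trans)
  interpret weight_times_function Dhat U \<Phi> x0 N H Kc Ce W V Wd Vd B V2 R
  proof unfold_locales
    show "integrable lborel W" by (rule int[OF W fin[OF W WB]])
    show "integrable lborel V" by (rule int[OF V lt[OF VL2]])
    show "(\<integral>\<^sup>+x. ennreal ((W x)\<^sup>2) \<partial>lborel) < \<infinity>" by (rule fin[OF W WB])
    show "(\<integral>\<^sup>+x. ennreal ((V x)\<^sup>2) \<partial>lborel) < \<infinity>" by (rule lt[OF VL2])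
    fix ys :: "'d list" assume ys: "length ys \<le> Suc N"
    then have mi: "mi_order (count_list ys) \<le> Suc N" by simp
    show "integrable lborel (Wd ys)" by (rule int[OF Wd[OF ys] fin[OF Wd[OF ys] WdB[OF ys]]])
    show "integrable lborel (Vd ys)" by (rule int[OF Vd[OF ys] lt[OF VdL2[OF ys]]])
    show "AE x in lborel. \<bar>Wd ys x\<bar> \<le> B" by (rule WdB[OF ys])
    show "(\<integral>\<^sup>+x. ennreal ((Vd ys x)\<^sup>2) \<partial>lborel) \<le> ennreal V2" by (rule VdL2[OF ys])
    fix e z assume e: "0 < e" "cball z e \<subseteq> ?\<Omega>"
    show "derivs ys (conv (mollifier e) W) z = conv (mollifier e) (Wd ys) z"
      by (rule derivs_mollify[OF \<Omega>(1) wd[OF mi] W int[OF W fin[OF W WB]] Wd[OF ys] e])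
    show "derivs ys (conv (mollifier e) V) z = conv (mollifier e) (Vd ys) z"
      by (rule derivs_mollify[OF \<Omega>(1) vd[OF mi] V int[OF V lt[OF VL2]] Vd[OF ys] e])
  qed (use WB B(1) V2(1) R in auto)
  obtain p where p: "poly_deg_le N p"
    "(\<integral>\<^sup>+x. ennreal ((W (\<Phi> x) * V (\<Phi> x) - p x)\<^sup>2) \<partial>lborel_on Dhat) \<le> ennreal ((2 + 8 * Ce) * (local_const * scale + \<eta>))"
    using poly_approx[OF \<eta>] by blast
  show ?thesis
  proof (rule that[OF _ _ _ _ WB VL2 p(1)])
    show "(\<integral>\<^sup>+x. ennreal ((W (\<Phi> x) * V (\<Phi> x) - p x)\<^sup>2) \<partial>lborel_on Dhat)
      \<le> ennreal ((2 + 8 * Ce) * (local_const * (B\<^sup>2 * R * V2 * (H ^ Suc N)\<^sup>2) + \<eta>))"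
      using p(2) by (simp only: scale_def)
    show "W \<in> borel_measurable borel" "V \<in> borel_measurable borel"
      by (rule borel_rep_measurable[OF repW] borel_rep_measurable[OF repV])+
    show "AE x in lborel. x \<in> ?\<Omega> \<longrightarrow> W x = w x" using repW unfolding borel_rep_def by blast
    show "AE x in lborel. x \<in> ?\<Omega> \<longrightarrow> V x = v x" using repV unfolding borel_rep_def by blast
  qed
qed

end

section \<open>Symmetric positive definite matrices\<close>

lemma norm_matrix_vector_le: "norm ((A :: real ^ 'm::finite ^ 'm) *v y) \<le> spectral_norm A * norm y"
  unfolding spectral_norm_def by (rule onorm[OF matrix_vector_mul_bounded_linear])

lemma spectral_norm_nonneg: "0 \<le> spectral_norm (A :: real ^ 'm::finite ^ 'm)"
  unfolding spectral_norm_def by (rule onorm_pos_le[OF matrix_vector_mul_bounded_linear])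

lemma entry_eq_inner: "(A :: real ^ 'm::finite ^ 'm) $ i $ j = axis i 1 \<bullet> (A *v axis j 1)"
  by (simp add: inner_axis' matrix_vector_mult_basis column_def)

lemma abs_entry_le_spectral_norm: "\<bar>(A :: real ^ 'm::finite ^ 'm) $ i $ j\<bar> \<le> spectral_norm A"
proof -
  have "\<bar>A $ i $ j\<bar> \<le> norm (axis i 1 :: real ^ 'm) * norm (A *v axis j 1)"
    unfolding entry_eq_inner by (rule Cauchy_Schwarz_ineq2)
  also have "\<dots> \<le> spectral_norm A" using norm_matrix_vector_le[of A "axis j 1"] by simp
  finally show ?thesis .
qed

lemma abs_spectral_norm_diff_le:
  "\<bar>spectral_norm (A :: real ^ 'm::finite ^ 'm) - spectral_norm B\<bar> \<le> spectral_norm (A - B)"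
proof -
  have *: "spectral_norm A \<le> spectral_norm B + spectral_norm (A - B)" for A B :: "real ^ 'm ^ 'm"
  proof -
    have "onorm (\<lambda>y. B *v y + (A - B) *v y) \<le> onorm (\<lambda>y. B *v y) + onorm (\<lambda>y. (A - B) *v y)"
      by (rule onorm_triangle; rule matrix_vector_mul_bounded_linear)
    then show ?thesis by (simp add: spectral_norm_def flip: matrix_vector_mult_add_rdistrib)
  qed
  have "spectral_norm (B - A) = spectral_norm (A - B)"
  proof -
    have "(\<lambda>y. (B - A) *v y) = (\<lambda>y. - ((A - B) *v y))" by (simp add: fun_eq_iff matrix_vector_mult_diff_rdistrib)
    then show ?thesis by (simp add: spectral_norm_def onorm_neg)
  qed
  then show ?thesis using *[of A B] *[of B A] by linarith
qed

lemma spectral_norm_le_sum: "spectral_norm (A :: real ^ 'm::finite ^ 'm) \<le> (\<Sum>i\<in>UNIV. \<Sum>j\<in>UNIV. \<bar>A $ i $ j\<bar>)"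
  unfolding spectral_norm_def
proof (rule onorm_le)
  fix y :: "real ^ 'm"
  have "norm (A *v y) \<le> (\<Sum>i\<in>UNIV. \<bar>(A *v y) $ i\<bar>)" by (rule norm_le_l1_cart)
  also have "\<dots> \<le> (\<Sum>i\<in>UNIV. \<Sum>j\<in>UNIV. \<bar>A $ i $ j\<bar> * norm y)"
  proof (rule sum_mono)
    fix i
    have "\<bar>(A *v y) $ i\<bar> \<le> (\<Sum>j\<in>UNIV. \<bar>A $ i $ j * y $ j\<bar>)" by (simp add: matrix_vector_mult_def sum_abs)
    also have "\<dots> \<le> (\<Sum>j\<in>UNIV. \<bar>A $ i $ j\<bar> * norm y)"
      by (intro sum_mono) (simp add: abs_mult mult_left_mono component_le_norm_cart)
    finally show "\<bar>(A *v y) $ i\<bar> \<le> (\<Sum>j\<in>UNIV. \<bar>A $ i $ j\<bar> * norm y)" .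
  qed
  also have "\<dots> = (\<Sum>i\<in>UNIV. \<Sum>j\<in>UNIV. \<bar>A $ i $ j\<bar>) * norm y" by (simp add: sum_distrib_right)
  finally show "norm (A *v y) \<le> (\<Sum>i\<in>UNIV. \<Sum>j\<in>UNIV. \<bar>A $ i $ j\<bar>) * norm y" .
qed

text \<open>Serves measurability of the spectral norm of a measurable matrix function; the essential
  supremum of a nonmeasurable function is infinite.\<close>

lemma continuous_spectral_norm: "continuous_on UNIV (spectral_norm :: real ^ 'm::finite ^ 'm \<Rightarrow> real)"
  unfolding continuous_on_def
proof
  fix A :: "real ^ 'm ^ 'm"
  have "((\<lambda>B. \<Sum>i\<in>UNIV. \<Sum>j\<in>UNIV. \<bar>(B - A) $ i $ j\<bar>) \<longlongrightarrow> (\<Sum>i\<in>(UNIV::'m set). \<Sum>j\<in>(UNIV::'m set). \<bar>(A - A) $ i $ j\<bar>)) (at A)"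
    by (intro tendsto_intros)
  then have lim: "((\<lambda>B. \<Sum>i\<in>UNIV. \<Sum>j\<in>UNIV. \<bar>(B - A) $ i $ j\<bar>) \<longlongrightarrow> 0) (at A)" by simp
  have "((\<lambda>B. spectral_norm B - spectral_norm A) \<longlongrightarrow> 0) (at A)"
  proof (rule Lim_null_comparison[OF _ lim])
    have "norm (spectral_norm B - spectral_norm A) \<le> (\<Sum>i\<in>UNIV. \<Sum>j\<in>UNIV. \<bar>(B - A) $ i $ j\<bar>)" for B
      using order_trans[OF abs_spectral_norm_diff_le spectral_norm_le_sum, of B A] by simp
    then show "\<forall>\<^sub>F B in at A. norm (spectral_norm B - spectral_norm A) \<le> (\<Sum>i\<in>UNIV. \<Sum>j\<in>UNIV. \<bar>(B - A) $ i $ j\<bar>)"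
      by simp
  qed
  then show "(spectral_norm \<longlongrightarrow> spectral_norm A) (at A within UNIV)" by (rule LIM_zero_cancel)
qed

lemma sym_pos_def_inner: "sym_pos_def A \<Longrightarrow> a \<bullet> (A *v b) = (A *v a) \<bullet> b"
  unfolding sym_pos_def_def by (metis dot_lmul_matrix transpose_matrix_vector)

lemma sym_pos_def_invertible:
  assumes "sym_pos_def A"
  shows "invertible A"
  unfolding invertible_left_inverse matrix_left_invertible_ker
  using assms unfolding sym_pos_def_def by (metis inner_zero_right less_irrefl)

lemma sym_pos_def_inv_mult [simp]:
  assumes "sym_pos_def A"
  shows "A *v (matrix_inv A *v y) = y" "matrix_inv A *v (A *v y) = y"
proof -
  have "A ** matrix_inv A = mat 1 \<and> matrix_inv A ** A = mat 1"
    using sym_pos_def_invertible[OF assms] unfolding invertible_def matrix_inv_def by (rule someI_ex)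
  then show "A *v (matrix_inv A *v y) = y" "matrix_inv A *v (A *v y) = y"
    by (simp_all add: matrix_vector_mul_assoc)
qed

lemma sym_pos_def_inv_inner:
  assumes "sym_pos_def A"
  shows "a \<bullet> (matrix_inv A *v b) = (matrix_inv A *v a) \<bullet> b"
  using sym_pos_def_inner[OF assms, of "matrix_inv A *v a" "matrix_inv A *v b"] assms by simp

text \<open>Eigenvalues are avoided: with \<open>A z = y\<close> the form of \<open>A\<close> is
  nonnegative at \<open>z - t y\<close>, and \<open>t = 1 / spectral_norm A\<close> minimises the
  resulting upper bound in \<open>t\<close>.\<close>

lemma norm_sq_le_inv_form:
  assumes A: "sym_pos_def A"
  shows "(norm y)\<^sup>2 \<le> spectral_norm A * ((matrix_inv A *v y) \<bullet> y)"
proof -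
  define z where "z = matrix_inv A *v y"
  have y: "y = A *v z" using A by (simp add: z_def)
  have nn: "0 \<le> a \<bullet> (A *v a)" for a using A unfolding sym_pos_def_def by (cases "a = 0") (auto intro: less_imp_le)
  have s: "y \<bullet> (A *v z) = z \<bullet> (A *v y)" using sym_pos_def_inner[OF A, of z y] by (simp add: inner_commute)
  let ?p = "z \<bullet> (A *v z)" and ?q = "(norm y)\<^sup>2" and ?r = "y \<bullet> (A *v y)"
  have q: "z \<bullet> (A *v y) = ?q" "y \<bullet> (A *v z) = ?q" using s by (simp_all add: y[symmetric] power2_norm_eq_inner)
  have quad: "0 \<le> ?p - 2 * t * ?q + t\<^sup>2 * ?r" for t
  proof -
    have "(z - t *\<^sub>R y) \<bullet> (A *v (z - t *\<^sub>R y)) = ?p - 2 * t * ?q + t\<^sup>2 * ?r"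
      by (simp add: q matrix_vector_mult_diff_distrib matrix_vector_mult_scaleR inner_diff_left inner_diff_right
          power2_eq_square[of t] algebra_simps)
    then show ?thesis using nn by metis
  qed
  have r: "?r \<le> spectral_norm A * ?q"
  proof -
    have "?r \<le> norm y * norm (A *v y)" by (rule norm_cauchy_schwarz)
    also have "\<dots> \<le> norm y * (spectral_norm A * norm y)" by (intro mult_left_mono norm_matrix_vector_le) simp
    finally show ?thesis by (simp add: power2_eq_square ac_simps)
  qed
  show ?thesis
  proof (cases "y = 0")
    case False
    then have "y \<bullet> (A *v y) > 0" and q0: "?q > 0" using A by (auto simp: sym_pos_def_def)
    then have L: "spectral_norm A > 0" using r by (smt (verit) mult_nonpos_nonneg)
    let ?L = "spectral_norm A"
    have "0 \<le> ?p - 2 * (1 / ?L) * ?q + (1 / ?L)\<^sup>2 * (?L * ?q)"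
      using quad[of "1 / ?L"] mult_left_mono[OF r, of "(1 / ?L)\<^sup>2"] by (smt (verit) zero_le_power2)
    also have "\<dots> = ?p - ?q / ?L" using L by (simp add: power2_eq_square field_simps)
    finally have "?q \<le> ?L * ?p" using L by (simp add: field_simps)
    then show ?thesis by (simp add: z_def y[unfolded z_def, symmetric])
  qed simp
qed

lemma inv_form_le: "(matrix_inv A *v y) \<bullet> y \<le> spectral_norm (matrix_inv A) * (norm y)\<^sup>2"
proof -
  have "(matrix_inv A *v y) \<bullet> y \<le> norm (matrix_inv A *v y) * norm y" by (rule norm_cauchy_schwarz)
  also have "\<dots> \<le> (spectral_norm (matrix_inv A) * norm y) * norm y" by (intro mult_right_mono norm_matrix_vector_le) simp
  finally show ?thesis by (simp add: power2_eq_square ac_simps)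
qed

text \<open>Lets the square root of \<open>w_max * wt_max\<close> that quasi-optimality produces be
  replaced by the product itself.\<close>

lemma spectral_norm_mult_inv_ge_1:
  assumes A: "sym_pos_def (A :: real ^ 'm::finite ^ 'm)"
  shows "1 \<le> spectral_norm A * spectral_norm (matrix_inv A)"
proof -
  define y :: "real ^ 'm" where "y = axis undefined 1"
  have "norm y = norm (A *v (matrix_inv A *v y))" using A by simp
  also have "\<dots> \<le> spectral_norm A * (spectral_norm (matrix_inv A) * norm y)"
    by (rule order_trans[OF norm_matrix_vector_le]) (intro mult_left_mono norm_matrix_vector_le spectral_norm_nonneg)
  finally show ?thesis by (simp add: y_def)
qed

text \<open>Cramer's rule writes the inverse as a quotient of determinants, from which its
  measurability is immediate.\<close>

lemma matrix_inv_entry: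
  assumes A: "sym_pos_def (A :: real ^ 'm::finite ^ 'm)"
  shows "matrix_inv A $ i $ j = det (\<chi> k l. if l = i then axis j 1 $ k else A $ k $ l) / det A"
proof -
  have "det A \<noteq> 0" using sym_pos_def_invertible[OF A] by (simp add: invertible_det_nz)
  then have "matrix_inv A *v axis j 1 = (\<chi> i. det (\<chi> k l. if l = i then axis j 1 $ k else A $ k $ l) / det A)"
    using cramer[of A "matrix_inv A *v axis j 1" "axis j 1"] A by simp
  then have "(matrix_inv A *v axis j 1) $ i = det (\<chi> k l. if l = i then axis j 1 $ k else A $ k $ l) / det A" by simp
  then show ?thesis by (simp add: matrix_vector_mult_basis column_def)
qed

lemma borel_measurable_det:
  fixes F :: "'a \<Rightarrow> real ^ 'm::finite ^ 'm"
  assumes "\<And>i j. (\<lambda>x. F x $ i $ j) \<in> borel_measurable M"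
  shows "(\<lambda>x. det (F x)) \<in> borel_measurable M"
  unfolding det_def using assms by (intro borel_measurable_sum borel_measurable_times borel_measurable_prod) auto

lemma borel_measurable_matrix_inv:
  fixes F :: "'a \<Rightarrow> real ^ 'm::finite ^ 'm"
  assumes F: "\<And>i j. (\<lambda>x. F x $ i $ j) \<in> borel_measurable M" and spd: "\<And>x. x \<in> space M \<Longrightarrow> sym_pos_def (F x)"
  shows "(\<lambda>x. matrix_inv (F x) $ i $ j) \<in> borel_measurable M"
proof -
  have "(\<lambda>x. det (\<chi> k l. if l = i then axis j 1 $ k else F x $ k $ l)) \<in> borel_measurable M"
  proof (rule borel_measurable_det)
    fix k l
    show "(\<lambda>x. (\<chi> k l. if l = i then axis j 1 $ k else F x $ k $ l) $ k $ l) \<in> borel_measurable M"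
      using F by (cases "l = i") simp_all
  qed
  then have "(\<lambda>x. det (\<chi> k l. if l = i then axis j 1 $ k else F x $ k $ l) / det (F x)) \<in> borel_measurable M"
    by (rule borel_measurable_divide[OF _ borel_measurable_det[OF F]])
  then show ?thesis
    by (rule measurable_cong[THEN iffD1, rotated]) (use matrix_inv_entry[OF spd] in auto)
qed

lemma borel_measurable_matrix:
  fixes F :: "'a \<Rightarrow> real ^ 'm::finite ^ 'm"
  assumes "\<And>i j. (\<lambda>x. F x $ i $ j) \<in> borel_measurable M"
  shows "F \<in> borel_measurable M"
proof -
  have "F = (\<lambda>x. \<Sum>i\<in>UNIV. \<Sum>j\<in>UNIV. F x $ i $ j *\<^sub>R (\<chi> k l. if k = i then if l = j then 1 else 0 else 0))"
  proof (intro ext, unfold vec_eq_iff, intro allI)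
    fix x k l
    have "(\<Sum>i\<in>UNIV. \<Sum>j\<in>UNIV. F x $ i $ j *\<^sub>R ((\<chi> k l. if k = i then if l = j then 1 else 0 else 0) :: real ^ 'm ^ 'm)) $ k $ l
      = (\<Sum>i\<in>UNIV. if k = i then (\<Sum>j\<in>UNIV. if l = j then F x $ i $ j else 0) else 0)"
      unfolding sum_component by (intro sum.cong refl) (auto simp: if_distrib[of "\<lambda>t. _ * t"] cong: if_cong)
    then show "F x $ k $ l = (\<Sum>i\<in>UNIV. \<Sum>j\<in>UNIV. F x $ i $ j *\<^sub>R (\<chi> k l. if k = i then if l = j then 1 else 0 else 0)) $ k $ l"
      by simp
  qed
  moreover have "(\<lambda>x. \<Sum>i\<in>UNIV. \<Sum>j\<in>UNIV. F x $ i $ j *\<^sub>R ((\<chi> k l. if k = i then if l = j then 1 else 0 else 0) :: real ^ 'm ^ 'm))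
      \<in> borel_measurable M"
    using assms by (intro borel_measurable_sum borel_measurable_scaleR) auto
  ultimately show ?thesis by simp
qed

section \<open>Orthogonal projection onto a finitely generated space of functions\<close>

text \<open>Gram-Schmidt as an induction over \<open>B\<close>, for a form that is only
  semidefinite. The second conclusion replaces membership of \<open>u\<close> in the span of
  \<open>B\<close>: whatever is orthogonal to \<open>B\<close> is orthogonal to
  \<open>u\<close>.\<close>

lemma projection_exists:
  fixes E :: "('a \<Rightarrow> 'b::real_vector) \<Rightarrow> ('a \<Rightarrow> 'b) \<Rightarrow> real"
  assumes V: "\<And>f g c. f \<in> V \<Longrightarrow> g \<in> V \<Longrightarrow> (\<lambda>x. f x + c *\<^sub>R g x) \<in> V"
    and lin: "\<And>f g h c. f \<in> V \<Longrightarrow> g \<in> V \<Longrightarrow> h \<in> V \<Longrightarrow> E (\<lambda>x. f x + c *\<^sub>R g x) h = E f h + c * E g h"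
    and sym: "\<And>f g. f \<in> V \<Longrightarrow> g \<in> V \<Longrightarrow> E f g = E g f"
    and pos: "\<And>f. f \<in> V \<Longrightarrow> 0 \<le> E f f"
    and S: "S \<subseteq> V" "(\<lambda>x. 0) \<in> S" "\<And>f g c. f \<in> S \<Longrightarrow> g \<in> S \<Longrightarrow> (\<lambda>x. f x + c *\<^sub>R g x) \<in> S"
    and B: "finite B" "B \<subseteq> S" and f: "f \<in> V"
  shows "\<exists>u\<in>S. (\<forall>b\<in>B. E f b = E u b) \<and> (\<forall>g\<in>V. (\<forall>b\<in>B. E g b = 0) \<longrightarrow> E g u = 0)"
  using B f
proof (induction B arbitrary: f rule: finite_induct)
  case empty
  have z: "(\<lambda>x. 0) \<in> V" using S by blast
  have "E (\<lambda>x. 0) g = 0" if "g \<in> V" for g using lin[OF z z that, of 1] by simp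
  then have "E g (\<lambda>x. 0) = 0" if "g \<in> V" for g using sym[OF that z] that by simp
  then show ?case using S by blast
next
  case (insert b B)
  have bS: "b \<in> S" and BS: "B \<subseteq> S" and bV: "b \<in> V" using insert.prems S by auto
  have VS: "\<And>s. s \<in> S \<Longrightarrow> s \<in> V" using S by blast
  obtain u where u: "u \<in> S" "\<And>c. c \<in> B \<Longrightarrow> E f c = E u c" "\<And>g. g \<in> V \<Longrightarrow> (\<forall>b\<in>B. E g b = 0) \<Longrightarrow> E g u = 0"
    using insert.IH[OF BS insert.prems(2)] by blast
  \<comment> \<open>The induction hypothesis is used a second time, for the new vector:
    \<open>r = b - w\<close> is orthogonal to \<open>B\<close>.\<close>
  obtain w where w: "w \<in> S" "\<And>c. c \<in> B \<Longrightarrow> E b c = E w c" "\<And>g. g \<in> V \<Longrightarrow> (\<forall>b\<in>B. E g b = 0) \<Longrightarrow> E g w = 0"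
    using insert.IH[OF BS bV] by blast
  define r where "r = (\<lambda>x. b x + (-1) *\<^sub>R w x)"
  define q where "q = (\<lambda>x. f x + (-1) *\<^sub>R u x)"
  have rS: "r \<in> S" unfolding r_def by (rule S(3)[OF bS w(1)])
  then have rV: "r \<in> V" by (rule VS)
  have qV: "q \<in> V" unfolding q_def by (rule V[OF insert.prems(2) VS[OF u(1)]])
  have Er: "E r h = E b h - E w h" if "h \<in> V" for h
    unfolding r_def using lin[OF bV VS[OF w(1)] that, of "-1"] by simp
  have Eq: "E q h = E f h - E u h" if "h \<in> V" for h
    unfolding q_def using lin[OF insert.prems(2) VS[OF u(1)] that, of "-1"] by simp
  have rB: "E r c = 0" if "c \<in> B" for c using Er[of c] w(2)[OF that] that BS VS by auto
  have qB: "E q c = 0" if "c \<in> B" for c using Eq[of c] u(2)[OF that] that BS VS by auto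
  have Ebr: "E h b = E h r + E h w" if "h \<in> V" for h
    using Er[OF that] sym[OF that rV] sym[OF that bV] sym[OF that VS[OF w(1)]] by simp
  have bB: "E h b = E h r" if "h \<in> V" "\<And>c. c \<in> B \<Longrightarrow> E h c = 0" for h
    using Ebr[OF that(1)] w(3)[OF that(1)] that(2) by simp
  \<comment> \<open>If \<open>E r r = 0\<close>, the quotient is 0 by convention; the coefficient is
    still correct, because semidefiniteness then forces \<open>E q r = 0\<close>.\<close>
  define s where "s = E q r / E r r"
  have Eqr: "E q r = s * E r r"
  proof (cases "E r r = 0")
    case True
    have "E q r = 0"
    proof (rule ccontr)
      assume ne: "E q r \<noteq> 0"
      have pq: "0 \<le> E q q + 2 * c * E q r" for c
      proof -
        let ?g = "\<lambda>x. q x + c *\<^sub>R r x"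
        have g: "?g \<in> V" by (rule V[OF qV rV])
        have "E ?g ?g = E q ?g + c * E r ?g" by (rule lin[OF qV rV g])
        also have "E q ?g = E q q + c * E r q" using lin[OF qV rV qV] sym[OF qV g] by simp
        also have "E r ?g = E q r + c * E r r" using lin[OF qV rV rV] sym[OF rV g] by simp
        finally show ?thesis using pos[OF g] True sym[OF qV rV] by (simp add: algebra_simps)
      qed
      show False using pq[of "- (E q q + 1) / (2 * E q r)"] ne by (simp add: field_simps)
    qed
    then show ?thesis using True by simp
  qed (simp add: s_def)
  define u' where "u' = (\<lambda>x. u x + s *\<^sub>R r x)"
  have u'S: "u' \<in> S" unfolding u'_def by (rule S(3)[OF u(1) rS])
  have Eu': "E u' h = E u h + s * E r h" if "h \<in> V" for h
    unfolding u'_def by (rule lin[OF VS[OF u(1)] rV that])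
  show ?case
  proof (intro bexI[of _ u'] conjI ballI impI)
    fix c assume c: "c \<in> insert b B"
    then have cV: "c \<in> V" using bV BS VS by blast
    show "E f c = E u' c"
    proof (cases "c = b")
      case True
      have "E q b = E q r" by (rule bB[OF qV qB])
      moreover have "E r b = E r r" by (rule bB[OF rV rB])
      ultimately show ?thesis using Eqr Eq[OF bV] Eu'[OF bV] True by simp
    next
      case False
      then have "c \<in> B" using c by simp
      then show ?thesis using Eu'[OF cV] rB u(2) by simp
    qed
  next
    fix g assume g: "g \<in> V" "\<forall>c\<in>insert b B. E g c = 0"
    have "E g r = 0" using bB[OF g(1)] g(2) by simp
    moreover have "E g u = 0" using u(3)[OF g(1)] g(2) by simp
    ultimately have "E r g = 0" "E u g = 0" using sym[OF g(1) rV] sym[OF g(1) VS[OF u(1)]] by simp_all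
    then show "E g u' = 0" using sym[OF g(1) VS[OF u'S]] Eu'[OF g(1)] by simp
  qed (rule u'S)
qed

text \<open>Pythagoras: \<open>f - u\<close> is orthogonal to \<open>u - p\<close>, and
  \<open>E\<close> is nonnegative on the latter.\<close>

lemma projection_best:
  fixes E :: "('a \<Rightarrow> 'b::real_vector) \<Rightarrow> ('a \<Rightarrow> 'b) \<Rightarrow> real"
  assumes V: "\<And>f g c. f \<in> V \<Longrightarrow> g \<in> V \<Longrightarrow> (\<lambda>x. f x + c *\<^sub>R g x) \<in> V"
    and lin: "\<And>f g h c. f \<in> V \<Longrightarrow> g \<in> V \<Longrightarrow> h \<in> V \<Longrightarrow> E (\<lambda>x. f x + c *\<^sub>R g x) h = E f h + c * E g h"
    and sym: "\<And>f g. f \<in> V \<Longrightarrow> g \<in> V \<Longrightarrow> E f g = E g f"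
    and pos: "\<And>f. f \<in> V \<Longrightarrow> 0 \<le> E f f"
    and S: "S \<subseteq> V" "\<And>f g c. f \<in> S \<Longrightarrow> g \<in> S \<Longrightarrow> (\<lambda>x. f x + c *\<^sub>R g x) \<in> S"
    and f: "f \<in> V" and u: "u \<in> S" "\<And>w. w \<in> S \<Longrightarrow> E f w = E u w" and p: "p \<in> S"
  shows "E (\<lambda>x. f x - u x) (\<lambda>x. f x - u x) \<le> E (\<lambda>x. f x - p x) (\<lambda>x. f x - p x)"
proof -
  have VS: "\<And>s. s \<in> S \<Longrightarrow> s \<in> V" using S by blast
  define q where "q = (\<lambda>x. f x + (-1) *\<^sub>R u x)"
  define r where "r = (\<lambda>x. u x + (-1) *\<^sub>R p x)"
  have rS: "r \<in> S" unfolding r_def by (rule S(2)[OF u(1) p])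
  note rV = VS[OF rS]
  have qV: "q \<in> V" unfolding q_def by (rule V[OF f VS[OF u(1)]])
  have qr: "E q r = 0" unfolding q_def using lin[OF f VS[OF u(1)] rV, of "-1"] u(2)[OF rS] by simp
  have t: "(\<lambda>x. f x - p x) = (\<lambda>x. q x + 1 *\<^sub>R r x)" by (simp add: q_def r_def)
  let ?t = "\<lambda>x. q x + 1 *\<^sub>R r x"
  have tV: "?t \<in> V" by (rule V[OF qV rV])
  have "E ?t ?t = E q ?t + 1 * E r ?t" by (rule lin[OF qV rV tV])
  also have "E q ?t = E q q + 1 * E r q" using lin[OF qV rV qV, of 1] sym[OF qV tV] by simp
  also have "E r ?t = E q r + 1 * E r r" using lin[OF qV rV rV, of 1] sym[OF rV tV] by simp
  finally have "E ?t ?t = E q q + E r r" using qr sym[OF qV rV] by simp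
  then have "E q q \<le> E ?t ?t" using pos[OF rV] by simp
  then show ?thesis unfolding t by (simp add: q_def)
qed

section \<open>The weight-adjusted projection\<close>

lemma norm_sq_component: "(norm y)\<^sup>2 = (\<Sum>i\<in>UNIV. (y $ i)\<^sup>2)" for y :: "real ^ 'k::finite"
  unfolding power2_norm_eq_inner inner_vec_def by (simp add: power2_eq_square)

lemma continuous_lebesgue_on:
  fixes f :: "real ^ 'd::finite \<Rightarrow> real"
  assumes "S \<in> sets borel" "continuous_on S f"
  shows "f \<in> borel_measurable (lebesgue_on S)"
proof -
  have "(\<lambda>x. indicator S x *\<^sub>R f x) \<in> borel_measurable borel"
    by (rule borel_measurable_continuous_on_indicator[OF assms])
  then have "(\<lambda>x. indicator S x * f x) \<in> borel_measurable lborel" by simp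
  then have "(\<lambda>x. indicator S x * f x) \<in> borel_measurable lebesgue" by (rule measurable_completion)
  then show ?thesis by (simp add: lebesgue_on_measurable_iff[OF assms(1)])
qed

text \<open>By continuity the exceptional set is open; being null, it is empty.\<close>

lemma AE_le_imp_le_open:
  fixes f :: "real ^ 'd::finite \<Rightarrow> real"
  assumes S: "open S" "continuous_on S f" and ae: "AE x in lborel. x \<in> S \<longrightarrow> f x \<le> c" and x: "x \<in> S"
  shows "f x \<le> c"
proof (rule ccontr)
  define Z where "Z = S \<inter> f -` {c<..}"
  have Z: "open Z" unfolding Z_def by (rule continuous_open_preimage[OF S(2,1)]) auto
  have "AE x in lebesgue. x \<notin> Z"
    unfolding AE_completion_iff using ae by eventually_elim (auto simp: Z_def)
  moreover have "Z \<in> sets lebesgue" using Z by (simp add: sets_completionI_sets)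
  ultimately have "negligible Z" by (simp add: AE_iff_null_sets negligible_iff_null_sets)
  moreover assume "\<not> f x \<le> c"
  then have "x \<in> Z" using x by (simp add: Z_def)
  ultimately show False using open_not_negligible[OF Z] by blast
qed

context element
begin

lemma D_lebesgue: "D \<in> sets lebesgue" and interior_borel: "interior D \<in> sets borel"
  using D_borel by (auto simp: sets_completionI_sets)

lemma AE_interior: "AE x in lborel. x \<in> D \<longrightarrow> x \<in> interior D"
proof -
  have "D - interior D \<in> null_sets lebesgue" using negligible_boundary by (simp add: negligible_iff_null_sets)
  then have "AE x in lebesgue. x \<notin> D - interior D" by (rule AE_not_in)
  then show ?thesis by (simp add: AE_completion_iff)
qed

lemma measurable_D_if_interior:
  fixes f :: "real ^ 'd \<Rightarrow> real"
  assumes "f \<in> borel_measurable (lebesgue_on (interior D))"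
  shows "f \<in> borel_measurable (lebesgue_on D)"
proof -
  have *: "(\<lambda>x. indicator (interior D) x * f x) \<in> borel_measurable lebesgue"
    using assms by (simp add: lebesgue_on_measurable_iff[OF interior_borel])
  have "AE x in lborel. indicator (interior D) x * f x = indicator D x * f x"
    using AE_interior by eventually_elim (use interior_subset[of D] in \<open>auto simp: indicator_def\<close>)
  then have "AE x in lebesgue. indicator (interior D) x * f x = indicator D x * f x" by (simp add: AE_completion_iff)
  from borel_measurable_AE[OF * this] show ?thesis by (simp add: lebesgue_on_measurable_iff[OF D_borel])
qed

lemma integrable_D_if_bounded:
  fixes f :: "real ^ 'd \<Rightarrow> real"
  assumes "f \<in> borel_measurable (lebesgue_on D)" "\<And>x. x \<in> D \<Longrightarrow> \<bar>f x\<bar> \<le> B"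
  shows "integrable (lebesgue_on D) f"
proof -
  have "emeasure (lebesgue_on D) D < \<infinity>"
    using emeasure_bounded_finite[OF compact_imp_bounded[OF compact_D]] D_borel D_lebesgue
    by (simp add: emeasure_restrict_space)
  then have "finite_measure (lebesgue_on D)" by (intro finite_measureI) (simp add: top.not_eq_extremum)
  then interpret finite_measure "lebesgue_on D" .
  show ?thesis by (rule integrable_const_bound[of _ B]) (use assms in \<open>auto intro: AE_I2\<close>)
qed

lemma continuous_inv_Phi: "continuous_on D (inv_into Dhat \<Phi>)"
  by (rule continuous_on_inv[OF continuous_Phi compact_Dhat]) (auto simp: inv_into_f_f[OF inj])

lemma inv_Phi [simp]: "x \<in> Dhat \<Longrightarrow> inv_into Dhat \<Phi> (\<Phi> x) = x"
  by (rule inv_into_f_f[OF inj])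

end

locale weighted_element = element Dhat U \<Phi> x0
  for Dhat U :: "(real ^ 'd::finite) set" and \<Phi> x0 +
  fixes N :: nat and W :: "real ^ 'd \<Rightarrow> real ^ 'm::finite ^ 'm" and w_max wt_max :: real
  assumes W_measurable: "\<And>i j. (\<lambda>x. W x $ i $ j) \<in> borel_measurable (lebesgue_on D)"
    and spd: "\<And>x. x \<in> D \<Longrightarrow> sym_pos_def (W x)"
    and W_le: "\<And>x. x \<in> D \<Longrightarrow> spectral_norm (W x) \<le> w_max"
    and W_inv_le: "\<And>x. x \<in> D \<Longrightarrow> spectral_norm (matrix_inv (W x)) \<le> wt_max"
begin

abbreviation "A \<equiv> \<lambda>x. matrix_inv (W x)"

definition L2_space :: "(real ^ 'd \<Rightarrow> real ^ 'm) set" where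
  "L2_space = {f. \<forall>i. (\<lambda>x. f x $ i) \<in> borel_measurable (lebesgue_on D) \<and> integrable (lebesgue_on D) (\<lambda>x. (f x $ i)\<^sup>2)}"

definition energy :: "(real ^ 'd \<Rightarrow> real ^ 'm) \<Rightarrow> (real ^ 'd \<Rightarrow> real ^ 'm) \<Rightarrow> real" where
  "energy f g = L2_inner D (\<lambda>x. A x *v f x) g"

lemma L2_spaceD:
  assumes "f \<in> L2_space"
  shows "(\<lambda>x. f x $ i) \<in> borel_measurable (lebesgue_on D)" "integrable (lebesgue_on D) (\<lambda>x. (f x $ i)\<^sup>2)"
  using assms by (auto simp: L2_space_def)

lemma integrable_norm_sq: "f \<in> L2_space \<Longrightarrow> integrable (lebesgue_on D) (\<lambda>x. (norm (f x))\<^sup>2)"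
  unfolding norm_sq_component by (intro Bochner_Integration.integrable_sum L2_spaceD)

lemma L2_spaceI:
  assumes m: "\<And>i. (\<lambda>x. f x $ i) \<in> borel_measurable (lebesgue_on D)"
    and g: "integrable (lebesgue_on D) g" "\<And>x. x \<in> D \<Longrightarrow> (norm (f x))\<^sup>2 \<le> g x"
  shows "f \<in> L2_space"
  unfolding L2_space_def
proof (intro CollectI allI conjI)
  fix i
  show "(\<lambda>x. f x $ i) \<in> borel_measurable (lebesgue_on D)" by (rule m)
  show "integrable (lebesgue_on D) (\<lambda>x. (f x $ i)\<^sup>2)"
  proof (rule Bochner_Integration.integrable_bound[OF g(1)])
    show "(\<lambda>x. (f x $ i)\<^sup>2) \<in> borel_measurable (lebesgue_on D)" by (rule borel_measurable_power[OF m])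
    have "(f x $ i)\<^sup>2 \<le> \<bar>g x\<bar>" if "x \<in> D" for x
    proof -
      have "(f x $ i)\<^sup>2 \<le> (norm (f x))\<^sup>2"
        unfolding norm_sq_component by (rule member_le_sum) auto
      then show ?thesis using g(2)[OF that] by linarith
    qed
    then show "AE x in lebesgue_on D. norm ((f x $ i)\<^sup>2) \<le> norm (g x)" by (intro AE_I2) simp
  qed
qed

lemma L2_space_add:
  assumes "f \<in> L2_space" "g \<in> L2_space"
  shows "(\<lambda>x. f x + c *\<^sub>R g x) \<in> L2_space"
proof (rule L2_spaceI)
  show "(\<lambda>x. (f x + c *\<^sub>R g x) $ i) \<in> borel_measurable (lebesgue_on D)" for i
    using L2_spaceD(1)[OF assms(1), of i] L2_spaceD(1)[OF assms(2), of i] by simp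
  show "integrable (lebesgue_on D) (\<lambda>x. 2 * (norm (f x))\<^sup>2 + 2 * c\<^sup>2 * (norm (g x))\<^sup>2)"
    by (intro Bochner_Integration.integrable_add integrable_mult_right integrable_norm_sq assms)
  fix x
  have "norm (f x + c *\<^sub>R g x) \<le> norm (f x) + \<bar>c\<bar> * norm (g x)"
    using norm_triangle_ineq[of "f x" "c *\<^sub>R g x"] by simp
  then have "(norm (f x + c *\<^sub>R g x))\<^sup>2 \<le> (norm (f x) + \<bar>c\<bar> * norm (g x))\<^sup>2" by (intro power_mono) auto
  also have "\<dots> \<le> 2 * (norm (f x))\<^sup>2 + 2 * (\<bar>c\<bar> * norm (g x))\<^sup>2" by (rule sum2_sq_le)
  finally show "(norm (f x + c *\<^sub>R g x))\<^sup>2 \<le> 2 * (norm (f x))\<^sup>2 + 2 * c\<^sup>2 * (norm (g x))\<^sup>2"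
    by (simp add: power_mult_distrib)
qed

lemma L2_space_diff: "f \<in> L2_space \<Longrightarrow> g \<in> L2_space \<Longrightarrow> (\<lambda>x. f x - g x) \<in> L2_space"
  using L2_space_add[of f g "-1"] by simp

lemma L2_space_matrix_mult:
  assumes M: "\<And>i j. (\<lambda>x. M x $ i $ j) \<in> borel_measurable (lebesgue_on D)"
    and le: "\<And>x. x \<in> D \<Longrightarrow> spectral_norm (M x) \<le> B" and f: "f \<in> L2_space"
  shows "(\<lambda>x. M x *v f x) \<in> L2_space"
proof (rule L2_spaceI)
  show "(\<lambda>x. (M x *v f x) $ i) \<in> borel_measurable (lebesgue_on D)" for i
    unfolding matrix_vector_mult_def vec_lambda_beta
    by (intro borel_measurable_sum borel_measurable_times M L2_spaceD(1)[OF f])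
  show "integrable (lebesgue_on D) (\<lambda>x. B\<^sup>2 * (norm (f x))\<^sup>2)"
    by (intro integrable_mult_right integrable_norm_sq f)
  fix x assume x: "x \<in> D"
  have "norm (M x *v f x) \<le> B * norm (f x)"
    by (rule order_trans[OF norm_matrix_vector_le mult_right_mono[OF le[OF x]]]) simp
  then have "(norm (M x *v f x))\<^sup>2 \<le> (B * norm (f x))\<^sup>2" by (intro power_mono) auto
  then show "(norm (M x *v f x))\<^sup>2 \<le> B\<^sup>2 * (norm (f x))\<^sup>2" by (simp add: power_mult_distrib)
qed

lemma A_measurable: "(\<lambda>x. A x $ i $ j) \<in> borel_measurable (lebesgue_on D)"
  by (rule borel_measurable_matrix_inv[OF W_measurable]) (use spd in auto)

lemma W_mult: "f \<in> L2_space \<Longrightarrow> (\<lambda>x. W x *v f x) \<in> L2_space"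
  by (rule L2_space_matrix_mult[OF W_measurable W_le])

lemma A_mult: "f \<in> L2_space \<Longrightarrow> (\<lambda>x. A x *v f x) \<in> L2_space"
  by (rule L2_space_matrix_mult[OF A_measurable W_inv_le])

lemma integrable_inner:
  assumes "f \<in> L2_space" "g \<in> L2_space"
  shows "integrable (lebesgue_on D) (\<lambda>x. f x \<bullet> g x)"
proof (rule Bochner_Integration.integrable_bound)
  show "integrable (lebesgue_on D) (\<lambda>x. (norm (f x))\<^sup>2 + (norm (g x))\<^sup>2)"
    by (intro Bochner_Integration.integrable_add integrable_norm_sq assms)
  show "(\<lambda>x. f x \<bullet> g x) \<in> borel_measurable (lebesgue_on D)"
    unfolding inner_vec_def inner_real_def
    by (intro borel_measurable_sum borel_measurable_times L2_spaceD(1)[OF assms(1)] L2_spaceD(1)[OF assms(2)])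
  have "\<bar>f x \<bullet> g x\<bar> \<le> (norm (f x))\<^sup>2 + (norm (g x))\<^sup>2" for x
    using Cauchy_Schwarz_ineq2[of "f x" "g x"] sum_squares_bound[of "norm (f x)" "norm (g x)"]
      mult_nonneg_nonneg[OF norm_ge_zero norm_ge_zero, of "f x" "g x"] by linarith
  then show "AE x in lebesgue_on D. norm (f x \<bullet> g x) \<le> norm ((norm (f x))\<^sup>2 + (norm (g x))\<^sup>2)"
    by (intro AE_I2) simp
qed

lemma integrable_energy: "f \<in> L2_space \<Longrightarrow> g \<in> L2_space \<Longrightarrow> integrable (lebesgue_on D) (\<lambda>x. (A x *v f x) \<bullet> g x)"
  by (rule integrable_inner[OF A_mult])

lemma energy_lin:
  assumes "f \<in> L2_space" "g \<in> L2_space" "h \<in> L2_space"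
  shows "energy (\<lambda>x. f x + c *\<^sub>R g x) h = energy f h + c * energy g h"
proof -
  have "energy (\<lambda>x. f x + c *\<^sub>R g x) h = (\<integral>x. (A x *v f x) \<bullet> h x + c * ((A x *v g x) \<bullet> h x) \<partial>lebesgue_on D)"
    unfolding energy_def L2_inner_def
    by (simp add: matrix_vector_right_distrib matrix_vector_mult_scaleR inner_add_left)
  also have "\<dots> = energy f h + c * energy g h"
    unfolding energy_def L2_inner_def using assms integrable_energy
    by (subst Bochner_Integration.integral_add) auto
  finally show ?thesis .
qed

lemma energy_sym: "energy f g = energy g f"
  unfolding energy_def L2_inner_def
proof (rule Bochner_Integration.integral_cong[OF refl])
  fix x assume "x \<in> space (lebesgue_on D)"
  then have "sym_pos_def (W x)" using spd by simp
  from sym_pos_def_inv_inner[OF this, of "g x" "f x"]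
  show "(A x *v f x) \<bullet> g x = (A x *v g x) \<bullet> f x" by (simp add: inner_commute)
qed

lemma norm_sq_le_energy: "f \<in> L2_space \<Longrightarrow> (\<integral>x. (norm (f x))\<^sup>2 \<partial>lebesgue_on D) \<le> w_max * energy f f"
  and energy_nonneg: "0 \<le> energy f f"
  and energy_le_norm_sq: "f \<in> L2_space \<Longrightarrow> energy f f \<le> wt_max * (\<integral>x. (norm (f x))\<^sup>2 \<partial>lebesgue_on D)"
proof -
  have nn: "0 \<le> (A x *v y) \<bullet> y" if "x \<in> D" for x y
  proof -
    have "0 \<le> (A x *v y) \<bullet> (W x *v (A x *v y))"
      using spd[OF that] unfolding sym_pos_def_def by (cases "A x *v y = 0") (auto intro: less_imp_le)
    then show ?thesis using spd[OF that] by simp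
  qed
  show "0 \<le> energy f f"
    unfolding energy_def L2_inner_def by (intro Bochner_Integration.integral_nonneg_AE AE_I2) (use nn in auto)
  assume f: "f \<in> L2_space"
  show "(\<integral>x. (norm (f x))\<^sup>2 \<partial>lebesgue_on D) \<le> w_max * energy f f"
    unfolding energy_def L2_inner_def Bochner_Integration.integral_mult_right_zero[symmetric]
  proof (rule Bochner_Integration.integral_mono[OF integrable_norm_sq[OF f] integrable_mult_right[OF integrable_energy[OF f f]]])
    fix x assume "x \<in> space (lebesgue_on D)"
    then have x: "x \<in> D" by simp
    show "(norm (f x))\<^sup>2 \<le> w_max * ((A x *v f x) \<bullet> f x)"
      by (rule order_trans[OF norm_sq_le_inv_form[OF spd[OF x]] mult_right_mono[OF W_le[OF x] nn[OF x]]])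
  qed
  show "energy f f \<le> wt_max * (\<integral>x. (norm (f x))\<^sup>2 \<partial>lebesgue_on D)"
    unfolding energy_def L2_inner_def Bochner_Integration.integral_mult_right_zero[symmetric]
  proof (rule Bochner_Integration.integral_mono[OF integrable_energy[OF f f] integrable_mult_right[OF integrable_norm_sq[OF f]]])
    fix x assume "x \<in> space (lebesgue_on D)"
    then have x: "x \<in> D" by simp
    show "(A x *v f x) \<bullet> f x \<le> wt_max * (norm (f x))\<^sup>2"
      by (rule order_trans[OF inv_form_le mult_right_mono[OF W_inv_le[OF x]]]) simp
  qed
qed

section \<open>The polynomial space and the Galerkin problem\<close>

abbreviation P :: "(real ^ 'd \<Rightarrow> real ^ 'm) set" where "P \<equiv> PN N Dhat \<Phi>"

lemma PN_zero: "(\<lambda>x. 0) \<in> P"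
  unfolding PN_def using poly_deg_le_const[of N 0] by (auto intro!: exI[of _ "\<lambda>x. 0"])

lemma PN_add:
  assumes "f \<in> P" "g \<in> P"
  shows "(\<lambda>x. f x + c *\<^sub>R g x) \<in> P"
proof -
  have "\<exists>p. poly_deg_le N p \<and> (\<forall>x\<in>Dhat. (f (\<Phi> x) + c *\<^sub>R g (\<Phi> x)) $ i = p x)" for i
  proof -
    obtain p where p: "poly_deg_le N p" "\<forall>x\<in>Dhat. f (\<Phi> x) $ i = p x" using assms(1) unfolding PN_def by blast
    obtain q where q: "poly_deg_le N q" "\<forall>x\<in>Dhat. g (\<Phi> x) $ i = q x" using assms(2) unfolding PN_def by blast
    show ?thesis
      using poly_deg_le_add[OF p(1) poly_deg_le_cmult[OF q(1), of c]] p(2) q(2)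
      by (intro exI[of _ "\<lambda>x. p x + c * q x"]) simp
  qed
  then show ?thesis using assms unfolding PN_def by simp
qed

lemma PN_continuous:
  assumes "u \<in> P"
  shows "continuous_on D (\<lambda>y. u y $ i)"
proof -
  obtain p where p: "poly_deg_le N p" "\<forall>x\<in>Dhat. u (\<Phi> x) $ i = p x" using assms unfolding PN_def by blast
  have "continuous_on D (\<lambda>y. p (inv_into Dhat \<Phi> y))"
    by (rule continuous_on_compose2[OF continuous_on_poly_deg_le[OF p(1), of UNIV] continuous_inv_Phi]) simp
  then show ?thesis by (rule continuous_on_eq) (use p(2) in auto)
qed

lemma PN_L2: "P \<subseteq> L2_space"
proof
  fix u assume u: "u \<in> P"
  have c: "continuous_on D (\<lambda>y. (u y $ i)\<^sup>2)" for i by (intro continuous_intros PN_continuous u)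
  show "u \<in> L2_space"
    unfolding L2_space_def
  proof (intro CollectI allI conjI)
    fix i
    show "(\<lambda>x. u x $ i) \<in> borel_measurable (lebesgue_on D)" by (rule continuous_lebesgue_on[OF D_borel PN_continuous[OF u]])
    obtain B where B: "\<forall>z\<in>(\<lambda>y. (u y $ i)\<^sup>2) ` D. norm z \<le> B"
      using compact_imp_bounded[OF compact_continuous_image[OF c compact_D]] unfolding bounded_iff by blast
    show "integrable (lebesgue_on D) (\<lambda>x. (u x $ i)\<^sup>2)"
      by (rule integrable_D_if_bounded[OF continuous_lebesgue_on[OF D_borel c], of _ B]) (use B in auto)
  qed
qed

text \<open>Generators of \<open>P\<close>: monomials carried to the element, times a unit vector,
  extended by zero as in \<open>PN\<close>.\<close>

definition monomial :: "('d \<Rightarrow> nat) \<times> 'm \<Rightarrow> real ^ 'd \<Rightarrow> real ^ 'm" where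
  "monomial k y = (if y \<in> D then (\<Prod>i\<in>UNIV. (inv_into Dhat \<Phi> y $ i) ^ fst k i) *\<^sub>R axis (snd k) 1 else 0)"

definition indices :: "(('d \<Rightarrow> nat) \<times> 'm) set" where
  "indices = {\<alpha>. mi_order \<alpha> \<le> N} \<times> UNIV"

lemma finite_indices: "finite indices"
  unfolding indices_def by (intro finite_cartesian_product finite_mi_order_le) auto

lemma monomial_PN:
  assumes "k \<in> indices"
  shows "monomial k \<in> P"
proof -
  have "\<exists>p. poly_deg_le N p \<and> (\<forall>x\<in>Dhat. monomial k (\<Phi> x) $ i = p x)" for i
  proof -
    define c where "c = (\<lambda>\<alpha>. if \<alpha> = fst k \<and> i = snd k then 1 else 0 :: real)"
    have fk: "mi_order (fst k) \<le> N" using assms by (auto simp: indices_def)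
    have "(\<Sum>\<alpha> | mi_order \<alpha> \<le> N. c \<alpha> * (\<Prod>i\<in>UNIV. (x $ i) ^ \<alpha> i))
      = (\<Sum>\<alpha> | mi_order \<alpha> \<le> N. if \<alpha> = fst k then (if i = snd k then \<Prod>i\<in>UNIV. (x $ i) ^ fst k i else 0) else 0)" for x
      by (rule sum.cong) (auto simp: c_def)
    also have "\<dots> x = (if i = snd k then \<Prod>i\<in>UNIV. (x $ i) ^ fst k i else 0)" for x
      using fk by (simp add: sum.delta finite_mi_order_le)
    finally have "monomial k (\<Phi> x) $ i = (\<Sum>\<alpha> | mi_order \<alpha> \<le> N. c \<alpha> * (\<Prod>i\<in>UNIV. (x $ i) ^ \<alpha> i))" if "x \<in> Dhat" for x
      using that by (auto simp: monomial_def axis_def)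
    moreover have "poly_deg_le N (\<lambda>x. \<Sum>\<alpha> | mi_order \<alpha> \<le> N. c \<alpha> * (\<Prod>i\<in>UNIV. (x $ i) ^ \<alpha> i))"
      unfolding poly_deg_le_def by blast
    ultimately show ?thesis by blast
  qed
  then show ?thesis unfolding PN_def by (auto simp: monomial_def)
qed

lemma PN_expand:
  assumes "u \<in> P"
  obtains c where "u = (\<lambda>y. \<Sum>k\<in>indices. c k *\<^sub>R monomial k y)"
proof -
  have "\<forall>i. \<exists>c. \<forall>x\<in>Dhat. u (\<Phi> x) $ i = (\<Sum>\<alpha> | mi_order \<alpha> \<le> N. c \<alpha> * (\<Prod>i\<in>UNIV. (x $ i) ^ \<alpha> i))"
    using assms unfolding PN_def poly_deg_le_def by fastforce
  then obtain c where c: "\<And>i x. x \<in> Dhat \<Longrightarrow> u (\<Phi> x) $ i = (\<Sum>\<alpha> | mi_order \<alpha> \<le> N. c i \<alpha> * (\<Prod>i\<in>UNIV. (x $ i) ^ \<alpha> i))"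
    by metis
  have "u y = (\<Sum>k\<in>indices. c (snd k) (fst k) *\<^sub>R monomial k y)" for y
  proof (cases "y \<in> D")
    case True
    then obtain x where x: "x \<in> Dhat" "y = \<Phi> x" by blast
    have "(\<Sum>k\<in>indices. c (snd k) (fst k) *\<^sub>R monomial k y) $ i = u y $ i" for i
    proof -
      have "(\<Sum>k\<in>indices. c (snd k) (fst k) *\<^sub>R monomial k y) $ i
        = (\<Sum>(\<alpha>, j)\<in>indices. c j \<alpha> * ((\<Prod>i\<in>UNIV. (x $ i) ^ \<alpha> i) * (if i = j then 1 else 0)))"
        using x by (simp add: monomial_def axis_def case_prod_unfold mult.assoc)
      also have "\<dots> = (\<Sum>\<alpha> | mi_order \<alpha> \<le> N. \<Sum>j\<in>UNIV. c j \<alpha> * ((\<Prod>i\<in>UNIV. (x $ i) ^ \<alpha> i) * (if i = j then 1 else 0)))"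
        unfolding indices_def by (rule sum.cartesian_product[symmetric])
      also have "\<dots> = u y $ i" using x by (simp add: c if_distrib[of "\<lambda>t. _ * t"] cong: if_cong)
      finally show ?thesis .
    qed
    then show ?thesis by (simp add: vec_eq_iff)
  next
    case False
    then show ?thesis using assms by (auto simp: PN_def monomial_def)
  qed
  then show ?thesis by (intro that[of "\<lambda>k. c (snd k) (fst k)"]) blast
qed

lemma energy_sum_eq_0:
  assumes g: "g \<in> L2_space" and "finite K" "\<And>k. k \<in> K \<Longrightarrow> b k \<in> P" "\<And>k. k \<in> K \<Longrightarrow> energy g (b k) = 0"
  shows "energy g (\<lambda>y. \<Sum>k\<in>K. c k *\<^sub>R b k y) = 0 \<and> (\<lambda>y. \<Sum>k\<in>K. c k *\<^sub>R b k y) \<in> P"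
  using assms(2-)
proof (induction K rule: finite_induct)
  case empty
  show ?case using PN_zero by (simp add: energy_def L2_inner_def)
next
  case (insert k K)
  let ?s = "\<lambda>y. \<Sum>k\<in>K. c k *\<^sub>R b k y"
  have IH: "energy g ?s = 0" "?s \<in> P" using insert by auto
  have bk: "b k \<in> P" using insert by simp
  have e: "(\<lambda>y. \<Sum>k\<in>insert k K. c k *\<^sub>R b k y) = (\<lambda>y. ?s y + c k *\<^sub>R b k y)" using insert by (simp add: add.commute)
  have "energy (\<lambda>y. ?s y + c k *\<^sub>R b k y) g = energy ?s g + c k * energy (b k) g"
    by (rule energy_lin) (use IH bk g PN_L2 in auto)
  then have "energy g (\<lambda>y. ?s y + c k *\<^sub>R b k y) = 0" using IH insert.prems by (simp add: energy_sym[of g])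
  then show ?case unfolding e using PN_add[OF IH(2) bk] by blast
qed

lemma galerkin_exists:
  assumes f: "f \<in> L2_space"
  obtains u where "u \<in> P" "\<And>w. w \<in> P \<Longrightarrow> energy f w = energy u w"
proof -
  have "\<exists>u\<in>P. (\<forall>b\<in>monomial ` indices. energy f b = energy u b) \<and>
      (\<forall>g\<in>L2_space. (\<forall>b\<in>monomial ` indices. energy g b = 0) \<longrightarrow> energy g u = 0)"
  proof (rule projection_exists[where V = L2_space and E = energy])
    show "finite (monomial ` indices)" using finite_indices by simp
    show "monomial ` indices \<subseteq> P" using monomial_PN by blast
    show "energy f g = energy g f" for f g by (rule energy_sym)
    show "0 \<le> energy f f" for f by (rule energy_nonneg)
  qed (fact f L2_space_add energy_lin PN_L2 PN_zero PN_add)+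
  then obtain u where u: "u \<in> P" "\<And>b. b \<in> monomial ` indices \<Longrightarrow> energy f b = energy u b" by blast
  let ?g = "\<lambda>x. f x + (-1) *\<^sub>R u x"
  have uL: "u \<in> L2_space" using u PN_L2 by blast
  have g: "?g \<in> L2_space" by (rule L2_space_add[OF f uL])
  have gE: "energy ?g h = energy f h - energy u h" if "h \<in> L2_space" for h
    using energy_lin[OF f uL that, of "-1"] by simp
  show ?thesis
  proof (rule that[OF u(1)])
    fix w assume w: "w \<in> P"
    obtain c where c: "w = (\<lambda>y. \<Sum>k\<in>indices. c k *\<^sub>R monomial k y)" using PN_expand[OF w] .
    have "energy ?g (\<lambda>y. \<Sum>k\<in>indices. c k *\<^sub>R monomial k y) = 0"
    proof (rule energy_sum_eq_0[OF g finite_indices, THEN conjunct1])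
      fix k assume k: "k \<in> indices"
      show "monomial k \<in> P" by (rule monomial_PN[OF k])
      then have "monomial k \<in> L2_space" using PN_L2 by blast
      from gE[OF this] show "energy ?g (monomial k) = 0" using u(2)[of "monomial k"] k by simp
    qed
    then show "energy f w = energy u w" using gE[of w] w PN_L2 c by auto
  qed
qed

text \<open>Zero energy forces \<open>d\<close> to vanish almost everywhere on \<open>D\<close>.
  Continuity improves this to the image of the interior of \<open>Dhat\<close> and then, by density,
  to all of \<open>D\<close>; outside, members of \<open>P\<close> vanish by definition. This is the
  uniqueness behind the \<open>THE\<close> in \<open>T_inv\<close>.\<close>

lemma PN_eq_zero:
  assumes d: "d \<in> P" and e: "energy d d = 0"
  shows "d y = 0"
proof (cases "y \<in> D")
  case True
  then obtain x where x: "x \<in> Dhat" "y = \<Phi> x" by blast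
  have dL: "d \<in> L2_space" using d PN_L2 by blast
  have int: "integrable (lebesgue_on D) (\<lambda>x. (norm (d x))\<^sup>2)" by (rule integrable_norm_sq[OF dL])
  have "(\<integral>x. (norm (d x))\<^sup>2 \<partial>lebesgue_on D) = 0"
    using norm_sq_le_energy[OF dL] e by (intro antisym) (auto intro: Bochner_Integration.integral_nonneg_AE)
  then have "AE x in lebesgue_on D. (norm (d x))\<^sup>2 = 0"
    by (subst (asm) integral_nonneg_eq_0_iff_AE[OF int]) auto
  then have "AE x in lborel. x \<in> D \<longrightarrow> d x = 0" by (simp add: AE_lebesgue_on_iff[OF D_borel])
  then have ae: "AE x in lborel. x \<in> interior D \<longrightarrow> \<bar>d x $ i\<bar> \<le> 0" for i
    by eventually_elim (use interior_subset[of D] in auto)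
  have "d y $ i = 0" for i
  proof -
    have 0: "d (\<Phi> z) $ i = 0" if "z \<in> interior Dhat" for z
    proof -
      have "continuous_on (interior D) (\<lambda>y. \<bar>d y $ i\<bar>)"
        by (intro continuous_intros continuous_on_subset[OF PN_continuous[OF d] interior_subset])
      from AE_le_imp_le_open[OF open_interior this ae, of "\<Phi> z"] show ?thesis using that interior_image by auto
    qed
    have cl: "closure (interior Dhat) = Dhat"
      using convex_closure_interior[OF convex_Dhat] x0 compact_imp_closed[OF compact_Dhat] by (auto simp: closure_closed)
    have c: "continuous_on (closure (interior Dhat)) (\<lambda>x. d (\<Phi> x) $ i)"
      unfolding cl by (rule continuous_on_compose2[OF PN_continuous[OF d] continuous_Phi]) auto
    show ?thesis
      using continuous_constant_on_closure[OF c 0, of x] x cl by simp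
  qed
  then show ?thesis by (simp add: vec_eq_iff)
qed (use d in \<open>auto simp: PN_def\<close>)

text \<open>Since \<open>A (W v) = v\<close>, the defining equation says that \<open>T_inv\<close>
  has the same energy products with \<open>P\<close> as \<open>W v\<close>. Existence and uniqueness
  have to be established before the description operator can be unfolded.\<close>

lemma T_inv_galerkin:
  assumes v: "v \<in> L2_space"
  shows "T_inv N Dhat \<Phi> A v \<in> P"
    and "\<And>w. w \<in> P \<Longrightarrow> energy (\<lambda>x. W x *v v x) w = energy (T_inv N Dhat \<Phi> A v) w"
proof -
  let ?f = "\<lambda>x. W x *v v x"
  let ?Q = "\<lambda>u. u \<in> P \<and> (\<forall>w\<in>P. L2_inner D (\<lambda>x. A x *v u x) w = L2_inner D v w)"
  have rhs: "L2_inner D v w = energy ?f w" for w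
    unfolding energy_def L2_inner_def
    by (rule Bochner_Integration.integral_cong[OF refl]) (use spd in simp)
  obtain u where u: "u \<in> P" "\<And>w. w \<in> P \<Longrightarrow> energy ?f w = energy u w" using galerkin_exists[OF W_mult[OF v]] by blast
  have "?Q (THE u. ?Q u)"
  proof (rule theI[of ?Q u])
    show "?Q u" using u by (simp add: rhs) (simp add: energy_def)
    fix u' assume u': "?Q u'"
    let ?d = "\<lambda>x. u' x + (-1) *\<^sub>R u x"
    have d: "?d \<in> P" using PN_add[of u' u "-1"] u' u(1) by blast
    have "energy ?d ?d = energy u' ?d - energy u ?d"
      using energy_lin[of u' u ?d "-1"] u' u(1) d PN_L2 by auto
    also have "energy u' ?d = energy ?f ?d" using u' d rhs by (simp add: energy_def)
    finally have "energy ?d ?d = 0" using u(2)[OF d] by simp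
    from PN_eq_zero[OF d this] show "u' = u" by (auto simp: fun_eq_iff)
  qed
  then have *: "?Q (T_inv N Dhat \<Phi> A v)" by (simp add: T_inv_def)
  then show "T_inv N Dhat \<Phi> A v \<in> P" by blast
  show "energy ?f w = energy (T_inv N Dhat \<Phi> A v) w" if "w \<in> P" for w
    using * that rhs by (simp add: energy_def)
qed

lemma quasi_optimal:
  assumes v: "v \<in> L2_space" and p: "p \<in> P" and D: "D \<noteq> {}"
  shows "(\<integral>x. (norm (W x *v v x - T_inv N Dhat \<Phi> A v x))\<^sup>2 \<partial>lebesgue_on D)
    \<le> w_max * wt_max * (\<integral>x. (norm (W x *v v x - p x))\<^sup>2 \<partial>lebesgue_on D)"
proof -
  let ?f = "\<lambda>x. W x *v v x" and ?u = "T_inv N Dhat \<Phi> A v"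
  have f: "?f \<in> L2_space" by (rule W_mult[OF v])
  have fu: "(\<lambda>x. ?f x - ?u x) \<in> L2_space" "(\<lambda>x. ?f x - p x) \<in> L2_space"
    using L2_space_diff[OF f] PN_L2 p T_inv_galerkin(1)[OF v] by blast+
  \<comment> \<open>Read off from a point of \<open>D\<close>; this is where
    \<open>D \<noteq> {}\<close> enters.\<close>
  have w0: "0 \<le> w_max" using D W_le order_trans[OF spectral_norm_nonneg] by blast
  have "(\<integral>x. (norm (?f x - ?u x))\<^sup>2 \<partial>lebesgue_on D) \<le> w_max * energy (\<lambda>x. ?f x - ?u x) (\<lambda>x. ?f x - ?u x)"
    by (rule norm_sq_le_energy[OF fu(1)])
  also have "\<dots> \<le> w_max * energy (\<lambda>x. ?f x - p x) (\<lambda>x. ?f x - p x)"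
  proof (rule mult_left_mono[OF _ w0], rule projection_best[where V = L2_space and S = P and E = energy and f = ?f and u = ?u and p = p])
    show "energy f g = energy g f" for f g by (rule energy_sym)
    show "0 \<le> energy f f" for f by (rule energy_nonneg)
  qed (fact f p T_inv_galerkin[OF v] L2_space_add energy_lin PN_L2 PN_add)+
  also have "\<dots> \<le> w_max * (wt_max * (\<integral>x. (norm (?f x - p x))\<^sup>2 \<partial>lebesgue_on D))"
    by (rule mult_left_mono[OF energy_le_norm_sq[OF fu(2)] w0])
  finally show ?thesis by (simp add: mult.assoc)
qed

end

section \<open>Essential suprema and norms\<close>

text \<open>\<open>real_of_ereal\<close> sends infinity to 0, so \<open>Linf_norm\<close> is a
  genuine bound only once the essential supremum is known to be finite.\<close>

lemma Linf_norm_AE: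
  fixes f :: "real ^ 'd::finite \<Rightarrow> 'b::real_normed_vector"
  assumes S: "S \<in> sets borel" and fin: "esssup (lebesgue_on S) (\<lambda>x. ereal (norm (f x))) < \<infinity>"
  shows "AE x in lborel. x \<in> S \<longrightarrow> norm (f x) \<le> Linf_norm S f"
proof -
  have "AE x in lebesgue_on S. ereal (norm (f x)) \<le> esssup (lebesgue_on S) (\<lambda>x. ereal (norm (f x)))" by (rule esssup_AE)
  then have "AE x in lebesgue_on S. norm (f x) \<le> Linf_norm S f"
    by eventually_elim (use fin in \<open>cases "esssup (lebesgue_on S) (\<lambda>x. ereal (norm (f x)))"; simp add: Linf_norm_def\<close>)
  then show ?thesis by (simp add: AE_lebesgue_on_iff[OF S])
qed

lemma esssup_finite_if_AE_le:
  fixes f :: "real ^ 'd::finite \<Rightarrow> real"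
  assumes "S \<in> sets borel" "f \<in> borel_measurable (lebesgue_on S)" "AE x in lborel. x \<in> S \<longrightarrow> f x \<le> B"
  shows "esssup (lebesgue_on S) (\<lambda>x. ereal (f x)) < \<infinity>"
proof -
  have "esssup (lebesgue_on S) (\<lambda>x. ereal (f x)) \<le> ereal B"
    using assms by (intro esssup_I borel_measurable_ereal) (auto simp: AE_lebesgue_on_iff)
  then show ?thesis by (rule order.strict_trans1) simp
qed

text \<open>A negative finite essential supremum would make the space null, where its value is
  infinite: negative for measurable \<open>f\<close>, positive otherwise. Infinite values are read
  as 0.\<close>

lemma Linf_norm_nonneg: "0 \<le> Linf_norm S f"
proof (cases "esssup (lebesgue_on S) (\<lambda>x. ereal (norm (f x)))")
  case (real r)
  have "0 \<le> r"
  proof (rule ccontr)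
    assume r: "\<not> 0 \<le> r"
    have "AE x in lebesgue_on S. ereal (norm (f x)) \<le> ereal r" using esssup_AE[of "\<lambda>x. ereal (norm (f x))" "lebesgue_on S"] real by simp
    then have "AE x in lebesgue_on S. False"
      by eventually_elim (use r in \<open>auto dest: order_trans[OF norm_ge_zero]\<close>)
    then have "ae_filter (lebesgue_on S) = bot" by (simp add: eventually_False)
    then have z: "emeasure (lebesgue_on S) (space (lebesgue_on S)) = 0" by (simp add: ae_filter_eq_bot_iff)
    show False
    proof (cases "(\<lambda>x. ereal (norm (f x))) \<in> borel_measurable (lebesgue_on S)")
      case True
      from esssup_zero_space[OF z True] show ?thesis using real by simp
    next
      case False
      from esssup_non_measurable[OF this] show ?thesis using real by (simp add: top_ereal_def)
    qed
  qed
  then show ?thesis by (simp add: Linf_norm_def real)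
qed (simp_all add: Linf_norm_def)

lemma Linf_norm_AE_continuous:
  fixes f :: "real ^ 'd::finite \<Rightarrow> 'b::real_normed_vector"
  assumes S: "compact S" and f: "continuous_on S f"
  shows "AE x in lborel. x \<in> S \<longrightarrow> norm (f x) \<le> Linf_norm S f"
proof (rule Linf_norm_AE)
  show Sb: "S \<in> sets borel" using S by (simp add: borel_compact)
  obtain B where B: "\<And>x. x \<in> S \<Longrightarrow> norm (f x) \<le> B"
    using compact_imp_bounded[OF compact_continuous_image[OF f S]] unfolding bounded_iff by blast
  show "esssup (lebesgue_on S) (\<lambda>x. ereal (norm (f x))) < \<infinity>"
    by (rule esssup_finite_if_AE_le[OF Sb continuous_lebesgue_on[OF Sb continuous_on_norm[OF f]], of B]) (simp add: B)
qed

text \<open>Entries are bounded by the spectral norm of the whole matrix of derivatives. Its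
  essential supremum has to be shown finite first, since \<open>Linf_norm\<close> would read an
  infinite one as 0.\<close>

lemma weak_deriv_le_matrix_norm:
  fixes W :: "real ^ 'd::finite \<Rightarrow> real ^ 'm::finite ^ 'm"
  assumes \<Omega>: "open \<Omega>" and W: "\<And>i j. (\<lambda>x. W x $ i $ j) \<in> sobolev_inf k \<Omega>" and \<alpha>: "mi_order \<alpha> \<le> k"
  shows "AE x in lborel. x \<in> \<Omega> \<longrightarrow> \<bar>weak_deriv \<Omega> \<alpha> (\<lambda>y. W y $ i $ j) x\<bar> \<le> matrix_norm_2_inf k \<Omega> W"
proof -
  have \<Omega>b: "\<Omega> \<in> sets borel" using \<Omega> by simp
  let ?d = "\<lambda>i j. weak_deriv \<Omega> \<alpha> (\<lambda>y. W y $ i $ j)"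
  let ?M = "\<lambda>x. (\<chi> i j. ?d i j x) :: real ^ 'm ^ 'm"
  have c: "AE x in lborel. x \<in> \<Omega> \<longrightarrow> \<bar>?d i j x\<bar> \<le> Linf_norm \<Omega> (?d i j)"
    and d_measurable: "?d i j \<in> borel_measurable (lebesgue_on \<Omega>)" for i j
  proof -
    obtain g where g: "is_weak_deriv \<Omega> \<alpha> (\<lambda>y. W y $ i $ j) g" "ess_bounded \<Omega> g"
      using W[of i j] \<alpha> unfolding sobolev_inf_def by blast
    note wd = weak_deriv_AE_eq[OF \<Omega> g(1)]
    show m: "?d i j \<in> borel_measurable (lebesgue_on \<Omega>)"
      by (rule locally_integrable_measurable[OF \<Omega> weak_deriv_locally_integrable(2)[OF wd(1)]])
    have "AE x in lborel. x \<in> \<Omega> \<longrightarrow> \<bar>g x\<bar> \<le> Linf_norm \<Omega> g"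
      using Linf_norm_AE[OF \<Omega>b, of g] g(2) by (simp add: ess_bounded_def)
    with wd(2) have "AE x in lborel. x \<in> \<Omega> \<longrightarrow> \<bar>?d i j x\<bar> \<le> Linf_norm \<Omega> g" by eventually_elim simp
    from esssup_finite_if_AE_le[OF \<Omega>b borel_measurable_abs[OF m] this]
    show "AE x in lborel. x \<in> \<Omega> \<longrightarrow> \<bar>?d i j x\<bar> \<le> Linf_norm \<Omega> (?d i j)"
      using Linf_norm_AE[OF \<Omega>b, of "?d i j"] by simp
  qed
  let ?c = "\<lambda>i j. Linf_norm \<Omega> (?d i j)"
  have "AE x in lborel. \<forall>i\<in>UNIV. \<forall>j\<in>UNIV. x \<in> \<Omega> \<longrightarrow> \<bar>?d i j x\<bar> \<le> ?c i j"
    by (intro AE_finite_allI c finite)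
  then have le: "AE x in lborel. x \<in> \<Omega> \<longrightarrow> spectral_norm (?M x) \<le> (\<Sum>i\<in>UNIV. \<Sum>j\<in>UNIV. ?c i j)"
  proof eventually_elim
    case (elim x)
    show ?case
    proof
      assume "x \<in> \<Omega>"
      then have "(\<Sum>i\<in>UNIV. \<Sum>j\<in>UNIV. \<bar>?M x $ i $ j\<bar>) \<le> (\<Sum>i\<in>UNIV. \<Sum>j\<in>UNIV. ?c i j)"
        using elim by (intro sum_mono) simp
      then show "spectral_norm (?M x) \<le> (\<Sum>i\<in>UNIV. \<Sum>j\<in>UNIV. ?c i j)" by (rule order_trans[OF spectral_norm_le_sum])
    qed
  qed
  have "?M \<in> borel_measurable (lebesgue_on \<Omega>)" by (rule borel_measurable_matrix) (simp add: d_measurable)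
  then have m: "(\<lambda>x. spectral_norm (?M x)) \<in> borel_measurable (lebesgue_on \<Omega>)"
    by (rule measurable_compose[OF _ borel_measurable_continuous_onI[OF continuous_spectral_norm]])
  have nn: "norm (spectral_norm A) = spectral_norm A" for A :: "real ^ 'm ^ 'm" by (simp add: spectral_norm_nonneg)
  have ae: "AE x in lborel. x \<in> \<Omega> \<longrightarrow> norm (spectral_norm (?M x)) \<le> Linf_norm \<Omega> (\<lambda>x. spectral_norm (?M x))"
    by (rule Linf_norm_AE[OF \<Omega>b]) (unfold nn, rule esssup_finite_if_AE_le[OF \<Omega>b m le])
  have Linf: "Linf_norm \<Omega> (\<lambda>x. spectral_norm (?M x)) \<le> matrix_norm_2_inf k \<Omega> W"
  proof (rule power2_le_imp_le)
    have "(Linf_norm \<Omega> (\<lambda>x. spectral_norm (?M x)))\<^sup>2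
      \<le> (\<Sum>\<alpha> | mi_order \<alpha> \<le> k. (Linf_norm \<Omega> (\<lambda>x. spectral_norm (\<chi> i j. weak_deriv \<Omega> \<alpha> (\<lambda>y. W y $ i $ j) x)))\<^sup>2)"
      by (rule member_le_sum[where f = "\<lambda>\<alpha>. (Linf_norm \<Omega> (\<lambda>x. spectral_norm (\<chi> i j. weak_deriv \<Omega> \<alpha> (\<lambda>y. W y $ i $ j) x)))\<^sup>2"])
        (use \<alpha> finite_mi_order_le in auto)
    then show "(Linf_norm \<Omega> (\<lambda>x. spectral_norm (?M x)))\<^sup>2 \<le> (matrix_norm_2_inf k \<Omega> W)\<^sup>2"
      by (simp add: matrix_norm_2_inf_def sum_nonneg)
  qed (simp add: matrix_norm_2_inf_def sum_nonneg)
  show ?thesis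
    using ae
  proof eventually_elim
    case (elim x)
    show ?case
    proof
      assume "x \<in> \<Omega>"
      then show "\<bar>?d i j x\<bar> \<le> matrix_norm_2_inf k \<Omega> W"
        using elim Linf abs_entry_le_spectral_norm[of "?M x" i j] by (simp add: spectral_norm_nonneg)
    qed
  qed
qed

lemma weak_deriv_le_sobolev_2_norm:
  assumes "mi_order \<alpha> \<le> k"
  shows "(L2_norm \<Omega> (weak_deriv \<Omega> \<alpha> v))\<^sup>2 \<le> (sobolev_2_norm k \<Omega> v)\<^sup>2"
proof -
  have "(L2_norm \<Omega> (weak_deriv \<Omega> \<alpha> v))\<^sup>2 \<le> (\<Sum>\<alpha> | mi_order \<alpha> \<le> k. (L2_norm \<Omega> (weak_deriv \<Omega> \<alpha> v))\<^sup>2)"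
    by (rule member_le_sum[where f = "\<lambda>\<alpha>. (L2_norm \<Omega> (weak_deriv \<Omega> \<alpha> v))\<^sup>2"])
      (use assms finite_mi_order_le in auto)
  then show ?thesis by (simp add: sobolev_2_norm_def sum_nonneg)
qed

lemma le_if_le_add_epsilon:
  fixes a b c :: real
  assumes "\<And>\<eta>. 0 < \<eta> \<Longrightarrow> a \<le> b + c * \<eta>" "0 \<le> c"
  shows "a \<le> b"
proof (rule field_le_epsilon)
  fix e :: real assume e: "0 < e"
  then have "a \<le> b + c * (e / (c + 1))" using assms by (intro assms(1)) (simp add: add_nonneg_pos)
  moreover have "c * (e / (c + 1)) \<le> e" using assms(2) e by (simp add: field_simps)
  ultimately show "a \<le> b + e" by linarith
qed

text \<open>Quasi-regularity bounds the essential supremum for one enumeration of each multi-index;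
  continuity makes the bound pointwise, and symmetry carries it to every list.
  \<open>\<bar>C0\<bar>\<close> keeps the constant nonnegative for arbitrary real
  \<open>C0\<close>.\<close>

lemma (in element) quasi_regular_derivs:
  assumes qr: "quasi_regular N C0 Dhat \<Phi>" and x: "x \<in> interior Dhat"
    and xs: "1 \<le> length xs" "length xs \<le> Suc N"
  shows "\<bar>derivs xs (\<lambda>y. \<Phi> y $ j) x\<bar> \<le> \<bar>C0\<bar> * diameter D ^ length xs"
proof -
  obtain ys where ys: "multi_deriv (count_list xs) \<Phi> = derivs ys \<Phi>" "count_list ys = count_list xs"
    using multi_deriv_eq_derivs by blast
  have xU: "x \<in> U" using x U(2) interior_subset by blast
  have sm: "smooth_on U (\<lambda>y. \<Phi> y $ j)" by (rule smooth_on_nth[OF U(1,3)])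
  have c: "continuous_on Dhat (derivs ys \<Phi>)"
    by (rule continuous_on_subset[OF smooth_on_continuous[OF smooth_on_derivs[OF U(3)]] U(2)])
  have "AE y in lborel. y \<in> Dhat \<longrightarrow> norm (derivs ys \<Phi> y) \<le> Linf_norm Dhat (derivs ys \<Phi>)"
    by (rule Linf_norm_AE_continuous[OF compact_Dhat c])
  then have ae: "AE y in lborel. y \<in> interior Dhat \<longrightarrow> norm (derivs ys \<Phi> y) \<le> Linf_norm Dhat (derivs ys \<Phi>)"
    by eventually_elim (use interior_subset in blast)
  have "\<bar>derivs xs (\<lambda>y. \<Phi> y $ j) x\<bar> = \<bar>derivs ys (\<lambda>y. \<Phi> y $ j) x\<bar>"
    using derivs_perm[OF U(1) sm xU, of xs ys] ys(2) by (simp add: mset_eq_iff_count_list)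
  also have "\<dots> = \<bar>derivs ys \<Phi> x $ j\<bar>" by (simp add: derivs_nth[OF U(1,3) xU])
  also have "\<dots> \<le> norm (derivs ys \<Phi> x)" by (rule component_le_norm_cart)
  also have "\<dots> \<le> Linf_norm Dhat (derivs ys \<Phi>)"
    by (rule AE_le_imp_le_open[OF open_interior continuous_on_norm[OF continuous_on_subset[OF c interior_subset]] ae x])
  also have "\<dots> \<le> C0 * diameter D ^ length xs"
    using qr[unfolded quasi_regular_def, rule_format, of "count_list xs"] xs ys(1) by simp
  also have "\<dots> \<le> \<bar>C0\<bar> * diameter D ^ length xs"
    using diameter_ge_0[OF compact_imp_bounded[OF compact_D]] by (intro mult_right_mono) auto
  finally show ?thesis .
qed

section \<open>The error estimate\<close>

text \<open>\<open>V2\<close> has one value per component of \<open>v\<close>, so that summation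
  restores the vector Sobolev norm in the end; \<open>B\<close> bounds all entries of
  \<open>W\<close> and of its derivatives at once.\<close>

locale weight_adjusted_element =
  scaled_element Dhat U \<Phi> x0 N H Kc Ce + weighted_element Dhat U \<Phi> x0 N W w_max wt_max
  for Dhat U :: "(real ^ 'd::finite) set" and \<Phi> x0 N H Kc Ce
    and W :: "real ^ 'd \<Rightarrow> real ^ 'm::finite ^ 'm" and w_max wt_max +
  fixes v :: "real ^ 'd \<Rightarrow> real ^ 'm" and B R Q :: real and V2 :: "'m \<Rightarrow> real"
  assumes W_sobolev: "\<And>i j. (\<lambda>x. W x $ i $ j) \<in> sobolev_inf (Suc N) (interior D)"
    and v_sobolev: "\<And>j. (\<lambda>x. v x $ j) \<in> sobolev_2 (Suc N) (interior D)"
    and B: "0 \<le> B" "\<And>i j \<alpha>. mi_order \<alpha> \<le> Suc N \<Longrightarrow>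
      AE x in lborel. x \<in> interior D \<longrightarrow> \<bar>weak_deriv (interior D) \<alpha> (\<lambda>x. W x $ i $ j) x\<bar> \<le> B"
    and V2: "\<And>j. 0 \<le> V2 j" "\<And>j \<alpha>. mi_order \<alpha> \<le> Suc N \<Longrightarrow>
      (L2_norm (interior D) (weak_deriv (interior D) \<alpha> (\<lambda>x. v x $ j)))\<^sup>2 \<le> V2 j"
    and R: "0 \<le> R" "AE y in lborel. y \<in> D \<longrightarrow> 1 / J y \<le> R"
    and Q: "0 \<le> Q" "AE y in lborel. y \<in> D \<longrightarrow> J y \<le> Q"
begin

lemma poly_approx_entry:
  assumes "0 < \<eta>"
  shows "\<exists>W' V p. W' \<in> borel_measurable borel \<and> V \<in> borel_measurable borel \<and>
    (AE x in lborel. x \<in> interior D \<longrightarrow> W' x = W x $ i $ j) \<and> (AE x in lborel. x \<in> interior D \<longrightarrow> V x = v x $ j) \<and>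
    (\<integral>\<^sup>+x. ennreal ((V x)\<^sup>2) \<partial>lborel) \<le> ennreal (V2 j) \<and> poly_deg_le N p \<and>
    (\<integral>\<^sup>+x. ennreal ((W' (\<Phi> x) * V (\<Phi> x) - p x)\<^sup>2) \<partial>lborel_on Dhat)
      \<le> ennreal ((2 + 8 * Ce) * (local_const * (B\<^sup>2 * R * V2 j * (H ^ Suc N)\<^sup>2) + \<eta>))"
    (is "\<exists>W' V p. ?P W' V p")
proof (rule poly_approx_weak[of "\<lambda>x. W x $ i $ j" "\<lambda>x. v x $ j" B "V2 j" R \<eta>])
  fix W' V p
  assume "W' \<in> borel_measurable borel" "V \<in> borel_measurable borel"
    "AE x in lborel. x \<in> interior D \<longrightarrow> W' x = W x $ i $ j" "AE x in lborel. x \<in> interior D \<longrightarrow> V x = v x $ j"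
    "(\<integral>\<^sup>+x. ennreal ((V x)\<^sup>2) \<partial>lborel) \<le> ennreal (V2 j)" "poly_deg_le N p"
    "(\<integral>\<^sup>+x. ennreal ((W' (\<Phi> x) * V (\<Phi> x) - p x)\<^sup>2) \<partial>lborel_on Dhat)
      \<le> ennreal ((2 + 8 * Ce) * (local_const * (B\<^sup>2 * R * V2 j * (H ^ Suc N)\<^sup>2) + \<eta>))"
  then have "?P W' V p" by (intro conjI)
  then show "\<exists>W' V p. ?P W' V p" by (intro exI)
qed (fact W_sobolev v_sobolev B V2 R assms)+

lemma v_L2: "v \<in> L2_space"
  unfolding L2_space_def
proof (intro CollectI allI conjI)
  fix j
  have "\<exists>g. is_weak_deriv (interior D) (\<lambda>_. 0) (\<lambda>x. v x $ j) g"
  proof -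
    have "mi_order (\<lambda>_ :: 'd. 0) \<le> Suc N" by (simp add: mi_order_def)
    then show ?thesis using v_sobolev[of j] unfolding sobolev_2_def by blast
  qed
  then have "locally_integrable (interior D) (\<lambda>x. v x $ j)" by (rule exE) (rule weak_deriv_locally_integrable(1))
  then show m: "(\<lambda>x. v x $ j) \<in> borel_measurable (lebesgue_on D)"
    by (intro measurable_D_if_interior locally_integrable_measurable open_interior)
  \<comment> \<open>Any row and any tolerance will do: only the representative of component
    \<open>j\<close> of \<open>v\<close> and its L2 bound are wanted.\<close>
  obtain V where V: "AE x in lborel. x \<in> interior D \<longrightarrow> V x = v x $ j" "(\<integral>\<^sup>+x. ennreal ((V x)\<^sup>2) \<partial>lborel) \<le> ennreal (V2 j)"
    using poly_approx_entry[OF zero_less_one, of undefined j] by (elim exE conjE)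
  have "(\<integral>\<^sup>+x. ennreal ((v x $ j)\<^sup>2) \<partial>lebesgue_on D) = (\<integral>\<^sup>+x\<in>D. ennreal ((v x $ j)\<^sup>2) \<partial>lborel)"
    by (simp add: nn_integral_lebesgue_on[OF D_borel] nn_integral_lborel_on[OF D_borel])
  also have "\<dots> \<le> (\<integral>\<^sup>+x. ennreal ((V x)\<^sup>2) \<partial>lborel)"
  proof (rule nn_integral_mono_AE)
    show "AE x in lborel. ennreal ((v x $ j)\<^sup>2) * indicator D x \<le> ennreal ((V x)\<^sup>2)"
      using V(1) AE_interior by eventually_elim (auto simp: indicator_def)
  qed
  also have "\<dots> < \<infinity>" using V(2) by (rule order.strict_trans1) simp
  finally show "integrable (lebesgue_on D) (\<lambda>x. (v x $ j)\<^sup>2)"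
    using m by (intro integrableI_nonneg borel_measurable_power) auto
qed

text \<open>One polynomial per entry, summed over \<open>j\<close> to give component
  \<open>i\<close>. Of the squared factor \<open>CARD('m)\<close>, one power comes from
  Cauchy-Schwarz in the row sums and one from adding the rows.\<close>

lemma best_approximation:
  assumes \<eta>: "0 < \<eta>"
  obtains u where "u \<in> P"
    "(\<integral>x. (norm (W x *v v x - u x))\<^sup>2 \<partial>lebesgue_on D) \<le> (real CARD('m))\<^sup>2 * (Q * ((2 + 8 * Ce) *
      (local_const * (B\<^sup>2 * R * (H ^ Suc N)\<^sup>2) * (\<Sum>j\<in>UNIV. V2 j) + real CARD('m) * \<eta>)))"
proof -
  define err where "err = (\<lambda>j. (2 + 8 * Ce) * (local_const * (B\<^sup>2 * R * V2 j * (H ^ Suc N)\<^sup>2) + \<eta>))"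
  have err0: "0 \<le> err j" for j
    unfolding err_def using Ce local_const_nonneg B(1) R(1) V2(1) \<eta> by (intro mult_nonneg_nonneg add_nonneg_nonneg) auto
  define good where "good = (\<lambda>i j W' V p. W' \<in> borel_measurable borel \<and> V \<in> borel_measurable borel \<and>
    (AE x in lborel. x \<in> interior D \<longrightarrow> W' x = W x $ i $ j) \<and> (AE x in lborel. x \<in> interior D \<longrightarrow> V x = v x $ j) \<and>
    (\<integral>\<^sup>+x. ennreal ((V x)\<^sup>2) \<partial>lborel) \<le> ennreal (V2 j) \<and> poly_deg_le N p \<and>
    (\<integral>\<^sup>+x. ennreal ((W' (\<Phi> x) * V (\<Phi> x) - p x)\<^sup>2) \<partial>lborel_on Dhat) \<le> ennreal (err j))"
  have "\<exists>W' V p. good i j W' V p" for i j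
    unfolding good_def err_def by (rule poly_approx_entry[OF \<eta>])
  then obtain W' V p where good: "\<And>i j. good i j (W' i j) (V i j) (p i j)" by metis
  have Vm: "V i j \<in> borel_measurable borel" and Wm: "W' i j \<in> borel_measurable borel"
    and WAE: "AE x in lborel. x \<in> interior D \<longrightarrow> W' i j x = W x $ i $ j"
    and VAE: "AE x in lborel. x \<in> interior D \<longrightarrow> V i j x = v x $ j"
    and p: "poly_deg_le N (p i j)"
    and pe: "(\<integral>\<^sup>+x. ennreal ((W' i j (\<Phi> x) * V i j (\<Phi> x) - p i j x)\<^sup>2) \<partial>lborel_on Dhat) \<le> ennreal (err j)" for i j
    using good[of i j] unfolding good_def by - (elim conjE; assumption)+
  \<comment> \<open>The squared entry error on the physical element, with cut-offs that make it
    Borel on the whole space; the inner one handles \<open>inv_into\<close> outside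
    \<open>D\<close>.\<close>
  define G where "G = (\<lambda>i j y. indicator D y * (W' i j y * V i j y - indicator D y *\<^sub>R p i j (inv_into Dhat \<Phi> y))\<^sup>2)"
  have Gm: "G i j \<in> borel_measurable borel" for i j
  proof -
    have "continuous_on D (\<lambda>y. p i j (inv_into Dhat \<Phi> y))"
      by (rule continuous_on_compose2[OF continuous_on_poly_deg_le[OF p[of i j], of UNIV] continuous_inv_Phi]) simp
    from borel_measurable_continuous_on_indicator[OF D_borel this]
    have [measurable]: "(\<lambda>y. indicator D y *\<^sub>R p i j (inv_into Dhat \<Phi> y)) \<in> borel_measurable borel" .
    note [measurable] = Vm[of i j] Wm[of i j]
    show ?thesis unfolding G_def by measurable
  qed
  have G0: "0 \<le> G i j y" for i j y by (simp add: G_def)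
  have Gint: "(\<integral>\<^sup>+y. ennreal (G i j y) \<partial>lborel_on D) \<le> ennreal (Q * err j)" for i j
  proof -
    have "(\<integral>\<^sup>+y. ennreal (G i j y) \<partial>lborel_on D) \<le> ennreal Q * (\<integral>\<^sup>+x. ennreal (G i j (\<Phi> x)) \<partial>lborel_on Dhat)"
      by (rule nn_integral_pushforward_le[OF Gm G0 Q])
    also have "(\<integral>\<^sup>+x. ennreal (G i j (\<Phi> x)) \<partial>lborel_on Dhat)
      = (\<integral>\<^sup>+x. ennreal ((W' i j (\<Phi> x) * V i j (\<Phi> x) - p i j x)\<^sup>2) \<partial>lborel_on Dhat)"
      by (rule nn_integral_cong) (simp add: G_def)
    also have "ennreal Q * \<dots> \<le> ennreal Q * ennreal (err j)" by (rule mult_left_mono[OF pe]) simp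
    also have "\<dots> = ennreal (Q * err j)" by (rule ennreal_mult[symmetric, OF Q(1) err0])
    finally show ?thesis .
  qed
  define u where "u = (\<lambda>y. if y \<in> D then (\<chi> i. \<Sum>j\<in>UNIV. p i j (inv_into Dhat \<Phi> y)) else 0 :: real ^ 'm)"
  have uP: "u \<in> P"
  proof -
    have "\<exists>q. poly_deg_le N q \<and> (\<forall>x\<in>Dhat. u (\<Phi> x) $ i = q x)" for i
      by (intro exI[of _ "\<lambda>x. \<Sum>j\<in>UNIV. p i j x"] conjI poly_deg_le_sum p) (simp add: u_def)
    then show ?thesis unfolding PN_def by (auto simp: u_def)
  qed
  let ?e = "\<lambda>x. W x *v v x - u x"
  have eL: "?e \<in> L2_space" using L2_space_diff[OF W_mult[OF v_L2]] uP PN_L2 by blast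
  have AEall: "AE x in lborel. \<forall>i\<in>UNIV. \<forall>j\<in>UNIV. x \<in> interior D \<longrightarrow> W' i j x * V i j x = W x $ i $ j * v x $ j"
  proof (intro AE_finite_allI)
    show "AE x in lborel. x \<in> interior D \<longrightarrow> W' i j x * V i j x = W x $ i $ j * v x $ j" for i j
      using WAE[of i j] VAE[of i j] by eventually_elim simp
  qed auto
  let ?m = "real CARD('m)"
  have "ennreal (\<integral>x. (norm (?e x))\<^sup>2 \<partial>lebesgue_on D) = (\<integral>\<^sup>+x. ennreal ((norm (?e x))\<^sup>2) \<partial>lebesgue_on D)"
    by (rule nn_integral_eq_integral[symmetric, OF integrable_norm_sq[OF eL]]) simp
  also have "\<dots> = (\<integral>\<^sup>+x\<in>D. ennreal ((norm (?e x))\<^sup>2) \<partial>lborel)"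
    by (simp add: nn_integral_lebesgue_on[OF D_borel] nn_integral_lborel_on[OF D_borel])
  also have "\<dots> \<le> (\<integral>\<^sup>+x\<in>D. ennreal (\<Sum>i\<in>UNIV. \<Sum>j\<in>UNIV. ?m * G i j x) \<partial>lborel)"
  proof (rule nn_integral_mono_AE)
    show "AE x in lborel. ennreal ((norm (?e x))\<^sup>2) * indicator D x
      \<le> ennreal (\<Sum>i\<in>UNIV. \<Sum>j\<in>UNIV. ?m * G i j x) * indicator D x"
      using AEall AE_interior
    proof eventually_elim
      case (elim x)
      show ?case
      proof (cases "x \<in> D")
        case True
        have "(norm (?e x))\<^sup>2 = (\<Sum>i\<in>UNIV. (?e x $ i)\<^sup>2)" by (rule norm_sq_component)
        also have "\<dots> \<le> (\<Sum>i\<in>UNIV. \<Sum>j\<in>UNIV. ?m * G i j x)"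
        proof (rule sum_mono)
          fix i
          have "?e x $ i = (\<Sum>j\<in>UNIV. W' i j x * V i j x - p i j (inv_into Dhat \<Phi> x))"
            using elim True by (simp add: matrix_vector_mult_def u_def sum_subtractf)
          then have "(?e x $ i)\<^sup>2 \<le> (\<Sum>j\<in>UNIV. (W' i j x * V i j x - p i j (inv_into Dhat \<Phi> x))\<^sup>2) * ?m"
            using sum_squared_le_sum_of_squares[of "\<lambda>j. W' i j x * V i j x - p i j (inv_into Dhat \<Phi> x)" "UNIV :: 'm set"] by simp
          also have "\<dots> = (\<Sum>j\<in>UNIV. ?m * G i j x)" using True by (simp add: G_def sum_distrib_left mult.commute)
          finally show "(?e x $ i)\<^sup>2 \<le> (\<Sum>j\<in>UNIV. ?m * G i j x)" .
        qed
        finally show ?thesis by (intro mult_right_mono ennreal_leI) auto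
      qed simp
    qed
  qed
  also have "\<dots> = (\<integral>\<^sup>+x. (\<Sum>i\<in>UNIV. \<Sum>j\<in>UNIV. ennreal ?m * ennreal (G i j x)) \<partial>lborel_on D)"
    unfolding nn_integral_lborel_on[OF D_borel]
    by (simp add: sum_ennreal[symmetric] sum_nonneg G0 ennreal_mult)
  also have "\<dots> = (\<Sum>i\<in>UNIV. \<Sum>j\<in>UNIV. ennreal ?m * (\<integral>\<^sup>+x. ennreal (G i j x) \<partial>lborel_on D))"
    using borel_measurable_lborel_on[OF Gm] by (simp add: nn_integral_sum nn_integral_cmult)
  also have "\<dots> \<le> (\<Sum>i\<in>(UNIV :: 'm set). \<Sum>j\<in>UNIV. ennreal ?m * ennreal (Q * err j))"
    by (intro sum_mono mult_left_mono Gint) simp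
  also have "\<dots> = ennreal (\<Sum>i\<in>(UNIV :: 'm set). \<Sum>j\<in>UNIV. ?m * (Q * err j))"
  proof -
    have "ennreal ?m * ennreal (Q * err j) = ennreal (?m * (Q * err j))" for j
      by (rule ennreal_mult[symmetric]) (simp_all add: Q(1) err0)
    then show ?thesis by (simp add: sum_ennreal sum_nonneg Q(1) err0 del: sum_constant)
  qed
  finally have "(\<integral>x. (norm (?e x))\<^sup>2 \<partial>lebesgue_on D) \<le> (\<Sum>i\<in>(UNIV :: 'm set). \<Sum>j\<in>UNIV. ?m * (Q * err j))"
    using Q(1) err0 by (subst (asm) ennreal_le_iff) (auto intro!: sum_nonneg mult_nonneg_nonneg)
  also have "\<dots> = ?m\<^sup>2 * (Q * (\<Sum>j\<in>UNIV. err j))"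
    by (simp add: sum_distrib_left power2_eq_square mult.assoc)
  also have "(\<Sum>j\<in>UNIV. err j) = (2 + 8 * Ce) * (local_const * (B\<^sup>2 * R * (H ^ Suc N)\<^sup>2) * (\<Sum>j\<in>UNIV. V2 j) + ?m * \<eta>)"
  proof -
    let ?k = "local_const * (B\<^sup>2 * R * (H ^ Suc N)\<^sup>2)"
    have "err j = (2 + 8 * Ce) * (?k * V2 j + \<eta>)" for j by (simp only: err_def mult_ac)
    then have "(\<Sum>j\<in>UNIV. err j) = (2 + 8 * Ce) * (\<Sum>j\<in>UNIV. ?k * V2 j + \<eta>)" by (simp only: sum_distrib_left)
    also have "(\<Sum>j\<in>UNIV. ?k * V2 j + \<eta>) = ?k * (\<Sum>j\<in>UNIV. V2 j) + ?m * \<eta>"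
      unfolding sum.distrib sum_distrib_left[symmetric] by simp
    finally show ?thesis .
  qed
  finally show ?thesis by (rule that[OF uP])
qed

lemma error_estimate:
  "(\<integral>x. (norm (W x *v v x - T_inv N Dhat \<Phi> A v x))\<^sup>2 \<partial>lebesgue_on D)
    \<le> w_max * wt_max * ((real CARD('m))\<^sup>2 * (2 + 8 * Ce) * local_const) * (Q * R) * B\<^sup>2 * (H ^ Suc N)\<^sup>2 * (\<Sum>j\<in>UNIV. V2 j)"
\<comment> \<open>The tolerance \<open>\<eta>\<close> of the approximation steps disappears here,
  its coefficient being independent of it.\<close>
proof (rule le_if_le_add_epsilon)
  let ?m = "real CARD('m)"
  have D0: "D \<noteq> {}" using x0 interior_subset[of Dhat] by auto
  then obtain y where y: "y \<in> D" by (rule ex_in_conv[THEN iffD2, THEN exE])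
  have w0: "0 \<le> w_max * wt_max"
    by (rule mult_nonneg_nonneg[OF order_trans[OF spectral_norm_nonneg W_le[OF y]] order_trans[OF spectral_norm_nonneg W_inv_le[OF y]]])
  show "0 \<le> w_max * wt_max * (?m\<^sup>2 * (Q * ((2 + 8 * Ce) * ?m)))" using w0 Q Ce by simp
  fix \<eta> :: real assume "0 < \<eta>"
  from best_approximation[OF this] obtain u where u: "u \<in> P"
    "(\<integral>x. (norm (W x *v v x - u x))\<^sup>2 \<partial>lebesgue_on D) \<le> ?m\<^sup>2 * (Q * ((2 + 8 * Ce) *
      (local_const * (B\<^sup>2 * R * (H ^ Suc N)\<^sup>2) * (\<Sum>j\<in>UNIV. V2 j) + ?m * \<eta>)))" by blast
  have "(\<integral>x. (norm (W x *v v x - T_inv N Dhat \<Phi> A v x))\<^sup>2 \<partial>lebesgue_on D)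
    \<le> w_max * wt_max * (\<integral>x. (norm (W x *v v x - u x))\<^sup>2 \<partial>lebesgue_on D)" by (rule quasi_optimal[OF v_L2 u(1) D0])
  also have "\<dots> \<le> w_max * wt_max * (?m\<^sup>2 * (Q * ((2 + 8 * Ce) *
      (local_const * (B\<^sup>2 * R * (H ^ Suc N)\<^sup>2) * (\<Sum>j\<in>UNIV. V2 j) + ?m * \<eta>))))" by (rule mult_left_mono[OF u(2) w0])
  also have "\<dots> = w_max * wt_max * (?m\<^sup>2 * (2 + 8 * Ce) * local_const) * (Q * R) * B\<^sup>2 * (H ^ Suc N)\<^sup>2 * (\<Sum>j\<in>UNIV. V2 j)
      + w_max * wt_max * (?m\<^sup>2 * (Q * ((2 + 8 * Ce) * ?m))) * \<eta>"
    by (simp only: distrib_left distrib_right mult_ac)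
  finally show "(\<integral>x. (norm (W x *v v x - T_inv N Dhat \<Phi> A v x))\<^sup>2 \<partial>lebesgue_on D)
    \<le> w_max * wt_max * (?m\<^sup>2 * (2 + 8 * Ce) * local_const) * (Q * R) * B\<^sup>2 * (H ^ Suc N)\<^sup>2 * (\<Sum>j\<in>UNIV. V2 j)
      + w_max * wt_max * (?m\<^sup>2 * (Q * ((2 + 8 * Ce) * ?m))) * \<eta>" .
qed

end

lemma interior_simplex_nonempty:
  assumes "int CARD('d) simplex (S :: (real ^ 'd::finite) set)"
  shows "interior S \<noteq> {}"
proof -
  have "aff_dim S = int DIM(real ^ 'd)" using aff_dim_simplex[OF assms] by simp
  then have "interior S = rel_interior S" by (simp add: interior_rel_interior_gen)
  moreover have "S \<noteq> {}" using assms by (metis aff_dim_empty aff_dim_simplex of_nat_0_le_iff neg_0_le_iff_le not_one_le_zero)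
  ultimately show ?thesis using rel_interior_eq_empty[OF convex_simplex[OF assms]] by simp
qed

theorem theorem4p5:
  fixes Dhat :: "(real ^ 'd::finite) set" and N :: nat and C0 :: real
  assumes "int CARD('d) simplex Dhat"
    and "0 < N"
  shows "\<exists>C_N :: real.
    \<forall>(\<Phi> :: real ^ 'd \<Rightarrow> real ^ 'd) (D :: (real ^ 'd) set) (h :: real) (J :: real ^ 'd \<Rightarrow> real)
     (W :: real ^ 'd \<Rightarrow> real ^ 'm::finite ^ 'm) (v :: real ^ 'd \<Rightarrow> real ^ 'm)
     (w_min :: real) (w_max :: real) (wt_min :: real) (wt_max :: real).
      element_map Dhat \<Phi> \<and> quasi_regular N C0 Dhat \<Phi> \<and>
      D = \<Phi> ` Dhat \<and> h = diameter D \<and> J = jacobian_det Dhat \<Phi> \<and>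
      (\<forall>i j. (\<lambda>x. W x $ i $ j) \<in> sobolev_inf (N + 1) (interior D)) \<and>
      (\<forall>x\<in>D. sym_pos_def (W x)) \<and>
      0 < w_min \<and> (\<forall>x\<in>D. w_min \<le> spectral_norm (W x) \<and> spectral_norm (W x) \<le> w_max) \<and>
      0 < wt_min \<and> (\<forall>x\<in>D. wt_min \<le> spectral_norm (matrix_inv (W x)) \<and>
                          spectral_norm (matrix_inv (W x)) \<le> wt_max) \<and>
      (\<forall>i. (\<lambda>x. v x $ i) \<in> sobolev_2 (N + 1) (interior D))
      \<longrightarrow>
      L2_norm D (\<lambda>x. W x *v v x - T_inv N Dhat \<Phi> (\<lambda>x. matrix_inv (W x)) v x)
        \<le> (C_N * Linf_norm D (\<lambda>x. sqrt (J x)) * Linf_norm D (\<lambda>x. 1 / sqrt (J x))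
              * wt_max * w_max * matrix_norm_2_inf (N + 1) (interior D) W)
            * h ^ (N + 1) * sobolev_2_norm_vec (N + 1) (interior D) v"
proof -
  \<comment> \<open>Both constants are obtained before \<open>\<Phi>\<close> is introduced:
    \<open>K\<close> depends on \<open>N\<close>, \<open>C0\<close> and the dimension,
    \<open>Ce\<close> on \<open>N\<close> and the dimension.\<close>
  obtain K where K: "1 \<le> K" "\<And>(f :: real ^ 'd \<Rightarrow> real) (\<Phi> :: real ^ 'd \<Rightarrow> real ^ 'd) U V x H B.
      open U \<Longrightarrow> open V \<Longrightarrow> smooth_on U \<Phi> \<Longrightarrow> \<Phi> ` U \<subseteq> V \<Longrightarrow> smooth_on V f \<Longrightarrow> x \<in> U \<Longrightarrow> 0 \<le> H \<Longrightarrow> 0 \<le> B \<Longrightarrow>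
      (\<forall>j xs. 1 \<le> length xs \<longrightarrow> length xs \<le> Suc N \<longrightarrow> \<bar>derivs xs (\<lambda>y. \<Phi> y $ j) x\<bar> \<le> \<bar>C0\<bar> * H ^ length xs) \<Longrightarrow>
      (\<forall>ys. length ys \<le> Suc N \<longrightarrow> \<bar>derivs ys f (\<Phi> x)\<bar> \<le> B) \<Longrightarrow> jet_le (Suc N) H (K * B) (\<lambda>y. f (\<Phi> y)) x"
    using jet_le_compose[where 'd = 'd and 'e = 'd and n = "Suc N", OF abs_ge_zero[of C0]] by metis
  obtain Ce :: real where Ce: "0 \<le> Ce" "\<And>(p :: real ^ 'd \<Rightarrow> real) K x0. compact K \<Longrightarrow> convex K \<Longrightarrow> x0 \<in> K \<Longrightarrow>
      poly_deg_le N p \<Longrightarrow> (\<integral>\<^sup>+x\<in>K. ennreal ((p x)\<^sup>2) \<partial>lborel) \<le>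
      ennreal Ce * (\<integral>\<^sup>+x\<in>dilate x0 (1/2) ` K. ennreal ((p x)\<^sup>2) \<partial>lborel)"
    by (rule poly_extrapolation_le[where 'd = 'd and N = N]) (rule that)
  obtain x0 where x0: "x0 \<in> interior Dhat" using interior_simplex_nonempty[OF assms(1)] by blast
  \<comment> \<open>Outside its locale \<open>local_const\<close> takes only \<open>Dhat\<close>,
    \<open>N\<close> and \<open>K\<close> as arguments, so \<open>C2\<close> is free of the map, of
    \<open>W\<close> and of \<open>v\<close>.\<close>
  define C2 where "C2 = (real CARD('m))\<^sup>2 * (2 + 8 * Ce) * scaled_element.local_const Dhat N K"
  show ?thesis
  proof (intro exI[of _ "sqrt C2"] allI impI, elim conjE)
    fix \<Phi> :: "real ^ 'd \<Rightarrow> real ^ 'd" and D h J and W :: "real ^ 'd \<Rightarrow> real ^ 'm ^ 'm" and v :: "real ^ 'd \<Rightarrow> real ^ 'm"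
      and w_min w_max wt_min wt_max :: real
    assume em: "element_map Dhat \<Phi>" and qr: "quasi_regular N C0 Dhat \<Phi>"
      and D: "D = \<Phi> ` Dhat" and h: "h = diameter D" and J: "J = jacobian_det Dhat \<Phi>"
      and W: "\<forall>i j. (\<lambda>x. W x $ i $ j) \<in> sobolev_inf (N + 1) (interior D)"
      and spd: "\<forall>x\<in>D. sym_pos_def (W x)"
      and w: "\<forall>x\<in>D. w_min \<le> spectral_norm (W x) \<and> spectral_norm (W x) \<le> w_max"
      and wt: "\<forall>x\<in>D. wt_min \<le> spectral_norm (matrix_inv (W x)) \<and> spectral_norm (matrix_inv (W x)) \<le> wt_max"
      and v: "\<forall>i. (\<lambda>x. v x $ i) \<in> sobolev_2 (N + 1) (interior D)"
    obtain U where U: "open U" "Dhat \<subseteq> U" "smooth_on U \<Phi>" using em unfolding element_map_def by blast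
    interpret element Dhat U \<Phi> x0
      by unfold_locales
        (use compact_simplex[OF assms(1)] convex_simplex[OF assms(1)] x0 U em in \<open>auto simp: element_map_def\<close>)
    have h0: "0 \<le> h" unfolding h D by (rule diameter_ge_0[OF compact_imp_bounded[OF compact_D]])
    interpret scaled_element Dhat U \<Phi> x0 N h K Ce
    proof
      show "0 \<le> h" by (rule h0)
      show "0 \<le> K" using K(1) by simp
      show "0 \<le> Ce" by (rule Ce(1))
    next
      fix f :: "real ^ 'd \<Rightarrow> real" and B x
      assume f: "smooth_on UNIV f" "x \<in> interior Dhat" "0 \<le> B" "\<And>ys. length ys \<le> Suc N \<Longrightarrow> \<bar>derivs ys f (\<Phi> x)\<bar> \<le> B"
      have xU: "x \<in> U" using f(2) U(2) interior_subset by blast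
      show "jet_le (Suc N) h (K * B) (\<lambda>y. f (\<Phi> y)) x"
      proof (rule K(2)[OF U(1) open_UNIV U(3) _ f(1) xU h0 f(3)])
        show "\<forall>j xs. 1 \<le> length xs \<longrightarrow> length xs \<le> Suc N \<longrightarrow> \<bar>derivs xs (\<lambda>y. \<Phi> y $ j) x\<bar> \<le> \<bar>C0\<bar> * h ^ length xs"
          using quasi_regular_derivs[OF qr f(2)] unfolding h D by blast
        show "\<forall>ys. length ys \<le> Suc N \<longrightarrow> \<bar>derivs ys f (\<Phi> x)\<bar> \<le> B" using f(4) by blast
      qed simp
    next
      fix p :: "real ^ 'd \<Rightarrow> real" assume p: "poly_deg_le N p"
      have "dilate x0 (1/2) ` Dhat \<in> sets borel" by (rule borel_compact[OF compact_dilate[OF compact_Dhat]])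
      moreover have "x0 \<in> Dhat" using x0 interior_subset by blast
      ultimately show "(\<integral>\<^sup>+x. ennreal ((p x)\<^sup>2) \<partial>lborel_on Dhat) \<le>
          ennreal Ce * (\<integral>\<^sup>+x. ennreal ((p x)\<^sup>2) \<partial>lborel_on (dilate x0 (1/2) ` Dhat))"
        using Ce(2)[OF compact_Dhat convex_Dhat _ p] Dhat_borel by (simp add: nn_integral_lborel_on)
    qed
    define B where "B = matrix_norm_2_inf (N + 1) (interior D) W"
    define q where "q = Linf_norm D (\<lambda>x. sqrt (J x))"
    define r where "r = Linf_norm D (\<lambda>x. 1 / sqrt (J x))"
    define V2 where "V2 = (\<lambda>j. (sobolev_2_norm (N + 1) (interior D) (\<lambda>x. v x $ j))\<^sup>2)"
    have B0: "0 \<le> B" by (simp add: B_def matrix_norm_2_inf_def sum_nonneg)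
    have q0: "0 \<le> q" and r0: "0 \<le> r" by (simp_all add: q_def r_def Linf_norm_nonneg)
    have cJ: "compact D" "continuous_on D J" and Jpos: "\<And>y. y \<in> D \<Longrightarrow> 0 < J y"
      using compact_D continuous_J J_pos by (simp_all add: D J)
    have AEJ: "AE y in lborel. y \<in> D \<longrightarrow> J y \<le> q\<^sup>2" and AEJ': "AE y in lborel. y \<in> D \<longrightarrow> 1 / J y \<le> r\<^sup>2"
    proof -
      have "continuous_on D (\<lambda>x. sqrt (J x))" by (intro continuous_intros cJ)
      from Linf_norm_AE_continuous[OF cJ(1) this]
      show "AE y in lborel. y \<in> D \<longrightarrow> J y \<le> q\<^sup>2"
      proof eventually_elim
        case (elim y)
        show ?case
        proof
          assume y: "y \<in> D"
          have "(sqrt (J y))\<^sup>2 \<le> q\<^sup>2" using elim y Jpos[OF y] by (intro power_mono) (auto simp: q_def)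
          then show "J y \<le> q\<^sup>2" using Jpos[OF y] by simp
        qed
      qed
      have "continuous_on D (\<lambda>x. 1 / sqrt (J x))" by (intro continuous_intros cJ) (use Jpos in fastforce)
      from Linf_norm_AE_continuous[OF cJ(1) this]
      show "AE y in lborel. y \<in> D \<longrightarrow> 1 / J y \<le> r\<^sup>2"
      proof eventually_elim
        case (elim y)
        show ?case
        proof
          assume y: "y \<in> D"
          have "(1 / sqrt (J y))\<^sup>2 \<le> r\<^sup>2" using elim y Jpos[OF y] by (intro power_mono) (auto simp: r_def)
          then show "1 / J y \<le> r\<^sup>2" using Jpos[OF y] by (simp add: power_divide)
        qed
      qed
    qed
    have zero: "mi_order (\<lambda>_ :: 'd. 0) \<le> Suc N" by (simp add: mi_order_def)
    \<comment> \<open>Integrals of squares involve \<open>1 / J\<close> and \<open>J\<close>, so the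
      parameters are the squares of the norms of \<open>1 / sqrt J\<close> and
      \<open>sqrt J\<close>.\<close>
    interpret weight_adjusted_element Dhat U \<Phi> x0 N h K Ce W w_max wt_max v B "r\<^sup>2" "q\<^sup>2" V2
    proof
      fix i j
      have Wij: "(\<lambda>x. W x $ i $ j) \<in> sobolev_inf (Suc N) (interior D)" using W by simp
      then obtain g where "is_weak_deriv (interior D) (\<lambda>_. 0) (\<lambda>x. W x $ i $ j) g"
        using zero unfolding sobolev_inf_def by blast
      then have "(\<lambda>x. W x $ i $ j) \<in> borel_measurable (lebesgue_on (interior D))"
        by (intro locally_integrable_measurable open_interior weak_deriv_locally_integrable(1))
      then show "(\<lambda>x. W x $ i $ j) \<in> borel_measurable (lebesgue_on (\<Phi> ` Dhat))"
        unfolding D by (rule measurable_D_if_interior)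
      show "(\<lambda>x. W x $ i $ j) \<in> sobolev_inf (Suc N) (interior (\<Phi> ` Dhat))" using Wij by (simp add: D)
      show "AE x in lborel. x \<in> interior (\<Phi> ` Dhat) \<longrightarrow> \<bar>weak_deriv (interior (\<Phi> ` Dhat)) \<alpha> (\<lambda>x. W x $ i $ j) x\<bar> \<le> B"
        if "mi_order \<alpha> \<le> Suc N" for \<alpha>
        unfolding B_def D[symmetric] by (rule weak_deriv_le_matrix_norm) (use W that in auto)
    next
      fix j
      show "(\<lambda>x. v x $ j) \<in> sobolev_2 (Suc N) (interior (\<Phi> ` Dhat))" using v by (simp add: D)
      show "0 \<le> V2 j" by (simp add: V2_def)
      show "(L2_norm (interior (\<Phi> ` Dhat)) (weak_deriv (interior (\<Phi> ` Dhat)) \<alpha> (\<lambda>x. v x $ j)))\<^sup>2 \<le> V2 j"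
        if "mi_order \<alpha> \<le> Suc N" for \<alpha>
        unfolding V2_def D[symmetric] by (rule weak_deriv_le_sobolev_2_norm) (use that in simp)
    next
      show "0 \<le> B" by (rule B0)
      show "AE y in lborel. y \<in> \<Phi> ` Dhat \<longrightarrow> 1 / jacobian_det Dhat \<Phi> y \<le> r\<^sup>2" using AEJ' by (simp only: D J)
      show "AE y in lborel. y \<in> \<Phi> ` Dhat \<longrightarrow> jacobian_det Dhat \<Phi> y \<le> q\<^sup>2" using AEJ by (simp only: D J)
    qed (use spd w wt D in auto)
    define s where "s = sobolev_2_norm_vec (N + 1) (interior D) v"
    have s: "0 \<le> s" "s\<^sup>2 = (\<Sum>j\<in>UNIV. V2 j)"
      by (simp_all add: s_def sobolev_2_norm_vec_def V2_def sum_nonneg)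
    let ?c = "w_max * wt_max"
    obtain y where y: "y \<in> D" using x0 interior_subset[of Dhat] unfolding D by blast
    have wpos: "0 \<le> w_max" "0 \<le> wt_max"
      using w wt y by (auto intro: order_trans[OF spectral_norm_nonneg])
    have "1 \<le> spectral_norm (W y) * spectral_norm (matrix_inv (W y))" by (rule spectral_norm_mult_inv_ge_1[OF spd]) (use y D in simp)
    also have "\<dots> \<le> ?c" using w wt y wpos by (intro mult_mono spectral_norm_nonneg) auto
    finally have c: "1 \<le> ?c" .
    have C2: "0 \<le> C2" unfolding C2_def using Ce(1) local_const_nonneg by (intro mult_nonneg_nonneg) auto
    have "(\<integral>x. (norm (W x *v v x - T_inv N Dhat \<Phi> (\<lambda>x. matrix_inv (W x)) v x))\<^sup>2 \<partial>lebesgue_on D)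
      \<le> ?c * C2 * (q\<^sup>2 * r\<^sup>2) * B\<^sup>2 * (h ^ Suc N)\<^sup>2 * s\<^sup>2"
      using error_estimate unfolding C2_def s(2) D .
    also have "\<dots> = ?c * (C2 * (q\<^sup>2 * r\<^sup>2) * B\<^sup>2 * (h ^ Suc N)\<^sup>2 * s\<^sup>2)" by (simp only: mult.assoc)
    \<comment> \<open>As \<open>?c\<close> is at least 1, it may be replaced by its square, whose
      root is the product \<open>wt_max * w_max\<close> of the claim.\<close>
    also have "\<dots> \<le> ?c\<^sup>2 * (C2 * (q\<^sup>2 * r\<^sup>2) * B\<^sup>2 * (h ^ Suc N)\<^sup>2 * s\<^sup>2)"
      by (rule mult_right_mono[OF self_le_power[OF c]]) (simp_all add: C2)
    also have "\<dots> = (sqrt C2 * q * r * wt_max * w_max * B * h ^ (N + 1) * s)\<^sup>2"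
      using C2 by (simp add: power_mult_distrib mult_ac)
    finally have "L2_norm D (\<lambda>x. W x *v v x - T_inv N Dhat \<Phi> (\<lambda>x. matrix_inv (W x)) v x)
        \<le> sqrt C2 * q * r * wt_max * w_max * B * h ^ (N + 1) * s"
      unfolding L2_norm_def using C2 q0 r0 wpos B0 h0 s(1) by (intro real_le_lsqrt mult_nonneg_nonneg) auto
    then show "L2_norm D (\<lambda>x. W x *v v x - T_inv N Dhat \<Phi> (\<lambda>x. matrix_inv (W x)) v x)
        \<le> (sqrt C2 * Linf_norm D (\<lambda>x. sqrt (J x)) * Linf_norm D (\<lambda>x. 1 / sqrt (J x))
              * wt_max * w_max * matrix_norm_2_inf (N + 1) (interior D) W)
            * h ^ (N + 1) * sobolev_2_norm_vec (N + 1) (interior D) v"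
      unfolding q_def r_def B_def s_def .
  qed
qed

end
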